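(* Let $0<t\le1\le s\le\infty$, $\alpha\ge0$, $\beta>0$ and $m>\max\left(\alpha+\frac{n-1}{t}-n,\,-1\right)$. For a double indexed sequence $c=\{c_k^j\}$ the following are equivalent: (1) $c\in M_H(H^t_\alpha,H^s_\beta)$; (2) $g_c(rx')=\sum_{k\ge0}r^k\sum_{j=1}^{d_k}c_k^jY^{(k)}_j(x')$ is harmonic in $\mathbb B$ and $$T_s(g_c)=\sup_{0\le\rho<1}\sup_{y'\in\mathbb S}(1-\rho)^{\beta-\alpha+m+n-\frac{n-1}{t}}\Big\|\Lambda_{m+1}(g_c*P_{x'})(\rho y')\Big\|_{L^s(dx')}<\infty.$$
   Context: $n\ge2$; $\mathbb B$ is the open unit ball of $\mathbb R^n$, $\mathbb S$ the unit sphere, $dx'$ normalized surface measure on $\mathbb S$; points of $\mathbb B$ are written $x=rx'$ with $r=|x|$, $x'\in\mathbb S$. $h(\mathbb B)$ is the space of harmonic functions on $\mathbb B$. $\{Y^{(k)}_j:k\ge0,\,1\le j\le d_k\}$ is a real orthonormal basis of $L^2(\mathbb S,dx')$ with $Y^{(k)}_j$ spherical harmonics of degree $k$. Every $f\in h(\mathbb B)$ expands as $f(rx')=\sum_k r^k\sum_j b_k^j(f)Y^{(k)}_j(x')$. For a double indexed sequence $c$ and $f\in h(\mathbb B)$, $(c*f)(rx')=\sum_k r^k\sum_j c_k^jb_k^j(f)Y^{(k)}_j(x')$ (when the series converges in $\mathbb B$). For spaces $X,Y\subset h(\mathbb B)$, $M_H(X,Y)$ is the set of sequences $c$ with $c*f\in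 Y$ for every $f\in X$. For $x'\in\mathbb S$, $t>0$ and $0\le\rho<1$, $y'\in\mathbb S$, $$\Lambda_{t}(g_c*P_{x'})(\rho y')=\sum_{k\ge0}\rho^k\frac{\Gamma(k+n/2+t)}{\Gamma(k+n/2)\Gamma(t)}\sum_{j=1}^{d_k}c_k^jY^{(k)}_j(x')Y^{(k)}_j(y'),$$ and $\|F(x')\|_{L^s(dx')}=(\int_{\mathbb S}|F(x')|^sdx')^{1/s}$ (supremum if $s=\infty$). $M_q(f,r)=(\int_{\mathbb S}|f(rx')|^qdx')^{1/q}$ (sup if $q=\infty$). For $\alpha\ge0$, $0<p\le\infty$: $H^p_\alpha=\{f\in h(\mathbb B):\sup_{r<1}M_p(f,r)(1-r)^\alpha<\infty\}$, $H^p=H^p_0$. *)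

theory Defs
  imports "HOL-Analysis.Analysis"
begin

text \<open>Direction x' of a point x = r x' (an arbitrary fixed unit vector when x = 0,
  where r = 0 and the choice of x' is immaterial).\<close>
definition dirn :: "real^'n \<Rightarrow> real^'n" where
  "dirn x = (if x = 0 then (SOME u. norm u = 1) else x /\<^sub>R norm x)"

text \<open>Normalized surface measure on the unit sphere: the push-forward of normalized
  Lebesgue measure on the unit ball under radial projection.\<close>
definition sphere_measure :: "(real^'n) measure" where
  "sphere_measure = distr (uniform_measure lborel (ball 0 1))
      (restrict_space borel (sphere 0 1)) dirn"

definition harmonic_on :: "(real^'n) set \<Rightarrow> (real^'n \<Rightarrow> real) \<Rightarrow> bool" where
  "harmonic_on S f \<longleftrightarrow> open S \<and>
     (\<forall>x\<in>S. f differentiable (at x)) \<and>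
     (\<forall>i\<in>Basis. \<forall>x\<in>S. (\<lambda>y. frechet_derivative f (at y) i) differentiable (at x)) \<and>
     (\<forall>i\<in>Basis. \<forall>k\<in>Basis. continuous_on S
        (\<lambda>x. frechet_derivative (\<lambda>y. frechet_derivative f (at y) i) (at x) k)) \<and>
     (\<forall>x\<in>S. (\<Sum>i\<in>Basis. frechet_derivative (\<lambda>y. frechet_derivative f (at y) i) (at x) i) = 0)"

inductive_set poly_fun :: "(real^'n \<Rightarrow> real) set" where
  pf_const: "(\<lambda>x. c) \<in> poly_fun"
| pf_coord: "(\<lambda>x. x $ i) \<in> poly_fun"
| pf_add: "p \<in> poly_fun \<Longrightarrow> q \<in> poly_fun \<Longrightarrow> (\<lambda>x. p x + q x) \<in> poly_fun"
| pf_mult: "p \<in> poly_fun \<Longrightarrow> q \<in> poly_fun \<Longrightarrow> (\<lambda>x. p x * q x) \<in> poly_fun"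

definition spherical_harmonic :: "nat \<Rightarrow> (real^'n \<Rightarrow> real) \<Rightarrow> bool" where
  "spherical_harmonic k Y \<longleftrightarrow> (\<exists>p. p \<in> poly_fun \<and>
      (\<forall>(a::real) x. p (a *\<^sub>R x) = a ^ k * p x) \<and>
      harmonic_on UNIV p \<and> (\<forall>x\<in>sphere 0 1. Y x = p x))"

definition sh_basis :: "(nat \<Rightarrow> nat \<Rightarrow> real^'n \<Rightarrow> real) \<Rightarrow> (nat \<Rightarrow> nat) \<Rightarrow> bool" where
  "sh_basis Y d \<longleftrightarrow>
     (\<forall>k. \<forall>j\<in>{1..d k}. spherical_harmonic k (Y k j)) \<and>
     (\<forall>k j k' j'. j \<in> {1..d k} \<longrightarrow> j' \<in> {1..d k'} \<longrightarrow>
        integral\<^sup>L sphere_measure (\<lambda>x. Y k j x * Y k' j' x) =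
          (if k = k' \<and> j = j' then 1 else 0)) \<and>
     (\<forall>f. f \<in> borel_measurable sphere_measure \<longrightarrow>
          integrable sphere_measure (\<lambda>x. (f x)\<^sup>2) \<longrightarrow>
          (\<forall>k. \<forall>j\<in>{1..d k}. integral\<^sup>L sphere_measure (\<lambda>x. f x * Y k j x) = 0) \<longrightarrow>
          (AE x in sphere_measure. f x = 0))"

definition hcoef :: "(nat \<Rightarrow> nat \<Rightarrow> real^'n \<Rightarrow> real) \<Rightarrow> (nat \<Rightarrow> nat) \<Rightarrow>
    (real^'n \<Rightarrow> real) \<Rightarrow> nat \<Rightarrow> nat \<Rightarrow> real" where
  "hcoef Y d f = (THE b. (\<forall>k j. j \<notin> {1..d k} \<longrightarrow> b k j = 0) \<and>
      (\<forall>x\<in>ball 0 1. (\<lambda>k. norm x ^ k * (\<Sum>j=1..d k. b k j * Y k j (dirn x))) sums f x))"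

definition hconv_term :: "(nat \<Rightarrow> nat \<Rightarrow> real^'n \<Rightarrow> real) \<Rightarrow> (nat \<Rightarrow> nat) \<Rightarrow>
    (nat \<Rightarrow> nat \<Rightarrow> real) \<Rightarrow> (real^'n \<Rightarrow> real) \<Rightarrow> real^'n \<Rightarrow> nat \<Rightarrow> real" where
  "hconv_term Y d c f x k =
     norm x ^ k * (\<Sum>j=1..d k. c k j * hcoef Y d f k j * Y k j (dirn x))"

definition hconv :: "(nat \<Rightarrow> nat \<Rightarrow> real^'n \<Rightarrow> real) \<Rightarrow> (nat \<Rightarrow> nat) \<Rightarrow>
    (nat \<Rightarrow> nat \<Rightarrow> real) \<Rightarrow> (real^'n \<Rightarrow> real) \<Rightarrow> real^'n \<Rightarrow> real" where
  "hconv Y d c f x = (\<Sum>k. hconv_term Y d c f x k)"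

definition MH :: "(nat \<Rightarrow> nat \<Rightarrow> real^'n \<Rightarrow> real) \<Rightarrow> (nat \<Rightarrow> nat) \<Rightarrow>
    (real^'n \<Rightarrow> real) set \<Rightarrow> (real^'n \<Rightarrow> real) set \<Rightarrow> (nat \<Rightarrow> nat \<Rightarrow> real) set" where
  "MH Y d X Z = {c. \<forall>f\<in>X. (\<forall>x\<in>ball 0 1. summable (hconv_term Y d c f x)) \<and>
                          hconv Y d c f \<in> Z}"

definition Lnorm :: "ennreal \<Rightarrow> (real^'n \<Rightarrow> real) \<Rightarrow> ennreal" where
  "Lnorm p F = (if p = \<infinity> then (SUP x\<in>sphere 0 1. ennreal \<bar>F x\<bar>)
     else (let I = (\<integral>\<^sup>+ x. ennreal (\<bar>F x\<bar> powr enn2real p) \<partial>sphere_measure)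
           in if I = \<infinity> then \<infinity> else ennreal (enn2real I powr (1 / enn2real p))))"

definition Mfun :: "ennreal \<Rightarrow> (real^'n \<Rightarrow> real) \<Rightarrow> real \<Rightarrow> ennreal" where
  "Mfun p f r = Lnorm p (\<lambda>x'. f (r *\<^sub>R x'))"

definition Hspace :: "ennreal \<Rightarrow> real \<Rightarrow> (real^'n \<Rightarrow> real) set" where
  "Hspace p \<alpha> = {f. harmonic_on (ball 0 1) f \<and>
      (SUP r\<in>{0..<1}. Mfun p f r * ennreal ((1 - r) powr \<alpha>)) < \<infinity>}"

definition gc_term :: "(nat \<Rightarrow> nat \<Rightarrow> real^'n \<Rightarrow> real) \<Rightarrow> (nat \<Rightarrow> nat) \<Rightarrow>
    (nat \<Rightarrow> nat \<Rightarrow> real) \<Rightarrow> real^'n \<Rightarrow> nat \<Rightarrow> real" where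
  "gc_term Y d c x k = norm x ^ k * (\<Sum>j=1..d k. c k j * Y k j (dirn x))"

definition gc :: "(nat \<Rightarrow> nat \<Rightarrow> real^'n \<Rightarrow> real) \<Rightarrow> (nat \<Rightarrow> nat) \<Rightarrow>
    (nat \<Rightarrow> nat \<Rightarrow> real) \<Rightarrow> real^'n \<Rightarrow> real" where
  "gc Y d c x = (\<Sum>k. gc_term Y d c x k)"

definition LambdaP :: "(nat \<Rightarrow> nat \<Rightarrow> real^'n \<Rightarrow> real) \<Rightarrow> (nat \<Rightarrow> nat) \<Rightarrow>
    (nat \<Rightarrow> nat \<Rightarrow> real) \<Rightarrow> real \<Rightarrow> real^'n \<Rightarrow> real \<Rightarrow> real^'n \<Rightarrow> real" where
  "LambdaP Y d c t x' \<rho> y' = (\<Sum>k. \<rho> ^ k *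
      (Gamma (real k + real CARD('n) / 2 + t) /
        (Gamma (real k + real CARD('n) / 2) * Gamma t)) *
      (\<Sum>j=1..d k. c k j * Y k j x' * Y k j y'))"

definition Ts :: "(nat \<Rightarrow> nat \<Rightarrow> real^'n \<Rightarrow> real) \<Rightarrow> (nat \<Rightarrow> nat) \<Rightarrow>
    (nat \<Rightarrow> nat \<Rightarrow> real) \<Rightarrow> ennreal \<Rightarrow> real \<Rightarrow> real \<Rightarrow> real \<Rightarrow> real \<Rightarrow> ennreal" where
  "Ts Y d c s t \<alpha> \<beta> m =
     (SUP \<rho>\<in>{0..<1}. SUP y'\<in>sphere (0::real^'n) 1.
        ennreal ((1 - \<rho>) powr (\<beta> - \<alpha> + m + real CARD('n) - (real CARD('n) - 1) / t)) *
        Lnorm s (\<lambda>x'. LambdaP Y d c (m + 1) x' \<rho> y'))"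

end

(*
  Harmonic functions on the ball are recovered from their dilates by the Poisson integral, and
  completeness of the Y k j makes the Poisson kernel the generating function of the zonal
  harmonics; this gives the expansion of every harmonic f with coefficients growing
  subexponentially. Applying the multiplier gamma(k + n/2 + T) / (gamma(k + n/2) gamma(T)) to the
  Poisson kernel yields a kernel of size at most C |x' - rho y'|^(1 - n - T).

  (2) ==> (1): c * f (r^2 x') is a Beta average over v of the spherical means of
  Lambda_(m+1)(g_c * P_x') f taken on the sphere of radius r sqrt (1 - v). Minkowski's inequality
  and the Hardy-Littlewood embedding of H^t_alpha into a weighted H^1 bound its L^s norm.

  (1) ==> (2): the fractional derivatives of order m + 1 of the Poisson kernels with pole y'
  and dilation rho, suitably normalised, are bounded in H^t_alpha, and c maps them to a multiple of
  Lambda_(m+1)(g_c * P_x')(rho y'). The uniform bound for their images comes from a Sokal-type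
  construction of a single f whose image would otherwise leave H^s_beta.
*)
theory Submission
  imports Defs "HOL-Probability.Probability_Measure"
begin

subsection \<open>Surface measure\<close>

text \<open>Growth is always expressed through \<open>tame\<close> sequences. They are closed under
  sums and products and contain the dimensions \<open>d k\<close>, the suprema of the zonal
  harmonics and the Gamma quotients, so that series and integrals are interchanged under absolute
  convergence. A noninteger order T is reached by N > T differentiations followed by an average over
  dilates against a Beta density; Beta moments also undo the Gamma quotient in the convolution
  formula. The weight in \<open>Ts\<close> has exponent \<beta> + e with e = m + n - \<alpha> - (n -
  1)/t. The lower bound on m says that e > 0, so the test kernels can be normalised by the e-th
  power of 1 - \<rho>. In the other direction this exponent and the one lost in the embedding into
  weighted H^1 add up to \<beta> + m + 1. The two exponents act differently: t \<le> 1 makes t-th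
  powers subadditive and gives the embedding, while s \<ge> 1 gives Minkowski's inequality in the
  target. For t < 1 the source space has only a quasi-norm, so uniform boundedness is obtained by
  summing test functions directly, with seminorms only on the target side.\<close>

lemma norm_dirn [simp]: "norm (dirn x) = 1"
proof -
  obtain u :: "real^'a" where "norm u = 1"
    using vector_choose_size[of 1] by (metis zero_le_one)
  then have "norm (SOME u::real^'a. norm u = 1) = 1"
    by (rule someI)
  then show ?thesis
    by (auto simp: dirn_def)
qed

lemma norm_scaleR_dirn [simp]: "norm x *\<^sub>R dirn x = x"
  by (auto simp: dirn_def)

lemma dirn_unit: "norm x = 1 \<Longrightarrow> dirn x = x"
  by (auto simp: dirn_def)

lemma measurable_dirn [measurable]: "dirn \<in> borel \<rightarrow>\<^sub>M restrict_space borel (sphere 0 1)"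
proof (rule measurable_restrict_space2)
  show "dirn \<in> space borel \<rightarrow> sphere 0 1"
    by auto
  show "dirn \<in> borel_measurable (borel :: (real^'n) measure)"
    unfolding dirn_def[abs_def] by measurable
qed

lemma emeasure_ball_pos: "emeasure lborel (ball (0::'a::euclidean_space) 1) > 0"
proof -
  have "ball (0::'a) 1 \<notin> null_sets lborel"
    using open_not_negligible[of "ball (0::'a) 1"] null_sets_completionI[of _ lborel]
    by (auto simp: negligible_iff_null_sets)
  then show ?thesis
    by (auto simp: null_sets_def zero_less_iff_neq_zero)
qed

lemma emeasure_ball_finite: "emeasure lborel (ball (0::'a::euclidean_space) 1) < \<infinity>"
  using emeasure_lborel_ball_finite[of 0 1] by (simp add: less_top)

text \<open>Fubini computes \<open>\<integral>\<integral> f(x) g(x + y)\<close> in two ways; this determines a translation invariant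
  measure by its value on a single symmetric set, without the decomposition of linear maps.\<close>
lemma translation_invariant_swap:
  fixes M :: "'a::euclidean_space measure"
  assumes [simp]: "sets M = sets borel" and "sigma_finite_measure M"
    and inv: "\<And>f y. f \<in> borel_measurable borel \<Longrightarrow> (\<integral>\<^sup>+x. f (x + y) \<partial>M) = (\<integral>\<^sup>+x. f x \<partial>M)"
    and [measurable]: "f \<in> borel_measurable borel" "g \<in> borel_measurable borel"
  shows "(\<integral>\<^sup>+x. f x \<partial>M) * (\<integral>\<^sup>+x. g x \<partial>lborel) = (\<integral>\<^sup>+x. g x \<partial>M) * (\<integral>\<^sup>+x. f (- x) \<partial>lborel)"
proof -
  interpret M: sigma_finite_measure M by fact
  interpret P: pair_sigma_finite M lborel ..
  note [measurable_cong] = assms(1)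
  have trl: "(\<integral>\<^sup>+y. h (x + y) \<partial>lborel) = (\<integral>\<^sup>+y. h y \<partial>lborel)"
    if [measurable]: "h \<in> borel_measurable borel" for h :: "'a \<Rightarrow> ennreal" and x
  proof -
    have "(\<integral>\<^sup>+y. h y \<partial>lborel) = (\<integral>\<^sup>+y. h y \<partial>(distr lborel borel ((+) x)))"
      by (simp add: lborel_distr_plus)
    also have "\<dots> = (\<integral>\<^sup>+y. h (x + y) \<partial>lborel)"
      by (subst nn_integral_distr) auto
    finally show ?thesis by simp
  qed
  have "(\<integral>\<^sup>+x. f x \<partial>M) * (\<integral>\<^sup>+x. g x \<partial>lborel) = (\<integral>\<^sup>+x. f x * (\<integral>\<^sup>+y. g (x + y) \<partial>lborel) \<partial>M)"
    by (simp add: trl nn_integral_multc)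
  also have "\<dots> = (\<integral>\<^sup>+x. (\<integral>\<^sup>+y. f x * g (x + y) \<partial>lborel) \<partial>M)"
    by (subst nn_integral_cmult) auto
  also have "\<dots> = (\<integral>\<^sup>+y. (\<integral>\<^sup>+x. f x * g (x + y) \<partial>M) \<partial>lborel)"
    by (rule P.Fubini'[symmetric]) measurable
  also have "\<dots> = (\<integral>\<^sup>+y. (\<integral>\<^sup>+x. f (x - y) * g x \<partial>M) \<partial>lborel)"
    using inv[of "\<lambda>x. f (x - y) * g x" y for y] by simp
  also have "\<dots> = (\<integral>\<^sup>+x. (\<integral>\<^sup>+y. f (x - y) * g x \<partial>lborel) \<partial>M)"
    by (rule P.Fubini') measurable
  also have "\<dots> = (\<integral>\<^sup>+x. (\<integral>\<^sup>+y. f (x - y) \<partial>lborel) * g x \<partial>M)"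
    by (subst nn_integral_multc) auto
  also have "\<dots> = (\<integral>\<^sup>+x. (\<integral>\<^sup>+y. f (- y) \<partial>lborel) * g x \<partial>M)"
    using trl[of "\<lambda>y. f (- y)" "- x" for x] by (simp add: algebra_simps)
  also have "\<dots> = (\<integral>\<^sup>+x. g x \<partial>M) * (\<integral>\<^sup>+x. f (- x) \<partial>lborel)"
    by (subst nn_integral_cmult) (auto simp: mult.commute)
  finally show ?thesis .
qed

text \<open>The image of Lebesgue measure under \<open>T\<close> is again translation invariant,
  since a shift by y comes from a shift by a preimage of y, and it gives the unit ball the same mass
  because \<open>T\<close> preserves norms. Swapping against the indicator of the ball, a symmetric
  set, compares the two measures.\<close>

lemma nn_integral_lborel_orthogonal:
  fixes T :: "'a::euclidean_space \<Rightarrow> 'a"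
  assumes T: "orthogonal_transformation T" and [measurable]: "f \<in> borel_measurable borel"
  shows "(\<integral>\<^sup>+x. f (T x) \<partial>lborel) = (\<integral>\<^sup>+x. f x \<partial>lborel)"
proof -
  let ?B = "ball (0::'a) 1"
  have lin: "linear T" and bij: "bij T" and nrm: "\<And>x. norm (T x) = norm x"
    using T by (auto simp: orthogonal_transformation_linear orthogonal_transformation_bij orthogonal_transformation_norm)
  have [measurable]: "T \<in> borel_measurable borel"
    using lin by (intro borel_measurable_continuous_onI linear_continuous_on) (simp add: linear_conv_bounded_linear)
  define M where "M = distr lborel borel T"
  have Mint: "(\<integral>\<^sup>+x. h x \<partial>M) = (\<integral>\<^sup>+x. h (T x) \<partial>lborel)" if [measurable]: "h \<in> borel_measurable borel" for h
    unfolding M_def by (subst nn_integral_distr) auto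
  have trl: "(\<integral>\<^sup>+y. h (y + x) \<partial>lborel) = (\<integral>\<^sup>+y. h y \<partial>lborel)"
    if [measurable]: "h \<in> borel_measurable borel" for h :: "'a \<Rightarrow> ennreal" and x
  proof -
    have "(\<integral>\<^sup>+y. h y \<partial>lborel) = (\<integral>\<^sup>+y. h y \<partial>(distr lborel borel ((+) x)))"
      by (simp add: lborel_distr_plus)
    also have "\<dots> = (\<integral>\<^sup>+y. h (y + x) \<partial>lborel)"
      by (subst nn_integral_distr) (auto simp: add.commute)
    finally show ?thesis by simp
  qed
  have sfM: "sigma_finite_measure M"
  proof
    define A where "A = range (\<lambda>k::nat. ball (0::'a) (real k))"
    have "emeasure M (ball 0 (real k)) \<noteq> \<infinity>" for k
    proof -
      have "T -` ball 0 (real k) = ball 0 (real k)"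
        using nrm by (auto simp: dist_norm)
      then have "emeasure M (ball 0 (real k)) = emeasure lborel (ball (0::'a) (real k))"
        unfolding M_def by (subst emeasure_distr) auto
      also have "\<dots> < \<infinity>"
        using emeasure_lborel_ball_finite[of "0::'a" "real k"] by (simp add: less_top)
      finally show ?thesis
        by simp
    qed
    moreover have "\<Union>A = UNIV"
      using reals_Archimedean2 by (auto simp: A_def dist_norm)
    ultimately show "\<exists>A. countable A \<and> A \<subseteq> sets M \<and> \<Union>A = space M \<and> (\<forall>a\<in>A. emeasure M a \<noteq> \<infinity>)"
      by (intro exI[of _ A]) (auto simp: A_def M_def)
  qed
  have inv: "(\<integral>\<^sup>+x. h (x + y) \<partial>M) = (\<integral>\<^sup>+x. h x \<partial>M)" if [measurable]: "h \<in> borel_measurable borel" for h y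
  proof -
    obtain z where z: "T z = y"
      using bij by (metis bij_pointE)
    have "(\<integral>\<^sup>+x. h (x + y) \<partial>M) = (\<integral>\<^sup>+x. h (T (x + z)) \<partial>lborel)"
      using z linear_add[OF lin] by (simp add: Mint)
    also have "\<dots> = (\<integral>\<^sup>+x. h (T x) \<partial>lborel)"
      by (rule trl) measurable
    finally show ?thesis
      by (simp add: Mint)
  qed
  let ?b = "emeasure lborel ?B"
  have b: "?b \<noteq> 0" "?b \<noteq> top"
    using emeasure_ball_pos[where 'a='a] emeasure_ball_finite[where 'a='a] by auto
  have cancel: "u = v" if "u * ?b = ?b * v" for u v :: ennreal
    using that b by (metis ennreal_mult_cancel_left mult.commute)
  have Bint: "(\<integral>\<^sup>+x. indicator ?B x \<partial>lborel) = ?b"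
    by simp
  have [measurable]: "?B \<in> sets borel"
    by (intro borel_open open_ball)
  have BintM: "(\<integral>\<^sup>+x. indicator ?B x \<partial>M) = ?b"
    using nrm by (subst Mint) (auto simp: indicator_def dist_norm simp flip: Bint)
  have "(\<integral>\<^sup>+x. f x \<partial>M) * ?b = ?b * (\<integral>\<^sup>+x. f (- x) \<partial>lborel)"
    using translation_invariant_swap[of M f "indicator ?B", OF _ sfM inv] Bint BintM
    by (simp add: M_def)
  \<comment> \<open>Only the reflected integral is reached this way; the same computation for
    \<open>lborel\<close> itself removes the reflection.\<close>
  then have 1: "(\<integral>\<^sup>+x. f x \<partial>M) = (\<integral>\<^sup>+x. f (- x) \<partial>lborel)"
    by (rule cancel)
  have "(\<integral>\<^sup>+x. f x \<partial>lborel) * ?b = ?b * (\<integral>\<^sup>+x. f (- x) \<partial>lborel)"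
    using translation_invariant_swap[of lborel f "indicator ?B", OF _ _ trl] Bint
    by (simp add: lborel.sigma_finite_measure_axioms)
  then have "(\<integral>\<^sup>+x. f x \<partial>lborel) = (\<integral>\<^sup>+x. f (- x) \<partial>lborel)"
    by (rule cancel)
  with 1 show ?thesis
    by (simp add: Mint)
qed

lemma space_sphere_measure [simp]: "space sphere_measure = sphere 0 1"
  by (simp add: sphere_measure_def space_restrict_space)

lemma sets_sphere_measure [simp, measurable_cong]:
  "sets sphere_measure = sets (restrict_space borel (sphere 0 1))"
  by (simp add: sphere_measure_def)

lemma prob_space_sphere_measure: "prob_space (sphere_measure :: (real^'n) measure)"
proof -
  interpret U: prob_space "uniform_measure lborel (ball (0::real^'n) 1)"
    using emeasure_ball_pos[where 'a="real^'n"] emeasure_ball_finite[where 'a="real^'n"]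
    by (intro prob_space_uniform_measure) auto
  show ?thesis
    unfolding sphere_measure_def by (rule U.prob_space_distr) measurable
qed

interpretation sph: prob_space "sphere_measure :: (real^'n) measure"
  by (rule prob_space_sphere_measure)

lemma nn_integral_sphere_measure:
  fixes f :: "real^'n \<Rightarrow> ennreal"
  assumes [measurable]: "f \<in> borel_measurable sphere_measure"
  shows "(\<integral>\<^sup>+y. f y \<partial>sphere_measure) =
    (\<integral>\<^sup>+z. f (dirn z) * indicator (ball 0 1) z \<partial>lborel) / emeasure lborel (ball (0::real^'n) 1)"
  unfolding sphere_measure_def
  by (subst nn_integral_distr, measurable, subst nn_integral_uniform_measure) (auto intro!: measurable_compose[OF measurable_dirn])

lemma measurable_sphere_continuous:
  fixes f :: "real^'n \<Rightarrow> 'b::topological_space"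
  shows "continuous_on (sphere 0 1) f \<Longrightarrow> f \<in> borel_measurable sphere_measure"
  using borel_measurable_continuous_on_restrict[of "sphere 0 1" f]
  by (simp cong: measurable_cong_sets)

lemma integrable_sphere_continuous:
  fixes f :: "real^'n \<Rightarrow> real"
  assumes "continuous_on (sphere 0 1) f"
  shows "integrable sphere_measure f"
proof -
  have "bounded (f ` sphere 0 1)"
    using assms by (intro compact_imp_bounded compact_continuous_image) auto
  then obtain B where "\<forall>y\<in>sphere 0 1. norm (f y) \<le> B"
    by (auto simp: bounded_iff)
  then show ?thesis
    using measurable_sphere_continuous[OF assms]
    by (intro sph.integrable_const_bound[of f B]) (auto intro!: AE_I2)
qed

lemma nn_integral_sphere_orthogonal:
  fixes T :: "real^'n \<Rightarrow> real^'n"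
  assumes T: "orthogonal_transformation T" and f: "continuous_on (sphere 0 1) (f :: real^'n \<Rightarrow> ennreal)"
  shows "(\<integral>\<^sup>+y. f (T y) \<partial>sphere_measure) = (\<integral>\<^sup>+y. f y \<partial>sphere_measure)"
proof -
  have lin: "linear T" and nrm: "\<And>x. norm (T x) = norm x"
    using T by (auto simp: orthogonal_transformation_linear orthogonal_transformation_norm)
  have cT: "continuous_on S T" for S
    using lin by (intro linear_continuous_on) (simp add: linear_conv_bounded_linear)
  have fT: "continuous_on (sphere 0 1) (\<lambda>y. f (T y))"
    by (rule continuous_on_compose2[OF f cT]) (auto simp: nrm)
  note [measurable] = measurable_sphere_continuous[OF f] measurable_sphere_continuous[OF fT]
  have [measurable]: "(\<lambda>z. f (dirn z)) \<in> borel_measurable borel"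
    using measurable_compose[OF measurable_dirn, of f borel] by simp
  have [measurable]: "ball (0::real^'n) 1 \<in> sets borel"
    by (intro borel_open open_ball)
  have "(\<integral>\<^sup>+z. f (dirn (T z)) * indicator (ball 0 1) (T z) \<partial>lborel) =
      (\<integral>\<^sup>+z. f (dirn z) * indicator (ball 0 1) z \<partial>lborel)"
    by (rule nn_integral_lborel_orthogonal[OF T, of "\<lambda>z. f (dirn z) * indicator (ball 0 1) z"]) measurable
  \<comment> \<open>The origin is discarded because \<open>dirn 0\<close> is an arbitrary unit
    vector, which \<open>T\<close> need not fix.\<close>
  moreover have "AE z in lborel. z \<noteq> (0::real^'n)"
    by (rule AE_lborel_singleton)
  then have "AE z in lborel. f (dirn (T z)) * indicator (ball 0 1) (T z) = f (T (dirn z)) * indicator (ball 0 1) z"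
  proof eventually_elim
    case (elim z)
    moreover have "T z \<noteq> 0"
      using elim nrm[of z] by auto
    ultimately show ?case
      by (simp add: dirn_def nrm linear_scale[OF lin] indicator_def)
  qed
  then have "(\<integral>\<^sup>+z. f (dirn (T z)) * indicator (ball 0 1) (T z) \<partial>lborel) =
      (\<integral>\<^sup>+z. f (T (dirn z)) * indicator (ball 0 1) z \<partial>lborel)"
    by (rule nn_integral_cong_AE)
  ultimately show ?thesis
    by (simp add: nn_integral_sphere_measure)
qed

lemma integral_sphere_orthogonal:
  fixes T :: "real^'n \<Rightarrow> real^'n" and f :: "real^'n \<Rightarrow> real"
  assumes T: "orthogonal_transformation T" and f: "continuous_on (sphere 0 1) f"
    and nn: "\<And>y. norm y = 1 \<Longrightarrow> 0 \<le> f y"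
  shows "(\<integral>y. f (T y) \<partial>sphere_measure) = (\<integral>y. f y \<partial>sphere_measure)"
proof -
  have nrm: "\<And>x. norm (T x) = norm x"
    using T by (auto simp: orthogonal_transformation_norm)
  have cT: "continuous_on S T" for S
    using orthogonal_transformation_linear[OF T] by (intro linear_continuous_on) (simp add: linear_conv_bounded_linear)
  have fT: "continuous_on (sphere 0 1) (\<lambda>y. f (T y))"
    by (rule continuous_on_compose2[OF f cT]) (auto simp: nrm)
  have "continuous_on (sphere 0 1) (\<lambda>y. ennreal (f y))"
    using f by (intro continuous_on_ennreal)
  from nn_integral_sphere_orthogonal[OF T this] show ?thesis
    using nn measurable_sphere_continuous[OF f] measurable_sphere_continuous[OF fT]
    by (subst (1 2) integral_eq_nn_integral) (auto simp: nrm intro!: AE_I2)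
qed

text \<open>A nonzero value of f persists on an open part of a cone inside the ball, and open sets
  have positive Lebesgue measure. This turns the almost-everywhere conclusion in
  \<open>sh_basis\<close> into a pointwise one for continuous functions.\<close>

lemma AE_sphere_continuous_zero:
  fixes f :: "real^'n \<Rightarrow> real"
  assumes f: "continuous_on (sphere 0 1) f" and ae: "AE y in sphere_measure. f y = 0" and y: "norm y = 1"
  shows "f y = 0"
proof (rule ccontr)
  assume ny: "f y \<noteq> 0"
  have [measurable]: "f \<in> borel_measurable sphere_measure"
    by (rule measurable_sphere_continuous[OF f])
  have cd: "continuous_on (- {0}) (\<lambda>z. f (z /\<^sub>R norm z))"
    by (rule continuous_on_compose2[OF f]) (auto intro!: continuous_intros simp: field_simps split: if_splits)
  define V where "V = {z \<in> - {0}. f (z /\<^sub>R norm z) \<noteq> 0} \<inter> ball 0 1"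
  have "open {z \<in> - {0}. f (z /\<^sub>R norm z) \<noteq> 0}"
    using continuous_open_preimage[OF cd, of "- {0}"] by (simp add: open_Compl vimage_def Int_def)
  then have "open V"
    by (auto simp: V_def)
  moreover have "(1/2) *\<^sub>R y \<in> V"
    using ny y by (auto simp: V_def)
  ultimately have nV: "\<not> negligible V"
    using open_not_negligible by blast
  have "(\<integral>\<^sup>+y. ennreal \<bar>f y\<bar> \<partial>sphere_measure) = 0"
    using ae by (subst nn_integral_0_iff_AE) auto
  then have "(\<integral>\<^sup>+z. ennreal \<bar>f (dirn z)\<bar> * indicator (ball 0 1) z \<partial>lborel) = 0"
    using emeasure_ball_finite[where 'a="real^'n"] by (auto simp: nn_integral_sphere_measure ennreal_divide_eq_0_iff)
  moreover have [measurable]: "(\<lambda>z. f (dirn z)) \<in> borel_measurable borel"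
    using measurable_compose[OF measurable_dirn, of f borel] by simp
  moreover have [measurable]: "ball (0::real^'n) 1 \<in> sets borel"
    by (intro borel_open open_ball)
  ultimately have "AE z in lborel. ennreal \<bar>f (dirn z)\<bar> * indicator (ball 0 1) z = 0"
    by (subst (asm) nn_integral_0_iff_AE) auto
  then have "AE z in lborel. z \<notin> V"
    by eventually_elim (auto simp: V_def dirn_def indicator_def)
  then have "V \<in> null_sets lborel"
    using AE_iff_null_sets[of V lborel] \<open>open V\<close> by auto
  with nV show False
    using null_sets_completionI by (auto simp: negligible_iff_null_sets)
qed

subsection \<open>Harmonic functions and the maximum principle\<close>

lemma harmonic_onI:
  fixes f :: "real^'n \<Rightarrow> real"
  assumes "open S"
    and d1: "\<And>x. x \<in> S \<Longrightarrow> (f has_derivative f' x) (at x)"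
    and d2: "\<And>i x. i \<in> Basis \<Longrightarrow> x \<in> S \<Longrightarrow> ((\<lambda>y. f' y i) has_derivative f'' i x) (at x)"
    and cont: "\<And>i k. i \<in> Basis \<Longrightarrow> k \<in> Basis \<Longrightarrow> continuous_on S (\<lambda>x. f'' i x k)"
    and lap: "\<And>x. x \<in> S \<Longrightarrow> (\<Sum>i\<in>Basis. f'' i x i) = 0"
  shows "harmonic_on S f"
proof -
  have fd: "frechet_derivative f (at x) = f' x" if "x \<in> S" for x
    using frechet_derivative_at[OF d1[OF that]] by simp
  have fd2: "((\<lambda>y. frechet_derivative f (at y) i) has_derivative f'' i x) (at x)"
    if "i \<in> Basis" "x \<in> S" for i x
    using d2[OF that] \<open>open S\<close> \<open>x \<in> S\<close> by (rule has_derivative_transform_within_open) (simp add: fd)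
  have fd3: "frechet_derivative (\<lambda>y. frechet_derivative f (at y) i) (at x) = f'' i x"
    if "i \<in> Basis" "x \<in> S" for i x
    using frechet_derivative_at[OF fd2[OF that]] by simp
  show ?thesis
    unfolding harmonic_on_def
  proof (intro conjI ballI)
    show "f differentiable at x" if "x \<in> S" for x
      using d1[OF that] by (rule differentiableI)
    show "(\<lambda>y. frechet_derivative f (at y) i) differentiable at x" if "i \<in> Basis" "x \<in> S" for i x
      using fd2[OF that] by (rule differentiableI)
    show "continuous_on S (\<lambda>x. frechet_derivative (\<lambda>y. frechet_derivative f (at y) i) (at x) k)"
      if "i \<in> Basis" "k \<in> Basis" for i k
      using cont[OF that] by (rule continuous_on_eq) (simp add: fd3 that)
    show "(\<Sum>i\<in>Basis. frechet_derivative (\<lambda>y. frechet_derivative f (at y) i) (at x) i) = 0" if "x \<in> S" for x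
      using lap[OF that] that by (simp add: fd3)
  qed fact
qed

text \<open>Chosen derivatives in place of the \<open>frechet_derivative\<close> terms of
  \<open>harmonic_on\<close>: \<open>f' x h\<close> is the derivative along h, and
  \<open>f'' i x h\<close> the derivative along h of the i-th partial. Differences and dilates are
  then handled by derivative rules.\<close>

definition harmonic_derivs ::
    "(real^'n) set \<Rightarrow> (real^'n \<Rightarrow> real) \<Rightarrow> (real^'n \<Rightarrow> real^'n \<Rightarrow> real) \<Rightarrow> (real^'n \<Rightarrow> real^'n \<Rightarrow> real^'n \<Rightarrow> real) \<Rightarrow> bool"
  where "harmonic_derivs S f f' f'' \<longleftrightarrow>
    (\<forall>x\<in>S. (f has_derivative f' x) (at x)) \<and>
    (\<forall>i\<in>Basis. \<forall>x\<in>S. ((\<lambda>y. f' y i) has_derivative f'' i x) (at x)) \<and>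
    (\<forall>i\<in>Basis. \<forall>k\<in>Basis. continuous_on S (\<lambda>x. f'' i x k)) \<and>
    (\<forall>x\<in>S. (\<Sum>i\<in>Basis. f'' i x i) = 0)"

lemma harmonic_derivsD:
  assumes "harmonic_derivs S f f' f''"
  shows "x \<in> S \<Longrightarrow> (f has_derivative f' x) (at x)"
    and "i \<in> Basis \<Longrightarrow> x \<in> S \<Longrightarrow> ((\<lambda>y. f' y i) has_derivative f'' i x) (at x)"
    and "i \<in> Basis \<Longrightarrow> k \<in> Basis \<Longrightarrow> continuous_on S (\<lambda>x. f'' i x k)"
    and "x \<in> S \<Longrightarrow> (\<Sum>i\<in>Basis. f'' i x i) = 0"
  using assms by (auto simp: harmonic_derivs_def)

lemma harmonic_onE:
  fixes f :: "real^'n \<Rightarrow> real"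
  assumes "harmonic_on S f"
  obtains f' f'' where "open S" and "harmonic_derivs S f f' f''"
  using assms
  by (intro that[of "\<lambda>x. frechet_derivative f (at x)"
        "\<lambda>i x. frechet_derivative (\<lambda>y. frechet_derivative f (at y) i) (at x)"])
     (auto simp: harmonic_on_def harmonic_derivs_def frechet_derivative_works)

lemma harmonic_on_imp_continuous_on:
  fixes f :: "real^'n \<Rightarrow> real"
  assumes "harmonic_on S f"
  shows "continuous_on S f"
  using assms
  by (auto simp: harmonic_on_def intro!: differentiable_imp_continuous_on differentiable_at_imp_differentiable_on)

lemma harmonic_on_diff:
  fixes f g :: "real^'n \<Rightarrow> real"
  assumes "harmonic_on S f" "harmonic_on S g"
  shows "harmonic_on S (\<lambda>x. f x - g x)"
proof -
  obtain f' f'' where "open S" "harmonic_derivs S f f' f''"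
    using assms(1) by (rule harmonic_onE)
  note f = this(1) harmonic_derivsD[OF this(2)]
  obtain g' g'' where "open S" "harmonic_derivs S g g' g''"
    using assms(2) by (rule harmonic_onE)
  note g = this(1) harmonic_derivsD[OF this(2)]
  show ?thesis
    by (rule harmonic_onI[where f' = "\<lambda>x h. f' x h - g' x h" and f'' = "\<lambda>i x h. f'' i x h - g'' i x h"])
      (auto intro!: f g derivative_intros continuous_intros simp: sum_subtractf f(5) g(5))
qed

lemma harmonic_on_const: "open S \<Longrightarrow> harmonic_on S (\<lambda>x::real^'n. c)"
  by (rule harmonic_onI[where f' = "\<lambda>x h. 0" and f'' = "\<lambda>i x h. 0"]) (auto intro!: derivative_eq_intros)

lemma harmonic_on_scaleR:
  fixes f :: "real^'n \<Rightarrow> real"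
  assumes "harmonic_on S f" and T: "open T" "\<And>x. x \<in> T \<Longrightarrow> a *\<^sub>R x \<in> S"
  shows "harmonic_on T (\<lambda>x. f (a *\<^sub>R x))"
proof -
  obtain f' f'' where "open S" "harmonic_derivs S f f' f''"
    using assms(1) by (rule harmonic_onE)
  note f = this(1) harmonic_derivsD[OF this(2)]
  have lin: "g h * a = g (a *\<^sub>R h)" if "(k has_derivative g) F" for k :: "real^'n \<Rightarrow> real" and g F h
    using linear_scale[OF has_derivative_linear[OF that], of a h] by simp
  show ?thesis
  proof (rule harmonic_onI[where f' = "\<lambda>x h. f' (a *\<^sub>R x) h * a" and f'' = "\<lambda>i x h. f'' i (a *\<^sub>R x) h * a * a"])
    show "open T" by fact
    have *: "((\<lambda>x. a *\<^sub>R x) has_derivative (\<lambda>h. a *\<^sub>R h)) (at x)" for x :: "real^'n"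
      by (auto intro!: derivative_eq_intros)
    show "((\<lambda>x. f (a *\<^sub>R x)) has_derivative (\<lambda>h. f' (a *\<^sub>R x) h * a)) (at x)" if "x \<in> T" for x
      using has_derivative_compose[OF * f(2)[OF T(2)[OF that]]] lin[OF f(2)[OF T(2)[OF that]]]
      by (simp add: o_def)
    show "((\<lambda>y. f' (a *\<^sub>R y) i * a) has_derivative (\<lambda>h. f'' i (a *\<^sub>R x) h * a * a)) (at x)"
      if "i \<in> Basis" "x \<in> T" for i x
      using has_derivative_mult_left[OF has_derivative_compose[OF * f(3)[OF that(1) T(2)[OF that(2)]]], of a]
        lin[OF f(3)[OF that(1) T(2)[OF that(2)]]]
      by (simp add: o_def)
    show "continuous_on T (\<lambda>x. f'' i (a *\<^sub>R x) k * a * a)" if "i \<in> Basis" "k \<in> Basis" for i k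
      by (intro continuous_intros continuous_on_compose2[OF f(4)[OF that]]) (auto intro: T)
    show "(\<Sum>i\<in>Basis. f'' i (a *\<^sub>R x) i * a * a) = 0" if "x \<in> T" for x
      using f(5)[OF T(2)[OF that]] by (simp flip: sum_distrib_right)
  qed
qed

lemma harmonic_on_subset: "harmonic_on S f \<Longrightarrow> open T \<Longrightarrow> T \<subseteq> S \<Longrightarrow> harmonic_on T f"
  using harmonic_on_scaleR[of S f T 1] by auto

text \<open>Lets a function be proved harmonic through different representations on smaller balls,
  as \<open>series_harmonic\<close> does with one Poisson integral for each radius.\<close>

lemma harmonic_on_locally:
  fixes f :: "real^'n \<Rightarrow> real"
  assumes "open S" and loc: "\<And>x. x \<in> S \<Longrightarrow> \<exists>T. x \<in> T \<and> harmonic_on T f"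
  shows "harmonic_on S f"
  unfolding harmonic_on_def
proof (intro conjI ballI)
  show "continuous_on S (\<lambda>x. frechet_derivative (\<lambda>y. frechet_derivative f (at y) i) (at x) k)"
    if "i \<in> Basis" "k \<in> Basis" for i k
  proof (intro continuous_at_imp_continuous_on ballI)
    fix x assume "x \<in> S"
    then obtain T where T: "x \<in> T" "harmonic_on T f"
      using loc by blast
    then have "continuous_on T (\<lambda>x. frechet_derivative (\<lambda>y. frechet_derivative f (at y) i) (at x) k)" "open T"
      using that by (auto simp: harmonic_on_def)
    with T show "isCont (\<lambda>x. frechet_derivative (\<lambda>y. frechet_derivative f (at y) i) (at x) k) x"
      by (auto simp: continuous_on_eq_continuous_at)
  qed
next
  fix x assume "x \<in> S"
  then obtain T where T: "x \<in> T" "harmonic_on T f"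
    using loc by blast
  then show "f differentiable at x"
    and "(\<Sum>i\<in>Basis. frechet_derivative (\<lambda>y. frechet_derivative f (at y) i) (at x) i) = 0"
    by (auto simp: harmonic_on_def)
  show "(\<lambda>y. frechet_derivative f (at y) i) differentiable at x" if "i \<in> Basis" for i
    using T that by (auto simp: harmonic_on_def)
qed fact

lemma harmonic_on_cong:
  fixes f :: "real^'n \<Rightarrow> real"
  assumes "harmonic_on S f" and eq: "\<And>x. x \<in> S \<Longrightarrow> f x = g x"
  shows "harmonic_on S g"
proof -
  obtain f' f'' where "open S" "harmonic_derivs S f f' f''"
    using assms(1) by (rule harmonic_onE)
  note f = this(1) harmonic_derivsD[OF this(2)]
  have "(g has_derivative f' x) (at x)" if "x \<in> S" for x
    using f(2)[OF that] f(1) that by (rule has_derivative_transform_within_open) (simp add: eq)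
  from harmonic_onI[OF f(1) this f(3-5)] show ?thesis .
qed

text \<open>If c were positive, g' would be positive just to the right of its zero at 0, and g would
  rise above \<open>g 0\<close>.\<close>

lemma second_derivative_at_max:
  fixes g g' :: "real \<Rightarrow> real"
  assumes "\<delta> > 0" and d1: "\<And>u. \<bar>u\<bar> < \<delta> \<Longrightarrow> (g has_real_derivative g' u) (at u)"
    and d2: "(g' has_real_derivative c) (at 0)" and max: "\<And>u. \<bar>u\<bar> < \<delta> \<Longrightarrow> g u \<le> g 0"
  shows "c \<le> 0"
proof (rule ccontr)
  assume "\<not> c \<le> 0"
  then obtain d where d: "d > 0" "\<And>h. 0 < h \<Longrightarrow> h < d \<Longrightarrow> g' 0 < g' h"
    using DERIV_pos_inc_right[OF d2] by auto
  have 0: "g' 0 = 0"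
    using DERIV_local_max[OF d1[of 0] \<open>\<delta> > 0\<close>] max \<open>\<delta> > 0\<close> by auto
  define u where "u = min \<delta> d / 2"
  have u: "0 < u" "u < \<delta>" "u < d"
    using d \<open>\<delta> > 0\<close> by (auto simp: u_def)
  obtain z where "0 < z" "z < u" "g u - g 0 = (u - 0) * g' z"
    using MVT2[of 0 u g g'] u d1 by auto
  moreover have "g' z > 0"
    using d(2)[of z] \<open>0 < z\<close> \<open>z < u\<close> u 0 by auto
  ultimately have "g u > g 0"
    using u by (metis diff_gt_0_iff_gt diff_zero mult_pos_pos)
  with max[of u] u show False by auto
qed

text \<open>Adding \<open>e * (x \<bullet> x)\<close> raises the Laplacian to 2 n e > 0, which is
  impossible at an interior maximum. The boundary condition is a uniform upper bound near the
  sphere, phrased without boundary values of f.\<close>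

theorem harmonic_max_principle:
  fixes f :: "real^'n \<Rightarrow> real"
  assumes harm: "harmonic_on (ball 0 1) f"
    and bdry: "\<And>e. e > 0 \<Longrightarrow> \<exists>r<1. \<forall>x. r < norm x \<longrightarrow> norm x < 1 \<longrightarrow> f x < e"
    and x0: "norm x0 < 1"
  shows "f x0 \<le> 0"
proof (rule ccontr)
  assume "\<not> f x0 \<le> 0"
  \<comment> \<open>With a third of the supposed value, \<open>w\<close> stays below 2 e where r <
    |x| < 1 but is at least 3 e at \<open>x0\<close>; so its maximum over the closed ball of radius
    \<open>R\<close> is attained in the interior.\<close>
  define e where "e = f x0 / 3"
  have e: "e > 0" "f x0 = 3 * e"
    using \<open>\<not> f x0 \<le> 0\<close> by (auto simp: e_def)
  obtain r where r: "r < 1" "\<And>x. r < norm x \<Longrightarrow> norm x < 1 \<Longrightarrow> f x < e"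
    using bdry[OF e(1)] by blast
  define R where "R = (1 + max r (norm x0)) / 2"
  have R: "r < R" "norm x0 < R" "R < 1"
    using r x0 by (auto simp: R_def max_def)
  define w where "w x = f x + e * (x \<bullet> x)" for x
  obtain f' f'' where "open (ball 0 1 :: (real^'n) set)" "harmonic_derivs (ball 0 1) f f' f''"
    using harm by (rule harmonic_onE)
  note f = this(1) harmonic_derivsD[OF this(2)]
  have "continuous_on (cball 0 R) f"
    using R by (intro continuous_on_subset[OF harmonic_on_imp_continuous_on[OF harm]]) auto
  then have "continuous_on (cball 0 R) w"
    unfolding w_def by (intro continuous_intros)
  then obtain z where z: "norm z \<le> R" "\<And>y. norm y \<le> R \<Longrightarrow> w y \<le> w z"
    using continuous_attains_sup[OF compact_cball, of 0 R w] R norm_ge_zero[of x0]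
    by (auto simp: dist_norm simp del: norm_ge_zero)
  have "norm z \<le> r"
  proof (rule ccontr)
    assume "\<not> norm z \<le> r"
    then have "f z < e"
      using r(2)[of z] z R by auto
    moreover have "e * (z \<bullet> z) \<le> e"
      using z R e by (simp add: dot_square_norm mult_left_le power_le_one)
    moreover have "w x0 \<ge> 3 * e"
      using e by (simp add: w_def)
    ultimately show False
      using z(2)[of x0] R e unfolding w_def by linarith
  qed
  then have zR: "norm z < R"
    using R by auto
  have "f'' i z i + 2 * e \<le> 0" if i: "i \<in> Basis" for i
  proof (rule second_derivative_at_max[where g = "\<lambda>u. w (z + u *\<^sub>R i)" and \<delta> = "R - norm z"
        and g' = "\<lambda>u. f' (z + u *\<^sub>R i) i + 2 * e * ((z + u *\<^sub>R i) \<bullet> i)"])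
    have quad: "(z + u *\<^sub>R i) \<bullet> (z + u *\<^sub>R i) = z \<bullet> z + 2 * u * (z \<bullet> i) + u\<^sup>2" for u
      using i by (simp add: inner_add_left inner_add_right inner_commute power2_eq_square)
    have nz: "norm (z + u *\<^sub>R i) < R" if "\<bar>u\<bar> < R - norm z" for u
      using norm_triangle_ineq[of z "u *\<^sub>R i"] i that by simp
    show "R - norm z > 0"
      using zR by simp
    show "((\<lambda>u. w (z + u *\<^sub>R i)) has_real_derivative f' (z + u *\<^sub>R i) i + 2 * e * ((z + u *\<^sub>R i) \<bullet> i)) (at u)"
      if "\<bar>u\<bar> < R - norm z" for u
    proof -
      have *: "((\<lambda>u. z + u *\<^sub>R i) has_derivative (\<lambda>h. h *\<^sub>R i)) (at u)"
        by (auto intro!: derivative_eq_intros)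
      have in1: "z + u *\<^sub>R i \<in> ball 0 1"
        using nz[OF that] R by (simp del: mem_ball add: mem_ball_0)
      have "((\<lambda>u. f (z + u *\<^sub>R i)) has_derivative (\<lambda>h. f' (z + u *\<^sub>R i) (h *\<^sub>R i))) (at u)"
        using has_derivative_compose[OF * f(2)[OF in1]] .
      then have "((\<lambda>u. f (z + u *\<^sub>R i)) has_real_derivative f' (z + u *\<^sub>R i) i) (at u)"
        using linear_scale[OF has_derivative_linear[OF f(2)[OF in1]]]
        by (simp add: has_field_derivative_def mult_commute_abs)
      moreover have "((\<lambda>u. e * ((z + u *\<^sub>R i) \<bullet> (z + u *\<^sub>R i))) has_real_derivative 2 * e * ((z + u *\<^sub>R i) \<bullet> i)) (at u)"
        unfolding quad by (auto intro!: derivative_eq_intros simp: i inner_add_left inner_commute algebra_simps)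
      ultimately show ?thesis
        unfolding w_def by (rule DERIV_add)
    qed
    show "((\<lambda>u. f' (z + u *\<^sub>R i) i + 2 * e * ((z + u *\<^sub>R i) \<bullet> i)) has_real_derivative f'' i z i + 2 * e) (at 0)"
    proof -
      have *: "((\<lambda>u. z + u *\<^sub>R i) has_derivative (\<lambda>h. h *\<^sub>R i)) (at 0)"
        by (auto intro!: derivative_eq_intros)
      have in1: "z + 0 *\<^sub>R i \<in> ball 0 1"
        using zR R by (simp del: mem_ball add: mem_ball_0)
      have "((\<lambda>u. f' (z + u *\<^sub>R i) i) has_derivative (\<lambda>h. f'' i (z + 0 *\<^sub>R i) (h *\<^sub>R i))) (at 0)"
        using has_derivative_compose[OF * f(3)[OF i in1]] .
      then have "((\<lambda>u. f' (z + u *\<^sub>R i) i) has_real_derivative f'' i z i) (at 0)"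
        using linear_scale[OF has_derivative_linear[OF f(3)[OF i in1]]]
        by (simp add: has_field_derivative_def mult_commute_abs)
      moreover have "((\<lambda>u. 2 * e * ((z + u *\<^sub>R i) \<bullet> i)) has_real_derivative 2 * e) (at 0)"
        by (auto intro!: derivative_eq_intros simp: i inner_add_left)
      ultimately show ?thesis
        by (rule DERIV_add)
    qed
    show "w (z + u *\<^sub>R i) \<le> w (z + 0 *\<^sub>R i)" if "\<bar>u\<bar> < R - norm z" for u
      using z(2)[of "z + u *\<^sub>R i"] nz[OF that] by simp
  qed
  then have "(\<Sum>i\<in>(Basis::(real^'n) set). f'' i z i + 2 * e) \<le> 0"
    by (rule sum_nonpos)
  then have "(\<Sum>i\<in>(Basis::(real^'n) set). f'' i z i) + real DIM(real^'n) * (2 * e) \<le> 0"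
    by (simp add: sum.distrib)
  moreover have "(\<Sum>i\<in>Basis. f'' i z i) = 0"
    using f(5)[of z] zR R by auto
  ultimately show False
    using e by (simp add: mult_le_0_iff)
qed

lemma harmonic_zero_principle:
  fixes f :: "real^'n \<Rightarrow> real"
  assumes harm: "harmonic_on (ball 0 1) f"
    and bdry: "\<And>e. e > 0 \<Longrightarrow> \<exists>r<1. \<forall>x. r < norm x \<longrightarrow> norm x < 1 \<longrightarrow> \<bar>f x\<bar> < e"
    and x0: "norm x0 < 1"
  shows "f x0 = 0"
proof -
  have "f x0 \<le> 0"
    by (rule harmonic_max_principle[OF harm _ x0]) (meson bdry abs_less_iff)
  moreover have "harmonic_on (ball 0 1) (\<lambda>x. - f x)"
    using harmonic_on_diff[OF harmonic_on_const[of "ball 0 1" 0] harm] by simp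
  then have "- f x0 \<le> 0"
    by (rule harmonic_max_principle[OF _ _ x0]) (meson bdry abs_less_iff)
  ultimately show ?thesis by simp
qed

subsection \<open>The Poisson integral\<close>

lemma abs_integral_sphere_le:
  fixes f :: "real^'n \<Rightarrow> real"
  assumes "continuous_on (sphere 0 1) f" and B: "\<And>y. norm y = 1 \<Longrightarrow> \<bar>f y\<bar> \<le> B"
  shows "\<bar>\<integral>y. f y \<partial>sphere_measure\<bar> \<le> B"
proof -
  have "\<bar>\<integral>y. f y \<partial>sphere_measure\<bar> \<le> (\<integral>y. \<bar>f y\<bar> \<partial>sphere_measure)"
    using integral_norm_bound[of sphere_measure f] by simp
  also have "\<dots> \<le> B"
    using assms integrable_sphere_continuous[of "\<lambda>y. \<bar>f y\<bar>"]
    by (intro sph.integral_le_const AE_I2) (auto intro!: continuous_intros)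
  finally show ?thesis .
qed

section \<open>Continuity and differentiation under the integral over the sphere\<close>

lemma continuous_on_slice:
  fixes F :: "'a::topological_space \<Rightarrow> 'b::topological_space \<Rightarrow> 'c::topological_space"
  assumes "continuous_on (U \<times> C) (\<lambda>(x, y). F x y)" "x \<in> U"
  shows "continuous_on C (F x)"
proof -
  have "continuous_on C (\<lambda>y. (\<lambda>(x, y). F x y) (x, y))"
    by (rule continuous_on_compose2[OF assms(1)]) (use assms(2) in \<open>auto intro!: continuous_intros\<close>)
  then show ?thesis by simp
qed

text \<open>Compactness of the sphere makes continuity in x uniform in the integration variable y,
  which moves limits through the integral.\<close>

lemma continuous_on_prod_sphere_uniform:
  fixes F :: "real^'n \<Rightarrow> real^'n \<Rightarrow> real"
  assumes cF: "continuous_on (U \<times> sphere 0 1) (\<lambda>(x, y). F x y)" and x: "x \<in> U" and e: "e > 0"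
  shows "\<exists>d>0. \<forall>z\<in>U. dist z x < d \<longrightarrow> (\<forall>y\<in>sphere 0 1. \<bar>F z y - F x y\<bar> \<le> e)"
proof -
  obtain X where X: "x \<in> X" "open X"
    "\<forall>z\<in>X \<inter> U. \<forall>y\<in>sphere 0 1. dist ((\<lambda>(x, y). F x y) (z, y)) ((\<lambda>(x, y). F x y) (x, y)) \<le> e"
    by (rule continuous_on_prod_compactE[OF cF compact_sphere x e])
  obtain d where "d > 0" "ball x d \<subseteq> X"
    using X(1,2) by (meson openE)
  then show ?thesis
    using X(3) by (intro exI[of _ d]) (auto simp: dist_real_def subset_iff dist_commute)
qed

lemma continuous_on_sphere_integral:
  fixes F :: "real^'n \<Rightarrow> real^'n \<Rightarrow> real"
  assumes cF: "continuous_on (U \<times> sphere 0 1) (\<lambda>(x, y). F x y)"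
  shows "continuous_on U (\<lambda>x. \<integral>y. F x y \<partial>sphere_measure)"
  unfolding continuous_on_iff
proof (intro ballI allI impI)
  fix x and e :: real assume x: "x \<in> U" and e: "e > 0"
  then obtain d where d: "d > 0"
    "\<And>z y. z \<in> U \<Longrightarrow> dist z x < d \<Longrightarrow> norm y = 1 \<Longrightarrow> \<bar>F z y - F x y\<bar> \<le> e / 2"
    using continuous_on_prod_sphere_uniform[OF cF x, of "e / 2"] by auto
  have "dist (\<integral>y. F z y \<partial>sphere_measure) (\<integral>y. F x y \<partial>sphere_measure) < e" if "z \<in> U" "dist z x < d" for z
  proof -
    have cc: "continuous_on (sphere 0 1) (F z)" "continuous_on (sphere 0 1) (F x)"
      using cF that x by (auto intro: continuous_on_slice)
    have "\<bar>\<integral>y. F z y - F x y \<partial>sphere_measure\<bar> \<le> e / 2"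
      using d(2)[OF that] cc by (intro abs_integral_sphere_le continuous_intros) auto
    also have "(\<integral>y. F z y - F x y \<partial>sphere_measure) = (\<integral>y. F z y \<partial>sphere_measure) - (\<integral>y. F x y \<partial>sphere_measure)"
      using cc by (intro Bochner_Integration.integral_diff integrable_sphere_continuous)
    finally show ?thesis
      using e by (simp add: dist_real_def)
  qed
  then show "\<exists>d>0. \<forall>x'\<in>U. dist x' x < d \<longrightarrow>
      dist (\<integral>y. F x' y \<partial>sphere_measure) (\<integral>y. F x y \<partial>sphere_measure) < e"
    using d by blast
qed

text \<open>Near x, \<open>F z y\<close> minus its linear part at x has a derivative in z of norm at
  most e, uniformly in y. The mean value inequality bounds the remainder by e |z - x| for every y,
  and this bound survives integration over a probability measure.\<close>

lemma has_derivative_sphere_integral: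
  fixes F :: "real^'n \<Rightarrow> real^'n \<Rightarrow> real" and G :: "real^'n \<Rightarrow> real^'n \<Rightarrow> real^'n \<Rightarrow> real"
  assumes U: "open U" and cF: "continuous_on (U \<times> sphere 0 1) (\<lambda>(x, y). F x y)"
    and cG: "\<And>i. i \<in> Basis \<Longrightarrow> continuous_on (U \<times> sphere 0 1) (\<lambda>(x, y). G i x y)"
    and d: "\<And>x y. x \<in> U \<Longrightarrow> norm y = 1 \<Longrightarrow>
      ((\<lambda>x. F x y) has_derivative (\<lambda>h. \<Sum>i\<in>Basis. (h \<bullet> i) * G i x y)) (at x)"
    and x: "x \<in> U"
  shows "((\<lambda>x. \<integral>y. F x y \<partial>sphere_measure) has_derivative
    (\<lambda>h. \<Sum>i\<in>Basis. (h \<bullet> i) * (\<integral>y. G i x y \<partial>sphere_measure))) (at x)"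
  unfolding has_derivative_at_alt
proof (intro conjI allI impI)
  show "bounded_linear (\<lambda>h. \<Sum>i\<in>Basis. (h \<bullet> i) * (\<integral>y. G i x y \<partial>sphere_measure))"
    by (intro bounded_linear_sum bounded_linear_mult_const bounded_linear_inner_left)
  fix e :: real assume e: "e > 0"
  \<comment> \<open>The operator norm is estimated by the sum over coordinates, hence the division
    by the dimension.\<close>
  define e' where "e' = e / real DIM(real^'n)"
  have e': "e' > 0"
    using e by (simp add: e'_def)
  have "\<forall>i\<in>Basis. \<exists>d>0. \<forall>z\<in>U. dist z x < d \<longrightarrow> (\<forall>y\<in>sphere 0 1. \<bar>G i z y - G i x y\<bar> \<le> e')"
    using continuous_on_prod_sphere_uniform[OF cG x e'] by blast
  then obtain D where "\<forall>i\<in>Basis. D i > 0 \<and> (\<forall>z\<in>U. dist z x < D i \<longrightarrow> (\<forall>y\<in>sphere 0 1. \<bar>G i z y - G i x y\<bar> \<le> e'))"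
    using bchoice[of Basis "\<lambda>i d. d > 0 \<and> (\<forall>z\<in>U. dist z x < d \<longrightarrow> (\<forall>y\<in>sphere 0 1. \<bar>G i z y - G i x y\<bar> \<le> e'))"] by blast
  then have D: "\<And>i. i \<in> Basis \<Longrightarrow> D i > 0"
    "\<And>i z y. i \<in> Basis \<Longrightarrow> z \<in> U \<Longrightarrow> dist z x < D i \<Longrightarrow> norm y = 1 \<Longrightarrow> \<bar>G i z y - G i x y\<bar> \<le> e'"
    by auto
  have "open (U \<inter> (\<Inter>i\<in>Basis. ball x (D i)))"
    using U by (intro open_Int open_INT) auto
  moreover have "x \<in> U \<inter> (\<Inter>i\<in>Basis. ball x (D i))"
    using x D(1) by auto
  ultimately obtain \<delta> where \<delta>: "\<delta> > 0" "ball x \<delta> \<subseteq> U \<inter> (\<Inter>i\<in>Basis. ball x (D i))"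
    by (meson openE)
  have G: "\<bar>G i z y - G i x y\<bar> \<le> e'" if "i \<in> Basis" "z \<in> ball x \<delta>" "norm y = 1" for i z y
    using D(2)[of i z y] subsetD[OF \<delta>(2) that(2)] that by (auto simp: dist_commute)
  have bd: "\<bar>F z y - F x y - (\<Sum>i\<in>Basis. ((z - x) \<bullet> i) * G i x y)\<bar> \<le> e * norm (z - x)"
    if z: "z \<in> ball x \<delta>" and y: "norm y = 1" for z y
  proof -
    let ?g = "\<lambda>z. F z y - (\<Sum>i\<in>Basis. (z \<bullet> i) * G i x y)"
    let ?L = "\<lambda>w h. (\<Sum>i\<in>Basis. (h \<bullet> i) * G i w y) - (\<Sum>i\<in>Basis. (h \<bullet> i) * G i x y)"
    have der: "(?g has_derivative ?L w) (at w within ball x \<delta>)" if w: "w \<in> ball x \<delta>" for w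
    proof -
      have bl: "bounded_linear (\<lambda>h. \<Sum>i\<in>Basis. (h \<bullet> i) * G i x y)"
        by (intro bounded_linear_sum bounded_linear_mult_const bounded_linear_inner_left)
      have "((\<lambda>z. F z y) has_derivative (\<lambda>h. \<Sum>i\<in>Basis. (h \<bullet> i) * G i w y)) (at w)"
        using d[of w y] w \<delta> y by auto
      from has_derivative_at_withinI[OF has_derivative_diff[OF this bounded_linear_imp_has_derivative[OF bl]]] show ?thesis .
    qed
    have onb: "onorm (?L w) \<le> e" if w: "w \<in> ball x \<delta>" for w
    proof (rule onorm_bound)
      fix h :: "real^'n"
      have "norm (?L w h) = \<bar>\<Sum>i\<in>Basis. (h \<bullet> i) * (G i w y - G i x y)\<bar>"
        by (simp add: sum_subtractf right_diff_distrib)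
      also have "\<dots> \<le> (\<Sum>i\<in>(Basis::(real^'n) set). \<bar>(h \<bullet> i) * (G i w y - G i x y)\<bar>)"
        by (rule sum_abs)
      also have "\<dots> \<le> (\<Sum>i\<in>(Basis::(real^'n) set). norm h * e')"
        unfolding abs_mult using G[OF _ w y] by (intro sum_mono mult_mono Basis_le_norm) auto
      also have "\<dots> = e * norm h"
        by (simp add: e'_def)
      finally show "norm (?L w h) \<le> e * norm h" .
    qed (use e in simp)
    have "norm (?g z - ?g x) \<le> e * norm (z - x)"
      using z \<delta>(1) by (intro differentiable_bound[OF convex_ball der onb]) auto
    then show ?thesis
      by (simp add: inner_diff_left left_diff_distrib sum_subtractf algebra_simps)
  qed
  show "\<exists>d>0. \<forall>z. norm (z - x) < d \<longrightarrow>
      norm ((\<integral>y. F z y \<partial>sphere_measure) - (\<integral>y. F x y \<partial>sphere_measure) -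
        (\<Sum>i\<in>Basis. ((z - x) \<bullet> i) * (\<integral>y. G i x y \<partial>sphere_measure))) \<le> e * norm (z - x)"
  proof (intro exI conjI allI impI)
    show "\<delta> > 0" by fact
    fix z assume "norm (z - x) < \<delta>"
    then have z: "z \<in> ball x \<delta>"
      by (simp add: dist_norm norm_minus_commute)
    have cont: "continuous_on (sphere 0 1) (F z)" "continuous_on (sphere 0 1) (F x)"
      "\<And>i. i \<in> Basis \<Longrightarrow> continuous_on (sphere 0 1) (G i x)"
      using z \<delta> x cF cG by (auto intro: continuous_on_slice)
    have int: "integrable sphere_measure (F z)" "integrable sphere_measure (F x)"
      "\<And>i. i \<in> Basis \<Longrightarrow> integrable sphere_measure (G i x)"
      using cont by (auto intro: integrable_sphere_continuous)
    have "(\<integral>y. F z y - F x y - (\<Sum>i\<in>Basis. ((z - x) \<bullet> i) * G i x y) \<partial>sphere_measure) =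
        (\<integral>y. F z y \<partial>sphere_measure) - (\<integral>y. F x y \<partial>sphere_measure) -
        (\<Sum>i\<in>Basis. ((z - x) \<bullet> i) * (\<integral>y. G i x y \<partial>sphere_measure))"
      using int by simp
    moreover have "\<bar>\<integral>y. F z y - F x y - (\<Sum>i\<in>Basis. ((z - x) \<bullet> i) * G i x y) \<partial>sphere_measure\<bar> \<le> e * norm (z - x)"
      using bd[OF z] cont by (intro abs_integral_sphere_le continuous_intros) auto
    ultimately show "norm ((\<integral>y. F z y \<partial>sphere_measure) - (\<integral>y. F x y \<partial>sphere_measure) -
        (\<Sum>i\<in>Basis. ((z - x) \<bullet> i) * (\<integral>y. G i x y \<partial>sphere_measure))) \<le> e * norm (z - x)"
      by simp
  qed
qed

text \<open>The Poisson kernel for normalised surface measure. Writing the distance as a power of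
  its square keeps the base polynomial in x, so that the partial derivatives \<open>poisson'\<close>
  and \<open>poisson''\<close> are explicit.\<close>

definition poisson :: "real^'n \<Rightarrow> real^'n \<Rightarrow> real" where
  "poisson x y = (1 - x \<bullet> x) * ((x - y) \<bullet> (x - y)) powr (- real CARD('n) / 2)"

definition poisson' :: "real^'n \<Rightarrow> real^'n \<Rightarrow> real^'n \<Rightarrow> real" where
  "poisson' i x y = (let a = (x - y) \<bullet> (x - y); \<nu> = real CARD('n) / 2 in
     - 2 * (x \<bullet> i) * a powr (- \<nu>) - 2 * \<nu> * (1 - x \<bullet> x) * ((x - y) \<bullet> i) * a powr (- \<nu> - 1))"

definition poisson'' :: "real^'n \<Rightarrow> real^'n \<Rightarrow> real^'n \<Rightarrow> real^'n \<Rightarrow> real" where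
  "poisson'' i k x y = (let a = (x - y) \<bullet> (x - y); \<nu> = real CARD('n) / 2 in
     - 2 * (k \<bullet> i) * a powr (- \<nu>) + 4 * \<nu> * (x \<bullet> i) * ((x - y) \<bullet> k) * a powr (- \<nu> - 1)
     + 4 * \<nu> * (x \<bullet> k) * ((x - y) \<bullet> i) * a powr (- \<nu> - 1)
     - 2 * \<nu> * (1 - x \<bullet> x) * (k \<bullet> i) * a powr (- \<nu> - 1)
     + 4 * \<nu> * (\<nu> + 1) * (1 - x \<bullet> x) * ((x - y) \<bullet> i) * ((x - y) \<bullet> k) * a powr (- \<nu> - 2))"

lemma dist2_pos:
  fixes x y :: "'a::real_inner"
  assumes "norm x < 1" "norm y = 1"
  shows "(x - y) \<bullet> (x - y) > 0"
  using assms by auto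

lemma has_derivative_powr_dist2:
  fixes x y :: "'a::real_inner"
  assumes "(x - y) \<bullet> (x - y) > 0"
  shows "((\<lambda>x. ((x - y) \<bullet> (x - y)) powr p) has_derivative
    (\<lambda>h. 2 * p * ((x - y) \<bullet> h) * ((x - y) \<bullet> (x - y)) powr (p - 1))) (at x)"
proof -
  have 1: "((\<lambda>a. a powr p) has_derivative (\<lambda>h. h * (p * ((x - y) \<bullet> (x - y)) powr (p - 1)))) (at ((x - y) \<bullet> (x - y)))"
    using has_real_derivative_powr[OF assms, of p] by (simp add: has_field_derivative_def mult_commute_abs)
  have 2: "((\<lambda>x. (x - y) \<bullet> (x - y)) has_derivative (\<lambda>h. 2 * ((x - y) \<bullet> h))) (at x)"
    by (auto intro!: derivative_eq_intros simp: inner_commute)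
  show ?thesis
    using has_derivative_compose[OF 2 1] by (simp add: mult_ac)
qed

text \<open>Brings a derivative into the coordinate form in which
  \<open>has_derivative_sphere_integral\<close> integrates it, one partial derivative at a
  time.\<close>

lemma has_derivative_basis_sum:
  fixes L :: "'a::euclidean_space \<Rightarrow> real"
  assumes "(f has_derivative L) F" and "\<And>i. i \<in> Basis \<Longrightarrow> L i = g i"
  shows "(f has_derivative (\<lambda>h. \<Sum>i\<in>Basis. (h \<bullet> i) * g i)) F"
proof -
  have "L h = (\<Sum>i\<in>Basis. (h \<bullet> i) * g i)" for h
  proof -
    have "L h = L (\<Sum>i\<in>Basis. (h \<bullet> i) *\<^sub>R i)"
      by (simp add: euclidean_representation)
    also have "\<dots> = (\<Sum>i\<in>Basis. (h \<bullet> i) * L i)"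
      using has_derivative_linear[OF assms(1)] by (simp add: linear_sum linear_scale)
    finally show ?thesis
      using assms(2) by simp
  qed
  then have "L = (\<lambda>h. \<Sum>i\<in>Basis. (h \<bullet> i) * g i)"
    by (rule ext)
  then show ?thesis
    using assms(1) by simp
qed

lemma poisson_has_derivative:
  fixes x y :: "real^'n"
  assumes "norm x < 1" "norm y = 1"
  shows "((\<lambda>x. poisson x y) has_derivative (\<lambda>h. \<Sum>i\<in>Basis. (h \<bullet> i) * poisson' i x y)) (at x)"
proof -
  define \<nu> where "\<nu> = real CARD('n) / 2"
  have 1: "((\<lambda>x. 1 - x \<bullet> x) has_derivative (\<lambda>h. - 2 * (x \<bullet> h))) (at x)"
    by (auto intro!: derivative_eq_intros simp: inner_commute)
  show ?thesis
    unfolding poisson_def minus_divide_left[symmetric] \<nu>_def[symmetric]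
  proof (rule has_derivative_basis_sum[OF has_derivative_mult[OF 1 has_derivative_powr_dist2[OF dist2_pos[OF assms]]]])
    fix i :: "real^'n"
    show "(1 - x \<bullet> x) * (2 * - \<nu> * ((x - y) \<bullet> i) * ((x - y) \<bullet> (x - y)) powr (- \<nu> - 1)) +
        - 2 * (x \<bullet> i) * ((x - y) \<bullet> (x - y)) powr - \<nu> = poisson' i x y"
      unfolding poisson'_def Let_def \<nu>_def[symmetric] by (simp add: algebra_simps)
  qed
qed

lemma poisson'_has_derivative:
  fixes x y :: "real^'n"
  assumes "norm x < 1" "norm y = 1"
  shows "((\<lambda>x. poisson' i x y) has_derivative (\<lambda>h. \<Sum>k\<in>Basis. (h \<bullet> k) * poisson'' i k x y)) (at x)"
proof -
  define \<nu> where "\<nu> = real CARD('n) / 2"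
  let ?a = "(x - y) \<bullet> (x - y)"
  have 1: "((\<lambda>x. - 2 * (x \<bullet> i)) has_derivative (\<lambda>h. - 2 * (h \<bullet> i))) (at x)"
    by (auto intro!: derivative_eq_intros)
  have 2: "((\<lambda>x. 2 * \<nu> * (1 - x \<bullet> x) * ((x - y) \<bullet> i)) has_derivative
      (\<lambda>h. 2 * \<nu> * ((1 - x \<bullet> x) * (h \<bullet> i) - 2 * (x \<bullet> h) * ((x - y) \<bullet> i)))) (at x)"
    by (auto intro!: derivative_eq_intros simp: inner_commute algebra_simps simp del: mult_minus_right)
  show ?thesis
    unfolding poisson'_def Let_def \<nu>_def[symmetric]
  proof (rule has_derivative_basis_sum[OF has_derivative_diff[
          OF has_derivative_mult[OF 1 has_derivative_powr_dist2[OF dist2_pos[OF assms]]]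
             has_derivative_mult[OF 2 has_derivative_powr_dist2[OF dist2_pos[OF assms]]]]])
    fix k :: "real^'n"
    have "- \<nu> - 1 - 1 = - \<nu> - 2" by simp
    then show "- 2 * (x \<bullet> i) * (2 * - \<nu> * ((x - y) \<bullet> k) * ?a powr (- \<nu> - 1)) + - 2 * (k \<bullet> i) * ?a powr - \<nu> -
        (2 * \<nu> * (1 - x \<bullet> x) * ((x - y) \<bullet> i) * (2 * (- \<nu> - 1) * ((x - y) \<bullet> k) * ?a powr (- \<nu> - 1 - 1)) +
         2 * \<nu> * ((1 - x \<bullet> x) * (k \<bullet> i) - 2 * (x \<bullet> k) * ((x - y) \<bullet> i)) * ?a powr (- \<nu> - 1)) = poisson'' i k x y"
      unfolding poisson''_def Let_def \<nu>_def[symmetric] by (simp add: algebra_simps del: mult_minus_right)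
  qed
qed

text \<open>With n = 2 \<nu> and all powers of the squared distance a reduced to a^(-\<nu> - 1), the
  trace has the factor - a + 2 (x \<bullet> x - x \<bullet> y) + (1 - x \<bullet> x). It vanishes
  because |y| = 1 gives a = x \<bullet> x - 2 (x \<bullet> y) + 1.\<close>

lemma poisson''_trace:
  fixes x y :: "real^'n"
  assumes "norm x < 1" "norm y = 1"
  shows "(\<Sum>i\<in>Basis. poisson'' i i x y) = 0"
proof -
  define \<nu> where "\<nu> = real CARD('n) / 2"
  define a where "a = (x - y) \<bullet> (x - y)"
  have a: "a > 0"
    unfolding a_def by (rule dist2_pos[OF assms])
  have a1: "a powr (- \<nu>) = a * a powr (- \<nu> - 1)"
    using powr_mult_base[of a "- \<nu> - 1"] a by simp
  have a2: "a powr (- \<nu> - 1) = a * a powr (- \<nu> - 2)"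
  proof -
    have eq: "1 + (- \<nu> - 2) = - \<nu> - 1"
      by simp
    show ?thesis
      using a powr_add[of a 1 "- \<nu> - 2"] unfolding eq by simp
  qed
  have "y \<bullet> y = 1"
    using assms by (simp add: dot_square_norm)
  then have aexp: "a = x \<bullet> x - 2 * (x \<bullet> y) + 1"
    by (simp add: a_def inner_diff_left inner_diff_right inner_commute)
  have e1: "(\<Sum>i\<in>Basis. (x \<bullet> i) * ((x - y) \<bullet> i)) = x \<bullet> x - x \<bullet> y"
    by (simp add: euclidean_inner[of x "x - y", symmetric] inner_diff_right)
  have e2: "(\<Sum>i\<in>Basis. ((x - y) \<bullet> i) * ((x - y) \<bullet> i)) = a"
    by (simp add: a_def euclidean_inner[of "x - y" "x - y", symmetric])
  have "poisson'' i i x y = - 2 * a powr (- \<nu>) + (8 * \<nu> * a powr (- \<nu> - 1)) * ((x \<bullet> i) * ((x - y) \<bullet> i))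
     - 2 * \<nu> * (1 - x \<bullet> x) * a powr (- \<nu> - 1)
     + (4 * \<nu> * (\<nu> + 1) * (1 - x \<bullet> x) * a powr (- \<nu> - 2)) * (((x - y) \<bullet> i) * ((x - y) \<bullet> i))" if "i \<in> Basis" for i
    using that unfolding poisson''_def Let_def \<nu>_def[symmetric] a_def[symmetric] by (simp add: algebra_simps)
  then have "(\<Sum>i\<in>Basis. poisson'' i i x y) = real CARD('n) * (- 2 * a powr (- \<nu>) - 2 * \<nu> * (1 - x \<bullet> x) * a powr (- \<nu> - 1))
     + (8 * \<nu> * a powr (- \<nu> - 1)) * (x \<bullet> x - x \<bullet> y) + (4 * \<nu> * (\<nu> + 1) * (1 - x \<bullet> x) * a powr (- \<nu> - 2)) * a"
    by (simp add: sum.distrib sum_subtractf e1 e2 sum_distrib_left[symmetric] right_diff_distrib)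
  also have "real CARD('n) = 2 * \<nu>"
    by (simp add: \<nu>_def)
  also have "2 * \<nu> * (- 2 * a powr (- \<nu>) - 2 * \<nu> * (1 - x \<bullet> x) * a powr (- \<nu> - 1))
     + (8 * \<nu> * a powr (- \<nu> - 1)) * (x \<bullet> x - x \<bullet> y) + (4 * \<nu> * (\<nu> + 1) * (1 - x \<bullet> x) * a powr (- \<nu> - 2)) * a =
     4 * \<nu> * a powr (- \<nu> - 1) * (- a + 2 * (x \<bullet> x - x \<bullet> y) + (1 - x \<bullet> x))"
    by (simp only: a1 a2) (simp add: algebra_simps)
  also have "\<dots> = 0"
    by (simp add: aexp)
  finally show ?thesis .
qed

lemma continuous_on_poisson [continuous_intros]:
  fixes f g :: "'a::topological_space \<Rightarrow> real^'n"
  assumes "continuous_on S f" "continuous_on S g" "\<And>z. z \<in> S \<Longrightarrow> norm (f z) < 1" "\<And>z. z \<in> S \<Longrightarrow> norm (g z) = 1"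
  shows "continuous_on S (\<lambda>z. poisson (f z) (g z))"
    and "continuous_on S (\<lambda>z. poisson' i (f z) (g z))"
    and "continuous_on S (\<lambda>z. poisson'' i k (f z) (g z))"
proof -
  have pos: "(f z - g z) \<bullet> (f z - g z) \<noteq> 0" if "z \<in> S" for z
    using dist2_pos[of "f z" "g z"] assms that by simp
  show "continuous_on S (\<lambda>z. poisson (f z) (g z))"
    unfolding poisson_def by (intro continuous_intros assms ballI pos)
  show "continuous_on S (\<lambda>z. poisson' i (f z) (g z))"
    unfolding poisson'_def Let_def by (intro continuous_intros assms ballI pos)
  show "continuous_on S (\<lambda>z. poisson'' i k (f z) (g z))"
    unfolding poisson''_def Let_def by (intro continuous_intros assms ballI pos)
qed

lemma poisson_integral_harmonic:
  fixes \<phi> :: "real^'n \<Rightarrow> real"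
  assumes \<phi>: "continuous_on (sphere 0 1) \<phi>"
  shows "harmonic_on (ball 0 1) (\<lambda>x. \<integral>y. poisson x y * \<phi> y \<partial>sphere_measure)"
proof -
  have c: "continuous_on (ball 0 1 \<times> sphere 0 1) (\<lambda>(x, y). poisson x y * \<phi> y)"
    "continuous_on (ball 0 1 \<times> sphere 0 1) (\<lambda>(x, y). poisson' i x y * \<phi> y)"
    "continuous_on (ball 0 1 \<times> sphere 0 1) (\<lambda>(x, y). poisson'' i k x y * \<phi> y)" for i k
    unfolding case_prod_unfold
    by (intro continuous_intros continuous_on_compose2[OF \<phi>]; auto)+
  have d1: "((\<lambda>x. \<integral>y. poisson x y * \<phi> y \<partial>sphere_measure) has_derivative
      (\<lambda>h. \<Sum>i\<in>Basis. (h \<bullet> i) * (\<integral>y. poisson' i x y * \<phi> y \<partial>sphere_measure))) (at x)"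
    if "x \<in> ball 0 1" for x
  proof (rule has_derivative_sphere_integral[OF open_ball c(1) c(2) _ that])
    fix x y :: "real^'n" assume "x \<in> ball 0 1" "norm y = 1"
    then show "((\<lambda>x. poisson x y * \<phi> y) has_derivative (\<lambda>h. \<Sum>i\<in>Basis. (h \<bullet> i) * (poisson' i x y * \<phi> y))) (at x)"
      using has_derivative_mult_left[OF poisson_has_derivative[of x y], of "\<phi> y"]
      by (simp add: sum_distrib_right mult.assoc)
  qed
  have d2: "((\<lambda>x. \<integral>y. poisson' i x y * \<phi> y \<partial>sphere_measure) has_derivative
      (\<lambda>h. \<Sum>k\<in>Basis. (h \<bullet> k) * (\<integral>y. poisson'' i k x y * \<phi> y \<partial>sphere_measure))) (at x)"
    if "x \<in> ball 0 1" for x i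
  proof (rule has_derivative_sphere_integral[OF open_ball c(2) c(3) _ that])
    fix x y :: "real^'n" assume "x \<in> ball 0 1" "norm y = 1"
    then show "((\<lambda>x. poisson' i x y * \<phi> y) has_derivative (\<lambda>h. \<Sum>k\<in>Basis. (h \<bullet> k) * (poisson'' i k x y * \<phi> y))) (at x)"
      using has_derivative_mult_left[OF poisson'_has_derivative[of x y i], of "\<phi> y"]
      by (simp add: sum_distrib_right mult.assoc)
  qed
  have pick: "(\<Sum>k\<in>Basis. (i \<bullet> k) * g k) = g i" if "i \<in> Basis" for i :: "real^'n" and g :: "real^'n \<Rightarrow> real"
  proof -
    have "(\<Sum>k\<in>Basis. (i \<bullet> k) * g k) = (\<Sum>k\<in>Basis. if k = i then g k else 0)"
      using that by (intro sum.cong) (auto simp: inner_Basis)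
    then show ?thesis
      using that by simp
  qed
  show ?thesis
  proof (rule harmonic_onI[OF open_ball d1])
    show "((\<lambda>x. \<Sum>j\<in>Basis. (i \<bullet> j) * (\<integral>y. poisson' j x y * \<phi> y \<partial>sphere_measure)) has_derivative
      (\<lambda>h. \<Sum>k\<in>Basis. (h \<bullet> k) * (\<integral>y. poisson'' i k x y * \<phi> y \<partial>sphere_measure))) (at x)"
      if "i \<in> Basis" "x \<in> ball 0 1" for i x
      using d2[OF that(2), of i] by (simp add: pick[OF that(1)])
    show "continuous_on (ball 0 1) (\<lambda>x. \<Sum>k\<in>Basis. (j \<bullet> k) * (\<integral>y. poisson'' i k x y * \<phi> y \<partial>sphere_measure))"
      if "i \<in> Basis" "j \<in> Basis" for i j
      unfolding pick[OF that(2)] by (rule continuous_on_sphere_integral[OF c(3)])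
    show "(\<Sum>i\<in>Basis. \<Sum>k\<in>Basis. (i \<bullet> k) * (\<integral>y. poisson'' i k x y * \<phi> y \<partial>sphere_measure)) = 0"
      if "x \<in> ball 0 1" for x
    proof -
      have "(\<Sum>i\<in>Basis. \<Sum>k\<in>Basis. (i \<bullet> k) * (\<integral>y. poisson'' i k x y * \<phi> y \<partial>sphere_measure)) =
          (\<Sum>i\<in>Basis. \<integral>y. poisson'' i i x y * \<phi> y \<partial>sphere_measure)"
        by (intro sum.cong) (auto simp: pick)
      also have "\<dots> = (\<integral>y. (\<Sum>i\<in>Basis. poisson'' i i x y * \<phi> y) \<partial>sphere_measure)"
        using that continuous_on_slice[OF c(3)]
        by (intro Bochner_Integration.integral_sum[symmetric] integrable_sphere_continuous) auto
      also have "\<dots> = 0"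
        using that by (intro Bochner_Integration.integral_eq_zero_AE AE_I2) (auto simp: poisson''_trace simp flip: sum_distrib_right)
      finally show ?thesis .
    qed
  qed
qed

lemma prob_sphere [simp]: "measure sphere_measure (sphere (0::real^'n) 1) = 1"
  using sph.prob_space[where 'n='n] by simp

lemma dist2_powr:
  fixes x y :: "'a::real_inner"
  shows "((x - y) \<bullet> (x - y)) powr p = norm (x - y) powr (2 * p)"
proof -
  have "(x - y) \<bullet> (x - y) = norm (x - y) powr 2"
    by (simp add: dot_square_norm powr_numeral)
  then show ?thesis
    by (simp only: powr_powr)
qed

lemma poisson_eq: "poisson x y = (1 - (norm x)\<^sup>2) * norm (x - y) powr (- real CARD('n))"
  for x y :: "real^'n"
  unfolding poisson_def dist2_powr by (simp add: dot_square_norm)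

lemma poisson_nonneg: "norm x < 1 \<Longrightarrow> 0 \<le> poisson x y"
  by (simp add: poisson_eq power_le_one)

lemma poisson_le:
  fixes x y :: "real^'n"
  assumes "norm x < 1" "norm y = 1"
  shows "poisson x y \<le> 2 * (1 - norm x) powr (1 - real CARD('n))"
proof -
  have "1 - norm x \<le> norm (x - y)"
    using norm_triangle_ineq2[of y x] assms by (simp add: norm_minus_commute)
  then have 1: "norm (x - y) powr (- real CARD('n)) \<le> (1 - norm x) powr (- real CARD('n))"
    using assms by (intro powr_mono2') auto
  have 2: "1 - (norm x)\<^sup>2 \<le> 2 * (1 - norm x)"
    using assms sum_power2_ge_zero[of "1 - norm x" 0] by (simp add: power2_eq_square algebra_simps)
  have "poisson x y \<le> (2 * (1 - norm x)) * (1 - norm x) powr (- real CARD('n))"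
    unfolding poisson_eq using assms 1 2 by (intro mult_mono) (auto simp: power_le_one)
  also have "\<dots> = 2 * (1 - norm x) powr (1 - real CARD('n))"
    unfolding mult.assoc using assms powr_mult_base[of "1 - norm x" "- real CARD('n)"] by simp
  finally show ?thesis .
qed

lemma continuous_on_poisson_sphere:
  assumes "norm x < 1"
  shows "continuous_on (sphere 0 1) (poisson x)"
  using assms by (intro continuous_intros) auto

text \<open>Uniform continuity on the closed ball, comparing x with \<open>dirn x\<close>, turns
  vanishing on the sphere into uniform smallness near it.\<close>

lemma harmonic_zero_boundary:
  fixes f :: "real^'n \<Rightarrow> real"
  assumes harm: "harmonic_on (ball 0 1) f" and cont: "continuous_on (cball 0 1) f"
    and z: "\<And>y. norm y = 1 \<Longrightarrow> f y = 0" and x: "norm x < 1"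
  shows "f x = 0"
proof (rule harmonic_zero_principle[OF harm _ x])
  fix e :: real assume "e > 0"
  then obtain \<delta> where \<delta>: "\<delta> > 0" "\<And>u v. norm u \<le> 1 \<Longrightarrow> norm v \<le> 1 \<Longrightarrow> dist v u < \<delta> \<Longrightarrow> dist (f v) (f u) < e"
    using compact_uniformly_continuous[OF cont compact_cball] unfolding uniformly_continuous_on_def by (metis mem_cball_0)
  have "\<bar>f x\<bar> < e" if "1 - \<delta> < norm x" "norm x < 1" for x
  proof -
    have "dist x (dirn x) = norm (norm x *\<^sub>R dirn x - 1 *\<^sub>R dirn x)"
      by (simp add: dist_norm)
    also have "\<dots> = 1 - norm x"
      unfolding scaleR_diff_left[symmetric] norm_scaleR using that by simp
    finally show ?thesis
      using \<delta>(2)[of "dirn x" x] that z[of "dirn x"] by (simp add: dist_real_def)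
  qed
  then show "\<exists>r<1. \<forall>x. r < norm x \<longrightarrow> norm x < 1 \<longrightarrow> \<bar>f x\<bar> < e"
    using \<delta>(1) by (intro exI[of _ "1 - \<delta>"]) auto
qed

text \<open>The total mass is rotation invariant, so it is constant on spheres, hence constant by the
  maximum principle.\<close>
lemma poisson_mass:
  fixes x :: "real^'n"
  assumes x: "norm x < 1"
  shows "(\<integral>y. poisson x y \<partial>sphere_measure) = 1"
proof -
  define h where "h x = (\<integral>y. poisson x y \<partial>sphere_measure)" for x :: "real^'n"
  have harm: "harmonic_on (ball 0 1) h"
    using poisson_integral_harmonic[of "\<lambda>_. 1"] by (simp add: h_def[abs_def])
  have inv: "h (T x) = h x" if T: "orthogonal_transformation T" and x: "norm x < 1" for T x
  proof -
    have lin: "linear T" and nrm: "\<And>x. norm (T x) = norm x"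
      using T by (auto simp: orthogonal_transformation_linear orthogonal_transformation_norm)
    have "poisson (T x) (T y) = poisson x y" for y
      by (simp add: poisson_eq nrm flip: linear_diff[OF lin])
    then have "h x = (\<integral>y. poisson (T x) (T y) \<partial>sphere_measure)"
      by (simp add: h_def)
    also have "\<dots> = h (T x)"
      unfolding h_def using x nrm
      by (intro integral_sphere_orthogonal[OF T continuous_on_poisson_sphere] poisson_nonneg) auto
    finally show ?thesis by simp
  qed
  have rad: "h u = h v" if uv: "norm u = norm v" "norm u < 1" for u v
  proof -
    obtain T where "orthogonal_transformation T" "T u = v"
      using orthogonal_transformation_exists[OF uv(1)] by metis
    then show ?thesis
      using inv[of T u] uv by simp
  qed
  \<comment> \<open>Dilating by \<open>norm x\<close> makes the sphere through x the boundary of the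
    unit ball, where \<open>h\<close> is constant by rotation invariance; the constant is read off
    at 0, where the kernel equals 1.\<close>
  have "h (norm x *\<^sub>R 0) - h x = 0"
  proof (rule harmonic_zero_boundary[where f = "\<lambda>z. h (norm x *\<^sub>R z) - h x" and x = 0])
    have in1: "norm x *\<^sub>R z \<in> ball 0 1" if "norm z \<le> 1" for z :: "real^'n"
      using that x mult_mono[of "norm x" "norm x" "norm z" 1] by simp
    show "harmonic_on (ball 0 1) (\<lambda>z. h (norm x *\<^sub>R z) - h x)"
      by (intro harmonic_on_diff harmonic_on_const harmonic_on_scaleR[OF harm] in1) auto
    show "continuous_on (cball 0 1) (\<lambda>z. h (norm x *\<^sub>R z) - h x)"
      by (intro continuous_intros continuous_on_compose2[OF harmonic_on_imp_continuous_on[OF harm]])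
        (use in1 in auto)
    show "h (norm x *\<^sub>R z) - h x = 0" if "norm z = 1" for z
      using rad[of "norm x *\<^sub>R z" x] x that by simp
  qed simp
  moreover have "h 0 = 1"
  proof -
    have "h 0 = (\<integral>y. 1 \<partial>(sphere_measure :: (real^'n) measure))"
      unfolding h_def by (intro Bochner_Integration.integral_cong refl) (simp add: poisson_eq)
    then show ?thesis
      by simp
  qed
  ultimately show ?thesis
    by (simp add: h_def)
qed

text \<open>The Poisson kernel is an approximate identity. The integral is compared with
  \<open>f x\<close> itself instead of a boundary value: uniform continuity handles the y near x,
  and the decay of the kernel handles the others. \<open>harmonic_zero_principle\<close> then
  removes the difference.\<close>

theorem poisson_formula:
  fixes f :: "real^'n \<Rightarrow> real"
  assumes harm: "harmonic_on (ball 0 1) f" and cont: "continuous_on (cball 0 1) f" and x: "norm x < 1"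
  shows "f x = (\<integral>y. poisson x y * f y \<partial>sphere_measure)"
proof -
  let ?n = "real CARD('n)"
  define u where "u x = (\<integral>y. poisson x y * f y \<partial>sphere_measure)" for x
  have cs: "continuous_on (sphere 0 1) f"
    using cont by (rule continuous_on_subset) auto
  have "bounded (f ` cball 0 1)"
    using cont by (intro compact_imp_bounded compact_continuous_image) auto
  then obtain M where M: "M > 0" "\<And>y. norm y \<le> 1 \<Longrightarrow> \<bar>f y\<bar> \<le> M"
    unfolding bounded_pos by auto
  have "u x - f x = 0"
  proof (rule harmonic_zero_principle[OF _ _ x])
    show "harmonic_on (ball 0 1) (\<lambda>x. u x - f x)"
      unfolding u_def by (intro harmonic_on_diff harm poisson_integral_harmonic cs)
    fix e :: real assume e: "e > 0"
    then obtain \<delta> where \<delta>: "\<delta> > 0"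
      "\<And>u v. norm u \<le> 1 \<Longrightarrow> norm v \<le> 1 \<Longrightarrow> dist v u < \<delta> \<Longrightarrow> dist (f v) (f u) < e / 2"
      using compact_uniformly_continuous[OF cont compact_cball] unfolding uniformly_continuous_on_def
      by (metis mem_cball_0 half_gt_zero)
    \<comment> \<open>Chosen so that the contribution of the y far from x, bounded by the constant c
      below, is less than e / 2 as soon as 1 - |x|^2 < 2 \<eta>.\<close>
    define \<eta> where "\<eta> = e * \<delta> powr ?n / (8 * M)"
    have \<eta>: "\<eta> > 0"
      using e \<delta> M by (simp add: \<eta>_def)
    have "\<bar>u x - f x\<bar> < e" if x: "1 - \<eta> < norm x" "norm x < 1" for x
    proof -
      define c where "c = 2 * M * ((1 - (norm x)\<^sup>2) * \<delta> powr (- ?n))"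
      have c0: "c \<ge> 0"
        using M x by (auto simp: c_def power_le_one)
      have "1 - (norm x)\<^sup>2 \<le> 2 * (1 - norm x)"
        using sum_power2_ge_zero[of "1 - norm x" 0] by (simp add: power2_eq_square algebra_simps)
      then have "1 - (norm x)\<^sup>2 < 2 * \<eta>"
        using x by simp
      then have "c < 2 * M * (2 * \<eta> * \<delta> powr (- ?n))"
        unfolding c_def using M \<delta> by (intro mult_strict_left_mono mult_strict_right_mono) auto
      also have "\<dots> = e / 2"
        using M \<delta> by (simp add: \<eta>_def powr_minus field_simps)
      finally have c: "c < e / 2" .
      have cp: "continuous_on (sphere 0 1) (poisson x)"
        using x by (intro continuous_on_poisson_sphere)
      have pt: "\<bar>poisson x y * (f y - f x)\<bar> \<le> poisson x y * (e / 2) + c" if y: "norm y = 1" for y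
      proof (cases "dist y x < \<delta>")
        case True
        then have "\<bar>f y - f x\<bar> \<le> e / 2"
          using \<delta>(2)[of x y] x y by (simp add: dist_real_def)
        then have "\<bar>poisson x y * (f y - f x)\<bar> \<le> poisson x y * (e / 2)"
          unfolding abs_mult using poisson_nonneg[OF x(2), of y] by (metis abs_of_nonneg mult_left_mono)
        then show ?thesis
          using c0 by simp
      next
        case False
        then have "norm (x - y) powr (- ?n) \<le> \<delta> powr (- ?n)"
          using \<delta> by (intro powr_mono2') (auto simp: dist_norm norm_minus_commute)
        then have "poisson x y \<le> (1 - (norm x)\<^sup>2) * \<delta> powr (- ?n)"
          unfolding poisson_eq using x by (intro mult_left_mono) (auto simp: power_le_one)
        moreover have "\<bar>f y - f x\<bar> \<le> 2 * M"
          using M(2)[of x] M(2)[of y] x y by auto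
        ultimately have "poisson x y * \<bar>f y - f x\<bar> \<le> ((1 - (norm x)\<^sup>2) * \<delta> powr (- ?n)) * (2 * M)"
          using poisson_nonneg[OF x(2), of y] by (intro mult_mono) auto
        then have "\<bar>poisson x y * (f y - f x)\<bar> \<le> c"
          using poisson_nonneg[OF x(2), of y] by (simp add: c_def abs_mult mult_ac)
        moreover have "0 \<le> poisson x y * (e / 2)"
          using poisson_nonneg[OF x(2), of y] e by simp
        ultimately show ?thesis
          by linarith
      qed
      have int1: "integrable sphere_measure (poisson x)"
        by (rule integrable_sphere_continuous[OF cp])
      have int2: "integrable sphere_measure (\<lambda>y. poisson x y * f y)"
        by (rule integrable_sphere_continuous[OF continuous_on_mult[OF cp cs]])
      have int3: "integrable sphere_measure (\<lambda>y. poisson x y * (f y - f x))"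
        by (rule integrable_sphere_continuous[OF continuous_on_mult[OF cp continuous_on_diff[OF cs continuous_on_const]]])
      note int = int1 int2 int3
      have "u x - f x = (\<integral>y. poisson x y * f y \<partial>sphere_measure) - (\<integral>y. poisson x y * f x \<partial>sphere_measure)"
        using poisson_mass[OF x(2)] by (simp add: u_def)
      also have "\<dots> = (\<integral>y. poisson x y * f y - poisson x y * f x \<partial>sphere_measure)"
        by (rule Bochner_Integration.integral_diff[symmetric]) (use int in simp_all)
      also have "\<dots> = (\<integral>y. poisson x y * (f y - f x) \<partial>sphere_measure)"
        by (simp add: right_diff_distrib)
      finally have "\<bar>u x - f x\<bar> \<le> (\<integral>y. \<bar>poisson x y * (f y - f x)\<bar> \<partial>sphere_measure)"
        using integral_norm_bound[of sphere_measure "\<lambda>y. poisson x y * (f y - f x)"] by simp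
      also have "\<dots> \<le> (\<integral>y. poisson x y * (e / 2) + c \<partial>sphere_measure)"
        using int pt by (intro integral_mono) auto
      also have "\<dots> = (\<integral>y. poisson x y * (e / 2) \<partial>sphere_measure) + (\<integral>y. c \<partial>(sphere_measure :: (real^'n) measure))"
        using int by (intro Bochner_Integration.integral_add) auto
      also have "\<dots> = e / 2 + c"
        using poisson_mass[OF x(2)] by simp
      finally show ?thesis
        using c by simp
    qed
    then show "\<exists>r<1. \<forall>x. r < norm x \<longrightarrow> norm x < 1 \<longrightarrow> \<bar>u x - f x\<bar> < e"
      using \<eta> by (intro exI[of _ "1 - \<eta>"]) auto
  qed
  then show ?thesis
    by (simp add: u_def)
qed

subsection \<open>Sequences of subexponential growth\<close>

text \<open>Subexponential growth: the power series with coefficients a converges on (-1, 1).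
  Demanding boundedness for every q < 1 makes products easy, because q splits into two factors sqrt
  q.\<close>

definition tame :: "(nat \<Rightarrow> real) \<Rightarrow> bool" where
  "tame a \<longleftrightarrow> (\<forall>q. 0 < q \<and> q < 1 \<longrightarrow> (\<exists>C. \<forall>k. q ^ k * \<bar>a k\<bar> \<le> C))"

lemma tameE:
  assumes "tame a" "0 < q" "q < 1"
  obtains C where "C > 0" "\<forall>k. q ^ k * \<bar>a k\<bar> \<le> C"
proof -
  obtain C where "\<And>k. q ^ k * \<bar>a k\<bar> \<le> C"
    using assms by (auto simp: tame_def)
  then show thesis
    by (intro that[of "max C 1"]) (auto simp: le_max_iff_disj)
qed

lemma tame_mono:
  assumes "tame b" "\<And>k. \<bar>a k\<bar> \<le> \<bar>b k\<bar>"
  shows "tame a"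
  unfolding tame_def
proof (intro allI impI)
  fix q :: real assume q: "0 < q \<and> q < 1"
  obtain C where C: "\<forall>k. q ^ k * \<bar>b k\<bar> \<le> C"
    by (rule tameE[OF assms(1) conjunct1[OF q] conjunct2[OF q]])
  have "q ^ k * \<bar>a k\<bar> \<le> C" for k
  proof -
    have "q ^ k * \<bar>a k\<bar> \<le> q ^ k * \<bar>b k\<bar>"
      using assms(2) q by (intro mult_left_mono) auto
    then show ?thesis
      using C order_trans by blast
  qed
  then show "\<exists>C. \<forall>k. q ^ k * \<bar>a k\<bar> \<le> C"
    by blast
qed

lemma tame_mult:
  assumes "tame a" "tame b"
  shows "tame (\<lambda>k. a k * b k)"
  unfolding tame_def
proof (intro allI impI)
  fix q :: real assume q: "0 < q \<and> q < 1"
  then have sq: "0 < sqrt q" "sqrt q < 1"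
    by auto
  obtain A where A: "A > 0" "\<forall>k. sqrt q ^ k * \<bar>a k\<bar> \<le> A" by (rule tameE[OF assms(1) sq])
  obtain B where B: "B > 0" "\<forall>k. sqrt q ^ k * \<bar>b k\<bar> \<le> B" by (rule tameE[OF assms(2) sq])
  have "q ^ k * \<bar>a k * b k\<bar> \<le> A * B" for k
  proof -
    have "q ^ k = sqrt q ^ k * sqrt q ^ k"
      using q by (simp flip: power_mult_distrib)
    then have "q ^ k * \<bar>a k * b k\<bar> = (sqrt q ^ k * \<bar>a k\<bar>) * (sqrt q ^ k * \<bar>b k\<bar>)"
      by (simp add: abs_mult)
    also have "\<dots> \<le> A * B"
      using A B sq by (intro mult_mono) auto
    finally show ?thesis .
  qed
  then show "\<exists>C. \<forall>k. q ^ k * \<bar>a k * b k\<bar> \<le> C" by blast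
qed

lemma tame_add:
  assumes "tame a" "tame b"
  shows "tame (\<lambda>k. a k + b k)"
  unfolding tame_def
proof (intro allI impI)
  fix q :: real assume q: "0 < q \<and> q < 1"
  obtain A where A: "A > 0" "\<forall>k. q ^ k * \<bar>a k\<bar> \<le> A" by (rule tameE[OF assms(1) conjunct1[OF q] conjunct2[OF q]])
  obtain B where B: "B > 0" "\<forall>k. q ^ k * \<bar>b k\<bar> \<le> B" by (rule tameE[OF assms(2) conjunct1[OF q] conjunct2[OF q]])
  have "q ^ k * \<bar>a k + b k\<bar> \<le> A + B" for k
  proof -
    have "q ^ k * \<bar>a k + b k\<bar> \<le> q ^ k * (\<bar>a k\<bar> + \<bar>b k\<bar>)"
      using q by (intro mult_left_mono) auto
    also have "\<dots> \<le> A + B"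
      using A(2)[rule_format, of k] B(2)[rule_format, of k] by (simp add: distrib_left)
    finally show ?thesis .
  qed
  then show "\<exists>C. \<forall>k. q ^ k * \<bar>a k + b k\<bar> \<le> C" by blast
qed

lemma tame_const: "tame (\<lambda>k. c)"
  unfolding tame_def
  by (intro allI impI exI[of _ "\<bar>c\<bar>"]) (auto intro!: mult_left_le_one_le power_le_one)

lemma tame_summable:
  assumes "tame a" "0 \<le> r" "r < 1"
  shows "summable (\<lambda>k. r ^ k * \<bar>a k\<bar>)"
proof -
  define q where "q = (1 + r) / 2"
  have q: "0 < q" "q < 1" "r < q"
    using assms by (auto simp: q_def)
  obtain C where "C > 0" and C: "\<forall>k. q ^ k * \<bar>a k\<bar> \<le> C"
    by (rule tameE[OF assms(1) q(1,2)])
  have "r ^ k * \<bar>a k\<bar> \<le> C * (r / q) ^ k" for k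
  proof -
    have "r ^ k * \<bar>a k\<bar> = (r / q) ^ k * (q ^ k * \<bar>a k\<bar>)"
      using q by (simp add: power_divide)
    also have "\<dots> \<le> (r / q) ^ k * C"
      using C assms q by (intro mult_left_mono) auto
    finally show ?thesis by (simp add: mult.commute)
  qed
  moreover have "summable (\<lambda>k. C * (r / q) ^ k)"
    using assms q by (simp add: summable_mult summable_geometric)
  ultimately show ?thesis
    using assms summable_comparison_test'[of "\<lambda>k. C * (r / q) ^ k" 0 "\<lambda>k. r ^ k * \<bar>a k\<bar>"] by simp
qed

lemma
  fixes f :: "nat \<Rightarrow> real^'n \<Rightarrow> real"
  assumes c: "\<And>k. continuous_on (sphere 0 1) (f k)" and b: "\<And>k y. norm y = 1 \<Longrightarrow> \<bar>f k y\<bar> \<le> M k"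
    and M: "summable M"
  shows sphere_series_continuous: "continuous_on (sphere 0 1) (\<lambda>y. \<Sum>k. f k y)"
    and sphere_series_integral: "(\<lambda>k. \<integral>y. f k y \<partial>sphere_measure) sums (\<integral>y. (\<Sum>k. f k y) \<partial>sphere_measure)"
proof -
  have "uniform_limit (sphere 0 1) (\<lambda>n x. \<Sum>k<n. f k x) (\<lambda>x. \<Sum>k. f k x) sequentially"
    using b M by (intro Weierstrass_m_test) auto
  then show "continuous_on (sphere 0 1) (\<lambda>y. \<Sum>k. f k y)"
    by (rule uniform_limit_theorem[rotated]) (auto intro!: continuous_intros c always_eventually)
  show "(\<lambda>k. \<integral>y. f k y \<partial>sphere_measure) sums (\<integral>y. (\<Sum>k. f k y) \<partial>sphere_measure)"
  proof (rule sums_integral)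
    show "integrable sphere_measure (f k)" for k
      by (rule integrable_sphere_continuous[OF c])
    have "summable (\<lambda>k. norm (f k y))" if "norm y = 1" for y
      by (rule summable_comparison_test'[OF M, of 0]) (simp add: b that)
    then show "AE y in sphere_measure. summable (\<lambda>k. norm (f k y))"
      by (intro AE_I2) simp
    have "\<bar>\<integral>y. norm (f k y) \<partial>sphere_measure\<bar> \<le> M k" for k
      by (rule abs_integral_sphere_le[OF continuous_on_norm[OF c]]) (simp add: b)
    then show "summable (\<lambda>k. \<integral>y. norm (f k y) \<partial>sphere_measure)"
      using summable_comparison_test'[OF M, of 0 "\<lambda>k. \<integral>y. norm (f k y) \<partial>sphere_measure"] by simp
  qed
qed

lemma power_series_zero:
  fixes a :: "nat \<Rightarrow> real"
  assumes "0 < s" and s: "\<And>x. \<bar>x\<bar> < s \<Longrightarrow> (\<lambda>n. a n * x ^ n) sums 0"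
  shows "a k = 0"
proof (induction k rule: less_induct)
  case (less k)
  have "(\<lambda>n. a (n + k) * x ^ n) sums 0" if "x \<noteq> 0" "norm x < s" for x
  proof -
    have "(\<lambda>n. a (n + k) * x ^ (n + k)) sums 0"
      using s[of x] that less sums_zero_iff_shift[of k "\<lambda>n. a n * x ^ n" 0] by simp
    from sums_mult2[OF this, of "1 / x ^ k"] show ?thesis
      using that by (simp add: power_add)
  qed
  then have "((\<lambda>_. 0) \<longlongrightarrow> a (0 + k)) (at (0::real))"
    by (intro powser_limit_0_strong[OF \<open>0 < s\<close>, of "\<lambda>n. a (n + k)"])
  then show ?case
    using tendsto_unique[OF _ tendsto_const] by force
qed

subsection \<open>Expansions in spherical harmonics\<close>

locale sh_system =
  fixes Y :: "nat \<Rightarrow> nat \<Rightarrow> real^'n \<Rightarrow> real" and d :: "nat \<Rightarrow> nat"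
  assumes basis: "sh_basis Y d"
begin

text \<open>The solid harmonic extending \<open>Y k j\<close>; being \<open>0\<close> outside the index range, it is harmonic for all
  \<open>k\<close> and \<open>j\<close>.\<close>
definition H :: "nat \<Rightarrow> nat \<Rightarrow> real^'n \<Rightarrow> real" where
  "H k j x = (if j \<in> {1..d k} then norm x ^ k * Y k j (dirn x) else 0)"

lemma H_poly:
  assumes "j \<in> {1..d k}"
  obtains p where "harmonic_on UNIV p" "\<forall>a x. p (a *\<^sub>R x) = a ^ k * p x" "H k j = p"
proof -
  have "spherical_harmonic k (Y k j)"
    using basis assms by (auto simp: sh_basis_def)
  then obtain p where p: "\<forall>a x. p (a *\<^sub>R x) = a ^ k * p x" "harmonic_on UNIV p" "\<forall>x\<in>sphere 0 1. Y k j x = p x"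
    by (auto simp: spherical_harmonic_def)
  have "H k j x = p x" for x
  proof -
    have "p x = p (norm x *\<^sub>R dirn x)"
      by simp
    also have "\<dots> = norm x ^ k * p (dirn x)"
      using p(1) by blast
    also have "\<dots> = H k j x"
      using p(3) assms by (simp add: H_def)
    finally show ?thesis by simp
  qed
  with p that show thesis
    by blast
qed

lemma H_harmonic: "harmonic_on UNIV (H k j)"
proof (cases "j \<in> {1..d k}")
  case True
  then show ?thesis
    by (rule H_poly) simp
next
  case False
  then have "H k j = (\<lambda>_. 0)"
    by (auto simp: H_def)
  then show ?thesis
    by (simp add: harmonic_on_const)
qed

lemma H_scaleR: "H k j (a *\<^sub>R x) = a ^ k * H k j x"
proof (cases "j \<in> {1..d k}")
  case True
  then show ?thesis
    by (rule H_poly) simp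
next
  case False
  then have "H k j z = 0" for z
    by (auto simp: H_def)
  then show ?thesis
    by simp
qed

lemma H_unit: "norm x = 1 \<Longrightarrow> j \<in> {1..d k} \<Longrightarrow> H k j x = Y k j x"
  by (simp add: H_def dirn_unit)

lemma H_cont [continuous_intros]: "continuous_on S (H k j)"
  using harmonic_on_imp_continuous_on[OF H_harmonic] by (rule continuous_on_subset) simp

lemma H_orth:
  assumes "j \<in> {1..d k}" "j' \<in> {1..d k'}"
  shows "(\<integral>y. H k j y * H k' j' y \<partial>sphere_measure) = (if k = k' \<and> j = j' then 1 else 0)"
proof -
  have "(\<integral>y. H k j y * H k' j' y \<partial>sphere_measure) = (\<integral>y. Y k j y * Y k' j' y \<partial>sphere_measure)"
    using assms by (intro Bochner_Integration.integral_cong refl) (simp add: H_unit)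
  then show ?thesis
    using basis assms by (auto simp: sh_basis_def)
qed

lemma H_complete:
  assumes f: "continuous_on (sphere 0 1) f"
    and orth: "\<And>k j. j \<in> {1..d k} \<Longrightarrow> (\<integral>y. f y * H k j y \<partial>sphere_measure) = 0" and y: "norm y = 1"
  shows "f y = 0"
proof (rule AE_sphere_continuous_zero[OF f _ y])
  have "f \<in> borel_measurable sphere_measure"
    by (rule measurable_sphere_continuous[OF f])
  moreover have "integrable sphere_measure (\<lambda>x. (f x)\<^sup>2)"
    by (rule integrable_sphere_continuous[OF continuous_on_power[OF f]])
  moreover have "(\<integral>y. f y * Y k j y \<partial>sphere_measure) = 0" if "j \<in> {1..d k}" for k j
  proof -
    have "(\<integral>y. f y * Y k j y \<partial>sphere_measure) = (\<integral>y. f y * H k j y \<partial>sphere_measure)"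
      using that by (intro Bochner_Integration.integral_cong refl) (simp add: H_unit)
    then show ?thesis
      using orth[OF that] by simp
  qed
  ultimately show "AE y in sphere_measure. f y = 0"
    using basis unfolding sh_basis_def by blast
qed

section \<open>Zonal harmonics and their growth\<close>

lemma H_reproduce: "norm x < 1 \<Longrightarrow> (\<integral>y. poisson x y * H k j y \<partial>sphere_measure) = H k j x"
  by (rule poisson_formula[symmetric, OF harmonic_on_subset[OF H_harmonic] H_cont]) auto

text \<open>The zonal harmonic: the reproducing kernel of the span of the \<open>H k j\<close> with
  this k, extended from the sphere to a solid harmonic in each variable.\<close>

definition Z :: "nat \<Rightarrow> real^'n \<Rightarrow> real^'n \<Rightarrow> real" where
  "Z k x y = (\<Sum>j=1..d k. H k j x * H k j y)"

lemma Z_scaleR: "Z k (a *\<^sub>R x) (b *\<^sub>R y) = (a * b) ^ k * Z k x y"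
  by (simp add: Z_def H_scaleR sum_distrib_left power_mult_distrib mult_ac)

lemma Z_scaleR_left: "Z k (a *\<^sub>R x) y = a ^ k * Z k x y"
  using Z_scaleR[of k a x 1 y] by simp

lemma Z_cont [continuous_intros]: "continuous_on S (Z k x)"
  unfolding Z_def[abs_def] by (intro continuous_intros)

lemma Z_nonneg: "0 \<le> Z k x x"
  by (auto simp: Z_def intro!: sum_nonneg)

lemma H_sq_le: "(H k j x)\<^sup>2 \<le> Z k x x"
proof (cases "j \<in> {1..d k}")
  case True
  then show ?thesis
    unfolding Z_def power2_eq_square by (intro member_le_sum[where f = "\<lambda>j. H k j x * H k j x"]) auto
next
  case False
  then show ?thesis
    using Z_nonneg by (auto simp: H_def)
qed

lemma sum_abs_H_le: "(\<Sum>j=1..d k. \<bar>H k j x * H k j y\<bar>) \<le> (Z k x x + Z k y y) / 2"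
proof -
  have "\<bar>u * v\<bar> \<le> (u * u + v * v) / 2" for u v :: real
    using zero_le_power2[of "\<bar>u\<bar> - \<bar>v\<bar>"] by (simp add: power2_eq_square algebra_simps abs_mult)
  then have "(\<Sum>j=1..d k. \<bar>H k j x * H k j y\<bar>) \<le> (\<Sum>j=1..d k. (H k j x * H k j x + H k j y * H k j y) / 2)"
    by (intro sum_mono) blast
  also have "\<dots> = (Z k x x + Z k y y) / 2"
    by (simp add: Z_def sum.distrib flip: sum_divide_distrib)
  finally show ?thesis .
qed

lemma Z_integral_H:
  assumes "j \<in> {1..d k}"
  shows "(\<integral>y. Z i x y * H k j y \<partial>sphere_measure) = (if i = k then H k j x else 0)"
proof -
  have "(\<integral>y. Z i x y * H k j y \<partial>sphere_measure) = (\<integral>y. (\<Sum>l=1..d i. H i l x * (H i l y * H k j y)) \<partial>sphere_measure)"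
    by (simp add: Z_def sum_distrib_right mult.assoc)
  also have "\<dots> = (\<Sum>l=1..d i. \<integral>y. H i l x * (H i l y * H k j y) \<partial>sphere_measure)"
    by (intro Bochner_Integration.integral_sum integrable_sphere_continuous continuous_intros)
  also have "\<dots> = (\<Sum>l=1..d i. H i l x * (if i = k \<and> l = j then 1 else 0))"
    using assms by (intro sum.cong refl) (simp add: H_orth)
  also have "\<dots> = (if i = k then H k j x else 0)"
    using assms by (auto simp: if_distrib[of "\<lambda>u. _ * u"] cong: if_cong)
  finally show ?thesis .
qed

text \<open>Bessel's inequality: by \<open>H_reproduce\<close> the coefficient of
  \<open>poisson x\<close> against \<open>H k j\<close> is \<open>H k j x\<close>, and
  \<open>Z k x x\<close> is the sum of the squares over j. The growth bounds below all start from
  here.\<close>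

lemma Z_bessel:
  assumes x: "norm x < 1"
  shows "(\<Sum>k<K. Z k x x) \<le> (\<integral>y. (poisson x y)\<^sup>2 \<partial>sphere_measure)"
proof -
  define S where "S y = (\<Sum>k<K. Z k x y)" for y
  have cS: "continuous_on (sphere 0 1) S"
    unfolding S_def[abs_def] by (intro continuous_intros)
  note cP = continuous_on_poisson_sphere[OF x]
  have SH: "(\<integral>y. S y * H k j y \<partial>sphere_measure) = H k j x" if "k < K" "j \<in> {1..d k}" for k j
  proof -
    have "(\<integral>y. S y * H k j y \<partial>sphere_measure) = (\<Sum>i<K. \<integral>y. Z i x y * H k j y \<partial>sphere_measure)"
      unfolding S_def sum_distrib_right
      by (intro Bochner_Integration.integral_sum integrable_sphere_continuous continuous_intros)
    also have "\<dots> = H k j x"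
      using that by (simp add: Z_integral_H)
    finally show ?thesis .
  qed
  \<comment> \<open>Stated for a general g because it is used for the Poisson kernel and for the
    partial sum \<open>S\<close>, which have the same coefficients below degree K.\<close>
  have gS: "(\<integral>y. g y * S y \<partial>sphere_measure) = (\<Sum>k<K. Z k x x)"
    if g: "continuous_on (sphere 0 1) g"
      and gH: "\<And>k j. k < K \<Longrightarrow> j \<in> {1..d k} \<Longrightarrow> (\<integral>y. g y * H k j y \<partial>sphere_measure) = H k j x" for g
  proof -
    have gZ: "(\<integral>y. g y * Z k x y \<partial>sphere_measure) = Z k x x" if "k < K" for k
    proof -
      have "(\<integral>y. g y * Z k x y \<partial>sphere_measure) = (\<integral>y. (\<Sum>j=1..d k. H k j x * (g y * H k j y)) \<partial>sphere_measure)"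
        by (simp add: Z_def sum_distrib_left mult_ac)
      also have "\<dots> = (\<Sum>j=1..d k. \<integral>y. H k j x * (g y * H k j y) \<partial>sphere_measure)"
        by (intro Bochner_Integration.integral_sum integrable_sphere_continuous continuous_intros g)
      also have "\<dots> = (\<Sum>j=1..d k. H k j x * H k j x)"
        by (intro sum.cong refl) (simp add: gH that)
      finally show ?thesis
        by (simp add: Z_def)
    qed
    have "(\<integral>y. g y * S y \<partial>sphere_measure) = (\<Sum>k<K. \<integral>y. g y * Z k x y \<partial>sphere_measure)"
      unfolding S_def sum_distrib_left
      by (intro Bochner_Integration.integral_sum integrable_sphere_continuous continuous_intros g)
    also have "\<dots> = (\<Sum>k<K. Z k x x)"
      by (intro sum.cong refl) (simp add: gZ)
    finally show ?thesis .
  qed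
  let ?A = "\<Sum>k<K. Z k x x"
  have PS: "(\<integral>y. poisson x y * S y \<partial>sphere_measure) = ?A"
    by (rule gS[OF cP]) (simp add: H_reproduce[OF x])
  have SS: "(\<integral>y. S y * S y \<partial>sphere_measure) = ?A"
    by (rule gS[OF cS SH])
  have int: "integrable sphere_measure (\<lambda>y. (poisson x y)\<^sup>2)"
    "integrable sphere_measure (\<lambda>y. poisson x y * S y)" "integrable sphere_measure (\<lambda>y. S y * S y)"
    using integrable_sphere_continuous[OF continuous_on_power[OF cP]]
      integrable_sphere_continuous[OF continuous_on_mult[OF cP cS]]
      integrable_sphere_continuous[OF continuous_on_mult[OF cS cS]] by auto
  have "0 \<le> (\<integral>y. (poisson x y - S y)\<^sup>2 \<partial>sphere_measure)"
    by (intro Bochner_Integration.integral_nonneg) simp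
  also have "\<dots> = (\<integral>y. (poisson x y)\<^sup>2 - 2 * (poisson x y * S y) + S y * S y \<partial>sphere_measure)"
    by (intro Bochner_Integration.integral_cong refl) (simp add: power2_eq_square algebra_simps)
  also have "\<dots> = (\<integral>y. (poisson x y)\<^sup>2 \<partial>sphere_measure) - 2 * ?A + ?A"
    using int by (simp add: PS SS)
  finally show ?thesis by simp
qed

definition zonal_sup :: "nat \<Rightarrow> real" where
  "zonal_sup k = (SUP y\<in>sphere 0 1. Z k y y)"

text \<open>A single term of Bessel's sum at the point r y, estimated by the square of the maximum
  of the Poisson kernel. As r < 1 is arbitrary, the diagonal of Z grows subexponentially.\<close>

lemma Z_bound:
  assumes r: "0 < r" "r < 1"
  shows "\<exists>C. \<forall>k y. norm y = 1 \<longrightarrow> r ^ (2 * k) * Z k y y \<le> C"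
proof (intro exI allI impI)
  fix k and y :: "real^'n" assume y: "norm y = 1"
  let ?B = "2 * (1 - r) powr (1 - real CARD('n))"
  have x: "norm (r *\<^sub>R y) < 1" "norm (r *\<^sub>R y) = r"
    using r y by auto
  have "r ^ (2 * k) * Z k y y = Z k (r *\<^sub>R y) (r *\<^sub>R y)"
    by (simp add: Z_scaleR power_mult power2_eq_square)
  also have "\<dots> \<le> (\<Sum>i<Suc k. Z i (r *\<^sub>R y) (r *\<^sub>R y))"
    using Z_nonneg by (intro member_le_sum) auto
  also have "\<dots> \<le> (\<integral>z. (poisson (r *\<^sub>R y) z)\<^sup>2 \<partial>sphere_measure)"
    by (rule Z_bessel[OF x(1)])
  also have "\<dots> \<le> ?B\<^sup>2"
  proof -
    have "\<bar>\<integral>z. (poisson (r *\<^sub>R y) z)\<^sup>2 \<partial>sphere_measure\<bar> \<le> ?B\<^sup>2"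
    proof (rule abs_integral_sphere_le[OF continuous_on_power[OF continuous_on_poisson_sphere[OF x(1)]]])
      fix z :: "real^'n" assume z: "norm z = 1"
      have "(poisson (r *\<^sub>R y) z)\<^sup>2 \<le> ?B\<^sup>2"
        using poisson_le[OF x(1) z] poisson_nonneg[OF x(1), of z] unfolding x(2) by (intro power_mono)
      then show "\<bar>(poisson (r *\<^sub>R y) z)\<^sup>2\<bar> \<le> ?B\<^sup>2" by simp
    qed
    then show ?thesis by simp
  qed
  finally show "r ^ (2 * k) * Z k y y \<le> ?B\<^sup>2" .
qed

lemma sphere_ne: "sphere (0::real^'n) 1 \<noteq> {}"
  using norm_dirn[of "0 :: real^'n"] by (metis mem_sphere_0 empty_iff)

lemma Z_le_zonal_sup:
  assumes "norm y = 1"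
  shows "Z k y y \<le> zonal_sup k"
proof -
  obtain C where C: "\<And>k y. norm y = 1 \<Longrightarrow> (1/2) ^ (2 * k) * Z k y y \<le> C"
    using Z_bound[of "1/2"] by auto
  have "bdd_above ((\<lambda>y. Z k y y) ` sphere 0 1)"
    using C[of _ k] by (intro bdd_aboveI2[of _ _ "C * 2 ^ (2 * k)"]) (auto simp: field_simps power_divide)
  then show ?thesis
    unfolding zonal_sup_def using assms by (intro cSUP_upper) auto
qed

lemma zonal_sup_nonneg: "0 \<le> zonal_sup k"
  using Z_nonneg[of k "dirn 0"] Z_le_zonal_sup[of "dirn 0" k] by (auto simp del: Z_nonneg)

lemma tame_zonal_sup: "tame zonal_sup"
  unfolding tame_def
proof (intro allI impI)
  fix q :: real assume q: "0 < q \<and> q < 1"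
  then obtain C where C: "\<And>k y. norm y = 1 \<Longrightarrow> sqrt q ^ (2 * k) * Z k y y \<le> C"
    using Z_bound[of "sqrt q"] by auto
  have "q ^ k * \<bar>zonal_sup k\<bar> \<le> C" for k
  proof -
    have eq: "sqrt q ^ (2 * k) = q ^ k"
      unfolding power_mult using q by simp
    have "Z k y y \<le> C / q ^ k" if "norm y = 1" for y
      using C[OF that, of k] q unfolding eq by (simp add: field_simps)
    then have "zonal_sup k \<le> C / q ^ k"
      unfolding zonal_sup_def using sphere_ne by (intro cSUP_least) auto
    then show ?thesis
      using q zonal_sup_nonneg[of k] by (simp add: field_simps)
  qed
  then show "\<exists>C. \<forall>k. q ^ k * \<bar>zonal_sup k\<bar> \<le> C" by blast
qed

text \<open>The inequality 2 |h| \<le> 1 + h^2 replaces the square root of \<open>zonal_sup\<close>,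
  so the bound is built from \<open>tame\<close> sequences by addition alone.\<close>

lemma abs_H_le: "norm y = 1 \<Longrightarrow> \<bar>H k j y\<bar> \<le> 1 + zonal_sup k"
proof -
  assume "norm y = 1"
  then have "(H k j y)\<^sup>2 \<le> zonal_sup k"
    using H_sq_le Z_le_zonal_sup by (meson order_trans)
  moreover have "2 * \<bar>H k j y\<bar> \<le> 1 + (H k j y)\<^sup>2"
    using zero_le_power2[of "\<bar>H k j y\<bar> - 1"] by (simp add: power2_diff)
  ultimately show ?thesis
    using zero_le_power2[of "H k j y"] by (simp only: abs_le_iff) linarith
qed

text \<open>Integrating the diagonal of the reproducing kernel gives its trace \<open>d k\<close>,
  so the dimension inherits the growth bound.\<close>

lemma d_le_zonal_sup: "real (d k) \<le> zonal_sup k"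
proof -
  have "(\<integral>y. Z k y y \<partial>sphere_measure) = (\<Sum>j=1..d k. \<integral>y. H k j y * H k j y \<partial>sphere_measure)"
    unfolding Z_def by (intro Bochner_Integration.integral_sum integrable_sphere_continuous continuous_intros)
  also have "\<dots> = real (d k)"
    by (simp add: H_orth)
  finally have "real (d k) = (\<integral>y. Z k y y \<partial>sphere_measure)" by simp
  moreover have "\<bar>\<integral>y. Z k y y \<partial>sphere_measure\<bar> \<le> zonal_sup k"
  proof (rule abs_integral_sphere_le)
    show "continuous_on (sphere 0 1) (\<lambda>y. Z k y y)"
      unfolding Z_def by (intro continuous_intros)
    show "\<bar>Z k y y\<bar> \<le> zonal_sup k" if "norm y = 1" for y
      using Z_nonneg[of k y] Z_le_zonal_sup[OF that] by simp
  qed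
  ultimately show ?thesis by simp
qed

lemma abs_Z_le:
  assumes "norm x = 1" "norm y = 1"
  shows "\<bar>Z k x y\<bar> \<le> zonal_sup k"
proof -
  have "\<bar>Z k x y\<bar> \<le> (\<Sum>j=1..d k. \<bar>H k j x * H k j y\<bar>)"
    unfolding Z_def by (rule sum_abs)
  also have "\<dots> \<le> (Z k x x + Z k y y) / 2"
    by (rule sum_abs_H_le)
  also have "\<dots> \<le> zonal_sup k"
    using Z_le_zonal_sup[OF assms(1), of k] Z_le_zonal_sup[OF assms(2), of k] by simp
  finally show ?thesis .
qed

lemma abs_Z_le_left:
  assumes "norm y = 1"
  shows "\<bar>Z k x y\<bar> \<le> norm x ^ k * \<bar>zonal_sup k\<bar>"
proof -
  have "\<bar>Z k x y\<bar> = norm x ^ k * \<bar>Z k (dirn x) y\<bar>"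
    using Z_scaleR_left[of k "norm x" "dirn x" y] by (simp add: abs_mult)
  also have "\<dots> \<le> norm x ^ k * \<bar>zonal_sup k\<bar>"
    using abs_Z_le[of "dirn x" y k] assms by (intro mult_left_mono) auto
  finally show ?thesis .
qed

text \<open>By termwise integration the series and the Poisson kernel are continuous functions of y
  with the same coefficients against every \<open>H k j\<close>. This is where completeness of the
  system enters; uniform convergence comes from the growth of \<open>zonal_sup\<close>.\<close>

theorem Z_sums_poisson:
  assumes x: "norm x < 1" and y: "norm y = 1"
  shows "(\<lambda>k. Z k x y) sums poisson x y"
proof -
  note b = abs_Z_le_left
  have sm: "summable (\<lambda>k. norm x ^ k * \<bar>zonal_sup k\<bar>)"
    by (rule tame_summable[OF tame_zonal_sup _ x]) simp
  define S where "S y = (\<Sum>k. Z k x y)" for y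
  have cS: "continuous_on (sphere 0 1) S"
    unfolding S_def[abs_def] by (rule sphere_series_continuous[OF Z_cont b sm])
  have summ: "summable (\<lambda>k. Z k x y)" if "norm y = 1" for y
    by (rule summable_comparison_test'[OF sm, of 0]) (use b[OF that] in simp)
  note cP = continuous_on_poisson_sphere[OF x]
  have "poisson x y - S y = 0"
  proof (rule H_complete[OF _ _ y])
    show "continuous_on (sphere 0 1) (\<lambda>y. poisson x y - S y)"
      by (rule continuous_on_diff[OF cP cS])
    fix k j assume j: "j \<in> {1..d k}"
    have s1: "(\<lambda>i. \<integral>y. Z i x y * H k j y \<partial>sphere_measure) sums (\<integral>y. (\<Sum>i. Z i x y * H k j y) \<partial>sphere_measure)"
    proof (rule sphere_series_integral)
      show "continuous_on (sphere 0 1) (\<lambda>y. Z i x y * H k j y)" for i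
        by (intro continuous_intros)
      show "\<bar>Z i x y * H k j y\<bar> \<le> (norm x ^ i * \<bar>zonal_sup i\<bar>) * (1 + zonal_sup k)" if "norm y = 1" for i y
        unfolding abs_mult using b[OF that, of i] abs_H_le[OF that, of k j] by (intro mult_mono) auto
      show "summable (\<lambda>i. (norm x ^ i * \<bar>zonal_sup i\<bar>) * (1 + zonal_sup k))"
        by (rule summable_mult2[OF sm])
    qed
    have e1: "(\<integral>y. (\<Sum>i. Z i x y * H k j y) \<partial>sphere_measure) = (\<integral>y. S y * H k j y \<partial>sphere_measure)"
      unfolding S_def using summ by (intro Bochner_Integration.integral_cong refl suminf_mult2[symmetric]) auto
    have s2: "(\<lambda>i. \<integral>y. Z i x y * H k j y \<partial>sphere_measure) sums H k j x"
    proof -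
      have "(\<lambda>i. if i = k then H k j x else 0) sums H k j x"
        by (rule sums_single)
      then show ?thesis
        by (simp add: Z_integral_H[OF j])
    qed
    have "(\<integral>y. S y * H k j y \<partial>sphere_measure) = H k j x"
      using sums_unique2[OF s1 s2] e1 by simp
    moreover have "(\<integral>y. poisson x y * H k j y - S y * H k j y \<partial>sphere_measure) =
        (\<integral>y. poisson x y * H k j y \<partial>sphere_measure) - (\<integral>y. S y * H k j y \<partial>sphere_measure)"
      by (intro Bochner_Integration.integral_diff integrable_sphere_continuous
          continuous_on_mult[OF cP H_cont] continuous_on_mult[OF cS H_cont])
    ultimately show "(\<integral>y. (poisson x y - S y) * H k j y \<partial>sphere_measure) = 0"
      by (simp add: left_diff_distrib H_reproduce[OF x])
  qed
  then show ?thesis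
    using summable_sums[OF summ[OF y]] by (simp add: S_def)
qed

section \<open>Series of solid harmonics with coefficients of subexponential growth\<close>

definition ctame :: "(nat \<Rightarrow> nat \<Rightarrow> real) \<Rightarrow> bool" where
  "ctame b \<longleftrightarrow> tame (\<lambda>k. \<Sum>j=1..d k. \<bar>b k j\<bar>)"

definition hterm :: "(nat \<Rightarrow> nat \<Rightarrow> real) \<Rightarrow> real^'n \<Rightarrow> nat \<Rightarrow> real" where
  "hterm b x k = (\<Sum>j=1..d k. b k j * H k j x)"

definition series :: "(nat \<Rightarrow> nat \<Rightarrow> real) \<Rightarrow> real^'n \<Rightarrow> real" where
  "series b x = (\<Sum>k. hterm b x k)"

lemma hterm_scaleR: "hterm b (a *\<^sub>R x) k = a ^ k * hterm b x k"
  by (simp add: hterm_def H_scaleR sum_distrib_left mult_ac)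

lemma hterm_cont [continuous_intros]: "continuous_on S (\<lambda>x. hterm b x k)"
  unfolding hterm_def by (intro continuous_intros)

lemma hterm_diff: "hterm (\<lambda>k j. b k j - c k j) x k = hterm b x k - hterm c x k"
  by (simp add: hterm_def left_diff_distrib sum_subtractf)

definition term_bound :: "(nat \<Rightarrow> nat \<Rightarrow> real) \<Rightarrow> nat \<Rightarrow> real" where
  "term_bound b k = (\<Sum>j=1..d k. \<bar>b k j\<bar>) * (1 + zonal_sup k)"

lemma term_bound_nonneg: "0 \<le> term_bound b k"
  using zonal_sup_nonneg[of k] by (auto simp: term_bound_def intro!: mult_nonneg_nonneg sum_nonneg)

lemma tame_term_bound: "ctame b \<Longrightarrow> tame (term_bound b)"
  unfolding ctame_def term_bound_def[abs_def] by (intro tame_mult tame_add tame_const tame_zonal_sup)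

lemma abs_hterm_le: "\<bar>hterm b x k\<bar> \<le> norm x ^ k * term_bound b k"
proof -
  have "\<bar>hterm b (dirn x) k\<bar> \<le> (\<Sum>j=1..d k. \<bar>b k j * H k j (dirn x)\<bar>)"
    unfolding hterm_def by (rule sum_abs)
  also have "\<dots> \<le> (\<Sum>j=1..d k. \<bar>b k j\<bar> * (1 + zonal_sup k))"
    unfolding abs_mult by (intro sum_mono mult_left_mono abs_H_le) auto
  also have "\<dots> = term_bound b k"
    by (simp add: term_bound_def sum_distrib_right)
  finally have "norm x ^ k * \<bar>hterm b (dirn x) k\<bar> \<le> norm x ^ k * term_bound b k"
    by (intro mult_left_mono) auto
  then show ?thesis
    using hterm_scaleR[of b "norm x" "dirn x" k] by (simp add: abs_mult)
qed

lemma term_bound_summable: "ctame b \<Longrightarrow> 0 \<le> r \<Longrightarrow> r < 1 \<Longrightarrow> summable (\<lambda>k. r ^ k * term_bound b k)"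
  using tame_summable[OF tame_term_bound, of b r] term_bound_nonneg by simp

lemma hterm_sums:
  assumes "ctame b" "norm x < 1"
  shows "hterm b x sums series b x"
proof -
  have "summable (hterm b x)"
    by (rule summable_comparison_test'[OF term_bound_summable[OF assms(1) norm_ge_zero assms(2)], of 0])
      (use abs_hterm_le in simp)
  then show ?thesis
    unfolding series_def by (rule summable_sums)
qed

lemma hterm_poisson:
  assumes "norm x < 1"
  shows "(\<integral>y. poisson x y * hterm b y k \<partial>sphere_measure) = hterm b x k"
proof -
  have "(\<integral>y. poisson x y * hterm b y k \<partial>sphere_measure) =
      (\<integral>y. (\<Sum>j=1..d k. b k j * (poisson x y * H k j y)) \<partial>sphere_measure)"
    by (simp add: hterm_def sum_distrib_left mult_ac)
  also have "\<dots> = (\<Sum>j=1..d k. \<integral>y. b k j * (poisson x y * H k j y) \<partial>sphere_measure)"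
    by (intro Bochner_Integration.integral_sum integrable_sphere_continuous
        continuous_on_mult[OF continuous_on_const continuous_on_mult[OF continuous_on_poisson_sphere[OF assms] H_cont]])
  also have "\<dots> = hterm b x k"
    using assms by (simp add: H_reproduce hterm_def)
  finally show ?thesis .
qed

text \<open>Instead of differentiating termwise, the series is identified on each ball of radius
  \<delta> < 1 with the Poisson integral of its own values on the sphere of that radius, by
  \<open>hterm_poisson\<close> in each degree.\<close>

theorem series_harmonic:
  assumes b: "ctame b"
  shows "harmonic_on (ball 0 1) (series b)"
proof (rule harmonic_on_locally[OF open_ball])
  fix x :: "real^'n" assume "x \<in> ball 0 1"
  then have x: "norm x < 1" by simp
  define \<delta> where "\<delta> = (1 + norm x) / 2"
  have \<delta>: "0 < \<delta>" "\<delta> < 1" "norm x < \<delta>"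
    using x by (auto simp: \<delta>_def add_pos_nonneg)
  define \<phi> where "\<phi> y = series b (\<delta> *\<^sub>R y)" for y
  have \<phi>: "\<phi> y = (\<Sum>k. \<delta> ^ k * hterm b y k)" for y
    by (simp add: \<phi>_def series_def hterm_scaleR)
  have bd: "\<bar>\<delta> ^ k * hterm b y k\<bar> \<le> \<delta> ^ k * term_bound b k" if "norm y = 1" for y k
    using abs_hterm_le[of b y k] \<delta> that by (simp add: abs_mult)
  have sm: "summable (\<lambda>k. \<delta> ^ k * term_bound b k)"
    using \<delta> by (intro term_bound_summable[OF b]) auto
  have c\<phi>: "continuous_on (sphere 0 1) \<phi>"
    unfolding \<phi>[abs_def] by (rule sphere_series_continuous[OF _ bd sm]) (auto intro!: continuous_intros)
  have "series b z = (\<integral>y. poisson (z /\<^sub>R \<delta>) y * \<phi> y \<partial>sphere_measure)" if z: "norm z < \<delta>" for z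
  proof -
    have z': "norm (z /\<^sub>R \<delta>) < 1"
      using z \<delta> by (simp add: field_simps)
    obtain M where M: "\<And>y. norm y = 1 \<Longrightarrow> \<bar>poisson (z /\<^sub>R \<delta>) y\<bar> \<le> M"
      using poisson_le[OF z'] poisson_nonneg[OF z'] by (metis abs_of_nonneg)
    have M0: "M \<ge> 0"
      using M[of "dirn 0"] by simp
    have "(\<lambda>k. \<integral>y. poisson (z /\<^sub>R \<delta>) y * (\<delta> ^ k * hterm b y k) \<partial>sphere_measure) sums
        (\<integral>y. (\<Sum>k. poisson (z /\<^sub>R \<delta>) y * (\<delta> ^ k * hterm b y k)) \<partial>sphere_measure)"
    proof (rule sphere_series_integral)
      show "continuous_on (sphere 0 1) (\<lambda>y. poisson (z /\<^sub>R \<delta>) y * (\<delta> ^ k * hterm b y k))" for k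
        by (intro continuous_on_mult[OF continuous_on_poisson_sphere[OF z']] continuous_intros)
      show "\<bar>poisson (z /\<^sub>R \<delta>) y * (\<delta> ^ k * hterm b y k)\<bar> \<le> M * (\<delta> ^ k * term_bound b k)" if "norm y = 1" for k y
        unfolding abs_mult[of "poisson _ _"] using M[OF that] bd[OF that] M0 by (intro mult_mono) auto
      show "summable (\<lambda>k. M * (\<delta> ^ k * term_bound b k))"
        by (rule summable_mult[OF sm])
    qed
    moreover have "(\<integral>y. (\<Sum>k. poisson (z /\<^sub>R \<delta>) y * (\<delta> ^ k * hterm b y k)) \<partial>sphere_measure) =
        (\<integral>y. poisson (z /\<^sub>R \<delta>) y * \<phi> y \<partial>sphere_measure)"
    proof (intro Bochner_Integration.integral_cong refl)
      fix y :: "real^'n" assume "y \<in> space sphere_measure"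
      then have y: "norm y = 1" by simp
      have "summable (\<lambda>k. \<delta> ^ k * hterm b y k)"
        by (rule summable_comparison_test'[OF sm, of 0]) (use bd[OF y] in simp)
      then show "(\<Sum>k. poisson (z /\<^sub>R \<delta>) y * (\<delta> ^ k * hterm b y k)) = poisson (z /\<^sub>R \<delta>) y * \<phi> y"
        unfolding \<phi> by (rule suminf_mult)
    qed
    moreover have "(\<integral>y. poisson (z /\<^sub>R \<delta>) y * (\<delta> ^ k * hterm b y k) \<partial>sphere_measure) = hterm b z k" for k
    proof -
      have "(\<integral>y. poisson (z /\<^sub>R \<delta>) y * (\<delta> ^ k * hterm b y k) \<partial>sphere_measure) =
          \<delta> ^ k * (\<integral>y. poisson (z /\<^sub>R \<delta>) y * hterm b y k \<partial>sphere_measure)"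
        by (subst Bochner_Integration.integral_mult_right_zero[symmetric]) (simp add: mult_ac)
      also have "\<dots> = hterm b (\<delta> *\<^sub>R (z /\<^sub>R \<delta>)) k"
        by (simp only: hterm_poisson[OF z'] hterm_scaleR)
      finally show ?thesis
        using \<delta> by simp
    qed
    ultimately have "hterm b z sums (\<integral>y. poisson (z /\<^sub>R \<delta>) y * \<phi> y \<partial>sphere_measure)"
      by simp
    then show ?thesis
      unfolding series_def by (rule sums_unique[symmetric])
  qed
  moreover have "harmonic_on (ball 0 \<delta>) (\<lambda>z. \<integral>y. poisson (z /\<^sub>R \<delta>) y * \<phi> y \<partial>sphere_measure)"
    using \<delta> by (intro harmonic_on_scaleR[OF poisson_integral_harmonic[OF c\<phi>]]) (auto simp: field_simps)
  ultimately have "harmonic_on (ball 0 \<delta>) (series b)"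
    by (elim harmonic_on_cong) auto
  then show "\<exists>T. x \<in> T \<and> harmonic_on T (series b)"
    using \<delta> by (intro exI[of _ "ball 0 \<delta>"]) auto
qed

text \<open>Along each ray the difference is a power series in the radius, so every homogeneous part
  vanishes on the sphere, and pairing with \<open>H k j\<close> isolates one coefficient. The
  hypotheses contain no growth condition, so the lemma applies to coefficient arrays before they are
  known to be \<open>ctame\<close>.\<close>

lemma coefficients_unique:
  assumes e: "e > 0"
    and s: "\<And>x. norm x < e \<Longrightarrow> hterm b x sums f x" "\<And>x. norm x < e \<Longrightarrow> hterm c x sums f x"
    and j: "j \<in> {1..d k}"
  shows "b k j = c k j"
proof -
  define a where "a k j = b k j - c k j" for k j
  have "hterm a y k = 0" if y: "norm y = 1" for y k
  proof (rule power_series_zero[OF e])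
    fix r :: real assume r: "\<bar>r\<bar> < e"
    then have "hterm a (r *\<^sub>R y) sums (f (r *\<^sub>R y) - f (r *\<^sub>R y))"
      unfolding a_def hterm_diff using y by (intro sums_diff s) auto
    moreover have "hterm a (r *\<^sub>R y) = (\<lambda>k. hterm a y k * r ^ k)"
      by (intro ext) (simp add: hterm_scaleR)
    ultimately show "(\<lambda>k. hterm a y k * r ^ k) sums 0"
      by simp
  qed
  then have "(\<integral>y. hterm a y k * H k j y \<partial>sphere_measure) = 0"
    by (intro Bochner_Integration.integral_eq_zero_AE AE_I2) simp
  moreover have "(\<integral>y. hterm a y k * H k j y \<partial>sphere_measure) = a k j"
  proof -
    have "(\<integral>y. hterm a y k * H k j y \<partial>sphere_measure) = (\<Sum>i=1..d k. \<integral>y. a k i * (H k i y * H k j y) \<partial>sphere_measure)"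
      unfolding hterm_def sum_distrib_right mult.assoc
      by (intro Bochner_Integration.integral_sum integrable_sphere_continuous continuous_intros)
    also have "\<dots> = (\<Sum>i=1..d k. a k i * (if i = j then 1 else 0))"
      using j by (intro sum.cong refl) (simp add: H_orth)
    also have "\<dots> = a k j"
      using j by (auto simp: if_distrib[of "\<lambda>u. _ * u"] cong: if_cong)
    finally show ?thesis .
  qed
  ultimately show ?thesis
    by (simp add: a_def)
qed


text \<open>Expanding the Poisson kernel in the Poisson formula for a dilate gives an expansion on a
  smaller ball. Uniqueness shows that the coefficients are the same for all dilations, and letting
  \<delta> approach 1 gives both convergence in the whole ball and the growth bound.\<close>

theorem harmonic_expansion:
  assumes harm: "harmonic_on (ball 0 1) f"
  shows "\<exists>b. ctame b \<and> (\<forall>k j. j \<notin> {1..d k} \<longrightarrow> b k j = 0) \<and> (\<forall>x. norm x < 1 \<longrightarrow> hterm b x sums f x)"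
proof -
  have cf: "continuous_on (ball 0 1) f"
    by (rule harmonic_on_imp_continuous_on[OF harm])
  have c\<delta>: "continuous_on (cball 0 1) (\<lambda>y. f (\<delta> *\<^sub>R y))" if "0 < \<delta>" "\<delta> < 1" for \<delta>
  proof (rule continuous_on_compose2[OF cf, where f = "\<lambda>y. \<delta> *\<^sub>R y"])
    show "(\<lambda>y. \<delta> *\<^sub>R y) ` cball 0 1 \<subseteq> ball (0 :: real^'n) 1"
    proof (rule image_subsetI)
      fix y :: "real^'n" assume "y \<in> cball 0 1"
      then have "\<delta> * norm y \<le> \<delta> * 1"
        using that by (intro mult_left_mono) auto
      then have "\<delta> * norm y < 1"
        using that by linarith
      then show "\<delta> *\<^sub>R y \<in> ball 0 1"
        using that by simp
    qed
  qed (intro continuous_intros)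
  have cs: "continuous_on (sphere 0 1) (\<lambda>y. f (\<delta> *\<^sub>R y))" if "0 < \<delta>" "\<delta> < 1" for \<delta>
    by (rule continuous_on_subset[OF c\<delta>[OF that]]) auto
  have bnd: "\<exists>M>0. \<forall>y. norm y = 1 \<longrightarrow> \<bar>f (\<delta> *\<^sub>R y)\<bar> \<le> M" if \<delta>: "0 < \<delta>" "\<delta> < 1" for \<delta>
  proof -
    have "bounded ((\<lambda>y. f (\<delta> *\<^sub>R y)) ` sphere 0 1)"
      using cs[OF \<delta>] by (intro compact_imp_bounded compact_continuous_image) auto
    then show ?thesis
      unfolding bounded_pos by auto
  qed
  \<comment> \<open>Division by \<delta>^k undoes the dilation in degree k.\<close>
  define \<beta> where "\<beta> \<delta> k j = (if j \<in> {1..d k} then (\<integral>y. H k j y * f (\<delta> *\<^sub>R y) \<partial>sphere_measure) / \<delta> ^ k else 0)" for \<delta> k j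
  have sums: "hterm (\<beta> \<delta>) x sums f x" if \<delta>: "0 < \<delta>" "\<delta> < 1" and x: "norm x < \<delta>" for \<delta> x
  proof -
    let ?x = "x /\<^sub>R \<delta>"
    have x': "norm ?x < 1"
      using \<delta> x by (simp add: field_simps)
    obtain M where M: "M > 0" "\<And>y. norm y = 1 \<Longrightarrow> \<bar>f (\<delta> *\<^sub>R y)\<bar> \<le> M"
      using bnd[OF \<delta>] by auto
    have "f (\<delta> *\<^sub>R ?x) = (\<integral>y. poisson ?x y * f (\<delta> *\<^sub>R y) \<partial>sphere_measure)"
    proof (rule poisson_formula[OF harmonic_on_scaleR[OF harm open_ball] c\<delta>[OF \<delta>] x'])
      show "\<delta> *\<^sub>R z \<in> ball 0 1" if "z \<in> ball 0 1" for z :: "real^'n"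
        using that \<delta> mult_strict_mono[of \<delta> 1 "norm z" 1] by simp
    qed
    then have fx: "f x = (\<integral>y. poisson ?x y * f (\<delta> *\<^sub>R y) \<partial>sphere_measure)"
      using \<delta> by simp
    have "(\<lambda>k. \<integral>y. Z k ?x y * f (\<delta> *\<^sub>R y) \<partial>sphere_measure) sums
        (\<integral>y. (\<Sum>k. Z k ?x y * f (\<delta> *\<^sub>R y)) \<partial>sphere_measure)"
    proof (rule sphere_series_integral)
      show "continuous_on (sphere 0 1) (\<lambda>y. Z k ?x y * f (\<delta> *\<^sub>R y))" for k
        by (rule continuous_on_mult[OF Z_cont cs[OF \<delta>]])
      show "\<bar>Z k ?x y * f (\<delta> *\<^sub>R y)\<bar> \<le> norm ?x ^ k * \<bar>zonal_sup k\<bar> * M" if "norm y = 1" for k y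
        unfolding abs_mult by (rule mult_mono[OF abs_Z_le_left[OF that] M(2)[OF that]]) auto
      show "summable (\<lambda>k. norm ?x ^ k * \<bar>zonal_sup k\<bar> * M)"
        by (intro summable_mult2 tame_summable[OF tame_zonal_sup _ x']) simp
    qed
    also have "(\<integral>y. (\<Sum>k. Z k ?x y * f (\<delta> *\<^sub>R y)) \<partial>sphere_measure) = f x"
      unfolding fx
    proof (intro Bochner_Integration.integral_cong refl)
      fix y :: "real^'n" assume "y \<in> space sphere_measure"
      then have "(\<lambda>k. Z k ?x y * f (\<delta> *\<^sub>R y)) sums (poisson ?x y * f (\<delta> *\<^sub>R y))"
        using Z_sums_poisson[OF x'] by (intro sums_mult2) auto
      then show "(\<Sum>k. Z k ?x y * f (\<delta> *\<^sub>R y)) = poisson ?x y * f (\<delta> *\<^sub>R y)"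
        by (rule sums_unique[symmetric])
    qed
    finally have 1: "(\<lambda>k. \<integral>y. Z k ?x y * f (\<delta> *\<^sub>R y) \<partial>sphere_measure) sums f x" .
    have 2: "(\<integral>y. Z k ?x y * f (\<delta> *\<^sub>R y) \<partial>sphere_measure) = hterm (\<beta> \<delta>) x k" for k
    proof -
      have "(\<integral>y. Z k ?x y * f (\<delta> *\<^sub>R y) \<partial>sphere_measure) =
          (\<integral>y. (\<Sum>j=1..d k. H k j ?x * (H k j y * f (\<delta> *\<^sub>R y))) \<partial>sphere_measure)"
        by (simp add: Z_def sum_distrib_right mult.assoc)
      also have "\<dots> = (\<Sum>j=1..d k. \<integral>y. H k j ?x * (H k j y * f (\<delta> *\<^sub>R y)) \<partial>sphere_measure)"
        by (intro Bochner_Integration.integral_sum integrable_sphere_continuous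
            continuous_on_mult[OF continuous_on_const continuous_on_mult[OF H_cont cs[OF \<delta>]]])
      also have "\<dots> = (\<Sum>j=1..d k. H k j ?x * (\<integral>y. H k j y * f (\<delta> *\<^sub>R y) \<partial>sphere_measure))"
        by simp
      also have "\<dots> = (\<Sum>j=1..d k. \<beta> \<delta> k j * H k j x)"
        by (intro sum.cong refl) (simp add: \<beta>_def H_scaleR power_inverse divide_inverse)
      finally show ?thesis
        by (simp add: hterm_def)
    qed
    show ?thesis
      using 1 unfolding 2 .
  qed
  \<comment> \<open>The radius 1/2 is an arbitrary reference; \<open>b\<delta>\<close> shows that
    any other gives the same coefficients.\<close>
  define b where "b = \<beta> (1/2)"
  have b\<delta>: "b k j = \<beta> \<delta> k j" if \<delta>: "0 < \<delta>" "\<delta> < 1" for \<delta> k j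
  proof (cases "j \<in> {1..d k}")
    case True
    show ?thesis
      unfolding b_def
      by (rule coefficients_unique[OF _ sums sums True, of "min (1/2) \<delta>"]) (use \<delta> in auto)
  next
    case False
    then show ?thesis
      by (auto simp: b_def \<beta>_def)
  qed
  have "ctame b"
    unfolding ctame_def tame_def
  proof (intro allI impI)
    fix q :: real assume q: "0 < q \<and> q < 1"
    \<comment> \<open>Of the two factors \<delta>^k in q^k, one cancels the division in the
      coefficients and the other absorbs the growth of the zonal bounds.\<close>
    define \<delta> where "\<delta> = sqrt q"
    have \<delta>: "0 < \<delta>" "\<delta> < 1" and q\<delta>: "q = \<delta> * \<delta>"
      using q by (auto simp: \<delta>_def)
    obtain M where M: "M > 0" "\<And>y. norm y = 1 \<Longrightarrow> \<bar>f (\<delta> *\<^sub>R y)\<bar> \<le> M"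
      using bnd[OF \<delta>] by auto
    have "tame (\<lambda>k. zonal_sup k * (1 + zonal_sup k))"
      by (intro tame_mult tame_add tame_const tame_zonal_sup)
    then obtain C where C: "C > 0" "\<forall>k. \<delta> ^ k * \<bar>zonal_sup k * (1 + zonal_sup k)\<bar> \<le> C"
      using tameE \<delta> by blast
    have "q ^ k * \<bar>\<Sum>j=1..d k. \<bar>b k j\<bar>\<bar> \<le> C * M" for k
    proof -
      have bj: "\<bar>b k j\<bar> \<le> (1 + zonal_sup k) * M / \<delta> ^ k" if j: "j \<in> {1..d k}" for j
      proof -
        have "\<bar>\<integral>y. H k j y * f (\<delta> *\<^sub>R y) \<partial>sphere_measure\<bar> \<le> (1 + zonal_sup k) * M"
        proof (rule abs_integral_sphere_le[OF continuous_on_mult[OF H_cont cs[OF \<delta>]]])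
          show "\<bar>H k j y * f (\<delta> *\<^sub>R y)\<bar> \<le> (1 + zonal_sup k) * M" if "norm y = 1" for y
            unfolding abs_mult using abs_H_le[OF that] M(2)[OF that] zonal_sup_nonneg[of k] by (intro mult_mono) auto
        qed
        then show ?thesis
          unfolding b\<delta>[OF \<delta>] \<beta>_def using j \<delta> by (simp add: divide_right_mono)
      qed
      have "(\<Sum>j=1..d k. \<bar>b k j\<bar>) \<le> real (d k) * ((1 + zonal_sup k) * M / \<delta> ^ k)"
        using sum_bounded_above[of "{1..d k}" "\<lambda>j. \<bar>b k j\<bar>", OF bj] by simp
      also have "\<dots> \<le> zonal_sup k * ((1 + zonal_sup k) * M / \<delta> ^ k)"
        using d_le_zonal_sup[of k] zonal_sup_nonneg[of k] M \<delta> by (intro mult_right_mono) auto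
      finally have "q ^ k * (\<Sum>j=1..d k. \<bar>b k j\<bar>) \<le> q ^ k * (zonal_sup k * ((1 + zonal_sup k) * M / \<delta> ^ k))"
        using q by (intro mult_left_mono) auto
      also have "\<dots> = (\<delta> ^ k * \<bar>zonal_sup k * (1 + zonal_sup k)\<bar>) * M"
        using \<delta> zonal_sup_nonneg[of k] by (simp add: q\<delta> power_mult_distrib field_simps)
      also have "\<dots> \<le> C * M"
        using C M by (intro mult_right_mono) auto
      finally show ?thesis
        by (simp add: sum_nonneg)
    qed
    then show "\<exists>C. \<forall>k. q ^ k * \<bar>\<Sum>j=1..d k. \<bar>b k j\<bar>\<bar> \<le> C"
      by blast
  qed
  moreover have "b k j = 0" if "j \<notin> {1..d k}" for k j
    using that by (auto simp: b_def \<beta>_def)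
  moreover have "hterm b x sums f x" if x: "norm x < 1" for x
  proof -
    define \<delta> where "\<delta> = (1 + norm x) / 2"
    have \<delta>: "0 < \<delta>" "\<delta> < 1" "norm x < \<delta>"
      using x by (auto simp: \<delta>_def add_pos_nonneg)
    have "b = \<beta> \<delta>"
      using b\<delta>[OF \<delta>(1,2)] by (intro ext)
    then show ?thesis
      using sums[OF \<delta>] by simp
  qed
  ultimately show ?thesis
    by blast
qed

section \<open>Identification of the coefficients and series in the definitions\<close>

lemma hterm_polar: "norm x ^ k * (\<Sum>j=1..d k. b k j * Y k j (dirn x)) = hterm b x k"
  unfolding hterm_def sum_distrib_left by (intro sum.cong refl) (simp add: H_def)

text \<open>Pointwise convergence fixes the coefficients on the index range, and the prescribed
  zeros fix the rest; together they make the definite description in \<open>hcoef\<close>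
  unique.\<close>

lemma hcoef_eq:
  assumes z: "\<And>k j. j \<notin> {1..d k} \<Longrightarrow> b k j = 0" and s: "\<And>x. norm x < 1 \<Longrightarrow> hterm b x sums f x"
  shows "hcoef Y d f = b"
  unfolding hcoef_def hterm_polar
proof (rule the_equality)
  show "(\<forall>k j. j \<notin> {1..d k} \<longrightarrow> b k j = 0) \<and> (\<forall>x\<in>ball 0 1. (\<lambda>k. hterm b x k) sums f x)"
    using assms by auto
  fix c assume c: "(\<forall>k j. j \<notin> {1..d k} \<longrightarrow> c k j = 0) \<and> (\<forall>x\<in>ball 0 1. (\<lambda>k. hterm c x k) sums f x)"
  show "c = b"
  proof (intro ext)
    fix k j
    show "c k j = b k j"
    proof (cases "j \<in> {1..d k}")
      case True
      show ?thesis
        by (rule coefficients_unique[OF zero_less_one _ s True]) (use c in auto)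
    next
      case False
      then show ?thesis
        using z c by auto
    qed
  qed
qed

lemma hcoef_harmonic:
  assumes "harmonic_on (ball 0 1) f"
  shows "ctame (hcoef Y d f)" and "norm x < 1 \<Longrightarrow> hterm (hcoef Y d f) x sums f x"
    and "j \<notin> {1..d k} \<Longrightarrow> hcoef Y d f k j = 0"
proof -
  obtain b where b: "ctame b" "\<forall>k j. j \<notin> {1..d k} \<longrightarrow> b k j = 0" "\<forall>x. norm x < 1 \<longrightarrow> hterm b x sums f x"
    using harmonic_expansion[OF assms] by blast
  then have "hcoef Y d f = b"
    by (intro hcoef_eq) auto
  with b show "ctame (hcoef Y d f)" "norm x < 1 \<Longrightarrow> hterm (hcoef Y d f) x sums f x"
    "j \<notin> {1..d k} \<Longrightarrow> hcoef Y d f k j = 0"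
    by auto
qed

lemma hconv_term_eq: "hconv_term Y d c f x = hterm (\<lambda>k j. c k j * hcoef Y d f k j) x"
  unfolding hconv_term_def hterm_polar[symmetric] by (intro ext) simp

lemma hconv_eq: "hconv Y d c f x = series (\<lambda>k j. c k j * hcoef Y d f k j) x"
  unfolding hconv_def hconv_term_eq series_def ..

lemma gc_term_eq: "gc_term Y d c x = hterm c x"
  unfolding gc_term_def hterm_polar[symmetric] by (intro ext) simp

lemma gc_eq: "gc Y d c x = series c x"
  unfolding gc_def gc_term_eq series_def ..

lemma ctame_mono:
  assumes "ctame b" "\<And>k j. j \<in> {1..d k} \<Longrightarrow> \<bar>a k j\<bar> \<le> \<bar>b k j\<bar>"
  shows "ctame a"
  unfolding ctame_def
proof (rule tame_mono[OF assms(1)[unfolded ctame_def]])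
  fix k
  have "(\<Sum>j=1..d k. \<bar>a k j\<bar>) \<le> (\<Sum>j=1..d k. \<bar>b k j\<bar>)"
    by (intro sum_mono assms(2))
  then show "\<bar>\<Sum>j=1..d k. \<bar>a k j\<bar>\<bar> \<le> \<bar>\<Sum>j=1..d k. \<bar>b k j\<bar>\<bar>"
    by (simp add: sum_nonneg)
qed

lemma ctame_mult:
  assumes "ctame a" "ctame b"
  shows "ctame (\<lambda>k j. a k j * b k j)"
  unfolding ctame_def
proof (rule tame_mono[OF tame_mult[OF assms[unfolded ctame_def]]])
  fix k
  have "(\<Sum>j=1..d k. \<bar>a k j * b k j\<bar>) \<le> (\<Sum>j=1..d k. \<bar>a k j\<bar> * (\<Sum>j=1..d k. \<bar>b k j\<bar>))"
    unfolding abs_mult by (intro sum_mono mult_left_mono member_le_sum) auto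
  then show "\<bar>\<Sum>j=1..d k. \<bar>a k j * b k j\<bar>\<bar> \<le> \<bar>(\<Sum>j=1..d k. \<bar>a k j\<bar>) * (\<Sum>j=1..d k. \<bar>b k j\<bar>)\<bar>"
    by (simp add: sum_nonneg flip: sum_distrib_right)
qed

lemma ctame_tame:
  assumes "tame a" shows "ctame (\<lambda>k j. a k)"
  unfolding ctame_def
proof (rule tame_mono[OF tame_mult[OF tame_zonal_sup assms]])
  show "\<bar>\<Sum>j=1..d k. \<bar>a k\<bar>\<bar> \<le> \<bar>zonal_sup k * a k\<bar>" for k
    using d_le_zonal_sup[of k] zonal_sup_nonneg[of k] by (simp add: abs_mult mult_right_mono)
qed

end

subsection \<open>One-dimensional integrals\<close>

lemma nn_integral_powr_from_0:
  assumes p: "p > 0" and a: "a \<ge> 0"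
  shows "(\<integral>\<^sup>+v. ennreal (indicator {0..a} v * v powr (p - 1)) \<partial>lborel) = ennreal (a powr p / p)"
  using nn_integral_has_integral_lebesgue[OF _ has_integral_powr_from_0[of "p - 1" a]] assms by simp

lemma nn_integral_powr_at_top:
  assumes b: "b > 0" and a: "a > 0"
  shows "(\<integral>\<^sup>+v. ennreal (indicator {a..} v * v powr (- b - 1)) \<partial>lborel) = ennreal (a powr (- b) / b)"
proof -
  have "(\<integral>\<^sup>+v. ennreal (v powr (- b - 1)) * indicator {a..} v \<partial>lborel) = ennreal (0 - (- (a powr (- b) / b)))"
  proof (rule nn_integral_FTC_atLeast)
    show "((\<lambda>v. - (v powr (- b) / b)) has_real_derivative v powr (- b - 1)) (at v)" if "a \<le> v" for v
      using a b that by (auto intro!: derivative_eq_intros)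
    have "((\<lambda>v. - (v powr (- b) / b)) \<longlongrightarrow> - (0 / b)) at_top"
      using b by (intro tendsto_intros tendsto_neg_powr filterlim_ident) auto
    then show "((\<lambda>v. - (v powr (- b) / b)) \<longlongrightarrow> 0) at_top"
      by simp
  qed auto
  then show ?thesis
    by (simp add: ennreal_indicator mult.commute ennreal_mult' flip: ennreal_indicator)
qed

text \<open>Splitting at v = a produces the two summands of the constant. This scalar integral lies
  behind both the kernel bound and the convolution bound.\<close>

lemma nn_integral_powr_max:
  assumes p: "p > 0" and b: "b > 0" and a: "a > 0"
  shows "(\<integral>\<^sup>+v. ennreal (indicator {0<..<1} v * v powr (p - 1) * max a v powr (- b - p)) \<partial>lborel)
    \<le> ennreal ((1 / p + 1 / b) * a powr (- b))"
proof -
  have "(\<integral>\<^sup>+v. ennreal (indicator {0<..<1} v * v powr (p - 1) * max a v powr (- b - p)) \<partial>lborel) \<le>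
     (\<integral>\<^sup>+v. ennreal (a powr (- b - p)) * ennreal (indicator {0..a} v * v powr (p - 1)) +
        ennreal (indicator {a..} v * v powr (- b - 1)) \<partial>lborel)"
  proof (intro nn_integral_mono)
    fix v :: real
    show "ennreal (indicator {0<..<1} v * v powr (p - 1) * max a v powr (- b - p)) \<le>
      ennreal (a powr (- b - p)) * ennreal (indicator {0..a} v * v powr (p - 1)) +
        ennreal (indicator {a..} v * v powr (- b - 1))"
    proof (cases "0 < v")
      case v: True
      show ?thesis
      proof (cases "v \<le> a")
        case True
        then have "ennreal (indicator {0<..<1} v * v powr (p - 1) * max a v powr (- b - p)) \<le>
            ennreal (a powr (- b - p)) * ennreal (indicator {0..a} v * v powr (p - 1))"
          using v by (simp add: max_def indicator_def mult.commute flip: ennreal_mult')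
        then show ?thesis
          by (rule order_trans) simp
      next
        case False
        have e: "(p - 1) + (- b - p) = - b - 1"
          by simp
        have "v powr (p - 1) * max a v powr (- b - p) = v powr (- b - 1)"
          using v False powr_add[of v "p - 1" "- b - p"] unfolding e by (simp add: max_def)
        then have "ennreal (indicator {0<..<1} v * v powr (p - 1) * max a v powr (- b - p)) \<le>
            ennreal (indicator {a..} v * v powr (- b - 1))"
          using False by (intro ennreal_leI) (simp add: indicator_def)
        then show ?thesis
          by (rule order_trans) simp
      qed
    qed simp
  qed
  also have "\<dots> = ennreal (a powr (- b - p)) * ennreal (a powr p / p) + ennreal (a powr (- b) / b)"
    using nn_integral_powr_from_0[OF p, of a] nn_integral_powr_at_top[OF b a] a
    by (subst nn_integral_add) (auto simp: nn_integral_cmult)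
  also have "\<dots> = ennreal ((1 / p + 1 / b) * a powr (- b))"
  proof -
    have "a powr (- b - p) * (a powr p / p) = a powr (- b) / p"
      using powr_add[of a "- b - p" p] by simp
    then show ?thesis
      using p b a by (simp add: algebra_simps flip: ennreal_mult ennreal_plus)
  qed
  finally show ?thesis .
qed

text \<open>The Beta distribution without normalisation. The k-th moment of 1 - v is
  \<open>Beta p (q + real k)\<close>; for p = t and q = z it is the reciprocal of
  \<open>gamma_ratio z t k\<close>.\<close>

definition beta_measure :: "real \<Rightarrow> real \<Rightarrow> real measure" where
  "beta_measure p q = density lborel (\<lambda>v. ennreal (indicator {0<..<1} v * v powr (p - 1) * (1 - v) powr (q - 1)))"

lemma sets_beta_measure [simp, measurable_cong]: "sets (beta_measure p q) = sets borel"
  by (simp add: beta_measure_def)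

lemma space_beta_measure [simp]: "space (beta_measure p q) = UNIV"
  by (simp add: beta_measure_def)

lemma nn_integral_beta_measure:
  assumes [measurable]: "f \<in> borel_measurable borel"
  shows "(\<integral>\<^sup>+v. f v \<partial>beta_measure p q) =
    (\<integral>\<^sup>+v. ennreal (indicator {0<..<1} v * v powr (p - 1) * (1 - v) powr (q - 1)) * f v \<partial>lborel)"
  unfolding beta_measure_def by (rule nn_integral_density) measurable

lemma AE_beta_measure: "AE v in beta_measure p q. 0 < v \<and> v < 1"
  unfolding beta_measure_def by (subst AE_density) (auto simp: indicator_def)

lemma nn_integral_beta_measure_power:
  assumes p: "p > 0" and q: "q > 0"
  shows "(\<integral>\<^sup>+v. ennreal ((1 - v) ^ k) \<partial>beta_measure p q) = ennreal (Beta p (q + real k))"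
proof -
  have "(\<integral>\<^sup>+v. ennreal ((1 - v) ^ k) \<partial>beta_measure p q) =
      (\<integral>\<^sup>+v. ennreal (indicator {0<..<1} v * v powr (p - 1) * (1 - v) powr (q - 1)) * ennreal ((1 - v) ^ k) \<partial>lborel)"
    by (rule nn_integral_beta_measure) measurable
  also have "\<dots> = (\<integral>\<^sup>+v. ennreal (indicator {0..1} v * (v powr (p - 1) * (1 - v) powr (q + real k - 1))) \<partial>lborel)"
  proof (rule nn_integral_cong_AE)
    have "AE v in lborel. v \<noteq> (0::real)" "AE v in lborel. v \<noteq> (1::real)"
      by (rule AE_lborel_singleton)+
    then show "AE v in lborel. ennreal (indicator {0<..<1} v * v powr (p - 1) * (1 - v) powr (q - 1)) * ennreal ((1 - v) ^ k) =
        ennreal (indicator {0..1} v * (v powr (p - 1) * (1 - v) powr (q + real k - 1)))"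
    proof eventually_elim
      case (elim v)
      show ?case
      proof (cases "0 < v \<and> v < 1")
        case True
        have "(1 - v) powr (q - 1) * (1 - v) ^ k = (1 - v) powr (q + real k - 1)"
          using True powr_add[of "1 - v" "q - 1" "real k"] by (simp add: powr_realpow algebra_simps)
        then show ?thesis
          using True by (simp add: indicator_def mult.assoc flip: ennreal_mult')
      qed (use elim in \<open>auto simp: indicator_def\<close>)
    qed
  qed
  also have "\<dots> = ennreal (Beta p (q + real k))"
    using assms by (intro nn_integral_has_integral_lebesgue has_integral_Beta_real) auto
  finally show ?thesis .
qed

lemma Beta_pos: "0 < p \<Longrightarrow> 0 < q \<Longrightarrow> 0 < (Beta p q :: real)"
  by (simp add: Beta_def Gamma_real_pos)

lemma beta_measure_power:
  assumes p: "p > 0" and q: "q > 0"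
  shows "integrable (beta_measure p q) (\<lambda>v. (1 - v) ^ k)"
    and "(\<integral>v. (1 - v) ^ k \<partial>beta_measure p q) = Beta p (q + real k)"
proof -
  have "AE v in beta_measure p q. 0 \<le> (1 - v) ^ k"
    using AE_beta_measure by eventually_elim simp
  then have "integrable (beta_measure p q) (\<lambda>v. (1 - v) ^ k) \<and> (\<integral>v. (1 - v) ^ k \<partial>beta_measure p q) = Beta p (q + real k)"
    using nn_integral_beta_measure_power[OF assms, of k] Beta_pos[of p "q + real k"] assms
    by (subst nn_integral_eq_integrable[symmetric]) auto
  then show "integrable (beta_measure p q) (\<lambda>v. (1 - v) ^ k)"
    and "(\<integral>v. (1 - v) ^ k \<partial>beta_measure p q) = Beta p (q + real k)"
    by auto
qed

text \<open>Summability of the |a k| suffices for termwise integration, since all moments of 1 - v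
  are bounded by the total mass \<open>Beta p q\<close>.\<close>

lemma beta_measure_series:
  fixes a :: "nat \<Rightarrow> real"
  assumes p: "p > 0" and q: "q > 0" and a: "summable (\<lambda>k. \<bar>a k\<bar>)"
  shows "integrable (beta_measure p q) (\<lambda>v. \<Sum>k. a k * (1 - v) ^ k)"
    and "(\<lambda>k. a k * Beta p (q + real k)) sums (\<integral>v. (\<Sum>k. a k * (1 - v) ^ k) \<partial>beta_measure p q)"
proof -
  have int: "integrable (beta_measure p q) (\<lambda>v. a k * (1 - v) ^ k)" for k
    using beta_measure_power(1)[OF p q] by (rule integrable_mult_right)
  have "AE v in beta_measure p q. summable (\<lambda>k. norm (a k * (1 - v) ^ k))"
    using AE_beta_measure
  proof eventually_elim
    case (elim v)
    have "\<bar>a k * (1 - v) ^ k\<bar> \<le> \<bar>a k\<bar>" for k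
      using elim by (simp add: abs_mult mult_left_le power_le_one)
    then show ?case
      using summable_comparison_test'[OF a, of 0 "\<lambda>k. norm (a k * (1 - v) ^ k)"] by simp
  qed
  moreover have "summable (\<lambda>k. \<integral>v. norm (a k * (1 - v) ^ k) \<partial>beta_measure p q)"
  proof -
    have "(\<integral>v. norm (a k * (1 - v) ^ k) \<partial>beta_measure p q) = \<bar>a k\<bar> * Beta p (q + real k)" for k
    proof -
      have "(\<integral>v. norm (a k * (1 - v) ^ k) \<partial>beta_measure p q) = (\<integral>v. \<bar>a k\<bar> * (1 - v) ^ k \<partial>beta_measure p q)"
      proof (rule integral_cong_AE)
        show "AE v in beta_measure p q. norm (a k * (1 - v) ^ k) = \<bar>a k\<bar> * (1 - v) ^ k"
          using AE_beta_measure by eventually_elim (simp add: abs_mult power_abs)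
      qed measurable
      then show ?thesis
        by (simp add: beta_measure_power(2)[OF p q])
    qed
    moreover have "norm (\<bar>a k\<bar> * Beta p (q + real k)) \<le> \<bar>a k\<bar> * Beta p q" for k
    proof -
      have "(\<integral>v. (1 - v) ^ k \<partial>beta_measure p q) \<le> (\<integral>v. (1 - v) ^ 0 \<partial>beta_measure p q)"
      proof (rule integral_mono_AE)
        show "AE v in beta_measure p q. (1 - v) ^ k \<le> (1 - v) ^ 0"
          using AE_beta_measure by eventually_elim (simp add: power_le_one)
      qed (rule beta_measure_power(1)[OF p q])+
      then have "Beta p (q + real k) \<le> Beta p q"
        unfolding beta_measure_power(2)[OF p q] by simp
      then show ?thesis
        using Beta_pos[of p "q + real k"] p q by (simp add: abs_mult mult_left_mono)
    qed
    ultimately show ?thesis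
      using summable_comparison_test'[OF summable_mult2[OF a, of "Beta p q"], of 0 "\<lambda>k. \<bar>a k\<bar> * Beta p (q + real k)"] by simp
  qed
  ultimately show "integrable (beta_measure p q) (\<lambda>v. \<Sum>k. a k * (1 - v) ^ k)"
    and "(\<lambda>k. a k * Beta p (q + real k)) sums (\<integral>v. (\<Sum>k. a k * (1 - v) ^ k) \<partial>beta_measure p q)"
    using integrable_suminf[OF int] sums_integral[OF int] by (simp_all add: beta_measure_power(2)[OF p q])
qed

lemma abs_integral_le_nn_integral:
  fixes f :: "'a \<Rightarrow> real"
  assumes "integrable M f" "(\<integral>\<^sup>+x. ennreal \<bar>f x\<bar> \<partial>M) \<le> ennreal B" "0 \<le> B"
  shows "\<bar>\<integral>x. f x \<partial>M\<bar> \<le> B"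
proof -
  have "ennreal (\<integral>x. \<bar>f x\<bar> \<partial>M) \<le> ennreal B"
    using assms by (subst nn_integral_eq_integral[symmetric]) auto
  then have "(\<integral>x. \<bar>f x\<bar> \<partial>M) \<le> B"
    using assms(3) by (simp add: ennreal_le_iff)
  then show ?thesis
    by (rule order_trans[OF integral_abs_bound])
qed

subsection \<open>Derivatives of the Poisson kernel\<close>

text \<open>For unit vectors with inner product \<xi> this is the distance from \<rho> x to y
  (\<open>rad_eq_norm\<close>). It turns kernels on the sphere into functions of one radial variable
  with parameter \<xi>.\<close>

definition rad :: "real \<Rightarrow> real \<Rightarrow> real" where
  "rad \<xi> \<rho> = sqrt (1 - 2 * \<rho> * \<xi> + \<rho>\<^sup>2)"

lemma rad_eq_norm:
  fixes x y :: "'a::real_inner"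
  assumes "norm x = 1" "norm y = 1"
  shows "rad (x \<bullet> y) \<rho> = norm (\<rho> *\<^sub>R x - y)"
proof -
  have 1: "x \<bullet> x = 1" "y \<bullet> y = 1"
    using assms by (simp_all add: dot_square_norm)
  have "(\<rho> *\<^sub>R x - y) \<bullet> (\<rho> *\<^sub>R x - y) = \<rho>\<^sup>2 * (x \<bullet> x) - 2 * \<rho> * (x \<bullet> y) + y \<bullet> y"
    by (simp add: inner_diff_left inner_diff_right inner_commute[of y x] power2_eq_square algebra_simps)
  then show ?thesis
    unfolding rad_def norm_eq_sqrt_inner[of "\<rho> *\<^sub>R x - y"] 1 by (simp add: algebra_simps)
qed

lemma rad_arg_ge:
  fixes \<xi> \<rho> :: real
  assumes "\<bar>\<xi>\<bar> \<le> 1"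
  shows "(1 - \<bar>\<rho>\<bar>)\<^sup>2 \<le> 1 - 2 * \<rho> * \<xi> + \<rho>\<^sup>2"
proof -
  have "\<bar>\<rho> * \<xi>\<bar> \<le> \<bar>\<rho>\<bar> * 1"
    unfolding abs_mult using assms by (intro mult_left_mono) auto
  then show ?thesis
    by (simp add: power2_eq_square algebra_simps)
qed

lemma rad_ge: "\<bar>\<xi>\<bar> \<le> 1 \<Longrightarrow> 1 - \<bar>\<rho>\<bar> \<le> rad \<xi> \<rho>"
  unfolding rad_def by (intro real_le_rsqrt rad_arg_ge)

lemma rad_nonneg: "\<bar>\<xi>\<bar> \<le> 1 \<Longrightarrow> 0 \<le> rad \<xi> \<rho>"
  unfolding rad_def using rad_arg_ge[of \<xi> \<rho>] by (simp add: order_trans[OF zero_le_power2])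

lemma rad_pos: "\<bar>\<xi>\<bar> \<le> 1 \<Longrightarrow> \<bar>\<rho>\<bar> < 1 \<Longrightarrow> 0 < rad \<xi> \<rho>"
  using rad_ge[of \<xi> \<rho>] by simp

lemma rad_sq: "\<bar>\<xi>\<bar> \<le> 1 \<Longrightarrow> (rad \<xi> \<rho>)\<^sup>2 = 1 - 2 * \<rho> * \<xi> + \<rho>\<^sup>2"
  unfolding rad_def using rad_arg_ge[of \<xi> \<rho>] by (simp add: order_trans[OF zero_le_power2])

lemma abs_diff_le_rad: "\<bar>\<xi>\<bar> \<le> 1 \<Longrightarrow> \<bar>\<rho> - \<xi>\<bar> \<le> rad \<xi> \<rho>"
proof -
  assume \<xi>: "\<bar>\<xi>\<bar> \<le> 1"
  then have "\<xi>\<^sup>2 \<le> 1"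
    by (simp add: abs_square_le_1)
  then have "(\<rho> - \<xi>)\<^sup>2 \<le> 1 - 2 * \<rho> * \<xi> + \<rho>\<^sup>2"
    by (simp add: power2_diff)
  then show ?thesis
    unfolding rad_def by (intro real_le_rsqrt) simp
qed

lemma rad_lipschitz:
  assumes \<xi>: "\<bar>\<xi>\<bar> \<le> 1"
  shows "rad \<xi> \<rho> \<le> rad \<xi> \<sigma> + \<bar>\<rho> - \<sigma>\<bar>"
proof (rule power2_le_imp_le)
  have "(\<rho> - \<sigma>) * (\<sigma> - \<xi>) \<le> \<bar>\<rho> - \<sigma>\<bar> * rad \<xi> \<sigma>"
    using abs_diff_le_rad[OF \<xi>, of \<sigma>] abs_le_iff[of "(\<rho> - \<sigma>) * (\<sigma> - \<xi>)" "\<bar>\<rho> - \<sigma>\<bar> * rad \<xi> \<sigma>"]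
    by (simp add: abs_mult mult_left_mono)
  moreover have "(rad \<xi> \<rho>)\<^sup>2 = (rad \<xi> \<sigma>)\<^sup>2 + 2 * ((\<rho> - \<sigma>) * (\<sigma> - \<xi>)) + (\<rho> - \<sigma>)\<^sup>2"
    unfolding rad_sq[OF \<xi>] by (simp add: power2_eq_square algebra_simps)
  moreover have "(rad \<xi> \<sigma> + \<bar>\<rho> - \<sigma>\<bar>)\<^sup>2 = (rad \<xi> \<sigma>)\<^sup>2 + 2 * (\<bar>\<rho> - \<sigma>\<bar> * rad \<xi> \<sigma>) + (\<rho> - \<sigma>)\<^sup>2"
    by (simp add: power2_sum)
  ultimately show "(rad \<xi> \<rho>)\<^sup>2 \<le> (rad \<xi> \<sigma> + \<bar>\<rho> - \<sigma>\<bar>)\<^sup>2"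
    by linarith
qed (use rad_nonneg[OF \<xi>] in simp)

lemma rad_le_2: "\<bar>\<xi>\<bar> \<le> 1 \<Longrightarrow> \<bar>\<rho>\<bar> \<le> 1 \<Longrightarrow> rad \<xi> \<rho> \<le> 2"
  using rad_lipschitz[of \<xi> \<rho> 0] by (simp add: rad_def)

lemma rad_has_derivative:
  assumes "\<bar>\<xi>\<bar> \<le> 1" "\<bar>\<rho>\<bar> < 1"
  shows "(rad \<xi> has_real_derivative (\<rho> - \<xi>) / rad \<xi> \<rho>) (at \<rho>)"
proof -
  have "1 - 2 * \<rho> * \<xi> + \<rho>\<^sup>2 > 0"
    using rad_pos[OF assms] by (simp add: rad_def)
  then show ?thesis
    unfolding rad_def[abs_def]
    by (auto intro!: derivative_eq_intros simp: field_simps)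
qed

text \<open>The functions of order \<open>q\<close>: sums of terms that are \<open>O(rad powr q)\<close> because each of
  \<open>1 - \<rho>\<^sup>2\<close> and \<open>\<rho> - \<xi>\<close> is \<open>O(rad)\<close>. Differentiation lowers the order by one.\<close>
inductive radial_order :: "real \<Rightarrow> (real \<Rightarrow> real \<Rightarrow> real) \<Rightarrow> bool" for q where
  monomial: "real e + real i - \<nu> \<ge> q \<Longrightarrow>
    radial_order q (\<lambda>\<xi> \<rho>. c * \<rho> ^ l * (1 - \<rho>\<^sup>2) ^ e * (\<rho> - \<xi>) ^ i * rad \<xi> \<rho> powr (- \<nu>))"
| sum: "radial_order q F \<Longrightarrow> radial_order q G \<Longrightarrow> radial_order q (\<lambda>\<xi> \<rho>. F \<xi> \<rho> + G \<xi> \<rho>)"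

lemma radial_order_mono: "radial_order q F \<Longrightarrow> q' \<le> q \<Longrightarrow> radial_order q' F"
  by (induction rule: radial_order.induct) (auto intro: radial_order.intros)

lemma radial_order_mult_left:
  "radial_order q F \<Longrightarrow> radial_order q (\<lambda>\<xi> \<rho>. (a * \<rho> ^ m) * F \<xi> \<rho>)"
proof (induction rule: radial_order.induct)
  case (monomial e i \<nu> c l)
  have "(\<lambda>\<xi> \<rho>. (a * \<rho> ^ m) * (c * \<rho> ^ l * (1 - \<rho>\<^sup>2) ^ e * (\<rho> - \<xi>) ^ i * rad \<xi> \<rho> powr (- \<nu>))) =
    (\<lambda>\<xi> \<rho>. (a * c) * \<rho> ^ (m + l) * (1 - \<rho>\<^sup>2) ^ e * (\<rho> - \<xi>) ^ i * rad \<xi> \<rho> powr (- \<nu>))"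
    by (intro ext) (simp add: power_add mult_ac)
  then show ?case
    using radial_order.monomial[OF monomial, of "a * c" "m + l"] by simp
next
  case (sum F G)
  then show ?case
    using radial_order.sum[OF sum.IH] by (simp add: distrib_left)
qed

lemma radial_order_bound:
  assumes "radial_order q F"
  shows "\<exists>C\<ge>0. \<forall>\<xi> \<rho>. \<bar>\<xi>\<bar> \<le> 1 \<longrightarrow> 0 \<le> \<rho> \<longrightarrow> \<rho> < 1 \<longrightarrow> \<bar>F \<xi> \<rho>\<bar> \<le> C * rad \<xi> \<rho> powr q"
  using assms
proof (induction rule: radial_order.induct)
  case (monomial e i \<nu> c l)
  define s where "s = real e + real i - \<nu>"
  have "\<bar>c * \<rho> ^ l * (1 - \<rho>\<^sup>2) ^ e * (\<rho> - \<xi>) ^ i * rad \<xi> \<rho> powr (- \<nu>)\<bar> \<le> (\<bar>c\<bar> * 2 ^ e * 2 powr (s - q)) * rad \<xi> \<rho> powr q"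
    if \<xi>: "\<bar>\<xi>\<bar> \<le> 1" and \<rho>: "0 \<le> \<rho>" "\<rho> < 1" for \<xi> \<rho>
  proof -
    let ?R = "rad \<xi> \<rho>"
    have R: "?R > 0" "?R \<le> 2"
      using rad_pos[OF \<xi>, of \<rho>] rad_le_2[OF \<xi>, of \<rho>] \<rho> by auto
    have "1 - \<rho>\<^sup>2 = (1 - \<rho>) * (1 + \<rho>)"
      by (simp add: power2_eq_square algebra_simps)
    also have "\<dots> \<le> ?R * 2"
      using rad_ge[OF \<xi>, of \<rho>] \<rho> R by (intro mult_mono) auto
    finally have "1 - \<rho>\<^sup>2 \<le> ?R * 2" .
    moreover have "0 \<le> 1 - \<rho>\<^sup>2"
      using \<rho> by (simp add: power_le_one)
    ultimately have e1: "\<bar>(1 - \<rho>\<^sup>2) ^ e\<bar> \<le> (?R * 2) ^ e"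
      unfolding power_abs by (intro power_mono) auto
    have e2: "\<bar>(\<rho> - \<xi>) ^ i\<bar> \<le> ?R ^ i"
      unfolding power_abs by (intro power_mono abs_diff_le_rad \<xi>) simp
    have e3: "\<bar>\<rho> ^ l\<bar> \<le> 1"
      using \<rho> by (simp add: power_abs power_le_one)
    have "\<bar>c * \<rho> ^ l * (1 - \<rho>\<^sup>2) ^ e * (\<rho> - \<xi>) ^ i * ?R powr (- \<nu>)\<bar> \<le>
        \<bar>c\<bar> * 1 * (?R * 2) ^ e * ?R ^ i * ?R powr (- \<nu>)"
      unfolding abs_mult using e1 e2 e3 R by (intro mult_mono mult_nonneg_nonneg) auto
    also have "\<dots> = \<bar>c\<bar> * 2 ^ e * ?R powr s"
      using R by (simp add: s_def powr_add powr_diff powr_minus powr_realpow power_mult_distrib divide_inverse)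
    \<comment> \<open>The actual order s of the monomial may exceed q; the surplus power is bounded
      because \<open>rad\<close> is at most 2.\<close>
    also have "?R powr s = ?R powr (s - q) * ?R powr q"
      using powr_add[of ?R "s - q" q] by simp
    also have "\<dots> \<le> 2 powr (s - q) * ?R powr q"
      using R monomial by (intro mult_right_mono powr_mono2) (auto simp: s_def)
    finally show ?thesis
      by (simp add: mult_left_mono mult.assoc)
  qed
  then show ?case
    by (intro exI[of _ "\<bar>c\<bar> * 2 ^ e * 2 powr (s - q)"]) auto
next
  case (sum F G)
  obtain C D where C: "C \<ge> 0" "\<And>\<xi> \<rho>. \<bar>\<xi>\<bar> \<le> 1 \<Longrightarrow> 0 \<le> \<rho> \<Longrightarrow> \<rho> < 1 \<Longrightarrow> \<bar>F \<xi> \<rho>\<bar> \<le> C * rad \<xi> \<rho> powr q"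
    and D: "D \<ge> 0" "\<And>\<xi> \<rho>. \<bar>\<xi>\<bar> \<le> 1 \<Longrightarrow> 0 \<le> \<rho> \<Longrightarrow> \<rho> < 1 \<Longrightarrow> \<bar>G \<xi> \<rho>\<bar> \<le> D * rad \<xi> \<rho> powr q"
    using sum.IH by auto
  have "\<bar>F \<xi> \<rho> + G \<xi> \<rho>\<bar> \<le> (C + D) * rad \<xi> \<rho> powr q" if "\<bar>\<xi>\<bar> \<le> 1" "0 \<le> \<rho>" "\<rho> < 1" for \<xi> \<rho>
    using C(2)[OF that] D(2)[OF that] by (simp add: distrib_right)
  then show ?case
    using C(1) D(1) by (intro exI[of _ "C + D"]) auto
qed

lemma radial_order_derivative:
  assumes "radial_order q F"
  shows "\<exists>F'. radial_order (q - 1) F' \<and>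
    (\<forall>\<xi> \<rho>. \<bar>\<xi>\<bar> \<le> 1 \<longrightarrow> \<bar>\<rho>\<bar> < 1 \<longrightarrow> (F \<xi> has_real_derivative F' \<xi> \<rho>) (at \<rho>))"
  using assms
proof (induction rule: radial_order.induct)
  case (monomial e i \<nu> c l)
  let ?m = "\<lambda>c l e i \<nu> \<xi> \<rho>. c * \<rho> ^ l * (1 - \<rho>\<^sup>2) ^ e * (\<rho> - \<xi>) ^ i * rad \<xi> \<rho> powr (- \<nu>)"
  \<comment> \<open>One monomial for each factor in the product rule. Where a truncated exponent
    such as \<open>l - 1\<close> is wrong, at 0, its coefficient vanishes.\<close>
  let ?F' = "\<lambda>\<xi> \<rho>. (?m (c * real l) (l - 1) e i \<nu> \<xi> \<rho> + ?m (- 2 * c * real e) (l + 1) (e - 1) i \<nu> \<xi> \<rho>)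
    + (?m (c * real i) l e (i - 1) \<nu> \<xi> \<rho> + ?m (- c * \<nu>) l e (i + 1) (\<nu> + 2) \<xi> \<rho>)"
  have "radial_order (q - 1) ?F'"
    using monomial by (intro radial_order.intros) auto
  moreover have "(?m c l e i \<nu> \<xi> has_real_derivative ?F' \<xi> \<rho>) (at \<rho>)" if "\<bar>\<xi>\<bar> \<le> 1" "\<bar>\<rho>\<bar> < 1" for \<xi> \<rho>
  proof -
    have R: "rad \<xi> \<rho> > 0"
      by (rule rad_pos[OF that])
    have 1: "((\<lambda>\<rho>. rad \<xi> \<rho> powr (- \<nu>)) has_real_derivative - \<nu> * ((\<rho> - \<xi>) * rad \<xi> \<rho> powr (- (\<nu> + 2)))) (at \<rho>)"
    proof -
      have eq: "rad \<xi> \<rho> powr (- \<nu> - 1) * ((\<rho> - \<xi>) / rad \<xi> \<rho>) = (\<rho> - \<xi>) * rad \<xi> \<rho> powr (- (\<nu> + 2))"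
      proof -
        have e: "- (\<nu> + 2) + 1 = - \<nu> - 1"
          by simp
        have "rad \<xi> \<rho> powr (- \<nu> - 1) = rad \<xi> \<rho> powr (- (\<nu> + 2)) * rad \<xi> \<rho>"
          using R powr_add[of "rad \<xi> \<rho>" "- (\<nu> + 2)" 1] unfolding e by simp
        then show ?thesis
          using R by simp
      qed
      show ?thesis
        by (rule DERIV_cong[OF DERIV_fun_powr[OF rad_has_derivative[OF that] R]]) (simp only: mult.assoc of_nat_1 eq)
    qed
    have 2: "((\<lambda>\<rho>. \<rho> ^ l) has_real_derivative real l * \<rho> ^ (l - 1)) (at \<rho>)"
      by (auto intro!: derivative_eq_intros)
    have 3: "((\<lambda>\<rho>. (1 - \<rho>\<^sup>2) ^ e) has_real_derivative - 2 * real e * \<rho> * (1 - \<rho>\<^sup>2) ^ (e - 1)) (at \<rho>)"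
      by (auto intro!: derivative_eq_intros)
    have 4: "((\<lambda>\<rho>. (\<rho> - \<xi>) ^ i) has_real_derivative real i * (\<rho> - \<xi>) ^ (i - 1)) (at \<rho>)"
      by (auto intro!: derivative_eq_intros)
    have "((\<lambda>\<rho>. c * (\<rho> ^ l * ((1 - \<rho>\<^sup>2) ^ e * ((\<rho> - \<xi>) ^ i * rad \<xi> \<rho> powr (- \<nu>))))) has_real_derivative ?F' \<xi> \<rho>) (at \<rho>)"
      by (rule DERIV_cong[OF DERIV_cmult[OF DERIV_mult[OF 2 DERIV_mult[OF 3 DERIV_mult[OF 4 1]]]]])
        (simp add: algebra_simps)
    then show ?thesis
      by (simp add: mult.assoc)
  qed
  ultimately show ?case
    by blast
next
  case (sum F G)
  obtain F' G' where "radial_order (q - 1) F'" "radial_order (q - 1) G'"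
    and D: "\<And>\<xi> \<rho>. \<bar>\<xi>\<bar> \<le> 1 \<Longrightarrow> \<bar>\<rho>\<bar> < 1 \<Longrightarrow> (F \<xi> has_real_derivative F' \<xi> \<rho>) (at \<rho>)"
      "\<And>\<xi> \<rho>. \<bar>\<xi>\<bar> \<le> 1 \<Longrightarrow> \<bar>\<rho>\<bar> < 1 \<Longrightarrow> (G \<xi> has_real_derivative G' \<xi> \<rho>) (at \<rho>)"
    using sum.IH by auto
  then have "radial_order (q - 1) (\<lambda>\<xi> \<rho>. F' \<xi> \<rho> + G' \<xi> \<rho>)"
    by (intro radial_order.sum)
  then show ?case
    using D by (intro exI[of _ "\<lambda>\<xi> \<rho>. F' \<xi> \<rho> + G' \<xi> \<rho>"]) (auto intro: DERIV_add)
qed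

text \<open>The Euler operator r d/dr multiplies the k-th coefficient by k and, unlike d/dr, does
  not shift the index.\<close>

lemma sums_euler_operator:
  fixes b :: "nat \<Rightarrow> real"
  assumes g: "\<And>r. \<bar>r\<bar> < 1 \<Longrightarrow> (\<lambda>k. b k * r ^ k) sums g r"
    and g': "(g has_real_derivative g') (at r)" and r: "\<bar>r\<bar> < 1"
  shows "(\<lambda>k. real k * b k * r ^ k) sums (r * g')"
proof -
  have "(\<lambda>k. diffs b k * r ^ k) sums g'"
    using termdiffs_sums_strong[of 1 b g g' r] assms by simp
  from sums_mult[OF this, of r] have "(\<lambda>k. real (Suc k) * b (Suc k) * r ^ Suc k) sums (r * g')"
    by (simp add: diffs_def mult_ac)
  then show ?thesis
    by (subst (asm) sums_Suc_iff) simp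
qed

text \<open>Each factor of the Pochhammer symbol is the Euler operator plus a constant and costs one
  order. \<open>G\<close> is chosen before \<xi> and a: a single function serves all parameters,
  which makes the later constants uniform.\<close>

lemma radial_order_pochhammer:
  assumes P: "radial_order q P"
  shows "\<exists>G. radial_order (q - real N) G \<and> (\<forall>\<xi> a. \<bar>\<xi>\<bar> \<le> 1 \<longrightarrow>
    (\<forall>r. \<bar>r\<bar> < 1 \<longrightarrow> (\<lambda>k. a k * r ^ k) sums P \<xi> r) \<longrightarrow>
    (\<forall>r. \<bar>r\<bar> < 1 \<longrightarrow> (\<lambda>k. pochhammer (z + real k) N * a k * r ^ k) sums G \<xi> r))"
proof (induction N)
  case 0
  then show ?case
    using P by (intro exI[of _ P]) auto
next
  case (Suc N)
  then obtain G where G: "radial_order (q - real N) G"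
    "\<And>\<xi> a r. \<bar>\<xi>\<bar> \<le> 1 \<Longrightarrow> (\<forall>r. \<bar>r\<bar> < 1 \<longrightarrow> (\<lambda>k. a k * r ^ k) sums P \<xi> r) \<Longrightarrow> \<bar>r\<bar> < 1 \<Longrightarrow>
      (\<lambda>k. pochhammer (z + real k) N * a k * r ^ k) sums G \<xi> r"
    by blast
  obtain G' where G': "radial_order (q - real N - 1) G'"
    "\<And>\<xi> r. \<bar>\<xi>\<bar> \<le> 1 \<Longrightarrow> \<bar>r\<bar> < 1 \<Longrightarrow> (G \<xi> has_real_derivative G' \<xi> r) (at r)"
    using radial_order_derivative[OF G(1)] by blast
  let ?E = "\<lambda>\<xi> r. (1 * r ^ 1) * G' \<xi> r + ((z + real N) * r ^ 0) * G \<xi> r"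
  have "radial_order (q - real (Suc N)) ?E"
    using G(1) G'(1) by (intro radial_order.sum radial_order_mult_left) (auto elim: radial_order_mono simp: algebra_simps)
  moreover have "(\<lambda>k. pochhammer (z + real k) (Suc N) * a k * r ^ k) sums ?E \<xi> r"
    if \<xi>: "\<bar>\<xi>\<bar> \<le> 1" and a: "\<forall>r. \<bar>r\<bar> < 1 \<longrightarrow> (\<lambda>k. a k * r ^ k) sums P \<xi> r" and r: "\<bar>r\<bar> < 1" for \<xi> a r
  proof -
    have 1: "(\<lambda>k. real k * (pochhammer (z + real k) N * a k) * r ^ k) sums (r * G' \<xi> r)"
      by (rule sums_euler_operator[OF G(2)[OF \<xi> a] G'(2)[OF \<xi> r] r])
    show ?thesis
      using sums_add[OF 1 sums_mult[OF G(2)[OF \<xi> a r], of "z + real N"]]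
      by (simp add: pochhammer_Suc algebra_simps)
  qed
  ultimately show ?case
    by blast
qed

subsection \<open>Fractional derivatives of the Poisson kernel\<close>

definition gamma_ratio :: "real \<Rightarrow> real \<Rightarrow> nat \<Rightarrow> real" where
  "gamma_ratio z t k = Gamma (real k + z + t) / (Gamma (real k + z) * Gamma t)"

lemma gamma_ratio_pos: "0 < z \<Longrightarrow> 0 < t \<Longrightarrow> 0 < gamma_ratio z t k"
  by (simp add: gamma_ratio_def Gamma_real_pos)

lemma gamma_ratio_Beta: "0 < z \<Longrightarrow> 0 < t \<Longrightarrow> gamma_ratio z t k * Beta t (z + real k) = 1"
  by (simp add: gamma_ratio_def Beta_def Gamma_real_pos[THEN less_imp_neq, THEN not_sym] add_ac)

text \<open>A derivative of order t splits into N differentiations, the Pochhammer factor, and a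
  fractional integration of order N - t, the Beta factor, which is a moment of
  \<open>beta_measure\<close>.\<close>

lemma gamma_ratio_pochhammer:
  assumes z: "z > 0" and t: "0 < t" and N: "t < real N"
  shows "gamma_ratio z t k = pochhammer (z + real k) N * Beta (real N - t) (z + t + real k) / (Gamma (real N - t) * Gamma t)"
proof -
  have pos: "Gamma (z + real k) > 0" "Gamma (real N - t) > 0" "Gamma t > 0" "Gamma (z + real k + real N) > 0"
    using assms by (auto intro!: Gamma_real_pos add_pos_nonneg)
  have 1: "pochhammer (z + real k) N = Gamma (z + real k + real N) / Gamma (z + real k)"
    using z by (intro pochhammer_Gamma) (auto elim!: nonpos_Ints_cases)
  have 2: "Beta (real N - t) (z + t + real k) = Gamma (real N - t) * Gamma (z + t + real k) / Gamma (z + real k + real N)"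
    by (simp add: Beta_def algebra_simps)
  show ?thesis
    unfolding gamma_ratio_def 1 2 using pos by (simp add: add_ac)
qed

lemma summable_abs_power_series:
  fixes a :: "nat \<Rightarrow> real" and r :: real
  assumes "\<And>r. \<bar>r\<bar> < 1 \<Longrightarrow> summable (\<lambda>k. a k * r ^ k)" "\<bar>r\<bar> < 1"
  shows "summable (\<lambda>k. \<bar>a k * r ^ k\<bar>)"
proof -
  define x where "x = (1 + \<bar>r\<bar>) / 2"
  have "\<bar>x\<bar> < 1" "\<bar>r\<bar> < \<bar>x\<bar>"
    using assms(2) by (auto simp: x_def)
  then show ?thesis
    using powser_insidea[OF assms(1)[of x], of r] by simp
qed

text \<open>N differentiations bring the order down to q - N, and averaging over the dilates \<rho>
  (1 - v) wins back p = N - t. The average of a negative power of the distance is again such a power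
  because q < t.\<close>

theorem fractional_kernel_bound:
  assumes P: "radial_order q P" and z: "z > 0" and t: "t > 0" and qt: "q < t" and zt: "z + t \<ge> 1"
  shows "\<exists>C\<ge>0. \<forall>\<xi> a \<rho>. \<bar>\<xi>\<bar> \<le> 1 \<longrightarrow> (\<forall>r. \<bar>r\<bar> < 1 \<longrightarrow> (\<lambda>k. a k * r ^ k) sums P \<xi> r) \<longrightarrow>
    0 \<le> \<rho> \<longrightarrow> \<rho> < 1 \<longrightarrow> \<bar>\<Sum>k. \<rho> ^ k * gamma_ratio z t k * a k\<bar> \<le> C * rad \<xi> \<rho> powr (q - t)"
proof -
  obtain N :: nat where N: "t < real N"
    using reals_Archimedean2 by blast
  define p where "p = real N - t"
  have p: "p > 0"
    using N by (simp add: p_def)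
  have qN: "q - real N = - (t - q) - p"
    by (simp add: p_def)
  obtain G where G: "radial_order (q - real N) G"
    "\<And>\<xi> a r. \<bar>\<xi>\<bar> \<le> 1 \<Longrightarrow> (\<forall>r. \<bar>r\<bar> < 1 \<longrightarrow> (\<lambda>k. a k * r ^ k) sums P \<xi> r) \<Longrightarrow> \<bar>r\<bar> < 1 \<Longrightarrow>
      (\<lambda>k. pochhammer (z + real k) N * a k * r ^ k) sums G \<xi> r"
    using radial_order_pochhammer[OF P, of N z] by blast
  obtain C where C: "C \<ge> 0" "\<And>\<xi> \<rho>. \<bar>\<xi>\<bar> \<le> 1 \<Longrightarrow> 0 \<le> \<rho> \<Longrightarrow> \<rho> < 1 \<Longrightarrow> \<bar>G \<xi> \<rho>\<bar> \<le> C * rad \<xi> \<rho> powr (q - real N)"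
    using radial_order_bound[OF G(1)] by blast
  define K where "K = 1 / (Gamma p * Gamma t)"
  have K: "K > 0"
    using p t by (simp add: K_def Gamma_real_pos)
  define B where "B = C * 2 powr (real N - q) * (1 / p + 1 / (t - q))"
  have B: "B \<ge> 0"
    using C p qt by (simp add: B_def)
  have "\<bar>\<Sum>k. \<rho> ^ k * gamma_ratio z t k * a k\<bar> \<le> (K * B) * rad \<xi> \<rho> powr (q - t)"
    if \<xi>: "\<bar>\<xi>\<bar> \<le> 1" and a: "\<forall>r. \<bar>r\<bar> < 1 \<longrightarrow> (\<lambda>k. a k * r ^ k) sums P \<xi> r" and \<rho>: "0 \<le> \<rho>" "\<rho> < 1" for \<xi> a \<rho>
  proof -
    define e where "e k = pochhammer (z + real k) N * a k * \<rho> ^ k" for k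
    define F where "F v = (\<Sum>k. e k * (1 - v) ^ k)" for v
    have e: "summable (\<lambda>k. \<bar>e k\<bar>)"
      unfolding e_def using G(2)[OF \<xi> a] \<rho> by (intro summable_abs_power_series) (auto simp: sums_iff)
    have FG: "F v = G \<xi> (\<rho> * (1 - v))" if "0 < v" "v < 1" for v
    proof -
      have "\<bar>\<rho> * (1 - v)\<bar> < 1"
        using \<rho> that mult_strict_mono[of \<rho> 1 "1 - v" 1] by (simp add: abs_mult)
      from G(2)[OF \<xi> a this] show ?thesis
        by (simp add: F_def e_def sums_iff power_mult_distrib mult_ac)
    qed
    note ser = beta_measure_series[OF p _ e, of "z + t", folded F_def]
    have zt0: "0 < z + t"
      using z t by simp
    let ?R = "rad \<xi> \<rho>"
    have R: "?R > 0"
      using rad_pos[OF \<xi>, of \<rho>] \<rho> by simp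
    \<comment> \<open>Moving from \<rho> to \<rho> (1 - v) leaves a distance that is at least v and
      at least half of the old one. This gives the integrand the shape required by
      \<open>nn_integral_powr_max\<close>.\<close>
    have Fb: "\<bar>F v\<bar> \<le> C * 2 powr (real N - q) * max ?R v powr (- (t - q) - p)" if v: "0 < v" "v < 1" for v
    proof -
      let ?S = "rad \<xi> (\<rho> * (1 - v))"
      have \<rho>v: "0 \<le> \<rho> * (1 - v)" "\<rho> * (1 - v) < 1"
        using \<rho> v mult_strict_mono[of \<rho> 1 "1 - v" 1] by auto
      have "\<rho> * (1 - v) \<le> 1 * (1 - v)"
        using \<rho> v by (intro mult_right_mono) auto
      then have vS: "v \<le> ?S"
        using rad_ge[OF \<xi>, of "\<rho> * (1 - v)"] \<rho>v by simp
      have "\<bar>\<rho> - \<rho> * (1 - v)\<bar> \<le> v"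
        using \<rho> v by (simp add: algebra_simps abs_mult mult_left_le_one_le)
      then have "?R \<le> 2 * ?S"
        using rad_lipschitz[OF \<xi>, of \<rho> "\<rho> * (1 - v)"] vS by simp
      with vS v have m: "max ?R v / 2 \<le> ?S" "0 < max ?R v / 2"
        by (auto simp: max_def)
      have "\<bar>F v\<bar> \<le> C * ?S powr (q - real N)"
        using FG[OF v] C(2)[OF \<xi> \<rho>v] by simp
      also have "\<dots> \<le> C * (max ?R v / 2) powr (q - real N)"
        using C(1) m qt N by (intro mult_left_mono powr_mono2') auto
      also have "(max ?R v / 2) powr (q - real N) = 2 powr (real N - q) * max ?R v powr (- (t - q) - p)"
      proof -
        have e1: "2 powr (real N - q) = inverse (2 powr (q - real N) :: real)"
          by (rule powr_minus[of 2 "q - real N", unfolded minus_diff_eq])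
        have "(max ?R v / 2) powr (q - real N) = max ?R v powr (q - real N) / 2 powr (q - real N)"
          by (rule powr_divide)
        then show ?thesis
          unfolding e1 qN[symmetric] by (simp only: divide_inverse mult.commute)
      qed
      finally show ?thesis
        by (simp add: mult.assoc)
    qed
    have int: "integrable (beta_measure p (z + t)) F"
      by (rule ser(1)[OF zt0])
    then have [measurable]: "F \<in> borel_measurable borel"
      using borel_measurable_integrable[OF int] by (simp cong: measurable_cong_sets)
    have "(\<integral>\<^sup>+v. ennreal \<bar>F v\<bar> \<partial>beta_measure p (z + t)) =
        (\<integral>\<^sup>+v. ennreal (indicator {0<..<1} v * v powr (p - 1) * (1 - v) powr (z + t - 1)) * ennreal \<bar>F v\<bar> \<partial>lborel)"
      by (rule nn_integral_beta_measure) measurable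
    also have "\<dots> \<le> (\<integral>\<^sup>+v. ennreal (C * 2 powr (real N - q)) *
        ennreal (indicator {0<..<1} v * v powr (p - 1) * max ?R v powr (- (t - q) - p)) \<partial>lborel)"
    proof (intro nn_integral_mono)
      fix v :: real
      show "ennreal (indicator {0<..<1} v * v powr (p - 1) * (1 - v) powr (z + t - 1)) * ennreal \<bar>F v\<bar> \<le>
        ennreal (C * 2 powr (real N - q)) * ennreal (indicator {0<..<1} v * v powr (p - 1) * max ?R v powr (- (t - q) - p))"
      proof (cases "0 < v \<and> v < 1")
        case True
        \<comment> \<open>Here z + t \<ge> 1 enters: it makes the second Beta weight at most
          1.\<close>
        have "(1 - v) powr (z + t - 1) \<le> 1"
          using True zt by (intro powr_le1) auto
        then have "v powr (p - 1) * (1 - v) powr (z + t - 1) * \<bar>F v\<bar> \<le>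
            v powr (p - 1) * 1 * (C * 2 powr (real N - q) * max ?R v powr (- (t - q) - p))"
          using Fb[of v] True by (intro mult_mono) auto
        then show ?thesis
          using True C(1) by (simp add: mult_ac flip: ennreal_mult')
      qed (auto simp: indicator_def)
    qed
    also have "\<dots> = ennreal (C * 2 powr (real N - q)) *
        (\<integral>\<^sup>+v. ennreal (indicator {0<..<1} v * v powr (p - 1) * max ?R v powr (- (t - q) - p)) \<partial>lborel)"
      by (rule nn_integral_cmult) measurable
    also have "\<dots> \<le> ennreal (C * 2 powr (real N - q)) * ennreal ((1 / p + 1 / (t - q)) * ?R powr (- (t - q)))"
      using nn_integral_powr_max[OF p, of "t - q" ?R] qt R by (intro mult_left_mono) auto
    also have "\<dots> = ennreal (B * ?R powr (q - t))"
      using C(1) p qt by (subst ennreal_mult[symmetric]) (auto simp: B_def mult.assoc)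
    finally have "\<bar>\<integral>v. F v \<partial>beta_measure p (z + t)\<bar> \<le> B * ?R powr (q - t)"
      using B by (intro abs_integral_le_nn_integral[OF int]) auto
    moreover have "(\<lambda>k. \<rho> ^ k * gamma_ratio z t k * a k) sums (K * (\<integral>v. F v \<partial>beta_measure p (z + t)))"
    proof -
      have "\<rho> ^ k * gamma_ratio z t k * a k = K * (e k * Beta p (z + t + real k))" for k
        unfolding gamma_ratio_pochhammer[OF z t N] e_def K_def p_def by simp
      then show ?thesis
        using sums_mult[OF ser(2)[OF zt0], of K] by simp
    qed
    ultimately show ?thesis
      using K by (simp add: sums_iff abs_mult mult.assoc mult_left_mono)
  qed
  then show ?thesis
    using K B by (intro exI[of _ "K * B"]) auto
qed

subsection \<open>Integrals over the sphere\<close>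

lemma measurable_id_sphere: "(\<lambda>y. y) \<in> borel_measurable (sphere_measure :: (real^'n) measure)"
  by (rule measurable_sphere_continuous) (rule continuous_on_id)

text \<open>The power beyond n is estimated by |r x - y| \<ge> 1 - r. What remains is, up to one
  factor 1 - r, bounded by the Poisson kernel, which has mass 1.\<close>

lemma nn_integral_norm_powr_ge:
  fixes x :: "real^'n"
  assumes q: "real CARD('n) \<le> q" and x: "norm x = 1" and r: "0 \<le> r" "r < 1"
  shows "(\<integral>\<^sup>+y. ennreal (norm (r *\<^sub>R x - y) powr (- q)) \<partial>sphere_measure) \<le> ennreal ((1 - r) powr (real CARD('n) - 1 - q))"
proof -
  let ?n = "real CARD('n)"
  have nx: "norm (r *\<^sub>R x) = r" "norm (r *\<^sub>R x) < 1"
    using x r by auto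
  have pt: "norm (r *\<^sub>R x - y) powr (- q) \<le> (1 - r) powr (?n - 1 - q) * poisson (r *\<^sub>R x) y" if y: "norm y = 1" for y
  proof -
    let ?A = "norm (r *\<^sub>R x - y)"
    have A: "1 - r \<le> ?A" "0 < ?A"
      using norm_triangle_ineq2[of y "r *\<^sub>R x"] nx y r by (auto simp: norm_minus_commute)
    have e: "(?n - 1 - q) + 1 = ?n - q" by simp
    have "?A powr (- q) = ?A powr (?n - q) * ?A powr (- ?n)"
      using powr_add[of ?A "?n - q" "- ?n"] by simp
    also have "\<dots> \<le> (1 - r) powr (?n - q) * ?A powr (- ?n)"
      using A q r by (intro mult_right_mono powr_mono2') auto
    also have "(1 - r) powr (?n - q) = (1 - r) powr (?n - 1 - q) * (1 - r)"
      using r powr_add[of "1 - r" "?n - 1 - q" 1] unfolding e by simp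
    also have "(1 - r) powr (?n - 1 - q) * (1 - r) * ?A powr (- ?n) \<le> (1 - r) powr (?n - 1 - q) * ((1 - r\<^sup>2) * ?A powr (- ?n))"
      unfolding mult.assoc using r by (intro mult_left_mono mult_right_mono) (auto simp: power2_eq_square mult_left_le)
    also have "(1 - r\<^sup>2) * ?A powr (- ?n) = poisson (r *\<^sub>R x) y"
      unfolding poisson_eq nx ..
    finally show ?thesis .
  qed
  have "(\<integral>\<^sup>+y. ennreal (norm (r *\<^sub>R x - y) powr (- q)) \<partial>sphere_measure) \<le>
      (\<integral>\<^sup>+y. ennreal ((1 - r) powr (?n - 1 - q) * poisson (r *\<^sub>R x) y) \<partial>sphere_measure)"
    using pt by (intro nn_integral_mono ennreal_leI) auto
  also have "\<dots> = ennreal (\<integral>y. (1 - r) powr (?n - 1 - q) * poisson (r *\<^sub>R x) y \<partial>sphere_measure)"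
    using poisson_nonneg[OF nx(2)] continuous_on_poisson_sphere[OF nx(2)]
    by (intro nn_integral_eq_integral integrable_sphere_continuous continuous_on_mult continuous_on_const AE_I2) auto
  also have "\<dots> = ennreal ((1 - r) powr (?n - 1 - q))"
    using poisson_mass[OF nx(2)] by simp
  finally show ?thesis .
qed

text \<open>Below the critical exponent \<open>n\<close>, integrate the radial derivative of \<open>norm (r x - y) powr (- q)\<close>,
  which is a kernel of exponent \<open>q + 1\<close>.\<close>
lemma norm_powr_le_radial_integral:
  fixes x y :: "real^'n"
  assumes q: "q > 0" and x: "norm x = 1" and y: "norm y = 1" and r: "0 \<le> r" "r < 1"
  shows "ennreal (norm (r *\<^sub>R x - y) powr (- q)) \<le>
    1 + (\<integral>\<^sup>+u. ennreal (indicator {0..r} u * (q * norm (u *\<^sub>R x - y) powr (- q - 1))) \<partial>lborel)"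
proof -
  define \<xi> where "\<xi> = x \<bullet> y"
  have \<xi>: "\<bar>\<xi>\<bar> \<le> 1"
    using Cauchy_Schwarz_ineq2[of x y] x y by (simp add: \<xi>_def)
  have R: "norm (u *\<^sub>R x - y) = rad \<xi> u" for u
    unfolding \<xi>_def using rad_eq_norm[OF x y] by simp
  let ?g = "\<lambda>u. rad \<xi> u powr (- q)" and ?b = "\<lambda>u. q * rad \<xi> u powr (- q - 1)"
  have pos: "rad \<xi> u > 0" if "u \<in> {0..r}" for u
    using rad_pos[OF \<xi>, of u] that r by auto
  have cr: "continuous_on {0..r} (rad \<xi>)"
    unfolding rad_def[abs_def] by (intro continuous_intros)
  have cb: "continuous_on {0..r} ?b"
    using pos by (intro continuous_intros cr) force
  let ?g' = "\<lambda>u. - q * rad \<xi> u powr (- q - 1) * ((u - \<xi>) / rad \<xi> u)"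
  have cg: "continuous_on {0..r} ?g'"
    using pos by (intro continuous_intros cr) force+
  have "(?g' has_integral (?g r - ?g 0)) {0..r}"
  proof (rule fundamental_theorem_of_calculus[OF r(1)])
    fix u assume u: "u \<in> {0..r}"
    then have "\<bar>u\<bar> < 1"
      using r by auto
    from DERIV_fun_powr[OF rad_has_derivative[OF \<xi> this] pos[OF u], of "- q"]
    show "(?g has_vector_derivative ?g' u) (at u within {0..r})"
      by - (rule has_vector_derivative_at_within, simp add: has_real_derivative_iff_has_vector_derivative)
  qed
  moreover have bi: "(?b has_integral (integral {0..r} ?b)) {0..r}"
    using integrable_continuous_interval[OF cb] by (rule integrable_integral)
  ultimately have "?g r - ?g 0 \<le> integral {0..r} ?b"
  proof (rule has_integral_le)
    fix u assume u: "u \<in> {0..r}"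
    have "- ((u - \<xi>) / rad \<xi> u) \<le> 1"
      using abs_diff_le_rad[OF \<xi>, of u] pos[OF u] by (simp add: field_simps)
    then have "(q * rad \<xi> u powr (- q - 1)) * (- ((u - \<xi>) / rad \<xi> u)) \<le> (q * rad \<xi> u powr (- q - 1)) * 1"
      using q by (intro mult_left_mono) auto
    then show "?g' u \<le> ?b u" by simp
  qed
  moreover have "?g 0 = 1"
    by (simp add: rad_def)
  ultimately have "ennreal (?g r) \<le> ennreal (1 + integral {0..r} ?b)"
    by (intro ennreal_leI) simp
  also have "\<dots> = 1 + ennreal (integral {0..r} ?b)"
    using q has_integral_nonneg[OF bi] by (subst ennreal_plus) auto
  also have "ennreal (integral {0..r} ?b) = (\<integral>\<^sup>+u. ennreal (indicator {0..r} u * ?b u) \<partial>lborel)"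
    using nn_integral_has_integral_lebesgue[OF _ bi] q by simp
  finally show ?thesis
    unfolding R .
qed

text \<open>After Fubini the inner integral has exponent q + 1 \<ge> n and falls under
  \<open>nn_integral_norm_powr_ge\<close>; integrating the resulting power of 1 - u gains one order.
  This reaches the range n - 1 < q < n, in which a full Poisson kernel cannot be split off.\<close>

lemma nn_integral_norm_powr:
  fixes x :: "real^'n"
  assumes q: "real CARD('n) - 1 < q" and x: "norm x = 1" and r: "0 \<le> r" "r < 1"
  shows "(\<integral>\<^sup>+y. ennreal (norm (r *\<^sub>R x - y) powr (- q)) \<partial>sphere_measure) \<le>
    ennreal ((1 + q / (q - real CARD('n) + 1)) * (1 - r) powr (real CARD('n) - 1 - q))"
proof -
  let ?n = "real CARD('n)"
  \<comment> \<open>The rate of blow-up; the factor q / s in the constant comes from integrating q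
    (1 - u)^(- s - 1).\<close>
  define s where "s = q - ?n + 1"
  have s: "s > 0"
    using q by (simp add: s_def)
  have n: "?n \<ge> 1"
    by (simp add: Suc_leI)
  have q0: "q > 0"
    using q n by linarith
  interpret P: pair_sigma_finite "sphere_measure :: (real^'n) measure" "lborel :: real measure" ..
  note [measurable] = measurable_id_sphere
  have [measurable]: "(\<lambda>(y, u). ennreal (indicator {0..r} u * (q * norm (u *\<^sub>R x - y) powr (- q - 1))))
      \<in> borel_measurable ((sphere_measure :: (real^'n) measure) \<Otimes>\<^sub>M (lborel :: real measure))"
  proof -
    have [measurable]: "fst \<in> borel_measurable ((sphere_measure :: (real^'n) measure) \<Otimes>\<^sub>M (lborel :: real measure))"
      using measurable_compose[OF measurable_fst measurable_id_sphere] by simp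
    have [measurable]: "snd \<in> borel_measurable ((sphere_measure :: (real^'n) measure) \<Otimes>\<^sub>M (lborel :: real measure))"
      using measurable_snd[of "sphere_measure :: (real^'n) measure" "lborel :: real measure"] by simp
    show ?thesis
      unfolding case_prod_unfold by measurable
  qed
  have "(\<integral>\<^sup>+y. ennreal (norm (r *\<^sub>R x - y) powr (- q)) \<partial>sphere_measure) \<le>
    (\<integral>\<^sup>+y. 1 + (\<integral>\<^sup>+u. ennreal (indicator {0..r} u * (q * norm (u *\<^sub>R x - y) powr (- q - 1))) \<partial>lborel) \<partial>sphere_measure)"
    using norm_powr_le_radial_integral[OF q0 x _ r] by (intro nn_integral_mono) auto
  also have "\<dots> = 1 + (\<integral>\<^sup>+y. (\<integral>\<^sup>+u. ennreal (indicator {0..r} u * (q * norm (u *\<^sub>R x - y) powr (- q - 1))) \<partial>lborel) \<partial>sphere_measure)"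
    using sph.emeasure_space_1[where 'n='n]
    by (subst nn_integral_add) (auto intro: P.borel_measurable_nn_integral)
  also have "(\<integral>\<^sup>+y. (\<integral>\<^sup>+u. ennreal (indicator {0..r} u * (q * norm (u *\<^sub>R x - y) powr (- q - 1))) \<partial>lborel) \<partial>sphere_measure) =
      (\<integral>\<^sup>+u. (\<integral>\<^sup>+y. ennreal (indicator {0..r} u * (q * norm (u *\<^sub>R x - y) powr (- q - 1))) \<partial>sphere_measure) \<partial>lborel)"
    by (rule P.Fubini'[symmetric]) measurable
  also have "\<dots> \<le> (\<integral>\<^sup>+u. ennreal (indicator {0..r} u * (q * (1 - u) powr (- s - 1))) \<partial>lborel)"
  proof (intro nn_integral_mono)
    fix u :: real
    show "(\<integral>\<^sup>+y. ennreal (indicator {0..r} u * (q * norm (u *\<^sub>R x - y) powr (- q - 1))) \<partial>sphere_measure) \<le>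
        ennreal (indicator {0..r} u * (q * (1 - u) powr (- s - 1)))"
    proof (cases "u \<in> {0..r}")
      case True
      have [measurable]: "(\<lambda>y. norm (u *\<^sub>R x - y) powr (- q - 1)) \<in> borel_measurable sphere_measure"
        by measurable
      have "(\<integral>\<^sup>+y. ennreal (q * norm (u *\<^sub>R x - y) powr (- q - 1)) \<partial>sphere_measure) =
          ennreal q * (\<integral>\<^sup>+y. ennreal (norm (u *\<^sub>R x - y) powr (- (q + 1))) \<partial>sphere_measure)"
        using q0 by (subst nn_integral_cmult[symmetric]) (auto simp: ennreal_mult')
      also have "\<dots> \<le> ennreal q * ennreal ((1 - u) powr (?n - 1 - (q + 1)))"
        using True r q x by (intro mult_left_mono nn_integral_norm_powr_ge) auto
      also have "?n - 1 - (q + 1) = - s - 1"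
        by (simp add: s_def)
      finally show ?thesis
        using True q0 by (simp add: ennreal_mult')
    qed simp
  qed
  also have "\<dots> \<le> ennreal (q / s * ((1 - r) powr (- s) - 1))"
  proof -
    have "((\<lambda>u. q * (1 - u) powr (- s - 1)) has_integral (q / s * (1 - r) powr (- s) - q / s * (1 - 0) powr (- s))) {0..r}"
    proof (rule fundamental_theorem_of_calculus[OF r(1)])
      fix u assume "u \<in> {0..r}"
      then have "1 - u > 0"
        using r by auto
      then have "((\<lambda>u. q / s * (1 - u) powr (- s)) has_real_derivative q * (1 - u) powr (- s - 1)) (at u)"
        using s by (auto intro!: derivative_eq_intros)
      then show "((\<lambda>u. q / s * (1 - u) powr (- s)) has_vector_derivative q * (1 - u) powr (- s - 1)) (at u within {0..r})"
        by - (rule has_vector_derivative_at_within, simp add: has_real_derivative_iff_has_vector_derivative)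
    qed
    from nn_integral_has_integral_lebesgue[OF _ this] q0 show ?thesis
      by (simp add: right_diff_distrib)
  qed
  also have "1 + ennreal (q / s * ((1 - r) powr (- s) - 1)) \<le> ennreal ((1 + q / s) * (1 - r) powr (- s))"
  proof -
    have g: "1 \<le> (1 - r) powr (- s)"
      using powr_mono2'[of "- s" "1 - r" 1] r s by simp
    then have nn: "0 \<le> q / s * ((1 - r) powr (- s) - 1)"
      using q0 s by (intro mult_nonneg_nonneg) auto
    have "1 + ennreal (q / s * ((1 - r) powr (- s) - 1)) = ennreal (1 + q / s * ((1 - r) powr (- s) - 1))"
      using nn ennreal_plus[of 1 "q / s * ((1 - r) powr (- s) - 1)"] by simp
    also have "\<dots> \<le> ennreal ((1 + q / s) * (1 - r) powr (- s))"
    proof (rule ennreal_leI)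
      have "0 \<le> q / s"
        using q0 s by simp
      then show "1 + q / s * ((1 - r) powr (- s) - 1) \<le> (1 + q / s) * (1 - r) powr (- s)"
        using g unfolding right_diff_distrib distrib_right by linarith
    qed
    finally show ?thesis .
  qed
  finally show ?thesis
    by (simp add: s_def algebra_simps)
qed

subsection \<open>Minkowski's integral inequality\<close>

lemma young_powr:
  fixes a b s :: real
  assumes "0 \<le> a" "0 \<le> b" "1 \<le> s"
  shows "a * b powr (s - 1) \<le> a powr s / s + (1 - 1 / s) * b powr s"
proof (cases "s = 1")
  case True
  then show ?thesis
    using assms by simp
next
  case False
  then have s: "s > 1"
    using assms by simp
  have "a * b powr (s - 1) \<le> a powr s / s + (b powr (s - 1)) powr (s / (s - 1)) / (s / (s - 1))"
    using s assms by (intro Youngs_inequality) (auto simp: field_simps)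
  also have "(b powr (s - 1)) powr (s / (s - 1)) = b powr s"
    using s by (simp add: powr_powr)
  also have "b powr s / (s / (s - 1)) = (1 - 1 / s) * b powr s"
    using s by (simp add: field_simps)
  finally show ?thesis .
qed

text \<open>Young's inequality with weights tuned to \<open>\<kappa> w\<close> and \<open>W\<close>
  yields X \<le> W^s / s + (1 - 1/s) X, where X is the integral of G^s. Hypothesis
  \<open>fin\<close> is what permits moving the last term to the left.\<close>

theorem nn_integral_minkowski:
  fixes K :: "'a \<Rightarrow> 'b \<Rightarrow> real"
  assumes N: "sigma_finite_measure N" and M: "sigma_finite_measure M"
    and Km [measurable]: "(\<lambda>(x, w). K x w) \<in> borel_measurable (N \<Otimes>\<^sub>M M)"
    and [measurable]: "\<kappa> \<in> borel_measurable M" "G \<in> borel_measurable N"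
    and pos: "\<And>x w. 0 \<le> K x w" "\<And>w. w \<in> space M \<Longrightarrow> 0 \<le> \<kappa> w" "\<And>x. 0 \<le> G x"
    and K\<kappa>: "\<And>w. w \<in> space M \<Longrightarrow> (\<integral>\<^sup>+x. ennreal (K x w powr s) \<partial>N) \<le> ennreal (\<kappa> w powr s)"
    and GK: "\<And>x. x \<in> space N \<Longrightarrow> ennreal (G x) \<le> (\<integral>\<^sup>+w. ennreal (K x w) \<partial>M)"
    and fin: "(\<integral>\<^sup>+x. ennreal (G x powr s) \<partial>N) < \<infinity>"
    and s: "1 \<le> s" and W: "W > 0" and \<kappa>W: "(\<integral>\<^sup>+w. ennreal (\<kappa> w) \<partial>M) \<le> ennreal W"
  shows "(\<integral>\<^sup>+x. ennreal (G x powr s) \<partial>N) \<le> ennreal (W powr s)"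
proof -
  interpret N: sigma_finite_measure N by fact
  interpret M: sigma_finite_measure M by fact
  interpret P: pair_sigma_finite N M ..
  obtain X where X: "X \<ge> 0" "(\<integral>\<^sup>+x. ennreal (G x powr s) \<partial>N) = ennreal X"
    using fin by (cases "\<integral>\<^sup>+x. ennreal (G x powr s) \<partial>N") auto
  \<comment> \<open>After Young's inequality the inner integral is at most
    \<open>\<kappa> w * Q\<close>; integrating in w then replaces \<open>\<kappa> w\<close> by
    \<open>W\<close>.\<close>
  define Q where "Q = W powr (s - 1) / s + (1 - 1 / s) * (X / W)"
  have Q: "Q \<ge> 0"
    using s W X by (simp add: Q_def)
  have inner: "(\<integral>\<^sup>+x. ennreal (K x w * G x powr (s - 1)) \<partial>N) \<le> ennreal (\<kappa> w * Q)" if w: "w \<in> space M" for w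
  \<comment> \<open>The weights of the main case divide by \<open>\<kappa> w\<close>; if it is 0,
    then \<open>K x w\<close> vanishes for almost every x.\<close>
  proof (cases "\<kappa> w = 0")
    case True
    have [measurable]: "(\<lambda>x. K x w) \<in> borel_measurable N"
      using measurable_Pair1[OF Km w] by simp
    have "(\<integral>\<^sup>+x. ennreal (K x w powr s) \<partial>N) = 0"
      using K\<kappa>[OF w] True by simp
    then have "AE x in N. ennreal (K x w powr s) = 0"
      by (subst (asm) nn_integral_0_iff_AE) auto
    then have "AE x in N. ennreal (K x w * G x powr (s - 1)) = 0"
      by eventually_elim (use pos(1)[of _ w] in auto)
    then have "(\<integral>\<^sup>+x. ennreal (K x w * G x powr (s - 1)) \<partial>N) = 0"
      by (subst nn_integral_0_iff_AE) auto
    then show ?thesis by simp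
  next
    case False
    then have c: "\<kappa> w > 0"
      using pos(2)[OF w] by simp
    have [measurable]: "(\<lambda>x. K x w) \<in> borel_measurable N"
      using measurable_Pair1[OF Km w] by simp
    define a where "a = \<kappa> w powr (1 - s) * W powr (s - 1) / s"
    define b where "b = (1 - 1 / s) * (\<kappa> w / W)"
    have ab: "a \<ge> 0" "b \<ge> 0"
      using s c W by (auto simp: a_def b_def)
    have "K x w * G x powr (s - 1) \<le> a * K x w powr s + b * G x powr s" for x
    proof -
      have "(K x w / \<kappa> w) * (G x / W) powr (s - 1) \<le> (K x w / \<kappa> w) powr s / s + (1 - 1 / s) * (G x / W) powr s"
        using pos c W s by (intro young_powr) auto
      then have "(\<kappa> w * W powr (s - 1)) * ((K x w / \<kappa> w) * (G x / W) powr (s - 1)) \<le>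
          (\<kappa> w * W powr (s - 1)) * ((K x w / \<kappa> w) powr s / s + (1 - 1 / s) * (G x / W) powr s)"
        using c by (intro mult_left_mono) auto
      also have "(\<kappa> w * W powr (s - 1)) * ((K x w / \<kappa> w) * (G x / W) powr (s - 1)) = K x w * G x powr (s - 1)"
        using c W by (simp add: powr_divide)
      also have "(\<kappa> w * W powr (s - 1)) * ((K x w / \<kappa> w) powr s / s + (1 - 1 / s) * (G x / W) powr s) =
          a * K x w powr s + b * G x powr s"
      proof -
        have e1: "\<kappa> w * (K x w / \<kappa> w) powr s = \<kappa> w powr (1 - s) * K x w powr s"
          using c powr_diff[of "\<kappa> w" 1 s] by (simp add: powr_divide)
        have e2: "W powr (s - 1) * (G x / W) powr s = G x powr s / W"
          using W powr_diff[of W s 1] by (simp add: powr_divide)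
        have "(\<kappa> w * W powr (s - 1)) * ((K x w / \<kappa> w) powr s / s + (1 - 1 / s) * (G x / W) powr s) =
            (\<kappa> w * (K x w / \<kappa> w) powr s) * W powr (s - 1) / s + (1 - 1 / s) * \<kappa> w * (W powr (s - 1) * (G x / W) powr s)"
          by (simp add: distrib_left mult_ac)
        then show ?thesis
          unfolding e1 e2 by (simp add: a_def b_def mult_ac)
      qed
      finally show ?thesis .
    qed
    then have "(\<integral>\<^sup>+x. ennreal (K x w * G x powr (s - 1)) \<partial>N) \<le>
        (\<integral>\<^sup>+x. ennreal a * ennreal (K x w powr s) + ennreal b * ennreal (G x powr s) \<partial>N)"
      using ab by (intro nn_integral_mono) (simp flip: ennreal_mult ennreal_plus)
    also have "\<dots> = ennreal a * (\<integral>\<^sup>+x. ennreal (K x w powr s) \<partial>N) + ennreal b * ennreal X"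
    proof -
      have "(\<integral>\<^sup>+x. ennreal a * ennreal (K x w powr s) + ennreal b * ennreal (G x powr s) \<partial>N) =
          (\<integral>\<^sup>+x. ennreal a * ennreal (K x w powr s) \<partial>N) + (\<integral>\<^sup>+x. ennreal b * ennreal (G x powr s) \<partial>N)"
        by (rule nn_integral_add) measurable
      moreover have "(\<integral>\<^sup>+x. ennreal a * ennreal (K x w powr s) \<partial>N) = ennreal a * (\<integral>\<^sup>+x. ennreal (K x w powr s) \<partial>N)"
        by (rule nn_integral_cmult) measurable
      moreover have "(\<integral>\<^sup>+x. ennreal b * ennreal (G x powr s) \<partial>N) = ennreal b * (\<integral>\<^sup>+x. ennreal (G x powr s) \<partial>N)"
        by (rule nn_integral_cmult) measurable
      ultimately show ?thesis
        by (simp only: X(2))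
    qed
    also have "\<dots> \<le> ennreal a * ennreal (\<kappa> w powr s) + ennreal b * ennreal X"
      by (intro add_right_mono mult_left_mono K\<kappa> w) auto
    also have "\<dots> = ennreal (a * \<kappa> w powr s + b * X)"
      using ab X by (simp flip: ennreal_mult ennreal_plus)
    also have "a * \<kappa> w powr s + b * X = \<kappa> w * Q"
    proof -
      have "\<kappa> w powr s * \<kappa> w powr (1 - s) = \<kappa> w"
        using c powr_add[of "\<kappa> w" s "1 - s"] by simp
      then have "a * \<kappa> w powr s = \<kappa> w * W powr (s - 1) / s"
        unfolding a_def by (metis mult.commute mult.left_commute times_divide_eq_left)
      then show ?thesis
        by (simp add: Q_def b_def distrib_left mult_ac)
    qed
    finally show ?thesis .
  qed
  have "ennreal X = (\<integral>\<^sup>+x. ennreal (G x) * ennreal (G x powr (s - 1)) \<partial>N)"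
  proof -
    have "G x powr s = G x * G x powr (s - 1)" for x
      using powr_mult_base[OF pos(3), of x "s - 1"] by simp
    then show ?thesis
      using pos(3) by (simp add: X(2)[symmetric] ennreal_mult')
  qed
  also have "\<dots> \<le> (\<integral>\<^sup>+x. (\<integral>\<^sup>+w. ennreal (K x w) \<partial>M) * ennreal (G x powr (s - 1)) \<partial>N)"
    by (intro nn_integral_mono mult_right_mono GK) auto
  also have "\<dots> = (\<integral>\<^sup>+x. (\<integral>\<^sup>+w. ennreal (K x w * G x powr (s - 1)) \<partial>M) \<partial>N)"
    using pos(1) measurable_Pair2[OF Km] by (intro nn_integral_cong) (simp add: nn_integral_multc ennreal_mult')
  also have "\<dots> = (\<integral>\<^sup>+w. (\<integral>\<^sup>+x. ennreal (K x w * G x powr (s - 1)) \<partial>N) \<partial>M)"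
    by (rule P.Fubini'[symmetric]) measurable
  also have "\<dots> \<le> (\<integral>\<^sup>+w. ennreal Q * ennreal (\<kappa> w) \<partial>M)"
    using inner Q by (intro nn_integral_mono) (simp add: mult.commute flip: ennreal_mult')
  also have "\<dots> = ennreal Q * (\<integral>\<^sup>+w. ennreal (\<kappa> w) \<partial>M)"
    by (rule nn_integral_cmult) measurable
  also have "\<dots> \<le> ennreal Q * ennreal W"
    by (intro mult_left_mono \<kappa>W) auto
  finally have "ennreal X \<le> ennreal (Q * W)"
    using Q by (simp add: ennreal_mult')
  then have "X \<le> Q * W"
    using Q W by (subst (asm) ennreal_le_iff) auto
  also have "Q * W = W powr s / s + (1 - 1 / s) * X"
  proof -
    have "W powr (s - 1) * W = W powr s"
      using W powr_add[of W "s - 1" 1] by simp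
    then show ?thesis
      using W by (simp add: Q_def distrib_right)
  qed
  finally have "X / s \<le> W powr s / s"
    by (simp add: left_diff_distrib)
  then have "X \<le> W powr s"
    using s by (simp add: divide_le_cancel)
  then show ?thesis
    unfolding X(2) by (rule ennreal_leI)
qed

subsection \<open>The norms\<close>

lemma Lnorm_ennreal_le_iff:
  assumes p: "0 < p" and W: "0 \<le> W"
  shows "Lnorm (ennreal p) F \<le> ennreal W \<longleftrightarrow> (\<integral>\<^sup>+x. ennreal (\<bar>F x\<bar> powr p) \<partial>sphere_measure) \<le> ennreal (W powr p)"
proof (cases "\<integral>\<^sup>+x. ennreal (\<bar>F x\<bar> powr p) \<partial>sphere_measure")
  case (real i)
  have "i powr (1 / p) \<le> W \<longleftrightarrow> i \<le> W powr p"
  proof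
    assume "i powr (1 / p) \<le> W"
    then have "(i powr (1 / p)) powr p \<le> W powr p"
      using p by (intro powr_mono2) auto
    then show "i \<le> W powr p"
      using p real by (simp add: powr_powr)
  next
    assume "i \<le> W powr p"
    then have "i powr (1 / p) \<le> (W powr p) powr (1 / p)"
      using p real by (intro powr_mono2) auto
    then show "i powr (1 / p) \<le> W"
      using p W by (simp add: powr_powr)
  qed
  then show ?thesis
    using p W real by (simp add: Lnorm_def Let_def)
next
  case top
  then show ?thesis
    using p by (simp add: Lnorm_def Let_def top_unique)
qed

lemma Lnorm_top_le_iff:
  assumes "0 \<le> W"
  shows "Lnorm top F \<le> ennreal W \<longleftrightarrow> (\<forall>x. norm x = 1 \<longrightarrow> \<bar>F x\<bar> \<le> W)"
  using assms by (auto simp: Lnorm_def SUP_le_iff)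

lemma exponent_cases:
  assumes "(1::ennreal) \<le> s"
  obtains "s = top" | p where "s = ennreal p" "1 \<le> p"
  using assms by (cases s) (auto simp flip: ennreal_1)

lemma Lnorm_cong: "(\<And>x. norm x = 1 \<Longrightarrow> F x = G x) \<Longrightarrow> Lnorm s F = Lnorm s G"
proof -
  assume eq: "\<And>x. norm x = 1 \<Longrightarrow> F x = G x"
  then have "(\<integral>\<^sup>+x. ennreal (\<bar>F x\<bar> powr enn2real s) \<partial>sphere_measure) = (\<integral>\<^sup>+x. ennreal (\<bar>G x\<bar> powr enn2real s) \<partial>sphere_measure)"
    by (intro nn_integral_cong) simp
  moreover have "(SUP x\<in>sphere 0 1. ennreal \<bar>F x\<bar>) = (SUP x\<in>sphere 0 1. ennreal \<bar>G x\<bar>)"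
    using eq by (intro SUP_cong) auto
  ultimately show ?thesis
    by (simp add: Lnorm_def)
qed

lemma Lnorm_le_bound:
  fixes F :: "real^'n \<Rightarrow> real"
  assumes s: "s = top \<or> (\<exists>p>0. s = ennreal p)" and B: "0 \<le> B" "\<And>x. norm x = 1 \<Longrightarrow> \<bar>F x\<bar> \<le> B"
  shows "Lnorm s F \<le> ennreal B"
  using s
proof (elim disjE exE conjE)
  assume "s = top"
  then show ?thesis
    using B by (simp add: Lnorm_top_le_iff)
next
  fix p :: real assume p: "p > 0" "s = ennreal p"
  have "(\<integral>\<^sup>+x. ennreal (\<bar>F x\<bar> powr p) \<partial>sphere_measure) \<le> (\<integral>\<^sup>+x. ennreal (B powr p) \<partial>(sphere_measure :: (real^'n) measure))"
    using B p by (intro nn_integral_mono ennreal_leI powr_mono2) auto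
  also have "\<dots> = ennreal (B powr p)"
    using sph.emeasure_space_1[where 'n='n] by simp
  finally show ?thesis
    using p B by (simp add: Lnorm_ennreal_le_iff)
qed

lemma measurable_abs_powr_sphere:
  fixes F :: "real^'n \<Rightarrow> real"
  assumes "continuous_on (sphere 0 1) F"
  shows "(\<lambda>x. ennreal (\<bar>F x\<bar> powr p)) \<in> borel_measurable sphere_measure"
  using measurable_sphere_continuous[OF assms] by measurable

lemma Lnorm_cmult_le:
  fixes F :: "real^'n \<Rightarrow> real"
  assumes s: "s = top \<or> (\<exists>p>0. s = ennreal p)" and F: "continuous_on (sphere 0 1) F"
    and B: "0 \<le> B" "Lnorm s F \<le> ennreal B"
  shows "Lnorm s (\<lambda>x. c * F x) \<le> ennreal (\<bar>c\<bar> * B)"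
  using s
proof (elim disjE exE conjE)
  assume "s = top"
  then show ?thesis
    using B by (auto simp: Lnorm_top_le_iff abs_mult mult_left_mono)
next
  fix p :: real assume p: "p > 0" "s = ennreal p"
  have "(\<integral>\<^sup>+x. ennreal (\<bar>c * F x\<bar> powr p) \<partial>sphere_measure) =
      (\<integral>\<^sup>+x. ennreal (\<bar>c\<bar> powr p) * ennreal (\<bar>F x\<bar> powr p) \<partial>sphere_measure)"
    by (simp add: abs_mult powr_mult ennreal_mult)
  also have "\<dots> = ennreal (\<bar>c\<bar> powr p) * (\<integral>\<^sup>+x. ennreal (\<bar>F x\<bar> powr p) \<partial>sphere_measure)"
    by (rule nn_integral_cmult[OF measurable_abs_powr_sphere[OF F]])
  also have "\<dots> \<le> ennreal (\<bar>c\<bar> powr p) * ennreal (B powr p)"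
    using B p by (intro mult_left_mono) (auto simp: Lnorm_ennreal_le_iff)
  also have "\<dots> = ennreal ((\<bar>c\<bar> * B) powr p)"
    using B by (simp add: powr_mult ennreal_mult)
  finally show ?thesis
    using p B by (simp add: Lnorm_ennreal_le_iff)
qed

text \<open>The form used both for the Beta average (\<open>convolution_norm_bound\<close>) and for
  series (\<open>nrm_series_le\<close>), with s = \<infinity> included. Continuity of G provides the
  finiteness that \<open>nn_integral_minkowski\<close> asks for.\<close>

theorem Lnorm_integral_le:
  fixes K :: "real^'n \<Rightarrow> 'b \<Rightarrow> real"
  assumes s: "1 \<le> s" and M: "sigma_finite_measure M"
    and Km [measurable]: "(\<lambda>(x, w). K x w) \<in> borel_measurable (sphere_measure \<Otimes>\<^sub>M M)"
    and \<kappa>m [measurable]: "\<kappa> \<in> borel_measurable M" and G: "continuous_on (sphere 0 1) G"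
    and \<kappa>: "\<And>w. w \<in> space M \<Longrightarrow> 0 \<le> \<kappa> w"
      "\<And>w. w \<in> space M \<Longrightarrow> Lnorm s (\<lambda>x. K x w) \<le> ennreal (\<kappa> w)"
    and GK: "\<And>x. norm x = 1 \<Longrightarrow> ennreal \<bar>G x\<bar> \<le> (\<integral>\<^sup>+w. ennreal \<bar>K x w\<bar> \<partial>M)"
    and W: "0 \<le> W" "(\<integral>\<^sup>+w. ennreal (\<kappa> w) \<partial>M) \<le> ennreal W"
  shows "Lnorm s G \<le> ennreal W"
  using s
proof (cases s rule: exponent_cases)
  case 1
  have "\<bar>G x\<bar> \<le> W" if x: "norm x = 1" for x
  proof -
    have "ennreal \<bar>G x\<bar> \<le> (\<integral>\<^sup>+w. ennreal \<bar>K x w\<bar> \<partial>M)"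
      by (rule GK[OF x])
    also have "\<dots> \<le> (\<integral>\<^sup>+w. ennreal (\<kappa> w) \<partial>M)"
      using \<kappa> x unfolding 1 by (intro nn_integral_mono) (auto simp: Lnorm_top_le_iff)
    also have "\<dots> \<le> ennreal W"
      by (rule W)
    finally show ?thesis
      using W by simp
  qed
  then show ?thesis
    unfolding 1 using W by (simp add: Lnorm_top_le_iff)
next
  case (2 p)
  have [measurable]: "G \<in> borel_measurable sphere_measure"
    by (rule measurable_sphere_continuous[OF G])
  have cp: "continuous_on (sphere 0 1) (\<lambda>x. \<bar>G x\<bar> powr p)"
    using 2 G by (intro continuous_on_powr' continuous_intros) auto
  \<comment> \<open>\<open>nn_integral_minkowski\<close> asks for a positive bound, so W is enlarged
    by e, which finally tends to 0.\<close>
  have "Lnorm s G \<le> ennreal (W + e)" if e: "e > 0" for e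
  proof -
    have "(\<integral>\<^sup>+x. ennreal (\<bar>G x\<bar> powr p) \<partial>sphere_measure) \<le> ennreal ((W + e) powr p)"
    proof (rule nn_integral_minkowski[OF _ M, where K = "\<lambda>x w. \<bar>K x w\<bar>" and \<kappa> = \<kappa>])
      show "sigma_finite_measure (sphere_measure :: (real^'n) measure)"
        by (rule sph.sigma_finite_measure_axioms)
      show "(\<integral>\<^sup>+x. ennreal (\<bar>K x w\<bar> powr p) \<partial>sphere_measure) \<le> ennreal (\<kappa> w powr p)" if "w \<in> space M" for w
        using \<kappa>[OF that] 2 by (simp add: Lnorm_ennreal_le_iff)
      show "(\<integral>\<^sup>+x. ennreal (\<bar>G x\<bar> powr p) \<partial>sphere_measure) < \<infinity>"
        using integrable_sphere_continuous[OF cp] by (subst nn_integral_eq_integral) auto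
      show "(\<integral>\<^sup>+w. ennreal (\<kappa> w) \<partial>M) \<le> ennreal (W + e)"
        using W(2) by (rule order_trans) (use e in \<open>auto intro: ennreal_leI\<close>)
      show "(\<lambda>(x, w). \<bar>K x w\<bar>) \<in> borel_measurable (sphere_measure \<Otimes>\<^sub>M M)"
        using borel_measurable_abs[OF Km] by (simp add: case_prod_unfold)
    qed (use \<kappa> GK 2 W e in auto)
    then show ?thesis
      unfolding 2(1) using 2(2) W(1) e by (subst Lnorm_ennreal_le_iff) auto
  qed
  then have "Lnorm s G \<le> ennreal W + ennreal e" if "e > 0" for e
    using that W(1) by (simp add: ennreal_plus)
  then show ?thesis
    by (rule ennreal_le_epsilon)
qed

lemma Hspace_iff:
  "f \<in> Hspace p \<alpha> \<longleftrightarrow> harmonic_on (ball 0 1) f \<and>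
    (\<exists>C\<ge>0. \<forall>r. 0 \<le> r \<longrightarrow> r < 1 \<longrightarrow> Mfun p f r \<le> ennreal (C * (1 - r) powr (- \<alpha>)))"
proof -
  have key: "m * ennreal (a powr \<alpha>) \<le> ennreal C \<longleftrightarrow> m \<le> ennreal (C * a powr (- \<alpha>))"
    if "a > 0" "C \<ge> 0" for m a C
  proof (cases m)
    case (real u)
    have "u * a powr \<alpha> \<le> C \<longleftrightarrow> u \<le> C * a powr (- \<alpha>)"
      using that by (simp add: powr_minus field_simps)
    then show ?thesis
      using real that by (simp flip: ennreal_mult)
  qed (use that in \<open>auto simp: ennreal_top_mult top_unique\<close>)
  have "(SUP r\<in>{0..<1}. Mfun p f r * ennreal ((1 - r) powr \<alpha>)) < \<infinity> \<longleftrightarrow>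
      (\<exists>C\<ge>0. \<forall>r. 0 \<le> r \<longrightarrow> r < 1 \<longrightarrow> Mfun p f r \<le> ennreal (C * (1 - r) powr (- \<alpha>)))"
  proof
    assume "(SUP r\<in>{0..<1}. Mfun p f r * ennreal ((1 - r) powr \<alpha>)) < \<infinity>"
    then obtain C where C: "C \<ge> 0" "(SUP r\<in>{0..<1}. Mfun p f r * ennreal ((1 - r) powr \<alpha>)) = ennreal C"
      by (cases "SUP r\<in>{0..<1}. Mfun p f r * ennreal ((1 - r) powr \<alpha>)") auto
    have "Mfun p f r \<le> ennreal (C * (1 - r) powr (- \<alpha>))" if "0 \<le> r" "r < 1" for r
    proof -
      have "Mfun p f r * ennreal ((1 - r) powr \<alpha>) \<le> ennreal C"
        unfolding C(2)[symmetric] using that by (intro SUP_upper) auto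
      then show ?thesis
        using key[of "1 - r" C "Mfun p f r"] that C by simp
    qed
    then show "\<exists>C\<ge>0. \<forall>r. 0 \<le> r \<longrightarrow> r < 1 \<longrightarrow> Mfun p f r \<le> ennreal (C * (1 - r) powr (- \<alpha>))"
      using C(1) by blast
  next
    assume "\<exists>C\<ge>0. \<forall>r. 0 \<le> r \<longrightarrow> r < 1 \<longrightarrow> Mfun p f r \<le> ennreal (C * (1 - r) powr (- \<alpha>))"
    then obtain C where C: "C \<ge> 0" "\<And>r. 0 \<le> r \<Longrightarrow> r < 1 \<Longrightarrow> Mfun p f r \<le> ennreal (C * (1 - r) powr (- \<alpha>))"
      by blast
    have "(SUP r\<in>{0..<1}. Mfun p f r * ennreal ((1 - r) powr \<alpha>)) \<le> ennreal C"
      using C key by (intro SUP_least) auto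
    then show "(SUP r\<in>{0..<1}. Mfun p f r * ennreal ((1 - r) powr \<alpha>)) < \<infinity>"
      by (rule le_less_trans) simp
  qed
  then show ?thesis
    by (simp add: Hspace_def)
qed

subsection \<open>Embedding \<open>H\<^sup>t\<close> into a weighted \<open>H\<^sup>1\<close> for \<open>t \<le> 1\<close>\<close>

lemma poisson_pointwise_bound:
  fixes f :: "real^'n \<Rightarrow> real"
  assumes harm: "harmonic_on (ball 0 1) f" and r: "0 \<le> r" "r < R" "R < 1" and y: "norm y = 1"
  shows "\<bar>f (r *\<^sub>R y)\<bar> \<le> 2 * (R - r) powr (1 - real CARD('n)) * (\<integral>z. \<bar>f (R *\<^sub>R z)\<bar> \<partial>sphere_measure)"
proof -
  let ?n = "real CARD('n)"
  have cf: "continuous_on (ball 0 1) f"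
    by (rule harmonic_on_imp_continuous_on[OF harm])
  have in1: "R *\<^sub>R z \<in> ball 0 1" if "norm z \<le> 1" for z :: "real^'n"
  proof -
    have "R * norm z \<le> R * 1"
      using that r by (intro mult_left_mono) auto
    then have "R * norm z < 1"
      using r by linarith
    then show ?thesis
      using r by simp
  qed
  have cR: "continuous_on (cball 0 1) (\<lambda>z. f (R *\<^sub>R z))"
    by (rule continuous_on_compose2[OF cf, where f = "\<lambda>z. R *\<^sub>R z"]) (auto intro!: continuous_intros in1[simplified])
  then have cs: "continuous_on (sphere 0 1) (\<lambda>z. f (R *\<^sub>R z))"
    by (rule continuous_on_subset) auto
  have hR: "harmonic_on (ball 0 1) (\<lambda>z. f (R *\<^sub>R z))"
    by (rule harmonic_on_scaleR[OF harm open_ball]) (use in1 in auto)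
  let ?x = "(r / R) *\<^sub>R y"
  have nx: "norm ?x = r / R" "norm ?x < 1"
    using r y by auto
  note cP = continuous_on_poisson_sphere[OF nx(2)]
  have "f (r *\<^sub>R y) = f (R *\<^sub>R ?x)"
    using r by simp
  also have "\<dots> = (\<integral>z. poisson ?x z * f (R *\<^sub>R z) \<partial>sphere_measure)"
    by (rule poisson_formula[OF hR cR nx(2)])
  finally have "\<bar>f (r *\<^sub>R y)\<bar> \<le> (\<integral>z. \<bar>poisson ?x z * f (R *\<^sub>R z)\<bar> \<partial>sphere_measure)"
    by (simp only: integral_abs_bound)
  also have "\<dots> \<le> (\<integral>z. (2 * (R - r) powr (1 - ?n)) * \<bar>f (R *\<^sub>R z)\<bar> \<partial>sphere_measure)"
  proof (rule integral_mono)
    show "integrable sphere_measure (\<lambda>z. \<bar>poisson ?x z * f (R *\<^sub>R z)\<bar>)"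
      by (rule integrable_sphere_continuous[OF continuous_on_rabs[OF continuous_on_mult[OF cP cs]]])
    show "integrable sphere_measure (\<lambda>z. (2 * (R - r) powr (1 - ?n)) * \<bar>f (R *\<^sub>R z)\<bar>)"
      by (rule integrable_sphere_continuous[OF continuous_on_mult[OF continuous_on_const continuous_on_rabs[OF cs]]])
    fix z :: "real^'n" assume "z \<in> space sphere_measure"
    then have z: "norm z = 1" by simp
    have "R - r \<le> 1 - r / R"
    proof -
      have "(R - r) * R \<le> (R - r) * 1"
        using r by (intro mult_left_mono) auto
      then show ?thesis
        using r by (simp add: field_simps)
    qed
    then have "(1 - r / R) powr (1 - ?n) \<le> (R - r) powr (1 - ?n)"
      using r by (intro powr_mono2') (auto simp: Suc_leI)
    then have "poisson ?x z \<le> 2 * (R - r) powr (1 - ?n)"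
      using poisson_le[OF nx(2) z] unfolding nx(1) by linarith
    then show "\<bar>poisson ?x z * f (R *\<^sub>R z)\<bar> \<le> (2 * (R - r) powr (1 - ?n)) * \<bar>f (R *\<^sub>R z)\<bar>"
      unfolding abs_mult using poisson_nonneg[OF nx(2), of z] by (intro mult_right_mono) auto
  qed
  finally show ?thesis
    by simp
qed

text \<open>Hardy and Littlewood: inserting \<open>|f| = |f|\<^sup>1\<^sup>-\<^sup>t |f|\<^sup>t\<close> in the Poisson bound gives \<open>S \<le> K S\<^sup>1\<^sup>-\<^sup>t\<close> for the
  weighted supremum \<open>S\<close> of a dilate of \<open>f\<close>, which is finite.\<close>
lemma hardy_littlewood_pointwise:
  fixes f :: "real^'n \<Rightarrow> real"
  assumes harm: "harmonic_on (ball 0 1) f" and t: "0 < t" "t \<le> 1" and \<alpha>: "\<alpha> \<ge> 0" and B: "B \<ge> 0"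
    and bd: "\<And>r. 0 \<le> r \<Longrightarrow> r < 1 \<Longrightarrow> (\<integral>y. \<bar>f (r *\<^sub>R y)\<bar> powr t \<partial>sphere_measure) \<le> B * (1 - r) powr (- \<alpha> * t)"
  shows "\<exists>C\<ge>0. \<forall>x. norm x < 1 \<longrightarrow> \<bar>f x\<bar> \<le> C * (1 - norm x) powr (- ((real CARD('n) - 1) / t + \<alpha>))"
proof -
  let ?n = "real CARD('n)"
  \<comment> \<open>The fixed point of \<gamma> = (n - 1) + \<gamma> (1 - t) + \<alpha> t, the
    balance of exponents in one step of the estimate.\<close>
  define \<gamma> where "\<gamma> = (?n - 1) / t + \<alpha>"
  have n: "?n \<ge> 1"
    by (simp add: Suc_leI)
  have \<gamma>: "\<gamma> \<ge> 0"
    using n t \<alpha> by (simp add: \<gamma>_def)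
  define K where "K = 2 * B * 2 powr \<gamma>"
  have K: "K \<ge> 0"
    using B by (simp add: K_def)
  have cf: "continuous_on (ball 0 1) f"
    by (rule harmonic_on_imp_continuous_on[OF harm])
  have dil: "(1 - r) powr \<gamma> * \<bar>f ((\<delta> * r) *\<^sub>R y)\<bar> \<le> K powr (1 / t)"
    if \<delta>: "0 < \<delta>" "\<delta> < 1" and r: "0 \<le> r" "r < 1" and y: "norm y = 1" for \<delta> r y
  proof -
    define w where "w = (\<lambda>(r, y). (1 - r) powr \<gamma> * \<bar>f ((\<delta> * r) *\<^sub>R y)\<bar>)"
    define D where "D = {0..<1::real} \<times> sphere (0::real^'n) 1"
    define S where "S = (SUP p\<in>D. w p)"
    have "bounded (f ` cball 0 \<delta>)"
      using \<delta> by (intro compact_imp_bounded compact_continuous_image continuous_on_subset[OF cf]) auto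
    then obtain M where "\<forall>x\<in>cball 0 \<delta>. \<bar>f x\<bar> \<le> M"
      by (auto simp: bounded_iff)
    then have M: "\<bar>f x\<bar> \<le> M" if "norm x \<le> \<delta>" for x
      using that by simp
    have wM: "w (r, y) \<le> M" if "0 \<le> r" "r < 1" "norm y = 1" for r y
    proof -
      have "\<bar>f ((\<delta> * r) *\<^sub>R y)\<bar> \<le> M"
        using that \<delta> by (intro M) (simp add: abs_mult mult_left_le)
      moreover have "(1 - r) powr \<gamma> \<le> 1"
        using that \<gamma> by (intro powr_le1) auto
      ultimately have "(1 - r) powr \<gamma> * \<bar>f ((\<delta> * r) *\<^sub>R y)\<bar> \<le> 1 * M"
        by (intro mult_mono) auto
      then show ?thesis
        by (simp add: w_def)
    qed
    have bdd: "bdd_above (w ` D)"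
      using wM by (intro bdd_aboveI2[of _ _ M]) (auto simp: D_def)
    have ne: "D \<noteq> {}"
      using y r by (auto simp: D_def)
    have wS: "w (r, y) \<le> S" if "0 \<le> r" "r < 1" "norm y = 1" for r y
      unfolding S_def using that by (intro cSUP_upper[OF _ bdd]) (auto simp: D_def)
    have step: "w (r, y) \<le> K * S powr (1 - t)" if r: "0 \<le> r" "r < 1" and y: "norm y = 1" for r y
    proof -
      define R where "R = (1 + r) / 2"
      have R: "0 \<le> R" "R < 1" "r < R" "1 - R = (1 - r) / 2" "R - r = (1 - r) / 2"
        using r by (auto simp: R_def field_simps)
      have \<delta>R: "0 \<le> \<delta> * R" "\<delta> * R < 1" "\<delta> * R \<le> R"
        using \<delta> R mult_strict_mono[of \<delta> 1 R 1] by (auto simp: mult_left_le_one_le)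
      let ?q = "(1 - r) / 2"
      have q: "?q > 0"
        using r by simp
      have in1: "\<delta> *\<^sub>R z \<in> ball 0 1" if "norm z < 1" for z :: "real^'n"
        using that \<delta> mult_strict_mono[of \<delta> 1 "norm z" 1] by simp
      have h\<delta>: "harmonic_on (ball 0 1) (\<lambda>z. f (\<delta> *\<^sub>R z))"
        by (rule harmonic_on_scaleR[OF harm open_ball]) (use in1 in auto)
      have cs: "continuous_on (sphere 0 1) (\<lambda>z. f ((\<delta> * R) *\<^sub>R z))"
        using \<delta>R by (intro continuous_on_compose2[OF cf, where f = "\<lambda>z. (\<delta> * R) *\<^sub>R z"] continuous_intros) auto
      have cst: "continuous_on (sphere 0 1) (\<lambda>z. \<bar>f ((\<delta> * R) *\<^sub>R z)\<bar> powr t)"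
        using t by (intro continuous_on_powr' continuous_on_rabs[OF cs] continuous_intros) auto
      have S0: "S \<ge> 0"
        using wS[OF r y] by (rule order_trans[rotated]) (simp add: w_def)
      have pt: "\<bar>f ((\<delta> * R) *\<^sub>R z)\<bar> \<le> (S * ?q powr (- \<gamma>)) powr (1 - t) * \<bar>f ((\<delta> * R) *\<^sub>R z)\<bar> powr t" if z: "norm z = 1" for z
      proof (cases "f ((\<delta> * R) *\<^sub>R z) = 0")
        case False
        have "?q powr \<gamma> * \<bar>f ((\<delta> * R) *\<^sub>R z)\<bar> \<le> S"
          using wS[OF R(1,2) z] by (simp add: w_def R)
        then have "\<bar>f ((\<delta> * R) *\<^sub>R z)\<bar> \<le> S * ?q powr (- \<gamma>)"
          using q by (simp add: powr_minus field_simps)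
        then have "\<bar>f ((\<delta> * R) *\<^sub>R z)\<bar> powr (1 - t) \<le> (S * ?q powr (- \<gamma>)) powr (1 - t)"
          using t by (intro powr_mono2) auto
        then have "\<bar>f ((\<delta> * R) *\<^sub>R z)\<bar> powr (1 - t) * \<bar>f ((\<delta> * R) *\<^sub>R z)\<bar> powr t \<le>
            (S * ?q powr (- \<gamma>)) powr (1 - t) * \<bar>f ((\<delta> * R) *\<^sub>R z)\<bar> powr t"
          by (intro mult_right_mono) auto
        moreover have "\<bar>f ((\<delta> * R) *\<^sub>R z)\<bar> powr (1 - t) * \<bar>f ((\<delta> * R) *\<^sub>R z)\<bar> powr t = \<bar>f ((\<delta> * R) *\<^sub>R z)\<bar>"
          using False powr_add[of "\<bar>f ((\<delta> * R) *\<^sub>R z)\<bar>" "1 - t" t] by simp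
        ultimately show ?thesis by simp
      qed simp
      have "(\<integral>z. \<bar>f ((\<delta> * R) *\<^sub>R z)\<bar> \<partial>sphere_measure) \<le>
          (\<integral>z. (S * ?q powr (- \<gamma>)) powr (1 - t) * \<bar>f ((\<delta> * R) *\<^sub>R z)\<bar> powr t \<partial>sphere_measure)"
        using pt by (intro integral_mono integrable_sphere_continuous[OF continuous_on_rabs[OF cs]]
            integrable_sphere_continuous[OF continuous_on_mult[OF continuous_on_const cst]]) auto
      also have "\<dots> = (S * ?q powr (- \<gamma>)) powr (1 - t) * (\<integral>z. \<bar>f ((\<delta> * R) *\<^sub>R z)\<bar> powr t \<partial>sphere_measure)"
        by simp
      also have "\<dots> \<le> (S * ?q powr (- \<gamma>)) powr (1 - t) * (B * ?q powr (- \<alpha> * t))"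
      proof (rule mult_left_mono)
        have "(\<integral>z. \<bar>f ((\<delta> * R) *\<^sub>R z)\<bar> powr t \<partial>sphere_measure) \<le> B * (1 - \<delta> * R) powr (- \<alpha> * t)"
          by (rule bd[OF \<delta>R(1,2)])
        also have "\<dots> \<le> B * (1 - R) powr (- \<alpha> * t)"
          using B \<delta>R R \<alpha> t by (intro mult_left_mono powr_mono2') auto
        finally show "(\<integral>z. \<bar>f ((\<delta> * R) *\<^sub>R z)\<bar> powr t \<partial>sphere_measure) \<le> B * ?q powr (- \<alpha> * t)"
          unfolding R .
      qed simp
      finally have J: "(\<integral>z. \<bar>f ((\<delta> * R) *\<^sub>R z)\<bar> \<partial>sphere_measure) \<le> (S * ?q powr (- \<gamma>)) powr (1 - t) * (B * ?q powr (- \<alpha> * t))" .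
      have "\<bar>f ((\<delta> * r) *\<^sub>R y)\<bar> \<le> 2 * ?q powr (1 - ?n) * (\<integral>z. \<bar>f ((\<delta> * R) *\<^sub>R z)\<bar> \<partial>sphere_measure)"
        using poisson_pointwise_bound[OF h\<delta> r(1) R(3,2) y] unfolding R(5) by simp
      also have "\<dots> \<le> 2 * ?q powr (1 - ?n) * ((S * ?q powr (- \<gamma>)) powr (1 - t) * (B * ?q powr (- \<alpha> * t)))"
        by (intro mult_left_mono J) simp
      also have "\<dots> = 2 * B * S powr (1 - t) * (?q powr (1 - ?n) * (?q powr (- \<gamma> * (1 - t)) * ?q powr (- \<alpha> * t)))"
        using S0 by (simp add: powr_mult powr_powr mult_ac)
      also have "?q powr (1 - ?n) * (?q powr (- \<gamma> * (1 - t)) * ?q powr (- \<alpha> * t)) = ?q powr (- \<gamma>)"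
      proof -
        have "(1 - ?n) + (- \<gamma> * (1 - t) + - \<alpha> * t) = - \<gamma>"
          using t by (simp add: \<gamma>_def field_simps)
        then show ?thesis
          by (metis powr_add)
      qed
      finally have "(1 - r) powr \<gamma> * \<bar>f ((\<delta> * r) *\<^sub>R y)\<bar> \<le> (1 - r) powr \<gamma> * (2 * B * S powr (1 - t) * ?q powr (- \<gamma>))"
        by (intro mult_left_mono) auto
      also have "\<dots> = 2 * B * S powr (1 - t) * ((1 - r) powr \<gamma> * ?q powr (- \<gamma>))"
        by (simp only: mult_ac)
      also have "(1 - r) powr \<gamma> * ?q powr (- \<gamma>) = 2 powr \<gamma>"
        using r by (simp add: powr_divide powr_minus field_simps)
      finally show ?thesis
        by (simp add: w_def K_def mult_ac)
    qed
    have "S \<le> K * S powr (1 - t)"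
      unfolding S_def[of] using ne step by (intro cSUP_least) (auto simp: D_def S_def)
    moreover have "w (r, y) \<le> S"
      by (rule wS[OF r y])
    moreover have "S \<le> K powr (1 / t)" if "S > 0" "S \<le> K * S powr (1 - t)"
    proof -
      have "S powr t * S powr (1 - t) \<le> K * S powr (1 - t)"
        using that powr_add[of S t "1 - t"] by simp
      then have "S powr t \<le> K"
        using that by simp
      then have "(S powr t) powr (1 / t) \<le> K powr (1 / t)"
        using t by (intro powr_mono2) auto
      then show ?thesis
        using t that by (simp add: powr_powr)
    qed
    ultimately have "w (r, y) \<le> K powr (1 / t)"
      using powr_ge_zero[of K "1 / t"] by (cases "S > 0") linarith+
    then show ?thesis
      by (simp add: w_def)
  qed
  have "\<bar>f x\<bar> \<le> (K powr (1 / t) * 2 powr \<gamma>) * (1 - norm x) powr (- \<gamma>)" if x: "norm x < 1" for x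
  proof -
    \<comment> \<open>Halfway to the boundary: since 1 - |x| / \<delta> \<ge> (1 - |x|) / 2,
      evaluating the dilate at |x| / \<delta> loses only the factor 2^\<gamma>.\<close>
    define \<delta> where "\<delta> = (1 + norm x) / 2"
    have \<delta>: "0 < \<delta>" "\<delta> < 1" "norm x < \<delta>" "\<delta> - norm x = (1 - norm x) / 2"
      using x by (auto simp: \<delta>_def field_simps add_pos_nonneg)
    let ?r = "norm x / \<delta>"
    have r: "0 \<le> ?r" "?r < 1"
      using \<delta> by auto
    have rq: "(1 - norm x) / 2 \<le> 1 - ?r"
    proof -
      have "(\<delta> - norm x) * \<delta> \<le> (\<delta> - norm x) * 1"
        using \<delta> by (intro mult_left_mono) auto
      then have "\<delta> - norm x \<le> 1 - ?r"
        using \<delta>(1) by (simp add: field_simps)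
      then show ?thesis
        unfolding \<delta>(4) .
    qed
    have "(1 - ?r) powr \<gamma> * \<bar>f ((\<delta> * ?r) *\<^sub>R dirn x)\<bar> \<le> K powr (1 / t)"
      by (rule dil[OF \<delta>(1,2) r]) simp
    then have 1: "(1 - ?r) powr \<gamma> * \<bar>f x\<bar> \<le> K powr (1 / t)"
      using \<delta>(1) by simp
    have "((1 - norm x) / 2) powr \<gamma> * \<bar>f x\<bar> \<le> (1 - ?r) powr \<gamma> * \<bar>f x\<bar>"
      using rq x \<gamma> by (intro mult_right_mono powr_mono2) auto
    with 1 have "((1 - norm x) / 2) powr \<gamma> * \<bar>f x\<bar> \<le> K powr (1 / t)"
      by linarith
    then show ?thesis
      using x by (simp add: powr_divide powr_minus field_simps)
  qed
  then show ?thesis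
    unfolding \<gamma>_def by (intro exI[of _ "K powr (1 / t) * 2 powr \<gamma>"]) (simp add: \<gamma>_def)
qed

section \<open>Growth of the Gamma quotients, and the embedding in the mean\<close>

lemma tame_linear: "tame (\<lambda>k. c + real k)"
proof (rule tame_add[OF tame_const])
  show "tame real"
    unfolding tame_def
  proof (intro allI impI)
    fix q :: real assume q: "0 < q \<and> q < 1"
    have "q ^ k * \<bar>real k\<bar> \<le> 1 / (1 / q - 1)" for k
    proof -
      have "1 + real k * (1 / q - 1) \<le> (1 + (1 / q - 1)) ^ k"
        using q by (intro Bernoulli_inequality) (simp add: field_simps)
      also have "\<dots> = 1 / q ^ k"
        by (simp add: power_one_over)
      finally have "real k * (1 / q - 1) \<le> 1 / q ^ k"
        by simp
      then show ?thesis
        using q by (simp add: field_simps)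
    qed
    then show "\<exists>C. \<forall>k. q ^ k * \<bar>real k\<bar> \<le> C"
      by blast
  qed
qed

lemma tame_pochhammer: "tame (\<lambda>k. pochhammer (z + real k) N)"
proof (induction N)
  case 0
  then show ?case
    by (simp add: tame_const)
next
  case (Suc N)
  have "tame (\<lambda>k. pochhammer (z + real k) N * ((z + real N) + real k))"
    by (intro tame_mult Suc tame_linear)
  then show ?case
    by (simp add: pochhammer_Suc add_ac)
qed

text \<open>In \<open>gamma_ratio_pochhammer\<close> the first factor is polynomial in k, and the
  Beta factor is bounded by its value at k = 0.\<close>

lemma tame_gamma_ratio:
  assumes z: "z > 0" and t: "t > 0"
  shows "tame (gamma_ratio z t)"
proof -
  obtain N :: nat where N: "t < real N"
    using reals_Archimedean2 by blast
  define p where "p = real N - t"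
  have p: "p > 0"
    using N by (simp add: p_def)
  define K where "K = Beta p (z + t) / (Gamma p * Gamma t)"
  have "\<bar>gamma_ratio z t k\<bar> \<le> \<bar>pochhammer (z + real k) N * K\<bar>" for k
  proof -
    have poch: "pochhammer (z + real k) N \<ge> 0"
      using z by (intro pochhammer_nonneg) simp
    have "Beta p (z + t + real k) \<le> Beta p (z + t)"
      using beta_measure_power[OF p, of "z + t"] z t p by (intro Beta_real_mono) auto
    then have "pochhammer (z + real k) N * Beta p (z + t + real k) / (Gamma p * Gamma t) \<le>
        pochhammer (z + real k) N * Beta p (z + t) / (Gamma p * Gamma t)"
      using poch p t by (intro divide_right_mono mult_left_mono) (auto simp: Gamma_real_pos less_imp_le)
    then have "gamma_ratio z t k \<le> pochhammer (z + real k) N * K"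
      unfolding gamma_ratio_pochhammer[OF z t N] K_def p_def[symmetric] by simp
    then show ?thesis
      using gamma_ratio_pos[OF z t, of k] by linarith
  qed
  then show ?thesis
    by (intro tame_mono[OF tame_mult[OF tame_pochhammer tame_const]])
qed

lemma ennreal_mult_powr_le_iff:
  assumes "a > 0" "C \<ge> 0"
  shows "ennreal (a powr e) * u \<le> ennreal C \<longleftrightarrow> u \<le> ennreal (C * a powr (- e))"
proof (cases u)
  case (real v)
  have "a powr e * v \<le> C \<longleftrightarrow> v \<le> C * a powr (- e)"
    using assms by (simp add: powr_minus field_simps)
  then show ?thesis
    using real assms by (simp flip: ennreal_mult)
qed (use assms in \<open>auto simp: ennreal_mult_top top_unique\<close>)

text \<open>The factorisation of |f| into its powers 1 - t and t is used once more, now with the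
  pointwise bound on the first factor: ((n - 1)/t + \<alpha>)(1 - t) + \<alpha> t is the exponent
  claimed.\<close>

lemma hardy_littlewood_mean:
  fixes f :: "real^'n \<Rightarrow> real"
  assumes harm: "harmonic_on (ball 0 1) f" and t: "0 < t" "t \<le> 1" and \<alpha>: "\<alpha> \<ge> 0" and B: "B \<ge> 0"
    and bd: "\<And>r. 0 \<le> r \<Longrightarrow> r < 1 \<Longrightarrow> (\<integral>y. \<bar>f (r *\<^sub>R y)\<bar> powr t \<partial>sphere_measure) \<le> B * (1 - r) powr (- \<alpha> * t)"
  shows "\<exists>C\<ge>0. \<forall>r. 0 \<le> r \<longrightarrow> r < 1 \<longrightarrow>
    (\<integral>y. \<bar>f (r *\<^sub>R y)\<bar> \<partial>sphere_measure) \<le> C * (1 - r) powr (- (\<alpha> + (real CARD('n) - 1) / t - (real CARD('n) - 1)))"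
proof -
  let ?n = "real CARD('n)"
  define \<gamma> where "\<gamma> = (?n - 1) / t + \<alpha>"
  obtain C where C: "C \<ge> 0" "\<And>x. norm x < 1 \<Longrightarrow> \<bar>f x\<bar> \<le> C * (1 - norm x) powr (- \<gamma>)"
    using hardy_littlewood_pointwise[OF assms] unfolding \<gamma>_def by blast
  have cf: "continuous_on (ball 0 1) f"
    by (rule harmonic_on_imp_continuous_on[OF harm])
  have "(\<integral>y. \<bar>f (r *\<^sub>R y)\<bar> \<partial>sphere_measure) \<le> (C powr (1 - t) * B) * (1 - r) powr (- (\<alpha> + (?n - 1) / t - (?n - 1)))"
    if r: "0 \<le> r" "r < 1" for r
  proof -
    have cs: "continuous_on (sphere 0 1) (\<lambda>z. f (r *\<^sub>R z))"
      using r by (intro continuous_on_compose2[OF cf, where f = "\<lambda>z. r *\<^sub>R z"] continuous_intros) auto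
    have cst: "continuous_on (sphere 0 1) (\<lambda>z. \<bar>f (r *\<^sub>R z)\<bar> powr t)"
      using t by (intro continuous_on_powr' continuous_on_rabs[OF cs] continuous_intros) auto
    let ?D = "(C * (1 - r) powr (- \<gamma>)) powr (1 - t)"
    have pt: "\<bar>f (r *\<^sub>R z)\<bar> \<le> ?D * \<bar>f (r *\<^sub>R z)\<bar> powr t" if z: "norm z = 1" for z
    proof (cases "f (r *\<^sub>R z) = 0")
      case False
      have "\<bar>f (r *\<^sub>R z)\<bar> \<le> C * (1 - r) powr (- \<gamma>)"
        using C(2)[of "r *\<^sub>R z"] r z by simp
      then have "\<bar>f (r *\<^sub>R z)\<bar> powr (1 - t) * \<bar>f (r *\<^sub>R z)\<bar> powr t \<le> ?D * \<bar>f (r *\<^sub>R z)\<bar> powr t"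
        using t by (intro mult_right_mono powr_mono2) auto
      moreover have "\<bar>f (r *\<^sub>R z)\<bar> powr (1 - t) * \<bar>f (r *\<^sub>R z)\<bar> powr t = \<bar>f (r *\<^sub>R z)\<bar>"
        using False powr_add[of "\<bar>f (r *\<^sub>R z)\<bar>" "1 - t" t] by simp
      ultimately show ?thesis by simp
    qed simp
    have "(\<integral>z. \<bar>f (r *\<^sub>R z)\<bar> \<partial>sphere_measure) \<le> (\<integral>z. ?D * \<bar>f (r *\<^sub>R z)\<bar> powr t \<partial>sphere_measure)"
      using pt by (intro integral_mono integrable_sphere_continuous[OF continuous_on_rabs[OF cs]]
          integrable_sphere_continuous[OF continuous_on_mult[OF continuous_on_const cst]]) auto
    also have "\<dots> = ?D * (\<integral>z. \<bar>f (r *\<^sub>R z)\<bar> powr t \<partial>sphere_measure)"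
      by simp
    also have "\<dots> \<le> ?D * (B * (1 - r) powr (- \<alpha> * t))"
      by (intro mult_left_mono bd r) auto
    also have "\<dots> = (C powr (1 - t) * B) * ((1 - r) powr (- \<gamma> * (1 - t)) * (1 - r) powr (- \<alpha> * t))"
      using C(1) by (simp add: powr_mult powr_powr mult_ac)
    also have "(1 - r) powr (- \<gamma> * (1 - t)) * (1 - r) powr (- \<alpha> * t) = (1 - r) powr (- (\<alpha> + (?n - 1) / t - (?n - 1)))"
    proof -
      have "- \<gamma> * (1 - t) + - \<alpha> * t = - (\<alpha> + (?n - 1) / t - (?n - 1))"
        using t by (simp add: \<gamma>_def field_simps)
      then show ?thesis
        by (metis powr_add)
    qed
    finally show ?thesis .
  qed
  then show ?thesis
    using B by (intro exI[of _ "C powr (1 - t) * B"]) auto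
qed

lemma Hspace_mean_bound:
  fixes f :: "real^'n \<Rightarrow> real"
  assumes f: "f \<in> Hspace (ennreal t) \<alpha>" and t: "0 < t" "t \<le> 1" and \<alpha>: "\<alpha> \<ge> 0"
  shows "\<exists>C\<ge>0. \<forall>r. 0 \<le> r \<longrightarrow> r < 1 \<longrightarrow> (\<integral>\<^sup>+y. ennreal \<bar>f (r *\<^sub>R y)\<bar> \<partial>sphere_measure) \<le>
    ennreal (C * (1 - r) powr (- (\<alpha> + (real CARD('n) - 1) / t - (real CARD('n) - 1))))"
proof -
  obtain A where harm: "harmonic_on (ball 0 1) f" and A: "A \<ge> 0"
    "\<And>r. 0 \<le> r \<Longrightarrow> r < 1 \<Longrightarrow> Mfun (ennreal t) f r \<le> ennreal (A * (1 - r) powr (- \<alpha>))"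
    using f unfolding Hspace_iff by blast
  have cf: "continuous_on (ball 0 1) f"
    by (rule harmonic_on_imp_continuous_on[OF harm])
  have cs: "continuous_on (sphere 0 1) (\<lambda>z. f (r *\<^sub>R z))" if "0 \<le> r" "r < 1" for r
    using that by (intro continuous_on_compose2[OF cf, where f = "\<lambda>z. r *\<^sub>R z"] continuous_intros) auto
  have "(\<integral>y. \<bar>f (r *\<^sub>R y)\<bar> powr t \<partial>sphere_measure) \<le> A powr t * (1 - r) powr (- \<alpha> * t)" if r: "0 \<le> r" "r < 1" for r
  proof -
    have cst: "continuous_on (sphere 0 1) (\<lambda>z. \<bar>f (r *\<^sub>R z)\<bar> powr t)"
      using t by (intro continuous_on_powr' continuous_on_rabs[OF cs[OF r]] continuous_intros) auto
    have "(\<integral>\<^sup>+y. ennreal (\<bar>f (r *\<^sub>R y)\<bar> powr t) \<partial>sphere_measure) \<le> ennreal ((A * (1 - r) powr (- \<alpha>)) powr t)"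
      using A(2)[OF r] A(1) t by (simp add: Mfun_def Lnorm_ennreal_le_iff)
    then have "ennreal (\<integral>y. \<bar>f (r *\<^sub>R y)\<bar> powr t \<partial>sphere_measure) \<le> ennreal ((A * (1 - r) powr (- \<alpha>)) powr t)"
      using integrable_sphere_continuous[OF cst] by (subst (asm) nn_integral_eq_integral) auto
    then have "(\<integral>y. \<bar>f (r *\<^sub>R y)\<bar> powr t \<partial>sphere_measure) \<le> (A * (1 - r) powr (- \<alpha>)) powr t"
      by (subst (asm) ennreal_le_iff) auto
    then show ?thesis
      using A(1) by (simp add: powr_mult powr_powr)
  qed
  then obtain C where C: "C \<ge> 0" "\<And>r. 0 \<le> r \<Longrightarrow> r < 1 \<Longrightarrow>
    (\<integral>y. \<bar>f (r *\<^sub>R y)\<bar> \<partial>sphere_measure) \<le> C * (1 - r) powr (- (\<alpha> + (real CARD('n) - 1) / t - (real CARD('n) - 1)))"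
    using hardy_littlewood_mean[OF harm t \<alpha>, of "A powr t"] by auto
  show ?thesis
  proof (intro exI[of _ C] conjI allI impI C(1))
    fix r :: real assume r: "0 \<le> r" "r < 1"
    have "(\<integral>\<^sup>+y. ennreal \<bar>f (r *\<^sub>R y)\<bar> \<partial>sphere_measure) = ennreal (\<integral>y. \<bar>f (r *\<^sub>R y)\<bar> \<partial>sphere_measure)"
      using integrable_sphere_continuous[OF continuous_on_rabs[OF cs[OF r]]] by (intro nn_integral_eq_integral) auto
    then show "(\<integral>\<^sup>+y. ennreal \<bar>f (r *\<^sub>R y)\<bar> \<partial>sphere_measure) \<le>
      ennreal (C * (1 - r) powr (- (\<alpha> + (real CARD('n) - 1) / t - (real CARD('n) - 1))))"
      using C(2)[OF r] by (simp add: ennreal_leI)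
  qed
qed

subsection \<open>Sufficiency\<close>

context sh_system
begin

text \<open>Coefficients of \<open>LambdaP\<close> as a harmonic function of one of its two sphere
  variables, the other one being x.\<close>

definition lam :: "(nat \<Rightarrow> nat \<Rightarrow> real) \<Rightarrow> real \<Rightarrow> real^'n \<Rightarrow> nat \<Rightarrow> nat \<Rightarrow> real" where
  "lam c T x k j = gamma_ratio (real CARD('n) / 2) T k * c k j * H k j x"

text \<open>The kernel is symmetric, so either variable may run: the pairing with f runs over y,
  while the norm in \<open>Ts\<close> is taken over x.\<close>

lemma LambdaP_eq:
  assumes "norm x = 1" "norm y = 1"
  shows "LambdaP Y d c T x \<rho> y = series (lam c T x) (\<rho> *\<^sub>R y)"
    and "LambdaP Y d c T x \<rho> y = series (lam c T y) (\<rho> *\<^sub>R x)"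
proof -
  have 1: "(\<Sum>j=1..d k. c k j * Y k j x * Y k j y) = (\<Sum>j=1..d k. c k j * H k j x * H k j y)" for k
    using assms by (intro sum.cong refl) (simp add: H_unit)
  show "LambdaP Y d c T x \<rho> y = series (lam c T x) (\<rho> *\<^sub>R y)"
    unfolding LambdaP_def series_def hterm_scaleR 1
    by (simp add: hterm_def lam_def gamma_ratio_def sum_distrib_left sum_divide_distrib mult_ac)
  show "LambdaP Y d c T x \<rho> y = series (lam c T y) (\<rho> *\<^sub>R x)"
    unfolding LambdaP_def series_def hterm_scaleR 1
    by (simp add: hterm_def lam_def gamma_ratio_def sum_distrib_left sum_divide_distrib mult_ac)
qed

lemma ctame_H: "norm x = 1 \<Longrightarrow> ctame (\<lambda>k j. H k j x)"
proof (rule ctame_mono)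
  show "ctame (\<lambda>k j. 1 + zonal_sup k)"
    by (intro ctame_tame tame_add tame_const tame_zonal_sup)
  show "\<bar>H k j x\<bar> \<le> \<bar>1 + zonal_sup k\<bar>" if "norm x = 1" for k j
    using abs_H_le[OF that, of k j] by linarith
qed

lemma ctame_lam: "ctame c \<Longrightarrow> 0 < T \<Longrightarrow> norm x = 1 \<Longrightarrow> ctame (lam c T x)"
  unfolding lam_def by (intro ctame_mult ctame_H ctame_tame tame_gamma_ratio) auto

lemma series_continuous_sphere:
  assumes "ctame b" "0 \<le> r" "r < 1"
  shows "continuous_on (sphere 0 1) (\<lambda>y. series b (r *\<^sub>R y))"
  using assms(2,3)
  by (intro continuous_on_compose2[OF harmonic_on_imp_continuous_on[OF series_harmonic[OF assms(1)]],
        where f = "\<lambda>z. r *\<^sub>R z"] continuous_intros) auto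

lemma series_eq: "ctame b \<Longrightarrow> norm x < 1 \<Longrightarrow> summable (hterm b x) \<and> series b x = (\<Sum>k. hterm b x k)"
  using hterm_sums[of b x] by (simp add: sums_iff)

lemma series_bound:
  assumes "ctame b" "norm x = 1" "0 \<le> r" "r < 1"
  shows "\<bar>series b (r *\<^sub>R x)\<bar> \<le> (\<Sum>k. r ^ k * term_bound b k)"
proof -
  have "\<bar>hterm b (r *\<^sub>R x) k\<bar> \<le> r ^ k * term_bound b k" for k
    using abs_hterm_le[of b "r *\<^sub>R x" k] assms by simp
  then have "norm (\<Sum>k. hterm b (r *\<^sub>R x) k) \<le> (\<Sum>k. r ^ k * term_bound b k)"
    using term_bound_summable[OF assms(1,3,4)] by (intro norm_suminf_le) auto
  then show ?thesis
    by (simp add: series_def)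
qed

lemma series_H_integral:
  assumes b: "ctame b" and r: "0 \<le> r" "r < 1" and j: "j \<in> {1..d k}"
  shows "(\<integral>y. H k j y * series b (r *\<^sub>R y) \<partial>sphere_measure) = r ^ k * b k j"
proof -
  have bd: "\<bar>H k j y * (r ^ i * hterm b y i)\<bar> \<le> (1 + zonal_sup k) * (r ^ i * term_bound b i)" if "norm y = 1" for i y
  proof -
    have "\<bar>r ^ i * hterm b y i\<bar> \<le> r ^ i * term_bound b i"
      using abs_hterm_le[of b y i] that r by (simp add: abs_mult mult_left_mono)
    then show ?thesis
      unfolding abs_mult[of "H k j y"] using abs_H_le[OF that, of k j] zonal_sup_nonneg[of k] by (intro mult_mono) auto
  qed
  have s1: "(\<lambda>i. \<integral>y. H k j y * (r ^ i * hterm b y i) \<partial>sphere_measure) sums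
      (\<integral>y. (\<Sum>i. H k j y * (r ^ i * hterm b y i)) \<partial>sphere_measure)"
    by (rule sphere_series_integral[OF _ bd summable_mult[OF term_bound_summable[OF b r]]])
      (auto intro!: continuous_intros)
  have e1: "(\<integral>y. (\<Sum>i. H k j y * (r ^ i * hterm b y i)) \<partial>sphere_measure) = (\<integral>y. H k j y * series b (r *\<^sub>R y) \<partial>sphere_measure)"
  proof (intro Bochner_Integration.integral_cong refl)
    fix y :: "real^'n" assume "y \<in> space sphere_measure"
    then have "norm (r *\<^sub>R y) < 1"
      using r by simp
    from hterm_sums[OF b this] have "(\<lambda>i. r ^ i * hterm b y i) sums series b (r *\<^sub>R y)"
      by (simp add: hterm_scaleR[abs_def])
    from sums_mult[OF this, of "H k j y"] show "(\<Sum>i. H k j y * (r ^ i * hterm b y i)) = H k j y * series b (r *\<^sub>R y)"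
      by (rule sums_unique[symmetric])
  qed
  have "(\<integral>y. H k j y * (r ^ i * hterm b y i) \<partial>sphere_measure) = (if i = k then r ^ k * b k j else 0)" for i
  proof -
    have "(\<integral>y. H k j y * (r ^ i * hterm b y i) \<partial>sphere_measure) =
        (\<integral>y. (\<Sum>l=1..d i. (r ^ i * b i l) * (H i l y * H k j y)) \<partial>sphere_measure)"
      by (simp add: hterm_def sum_distrib_left mult_ac)
    also have "\<dots> = (\<Sum>l=1..d i. \<integral>y. (r ^ i * b i l) * (H i l y * H k j y) \<partial>sphere_measure)"
      by (intro Bochner_Integration.integral_sum integrable_sphere_continuous continuous_intros)
    also have "\<dots> = (\<Sum>l=1..d i. (r ^ i * b i l) * (if i = k \<and> l = j then 1 else 0))"
      using j by (intro sum.cong refl) (simp add: H_orth)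
    also have "\<dots> = (if i = k then r ^ k * b k j else 0)"
      using j by (auto simp: if_distrib[of "\<lambda>u. _ * u"] cong: if_cong)
    finally show ?thesis .
  qed
  then have "(\<lambda>i. \<integral>y. H k j y * (r ^ i * hterm b y i) \<partial>sphere_measure) sums (r ^ k * b k j)"
    using sums_single[of k "\<lambda>_. r ^ k * b k j"] by simp
  from sums_unique2[OF s1 this] show ?thesis
    by (simp add: e1)
qed

lemma series_parseval:
  assumes a: "ctame a" and b: "ctame b" and r: "0 \<le> r" "r < 1"
  shows "(\<integral>y. series a (r *\<^sub>R y) * series b (r *\<^sub>R y) \<partial>sphere_measure) =
    (\<Sum>k. (r\<^sup>2) ^ k * (\<Sum>j=1..d k. a k j * b k j))"
proof -
  note cb = series_continuous_sphere[OF b r]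
  let ?M = "\<Sum>k. r ^ k * term_bound b k"
  have bd: "\<bar>(r ^ k * hterm a y k) * series b (r *\<^sub>R y)\<bar> \<le> (r ^ k * term_bound a k) * ?M" if "norm y = 1" for k y
  proof -
    have "\<bar>r ^ k * hterm a y k\<bar> \<le> r ^ k * term_bound a k"
      using abs_hterm_le[of a y k] that r by (simp add: abs_mult mult_left_mono)
    moreover have "0 \<le> r ^ k * term_bound a k"
      using r term_bound_nonneg by simp
    ultimately show ?thesis
      unfolding abs_mult[of _ "series b _"] using series_bound[OF b that r] by (intro mult_mono) auto
  qed
  have c: "continuous_on (sphere 0 1) (\<lambda>y. (r ^ k * hterm a y k) * series b (r *\<^sub>R y))" for k
    by (intro continuous_on_mult[OF _ cb] continuous_intros)
  have s1: "(\<lambda>k. \<integral>y. (r ^ k * hterm a y k) * series b (r *\<^sub>R y) \<partial>sphere_measure) sums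
      (\<integral>y. (\<Sum>k. (r ^ k * hterm a y k) * series b (r *\<^sub>R y)) \<partial>sphere_measure)"
    by (rule sphere_series_integral[OF c bd summable_mult2[OF term_bound_summable[OF a r]]])
  have e1: "(\<integral>y. (\<Sum>k. (r ^ k * hterm a y k) * series b (r *\<^sub>R y)) \<partial>sphere_measure) =
      (\<integral>y. series a (r *\<^sub>R y) * series b (r *\<^sub>R y) \<partial>sphere_measure)"
  proof (intro Bochner_Integration.integral_cong refl)
    fix y :: "real^'n" assume "y \<in> space sphere_measure"
    then have "norm (r *\<^sub>R y) < 1"
      using r by simp
    from hterm_sums[OF a this] have "(\<lambda>i. r ^ i * hterm a y i) sums series a (r *\<^sub>R y)"
      by (simp add: hterm_scaleR[abs_def])
    from sums_mult2[OF this, of "series b (r *\<^sub>R y)"]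
    show "(\<Sum>k. (r ^ k * hterm a y k) * series b (r *\<^sub>R y)) = series a (r *\<^sub>R y) * series b (r *\<^sub>R y)"
      by (rule sums_unique[symmetric])
  qed
  have "(\<integral>y. (r ^ k * hterm a y k) * series b (r *\<^sub>R y) \<partial>sphere_measure) = (r\<^sup>2) ^ k * (\<Sum>j=1..d k. a k j * b k j)" for k
  proof -
    have "(\<integral>y. (r ^ k * hterm a y k) * series b (r *\<^sub>R y) \<partial>sphere_measure) =
        (\<integral>y. (\<Sum>j=1..d k. (r ^ k * a k j) * (H k j y * series b (r *\<^sub>R y))) \<partial>sphere_measure)"
      by (simp add: hterm_def sum_distrib_left sum_distrib_right mult_ac)
    also have "\<dots> = (\<Sum>j=1..d k. \<integral>y. (r ^ k * a k j) * (H k j y * series b (r *\<^sub>R y)) \<partial>sphere_measure)"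
      by (intro Bochner_Integration.integral_sum integrable_sphere_continuous
          continuous_on_mult[OF continuous_on_const continuous_on_mult[OF H_cont cb]])
    also have "\<dots> = (\<Sum>j=1..d k. (r ^ k * a k j) * (r ^ k * b k j))"
      by (intro sum.cong refl) (simp add: series_H_integral[OF b r])
    also have "\<dots> = (r\<^sup>2) ^ k * (\<Sum>j=1..d k. a k j * b k j)"
      by (simp add: sum_distrib_left power2_eq_square power_mult_distrib mult_ac)
    finally show ?thesis .
  qed
  with s1 show ?thesis
    by (simp add: e1 sums_iff)
qed

text \<open>The convolution is recovered from \<open>\<Lambda>\<close> because the Beta integral inverts its Gamma quotients.\<close>
lemma convolution_integral:
  assumes c: "ctame c" and b: "ctame b" and T: "T > 0" and x: "norm x = 1" and r: "0 \<le> r" "r < 1"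
  defines "F \<equiv> \<lambda>v. \<Sum>k. (r\<^sup>2) ^ k * (\<Sum>j=1..d k. lam c T x k j * b k j) * (1 - v) ^ k"
  shows "integrable (beta_measure T (real CARD('n) / 2)) F"
    and "series (\<lambda>k j. c k j * b k j) (r\<^sup>2 *\<^sub>R x) = (\<integral>v. F v \<partial>beta_measure T (real CARD('n) / 2))"
    and "0 < v \<Longrightarrow> v < 1 \<Longrightarrow> F v =
      (\<integral>y. series (lam c T x) ((r * sqrt (1 - v)) *\<^sub>R y) * series b ((r * sqrt (1 - v)) *\<^sub>R y) \<partial>sphere_measure)"
proof -
  let ?z = "real CARD('n) / 2"
  have z: "?z > 0"
    by simp
  define a where "a k = (r\<^sup>2) ^ k * (\<Sum>j=1..d k. lam c T x k j * b k j)" for k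
  have r2: "0 \<le> r\<^sup>2" "r\<^sup>2 < 1"
    using r by (auto simp: power_less_one_iff abs_square_less_1)
  have "ctame (\<lambda>k j. lam c T x k j * b k j)"
    by (intro ctame_mult ctame_lam c b T x)
  then have "summable (\<lambda>k. (r\<^sup>2) ^ k * \<bar>\<Sum>j=1..d k. \<bar>lam c T x k j * b k j\<bar>\<bar>)"
    unfolding ctame_def by (rule tame_summable[OF _ r2])
  then have a: "summable (\<lambda>k. \<bar>a k\<bar>)"
  proof (rule summable_comparison_test'[where N = 0])
    fix k
    have "\<bar>\<Sum>j=1..d k. lam c T x k j * b k j\<bar> \<le> \<bar>\<Sum>j=1..d k. \<bar>lam c T x k j * b k j\<bar>\<bar>"
      by (rule order_trans[OF sum_abs]) simp
    then show "norm \<bar>a k\<bar> \<le> (r\<^sup>2) ^ k * \<bar>\<Sum>j=1..d k. \<bar>lam c T x k j * b k j\<bar>\<bar>"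
      by (simp add: a_def abs_mult mult_left_mono)
  qed
  have F: "F v = (\<Sum>k. a k * (1 - v) ^ k)" for v
    by (simp add: F_def a_def)
  note ser = beta_measure_series[OF T z a, folded F]
  show "integrable (beta_measure T ?z) F"
    by (rule ser(1))
  have "a k * Beta T (?z + real k) = hterm (\<lambda>k j. c k j * b k j) (r\<^sup>2 *\<^sub>R x) k" for k
  proof -
    have "a k * Beta T (?z + real k) = (r\<^sup>2) ^ k * (\<Sum>j=1..d k. (gamma_ratio ?z T k * Beta T (?z + real k)) * (c k j * b k j * H k j x))"
      by (simp add: a_def lam_def sum_distrib_left sum_distrib_right mult_ac)
    also have "\<dots> = (r\<^sup>2) ^ k * hterm (\<lambda>k j. c k j * b k j) x k"
      by (simp only: gamma_ratio_Beta[OF z T] mult_1 hterm_def)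
    finally show ?thesis
      by (simp add: hterm_scaleR)
  qed
  then show "series (\<lambda>k j. c k j * b k j) (r\<^sup>2 *\<^sub>R x) = (\<integral>v. F v \<partial>beta_measure T ?z)"
    using ser(2) by (simp add: series_def sums_iff)
  show "F v = (\<integral>y. series (lam c T x) ((r * sqrt (1 - v)) *\<^sub>R y) * series b ((r * sqrt (1 - v)) *\<^sub>R y) \<partial>sphere_measure)"
    if v: "0 < v" "v < 1"
  proof -
    have "r * sqrt (1 - v) \<le> r * 1"
      using r v by (intro mult_left_mono) auto
    then have \<rho>: "0 \<le> r * sqrt (1 - v)" "r * sqrt (1 - v) < 1"
      using r v by auto
    \<comment> \<open>Parseval multiplies the two dilations, so equal radii r sqrt (1 - v) produce
      the powers of r^2 (1 - v) that occur in \<open>F\<close>.\<close>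
    have sq: "(r * sqrt (1 - v))\<^sup>2 = r\<^sup>2 * (1 - v)"
      using v by (simp add: power_mult_distrib)
    show ?thesis
      unfolding series_parseval[OF ctame_lam[OF c T x] b \<rho>] F_def sq by (simp add: power_mult_distrib mult_ac)
  qed
qed

lemma finite_beta_measure:
  assumes "p > 0" "q > 0"
  shows "finite_measure (beta_measure p q)"
proof (rule finite_measureI)
  have "emeasure (beta_measure p q) (space (beta_measure p q)) = (\<integral>\<^sup>+v. ennreal ((1 - v) ^ 0) \<partial>beta_measure p q)"
    by simp
  then show "emeasure (beta_measure p q) (space (beta_measure p q)) \<noteq> \<infinity>"
    unfolding nn_integral_beta_measure_power[OF assms] by simp
qed

lemma H_measurable [measurable]: "H k j \<in> borel_measurable borel"
  by (rule borel_measurable_continuous_onI) (rule H_cont)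

text \<open>The two bounds contribute powers of 1 - r sqrt (1 - v) whose exponents add up to \<beta>
  + T by hypothesis \<open>e\<close>. That base is at least half of \<open>max (1 - r) v\<close>,
  and \<open>nn_integral_powr_max\<close> with b = \<beta> leaves the power -\<beta> of 1 - r; this
  is where \<beta> > 0 enters.\<close>

lemma convolution_norm_bound:
  assumes n2: "CARD('n) \<ge> 2" and s: "1 \<le> s" and c: "ctame c" and b: "ctame b" and \<beta>: "\<beta> > 0" and T: "T > 0"
    and T0: "T0 \<ge> 0" "\<And>\<rho> y. 0 \<le> \<rho> \<Longrightarrow> \<rho> < 1 \<Longrightarrow> norm y = 1 \<Longrightarrow>
      Lnorm s (\<lambda>x. series (lam c T y) (\<rho> *\<^sub>R x)) \<le> ennreal (T0 * (1 - \<rho>) powr (- E))"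
    and Cf: "Cf \<ge> 0" "\<And>\<rho>. 0 \<le> \<rho> \<Longrightarrow> \<rho> < 1 \<Longrightarrow>
      (\<integral>\<^sup>+y. ennreal \<bar>series b (\<rho> *\<^sub>R y)\<bar> \<partial>sphere_measure) \<le> ennreal (Cf * (1 - \<rho>) powr (- \<eta>))"
    and e: "E + \<eta> = \<beta> + T" and r: "0 \<le> r" "r < 1"
  shows "Lnorm s (\<lambda>x. series (\<lambda>k j. c k j * b k j) (r\<^sup>2 *\<^sub>R x)) \<le>
    ennreal (T0 * Cf * 2 powr (\<beta> + T) * (1 / T + 1 / \<beta>) * (1 - r) powr (- \<beta>))"
proof -
  let ?z = "real CARD('n) / 2"
  let ?\<sigma> = "sphere_measure :: (real^'n) measure"
  define \<mu> where "\<mu> = beta_measure T ?z"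
  define \<rho> where "\<rho> v = r * sqrt (1 - v)" for v
  \<comment> \<open>The parameter w is a pair of v and a point y of the sphere; x is the variable of
    the norm. The indicator discards v outside (0, 1), where \<open>\<rho> v\<close> need not be a
    radius below 1.\<close>
  define K where "K x w = indicator {0<..<1} (fst w) * (series b (\<rho> (fst w) *\<^sub>R snd w) * series (lam c T (snd w)) (\<rho> (fst w) *\<^sub>R x))"
    for x :: "real^'n" and w :: "real \<times> (real^'n)"
  define \<kappa> where "\<kappa> w = indicator {0<..<1} (fst w) * (\<bar>series b (\<rho> (fst w) *\<^sub>R snd w)\<bar> * (T0 * (1 - \<rho> (fst w)) powr (- E)))"
    for w :: "real \<times> (real^'n)"
  have z: "?z > 0" "?z \<ge> 1"
    using n2 by auto
  interpret \<mu>: finite_measure \<mu>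
    unfolding \<mu>_def by (rule finite_beta_measure[OF T z(1)])
  interpret P: pair_sigma_finite \<mu> ?\<sigma> ..
  have [measurable_cong]: "sets \<mu> = sets borel"
    by (simp add: \<mu>_def)
  \<comment> \<open>For the last bound, 1 - \<rho>^2 = 1 - r^2 (1 - v) is at least 1 - r and at
    least v, and it is at most 2 (1 - \<rho>).\<close>
  have \<rho>v: "0 \<le> \<rho> v" "\<rho> v < 1" "max (1 - r) v / 2 \<le> 1 - \<rho> v" if v: "0 < v" "v < 1" for v
  proof -
    have "r * sqrt (1 - v) \<le> r * 1"
      using r v by (intro mult_left_mono) auto
    then show \<rho>: "0 \<le> \<rho> v" "\<rho> v < 1"
      using r v by (auto simp: \<rho>_def)
    have sq: "(\<rho> v)\<^sup>2 = r\<^sup>2 * (1 - v)"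
      using v by (simp add: \<rho>_def power_mult_distrib)
    have "r\<^sup>2 \<le> r" "r\<^sup>2 \<le> 1"
      using r by (auto simp: power2_eq_square mult_left_le mult_le_one)
    moreover have "r\<^sup>2 * (1 - v) \<le> r\<^sup>2 * 1" "r\<^sup>2 * (1 - v) \<le> 1 * (1 - v)"
      using v \<open>r\<^sup>2 \<le> 1\<close> by (intro mult_left_mono mult_right_mono; simp)+
    ultimately have "max (1 - r) v \<le> 1 - (\<rho> v)\<^sup>2"
      unfolding sq by simp
    also have "\<dots> = (1 - \<rho> v) * (1 + \<rho> v)"
      by (simp add: power2_eq_square algebra_simps)
    also have "\<dots> \<le> (1 - \<rho> v) * 2"
      using \<rho> by (intro mult_left_mono) auto
    finally show "max (1 - r) v / 2 \<le> 1 - \<rho> v"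
      by simp
  qed
  have r2: "0 \<le> r\<^sup>2" "r\<^sup>2 < 1"
    using r by (auto simp: abs_square_less_1)
  have m1: "fst \<in> borel_measurable (\<mu> \<Otimes>\<^sub>M ?\<sigma>)"
    by measurable
  have m2: "snd \<in> borel_measurable (\<mu> \<Otimes>\<^sub>M ?\<sigma>)"
    by (rule measurable_compose[OF measurable_snd measurable_id_sphere])
  have \<rho>m [measurable]: "\<rho> \<in> borel_measurable borel"
    unfolding \<rho>_def[abs_def] by measurable
  have bm: "(\<lambda>w. series b (\<rho> (fst w) *\<^sub>R snd w)) \<in> borel_measurable (\<mu> \<Otimes>\<^sub>M ?\<sigma>)"
    unfolding series_def hterm_def using m1 m2 by measurable
  have \<kappa>m: "\<kappa> \<in> borel_measurable (\<mu> \<Otimes>\<^sub>M ?\<sigma>)"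
    unfolding \<kappa>_def[abs_def] using m1 bm by measurable
  have Km: "(\<lambda>(x, w). K x w) \<in> borel_measurable (?\<sigma> \<Otimes>\<^sub>M (\<mu> \<Otimes>\<^sub>M ?\<sigma>))"
  proof -
    have [measurable]: "(\<lambda>p. fst p) \<in> borel_measurable (?\<sigma> \<Otimes>\<^sub>M (\<mu> \<Otimes>\<^sub>M ?\<sigma>))"
      by (rule measurable_compose[OF measurable_fst measurable_id_sphere])
    have [measurable]: "(\<lambda>p. fst (snd p)) \<in> borel_measurable (?\<sigma> \<Otimes>\<^sub>M (\<mu> \<Otimes>\<^sub>M ?\<sigma>))"
      by (rule measurable_compose[OF measurable_snd m1])
    have [measurable]: "(\<lambda>p. snd (snd p)) \<in> borel_measurable (?\<sigma> \<Otimes>\<^sub>M (\<mu> \<Otimes>\<^sub>M ?\<sigma>))"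
      by (rule measurable_compose[OF measurable_snd m2])
    show ?thesis
      unfolding case_prod_unfold K_def series_def hterm_def lam_def by measurable
  qed
  show ?thesis
  proof (rule Lnorm_integral_le[OF s P.sigma_finite_measure_axioms Km \<kappa>m])
    show "continuous_on (sphere 0 1) (\<lambda>x. series (\<lambda>k j. c k j * b k j) (r\<^sup>2 *\<^sub>R x))"
      by (rule series_continuous_sphere[OF ctame_mult[OF c b] r2])
    show "0 \<le> \<kappa> w" for w
      using T0(1) by (simp add: \<kappa>_def)
    show "Lnorm s (\<lambda>x. K x w) \<le> ennreal (\<kappa> w)" if "w \<in> space (\<mu> \<Otimes>\<^sub>M ?\<sigma>)" for w
    proof (cases "0 < fst w \<and> fst w < 1")
      case True
      have y: "norm (snd w) = 1"
        using that by (auto simp: space_pair_measure)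
      have "s = top \<or> (\<exists>p>0. s = ennreal p)"
        using s by (cases s rule: exponent_cases) (auto intro: order_less_le_trans[OF zero_less_one])
      moreover note series_continuous_sphere[OF ctame_lam[OF c T y] \<rho>v(1,2)[of "fst w"]]
      moreover have "0 \<le> T0 * (1 - \<rho> (fst w)) powr (- E)"
        using T0(1) by simp
      ultimately have "Lnorm s (\<lambda>x. series b (\<rho> (fst w) *\<^sub>R snd w) * series (lam c T (snd w)) (\<rho> (fst w) *\<^sub>R x)) \<le>
          ennreal (\<bar>series b (\<rho> (fst w) *\<^sub>R snd w)\<bar> * (T0 * (1 - \<rho> (fst w)) powr (- E)))"
        using True T0(2)[OF \<rho>v(1,2)[of "fst w"] y] by (intro Lnorm_cmult_le) auto
      then show ?thesis
        using True by (simp add: K_def \<kappa>_def)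
    next
      case False
      have "Lnorm s (\<lambda>x. 0 :: real) \<le> ennreal 0"
        using s by (intro Lnorm_le_bound) (auto elim!: exponent_cases intro: order_less_le_trans[OF zero_less_one])
      then show ?thesis
        using False by (auto simp: K_def \<kappa>_def indicator_def)
    qed
    show "ennreal \<bar>series (\<lambda>k j. c k j * b k j) (r\<^sup>2 *\<^sub>R x)\<bar> \<le> (\<integral>\<^sup>+w. ennreal \<bar>K x w\<bar> \<partial>(\<mu> \<Otimes>\<^sub>M ?\<sigma>))"
      if x: "norm x = 1" for x
    proof -
      define F where "F v = (\<Sum>k. (r\<^sup>2) ^ k * (\<Sum>j=1..d k. lam c T x k j * b k j) * (1 - v) ^ k)" for v
      note conv = convolution_integral[OF c b T x r, folded F_def, folded \<mu>_def]
      have [measurable]: "(\<lambda>w. K x w) \<in> borel_measurable (\<mu> \<Otimes>\<^sub>M ?\<sigma>)"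
        using measurable_Pair2[OF Km, of x] x by simp
      have "ennreal \<bar>series (\<lambda>k j. c k j * b k j) (r\<^sup>2 *\<^sub>R x)\<bar> \<le> (\<integral>\<^sup>+v. ennreal \<bar>F v\<bar> \<partial>\<mu>)"
        using integral_norm_bound_ennreal[OF conv(1)] by (simp add: conv(2))
      also have "\<dots> \<le> (\<integral>\<^sup>+v. (\<integral>\<^sup>+y. ennreal \<bar>K x (v, y)\<bar> \<partial>?\<sigma>) \<partial>\<mu>)"
      proof (rule nn_integral_mono_AE)
        have "AE v in \<mu>. 0 < v \<and> v < 1"
          unfolding \<mu>_def by (rule AE_beta_measure)
        then show "AE v in \<mu>. ennreal \<bar>F v\<bar> \<le> (\<integral>\<^sup>+y. ennreal \<bar>K x (v, y)\<bar> \<partial>?\<sigma>)"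
        proof eventually_elim
          case (elim v)
          then have v: "0 < v" "v < 1" by auto
          have Fv: "F v = (\<integral>y. series (lam c T x) (\<rho> v *\<^sub>R y) * series b (\<rho> v *\<^sub>R y) \<partial>?\<sigma>)"
            using conv(3)[OF v] by (simp add: \<rho>_def)
          have int: "integrable ?\<sigma> (\<lambda>y. series (lam c T x) (\<rho> v *\<^sub>R y) * series b (\<rho> v *\<^sub>R y))"
            by (intro integrable_sphere_continuous continuous_on_mult series_continuous_sphere ctame_lam c b T x \<rho>v v)
          have "ennreal \<bar>F v\<bar> \<le> (\<integral>\<^sup>+y. ennreal \<bar>series (lam c T x) (\<rho> v *\<^sub>R y) * series b (\<rho> v *\<^sub>R y)\<bar> \<partial>?\<sigma>)"
            using integral_norm_bound_ennreal[OF int] by (simp add: Fv)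
          also have "\<dots> = (\<integral>\<^sup>+y. ennreal \<bar>K x (v, y)\<bar> \<partial>?\<sigma>)"
          proof (intro nn_integral_cong)
            fix y assume "y \<in> space ?\<sigma>"
            then have y: "norm y = 1" by simp
            \<comment> \<open>Symmetry moves the fixed pole from x to y, as the assumed bound is on
              the norm in x for fixed y.\<close>
            have "series (lam c T x) (\<rho> v *\<^sub>R y) = series (lam c T y) (\<rho> v *\<^sub>R x)"
              using LambdaP_eq[OF x y, of c T "\<rho> v"] by simp
            then show "ennreal \<bar>series (lam c T x) (\<rho> v *\<^sub>R y) * series b (\<rho> v *\<^sub>R y)\<bar> = ennreal \<bar>K x (v, y)\<bar>"
              using v by (simp add: K_def mult.commute)
          qed
          finally show ?case .
        qed
      qed
      also have "\<dots> = (\<integral>\<^sup>+w. ennreal \<bar>K x w\<bar> \<partial>(\<mu> \<Otimes>\<^sub>M ?\<sigma>))"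
        using sph.nn_integral_fst[of "\<lambda>w. ennreal \<bar>K x w\<bar>" \<mu>] by simp
      finally show ?thesis .
    qed
    show "0 \<le> T0 * Cf * 2 powr (\<beta> + T) * (1 / T + 1 / \<beta>) * (1 - r) powr (- \<beta>)"
      using T0(1) Cf(1) T \<beta> by simp
    define A where "A = T0 * Cf * 2 powr (\<beta> + T)"
    have A: "A \<ge> 0"
      using T0(1) Cf(1) by (simp add: A_def)
    have "(\<integral>\<^sup>+w. ennreal (\<kappa> w) \<partial>(\<mu> \<Otimes>\<^sub>M ?\<sigma>)) = (\<integral>\<^sup>+v. (\<integral>\<^sup>+y. ennreal (\<kappa> (v, y)) \<partial>?\<sigma>) \<partial>\<mu>)"
      using sph.nn_integral_fst[of "\<lambda>w. ennreal (\<kappa> w)" \<mu>] \<kappa>m by simp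
    also have "\<dots> \<le> (\<integral>\<^sup>+v. ennreal (A * max (1 - r) v powr (- \<beta> - T)) \<partial>\<mu>)"
    proof (rule nn_integral_mono_AE)
      have "AE v in \<mu>. 0 < v \<and> v < 1"
        unfolding \<mu>_def by (rule AE_beta_measure)
      then show "AE v in \<mu>. (\<integral>\<^sup>+y. ennreal (\<kappa> (v, y)) \<partial>?\<sigma>) \<le> ennreal (A * max (1 - r) v powr (- \<beta> - T))"
      proof eventually_elim
        case (elim v)
        then have v: "0 < v" "v < 1" by auto
        note \<rho> = \<rho>v[OF v]
        have cs: "continuous_on (sphere 0 1) (\<lambda>y. series b (\<rho> v *\<^sub>R y))"
          by (rule series_continuous_sphere[OF b \<rho>(1,2)])
        let ?q = "1 - \<rho> v"
        have "(\<integral>\<^sup>+y. ennreal (\<kappa> (v, y)) \<partial>?\<sigma>) =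
            (\<integral>\<^sup>+y. ennreal (T0 * ?q powr (- E)) * ennreal \<bar>series b (\<rho> v *\<^sub>R y)\<bar> \<partial>?\<sigma>)"
          using v T0(1) by (intro nn_integral_cong) (simp add: \<kappa>_def mult.commute flip: ennreal_mult)
        also have "\<dots> = ennreal (T0 * ?q powr (- E)) * (\<integral>\<^sup>+y. ennreal \<bar>series b (\<rho> v *\<^sub>R y)\<bar> \<partial>?\<sigma>)"
          by (rule nn_integral_cmult[OF measurable_compose[OF borel_measurable_abs[OF measurable_sphere_continuous[OF cs]] measurable_ennreal]])
        also have "\<dots> \<le> ennreal (T0 * ?q powr (- E)) * ennreal (Cf * ?q powr (- \<eta>))"
          by (intro mult_left_mono Cf(2) \<rho>) auto
        also have "\<dots> = ennreal (T0 * Cf * (?q powr (- E) * ?q powr (- \<eta>)))"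
          using T0(1) Cf(1) by (simp add: mult_ac flip: ennreal_mult)
        also have "?q powr (- E) * ?q powr (- \<eta>) = ?q powr (- \<beta> - T)"
        proof -
          have "- E + - \<eta> = - \<beta> - T"
            using e by simp
          then show ?thesis
            by (metis powr_add)
        qed
        also have "ennreal (T0 * Cf * ?q powr (- \<beta> - T)) \<le> ennreal (T0 * Cf * (2 powr (\<beta> + T) * max (1 - r) v powr (- \<beta> - T)))"
        proof (intro ennreal_leI mult_left_mono)
          have m0: "0 < max (1 - r) v / 2"
            using v by (simp add: max_def)
          have "?q powr (- \<beta> - T) \<le> (max (1 - r) v / 2) powr (- \<beta> - T)"
            using \<rho>(3) m0 \<beta> T by (intro powr_mono2') auto
          also have "\<dots> = max (1 - r) v powr (- \<beta> - T) / 2 powr (- \<beta> - T)"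
            by (rule powr_divide)
          also have "\<dots> = 2 powr (\<beta> + T) * max (1 - r) v powr (- \<beta> - T)"
          proof -
            have "(2::real) powr (\<beta> + T) = inverse (2 powr (- (\<beta> + T)))"
              by (simp only: powr_minus inverse_inverse_eq)
            moreover have "- (\<beta> + T) = - \<beta> - T"
              by simp
            ultimately show ?thesis
              by (simp only: divide_inverse mult.commute)
          qed
          finally show "?q powr (- \<beta> - T) \<le> 2 powr (\<beta> + T) * max (1 - r) v powr (- \<beta> - T)" .
        qed (use T0(1) Cf(1) in simp)
        finally show ?case
          by (simp add: A_def mult.assoc)
      qed
    qed
    also have "\<dots> = (\<integral>\<^sup>+v. ennreal (indicator {0<..<1} v * v powr (T - 1) * (1 - v) powr (?z - 1)) *
        ennreal (A * max (1 - r) v powr (- \<beta> - T)) \<partial>lborel)"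
      unfolding \<mu>_def by (rule nn_integral_beta_measure) measurable
    also have "\<dots> \<le> (\<integral>\<^sup>+v. ennreal A * ennreal (indicator {0<..<1} v * v powr (T - 1) * max (1 - r) v powr (- \<beta> - T)) \<partial>lborel)"
    proof (intro nn_integral_mono)
      fix v :: real
      show "ennreal (indicator {0<..<1} v * v powr (T - 1) * (1 - v) powr (?z - 1)) * ennreal (A * max (1 - r) v powr (- \<beta> - T)) \<le>
        ennreal A * ennreal (indicator {0<..<1} v * v powr (T - 1) * max (1 - r) v powr (- \<beta> - T))"
      proof (cases "0 < v \<and> v < 1")
        case True
        have "(1 - v) powr (?z - 1) \<le> 1"
          using True z by (intro powr_le1) auto
        then have "v powr (T - 1) * (1 - v) powr (?z - 1) * (A * max (1 - r) v powr (- \<beta> - T)) \<le>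
            v powr (T - 1) * 1 * (A * max (1 - r) v powr (- \<beta> - T))"
          using A by (intro mult_right_mono mult_left_mono mult_nonneg_nonneg) auto
        then show ?thesis
          using True A by (simp add: mult_ac flip: ennreal_mult')
      qed (auto simp: indicator_def)
    qed
    also have "\<dots> = ennreal A * (\<integral>\<^sup>+v. ennreal (indicator {0<..<1} v * v powr (T - 1) * max (1 - r) v powr (- \<beta> - T)) \<partial>lborel)"
      by (rule nn_integral_cmult) measurable
    also have "\<dots> \<le> ennreal A * ennreal ((1 / T + 1 / \<beta>) * (1 - r) powr (- \<beta>))"
      using nn_integral_powr_max[OF T \<beta>, of "1 - r"] r by (intro mult_left_mono) auto
    also have "\<dots> = ennreal (T0 * Cf * 2 powr (\<beta> + T) * (1 / T + 1 / \<beta>) * (1 - r) powr (- \<beta>))"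
      using A by (subst ennreal_mult'[symmetric]) (auto simp: A_def mult.assoc)
    finally show "(\<integral>\<^sup>+w. ennreal (\<kappa> w) \<partial>(\<mu> \<Otimes>\<^sub>M ?\<sigma>)) \<le>
      ennreal (T0 * Cf * 2 powr (\<beta> + T) * (1 / T + 1 / \<beta>) * (1 - r) powr (- \<beta>))" .
  qed
qed

theorem multiplier_sufficient:
  assumes n2: "CARD('n) \<ge> 2" and t: "0 < t" "t \<le> 1" and s: "1 \<le> s" and \<alpha>: "\<alpha> \<ge> 0" and \<beta>: "\<beta> > 0" and m: "m > -1"
    and gc: "\<forall>x\<in>ball 0 1. summable (gc_term Y d c x)" "harmonic_on (ball 0 1) (gc Y d c)"
    and Ts: "Ts Y d c s t \<alpha> \<beta> m < \<infinity>"
  shows "c \<in> MH Y d (Hspace (ennreal t) \<alpha>) (Hspace s \<beta>)"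
proof -
  let ?n = "real CARD('n)"
  define T where "T = m + 1"
  define E where "E = \<beta> - \<alpha> + m + ?n - (?n - 1) / t"
  define \<eta> where "\<eta> = \<alpha> + (?n - 1) / t - (?n - 1)"
  have T: "T > 0"
    using m by (simp add: T_def)
  \<comment> \<open>The weight in \<open>Ts\<close> is made for this: its exponent is \<beta> + m +
    1 less what the embedding into weighted H^1 costs.\<close>
  have e: "E + \<eta> = \<beta> + T"
    by (simp add: E_def \<eta>_def T_def)
  \<comment> \<open>By uniqueness c agrees on the index range with the coefficients of the harmonic
    function \<open>gc\<close>, so the expansion theorem supplies its growth.\<close>
  have c: "ctame c"
  proof (rule ctame_mono)
    show "ctame (hcoef Y d (gc Y d c))"
      by (rule hcoef_harmonic[OF gc(2)])
    have hs: "hterm c x sums gc Y d c x" if "norm x < 1" for x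
      using gc(1) that by (simp add: gc_eq gc_term_eq series_def summable_sums)
    show "\<bar>c k j\<bar> \<le> \<bar>hcoef Y d (gc Y d c) k j\<bar>" if "j \<in> {1..d k}" for k j
      using coefficients_unique[OF zero_less_one hs hcoef_harmonic(2)[OF gc(2)] that] by simp
  qed
  define T0 where "T0 = enn2real (Ts Y d c s t \<alpha> \<beta> m)"
  have T0: "T0 \<ge> 0" "Ts Y d c s t \<alpha> \<beta> m = ennreal T0"
    using Ts by (auto simp: T0_def)
  have T0b: "Lnorm s (\<lambda>x. series (lam c T y) (\<rho> *\<^sub>R x)) \<le> ennreal (T0 * (1 - \<rho>) powr (- E))"
    if \<rho>: "0 \<le> \<rho>" "\<rho> < 1" and y: "norm y = 1" for \<rho> y
  proof -
    have "ennreal ((1 - \<rho>) powr E) * Lnorm s (\<lambda>x'. LambdaP Y d c (m + 1) x' \<rho> y) \<le> ennreal T0"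
      unfolding T0(2)[symmetric] Ts_def E_def using \<rho> y
      by (intro SUP_upper2[of \<rho>] SUP_upper2[of y]) auto
    also have "Lnorm s (\<lambda>x'. LambdaP Y d c (m + 1) x' \<rho> y) = Lnorm s (\<lambda>x. series (lam c T y) (\<rho> *\<^sub>R x))"
      by (rule Lnorm_cong) (simp add: LambdaP_eq(2) y T_def)
    finally show ?thesis
      using \<rho> T0(1) by (subst (asm) ennreal_mult_powr_le_iff) auto
  qed
  have "(\<forall>x\<in>ball 0 1. summable (hconv_term Y d c f x)) \<and> hconv Y d c f \<in> Hspace s \<beta>"
    if f: "f \<in> Hspace (ennreal t) \<alpha>" for f
  proof -
    have harm: "harmonic_on (ball 0 1) f"
      using f by (simp add: Hspace_def)
    define b where "b = hcoef Y d f"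
    have b: "ctame b" "\<And>x. norm x < 1 \<Longrightarrow> hterm b x sums f x"
      unfolding b_def using hcoef_harmonic[OF harm] by auto
    have fb: "series b x = f x" if "norm x < 1" for x
      using sums_unique2[OF hterm_sums[OF b(1) that] b(2)[OF that]] .
    have cb: "ctame (\<lambda>k j. c k j * b k j)"
      by (rule ctame_mult[OF c b(1)])
    have hc: "hconv Y d c f = series (\<lambda>k j. c k j * b k j)"
      by (intro ext) (simp add: hconv_eq b_def)
    obtain Cf where Cf: "Cf \<ge> 0" "\<And>r. 0 \<le> r \<Longrightarrow> r < 1 \<Longrightarrow>
        (\<integral>\<^sup>+y. ennreal \<bar>f (r *\<^sub>R y)\<bar> \<partial>sphere_measure) \<le> ennreal (Cf * (1 - r) powr (- \<eta>))"
      using Hspace_mean_bound[OF f t \<alpha>] unfolding \<eta>_def by blast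
    have Cf': "(\<integral>\<^sup>+y. ennreal \<bar>series b (r *\<^sub>R y)\<bar> \<partial>sphere_measure) \<le> ennreal (Cf * (1 - r) powr (- \<eta>))"
      if r: "0 \<le> r" "r < 1" for r
    proof -
      have "(\<integral>\<^sup>+y. ennreal \<bar>series b (r *\<^sub>R y)\<bar> \<partial>sphere_measure) = (\<integral>\<^sup>+y. ennreal \<bar>f (r *\<^sub>R y)\<bar> \<partial>sphere_measure)"
        using r by (intro nn_integral_cong) (simp add: fb)
      then show ?thesis
        using Cf(2)[OF r] by simp
    qed
    define W where "W = T0 * Cf * 2 powr (\<beta> + T) * (1 / T + 1 / \<beta>)"
    have W: "W \<ge> 0"
      using T0(1) Cf(1) T \<beta> by (simp add: W_def)
    have "Mfun s (hconv Y d c f) r \<le> ennreal ((W * 2 powr \<beta>) * (1 - r) powr (- \<beta>))" if r: "0 \<le> r" "r < 1" for r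
    proof -
      \<comment> \<open>The convolution bound lives at squared radii, so it is applied at sqrt r, at
        the cost of a factor 2^\<beta>.\<close>
      have q: "0 \<le> sqrt r" "sqrt r < 1" "(sqrt r)\<^sup>2 = r"
        using r by auto
      have "1 - r = (1 - sqrt r) * (1 + sqrt r)"
        using q(3) by (simp add: power2_eq_square algebra_simps)
      also have "\<dots> \<le> (1 - sqrt r) * 2"
        using q by (intro mult_left_mono) auto
      finally have h: "(1 - r) / 2 \<le> 1 - sqrt r"
        by simp
      have "(1 - sqrt r) powr (- \<beta>) \<le> ((1 - r) / 2) powr (- \<beta>)"
        using h r \<beta> by (intro powr_mono2') auto
      also have "\<dots> = 2 powr \<beta> * (1 - r) powr (- \<beta>)"
        using r by (simp add: powr_divide powr_minus field_simps)
      finally have m2: "W * (1 - sqrt r) powr (- \<beta>) \<le> W * (2 powr \<beta> * (1 - r) powr (- \<beta>))"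
        using W by (rule mult_left_mono)
      have m1: "Mfun s (hconv Y d c f) r \<le> ennreal (W * (1 - sqrt r) powr (- \<beta>))"
        using convolution_norm_bound[OF n2 s c b(1) \<beta> T T0(1) T0b Cf(1) Cf' e q(1,2)]
        unfolding q(3) Mfun_def hc W_def .
      show ?thesis
        unfolding mult.assoc by (rule order_trans[OF m1 ennreal_leI[OF m2]])
    qed
    then have "hconv Y d c f \<in> Hspace s \<beta>"
      unfolding Hspace_iff using series_harmonic[OF cb] W
      by (auto simp: hc intro!: exI[of _ "W * 2 powr \<beta>"])
    moreover have "summable (hconv_term Y d c f x)" if "x \<in> ball 0 1" for x
      using series_eq[OF cb, of x] that by (simp add: hconv_term_eq b_def)
    ultimately show ?thesis
      by blast
  qed
  then show ?thesis
    by (simp add: MH_def)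
qed

end

subsection \<open>Necessity\<close>

text \<open>Real-valued version of \<open>Lnorm\<close>, faithful for s \<ge> 1 and functions
  continuous on the sphere, since these are bounded there (\<open>Lnorm_eq_nrm\<close>).\<close>

definition nrm :: "ennreal \<Rightarrow> (real^'n \<Rightarrow> real) \<Rightarrow> real" where
  "nrm s F = enn2real (Lnorm s F)"

lemma exponent_ge_1: "(1::ennreal) \<le> s \<Longrightarrow> s = top \<or> (\<exists>p>0. s = ennreal p)"
  by (erule exponent_cases) (auto intro: order_less_le_trans[OF zero_less_one])

lemma Lnorm_eq_nrm:
  fixes F :: "real^'n \<Rightarrow> real"
  assumes s: "1 \<le> s" and F: "continuous_on (sphere 0 1) F"
  shows "Lnorm s F = ennreal (nrm s F)"
proof -
  have "bounded (F ` sphere 0 1)"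
    using F by (intro compact_imp_bounded compact_continuous_image) auto
  then obtain B where B: "B > 0" "\<forall>x\<in>sphere 0 1. \<bar>F x\<bar> \<le> B"
    unfolding bounded_pos by auto
  then have "Lnorm s F \<le> ennreal B"
    by (intro Lnorm_le_bound exponent_ge_1 s) auto
  then have "Lnorm s F < top"
    by (rule le_less_trans) simp
  then show ?thesis
    by (simp add: nrm_def)
qed

lemma nrm_nonneg: "0 \<le> nrm s F"
  by (simp add: nrm_def)

lemma nrm_le_iff:
  fixes F :: "real^'n \<Rightarrow> real"
  assumes "1 \<le> s" "continuous_on (sphere 0 1) F" "0 \<le> W"
  shows "nrm s F \<le> W \<longleftrightarrow> Lnorm s F \<le> ennreal W"
  using assms by (simp add: Lnorm_eq_nrm)

lemma nrm_cmult_le: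
  fixes F :: "real^'n \<Rightarrow> real"
  assumes s: "1 \<le> s" and F: "continuous_on (sphere 0 1) F"
  shows "nrm s (\<lambda>x. c * F x) \<le> \<bar>c\<bar> * nrm s F"
proof -
  have "Lnorm s (\<lambda>x. c * F x) \<le> ennreal (\<bar>c\<bar> * nrm s F)"
    by (rule Lnorm_cmult_le[OF exponent_ge_1[OF s] F nrm_nonneg]) (simp add: Lnorm_eq_nrm[OF s F])
  then show ?thesis
    by (subst nrm_le_iff[OF s continuous_on_mult[OF continuous_on_const F]]) (auto simp: nrm_nonneg)
qed

text \<open>Minkowski's integral inequality for counting measure, that is, the countable triangle
  inequality.\<close>

lemma nrm_series_le:
  fixes F :: "nat \<Rightarrow> real^'n \<Rightarrow> real"
  assumes s: "1 \<le> s" and F: "\<And>i. continuous_on (sphere 0 1) (F i)" and G: "continuous_on (sphere 0 1) G"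
    and sm: "\<And>x. norm x = 1 \<Longrightarrow> summable (\<lambda>i. \<bar>F i x\<bar>)"
    and le: "\<And>x. norm x = 1 \<Longrightarrow> \<bar>G x\<bar> \<le> (\<Sum>i. \<bar>F i x\<bar>)"
    and \<kappa>: "\<And>i. nrm s (F i) \<le> \<kappa> i" "summable \<kappa>"
  shows "nrm s G \<le> (\<Sum>i. \<kappa> i)"
proof -
  have \<kappa>0: "0 \<le> \<kappa> i" for i
    using \<kappa>(1)[of i] nrm_nonneg[of s "F i"] by linarith
  have "Lnorm s G \<le> ennreal (\<Sum>i. \<kappa> i)"
  proof (rule Lnorm_integral_le[OF s, where M = "count_space (UNIV :: nat set)" and K = "\<lambda>x i. F i x" and \<kappa> = \<kappa>])
    show "sigma_finite_measure (count_space (UNIV :: nat set))"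
      by (rule sigma_finite_measure_count_space)
    have "(\<lambda>p. F (snd p) (fst p)) \<in> borel_measurable (sphere_measure \<Otimes>\<^sub>M count_space (UNIV :: nat set))"
      by (rule measurable_compose_countable[where f = "\<lambda>i p. F i (fst p)" and g = snd])
        (auto intro!: measurable_compose[OF measurable_fst measurable_sphere_continuous[OF F]])
    then show "(\<lambda>(x, i). F i x) \<in> borel_measurable (sphere_measure \<Otimes>\<^sub>M count_space (UNIV :: nat set))"
      by (simp add: case_prod_unfold)
    show "Lnorm s (\<lambda>x. F i x) \<le> ennreal (\<kappa> i)" for i
      using \<kappa>(1)[of i] \<kappa>0[of i] by (simp add: nrm_le_iff[OF s F])
    show "ennreal \<bar>G x\<bar> \<le> (\<integral>\<^sup>+i. ennreal \<bar>F i x\<bar> \<partial>count_space UNIV)" if "norm x = 1" for x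
      using le[OF that] sm[OF that] by (simp add: nn_integral_count_space_nat suminf_ennreal2 ennreal_leI)
    show "(\<integral>\<^sup>+i. ennreal (\<kappa> i) \<partial>count_space UNIV) \<le> ennreal (\<Sum>i. \<kappa> i)"
      using \<kappa>(2) \<kappa>0 by (simp add: nn_integral_count_space_nat suminf_ennreal2)
    show "0 \<le> (\<Sum>i. \<kappa> i)"
      using \<kappa>(2) \<kappa>0 by (rule suminf_nonneg)
  qed (use G \<kappa>0 in auto)
  then show ?thesis
    using nrm_le_iff[OF s G suminf_nonneg[OF \<kappa>(2) \<kappa>0]] by simp
qed

lemma nrm_triangle:
  fixes F G :: "real^'n \<Rightarrow> real"
  assumes s: "1 \<le> s" and F: "continuous_on (sphere 0 1) F" and G: "continuous_on (sphere 0 1) G"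
  shows "nrm s (\<lambda>x. F x + G x) \<le> nrm s F + nrm s G"
proof -
  define A where "A i = (if i = 0 then F else if i = 1 then G else (\<lambda>_. 0))" for i :: nat
  define \<kappa> where "\<kappa> i = (if i = 0 then nrm s F else if i = 1 then nrm s G else 0)" for i :: nat
  have z: "nrm s (\<lambda>_::real^'n. 0) \<le> 0"
    using nrm_cmult_le[OF s F, of 0] by simp
  have 1: "(\<lambda>i. \<bar>A i x\<bar>) sums (\<bar>F x\<bar> + \<bar>G x\<bar>)" for x
    using sums_finite[of "{0, 1}" "\<lambda>i. \<bar>A i x\<bar>"] by (auto simp: A_def)
  have 2: "\<kappa> sums (nrm s F + nrm s G)"
    using sums_finite[of "{0, 1}" \<kappa>] by (auto simp: \<kappa>_def)
  have "nrm s (\<lambda>x. F x + G x) \<le> (\<Sum>i. \<kappa> i)"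
  proof (rule nrm_series_le[OF s, where F = A])
    show "continuous_on (sphere 0 1) (A i)" for i
      using F G by (auto simp: A_def)
    show "continuous_on (sphere 0 1) (\<lambda>x. F x + G x)"
      using F G by (rule continuous_on_add)
    show "summable (\<lambda>i. \<bar>A i x\<bar>)" for x
      using 1 by (rule sums_summable)
    show "\<bar>F x + G x\<bar> \<le> (\<Sum>i. \<bar>A i x\<bar>)" for x
      using sums_unique[OF 1[of x]] abs_triangle_ineq[of "F x" "G x"] by simp
    show "nrm s (A i) \<le> \<kappa> i" for i
      using z by (auto simp: A_def \<kappa>_def)
    show "summable \<kappa>"
      using 2 by (rule sums_summable)
  qed
  then show ?thesis
    using sums_unique[OF 2] by simp
qed

section \<open>Subadditivity of t-th powers and interchange of double series\<close>

lemma powr_add_le: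
  fixes a b t :: real
  assumes "0 \<le> a" "0 \<le> b" "0 < t" "t \<le> 1"
  shows "(a + b) powr t \<le> a powr t + b powr t"
proof (cases "a + b = 0")
  case False
  then have ab: "a + b > 0"
    using assms by linarith
  have le: "u \<le> u powr t" if "0 \<le> u" "u \<le> 1" for u
  proof (cases "u = 0")
    case False
    then show ?thesis
      using powr_mono'[of t 1 u] that assms by simp
  qed simp
  have "1 = a / (a + b) + b / (a + b)"
    using ab by (simp flip: add_divide_distrib)
  also have "\<dots> \<le> (a / (a + b)) powr t + (b / (a + b)) powr t"
    using assms ab by (intro add_mono le) auto
  also have "\<dots> = (a powr t + b powr t) / (a + b) powr t"
    by (simp add: powr_divide add_divide_distrib)
  finally show ?thesis
    using ab by (simp add: field_simps)
qed (use assms in auto)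

text \<open>The finite inequality passes to the limit by continuity of the power. The right side is
  taken in \<open>ennreal\<close>, where it may be infinite.\<close>

lemma suminf_powr_le:
  fixes u :: "nat \<Rightarrow> real"
  assumes u: "summable (\<lambda>i. \<bar>u i\<bar>)" and t: "0 < t" "t \<le> 1"
  shows "ennreal (\<bar>\<Sum>i. u i\<bar> powr t) \<le> (\<Sum>i. ennreal (\<bar>u i\<bar> powr t))"
proof -
  have fin: "(\<Sum>i<N. \<bar>u i\<bar>) powr t \<le> (\<Sum>i<N. \<bar>u i\<bar> powr t)" for N
  proof (induction N)
    case (Suc N)
    have "(\<Sum>i<Suc N. \<bar>u i\<bar>) powr t \<le> (\<Sum>i<N. \<bar>u i\<bar>) powr t + \<bar>u N\<bar> powr t"
      using t by (simp add: powr_add_le sum_nonneg)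
    then show ?case
      using Suc by simp
  qed simp
  have lim: "(\<lambda>N. ennreal ((\<Sum>i<N. \<bar>u i\<bar>) powr t)) \<longlonglongrightarrow> ennreal ((\<Sum>i. \<bar>u i\<bar>) powr t)"
    using t summable_LIMSEQ[OF u] by (intro tendsto_ennrealI tendsto_powr2 tendsto_const) (auto intro!: always_eventually sum_nonneg)
  have part: "ennreal ((\<Sum>i<N. \<bar>u i\<bar>) powr t) \<le> (\<Sum>i. ennreal (\<bar>u i\<bar> powr t))" for N
  proof -
    have "ennreal ((\<Sum>i<N. \<bar>u i\<bar>) powr t) \<le> ennreal (\<Sum>i<N. \<bar>u i\<bar> powr t)"
      by (rule ennreal_leI[OF fin])
    also have "\<dots> = (\<Sum>i<N. ennreal (\<bar>u i\<bar> powr t))"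
      by (rule sum_ennreal[symmetric]) simp
    also have "\<dots> \<le> (\<Sum>i. ennreal (\<bar>u i\<bar> powr t))"
      by (rule sum_le_suminf) auto
    finally show ?thesis .
  qed
  have "ennreal ((\<Sum>i. \<bar>u i\<bar>) powr t) \<le> (\<Sum>i. ennreal (\<bar>u i\<bar> powr t))"
    by (rule LIMSEQ_le_const2[OF lim]) (use part in blast)
  moreover have "ennreal (\<bar>\<Sum>i. u i\<bar> powr t) \<le> ennreal ((\<Sum>i. \<bar>u i\<bar>) powr t)"
    using t summable_rabs[OF u] by (intro ennreal_leI powr_mono2) auto
  ultimately show ?thesis
    by (rule order_trans[rotated])
qed

lemma double_series_swap:
  fixes a :: "nat \<Rightarrow> nat \<Rightarrow> real"
  assumes b: "\<And>i k. \<bar>a i k\<bar> \<le> u i * v k" and u: "summable u" and v: "summable v"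
  shows "(\<lambda>i. \<Sum>k. a i k) sums (\<Sum>k. \<Sum>i. a i k)"
proof -
  let ?N = "count_space (UNIV :: nat set)"
  have si: "summable (\<lambda>k. norm (a i k))" for i
    by (rule summable_comparison_test'[OF summable_mult[OF v, of "u i"], of 0]) (use b in simp)
  have sk: "summable (\<lambda>i. norm (a i k))" for k
    by (rule summable_comparison_test'[OF summable_mult2[OF u, of "v k"], of 0]) (use b in simp)
  have int: "integrable ?N (a i)" for i
    using si by (simp add: integrable_count_space_nat_iff)
  have "summable (\<lambda>i. \<integral>k. norm (a i k) \<partial>?N)"
  proof (rule summable_comparison_test'[OF summable_mult2[OF u, of "\<Sum>k. v k"], of 0])
    fix i
    have "(\<integral>k. norm (a i k) \<partial>?N) = (\<Sum>k. norm (a i k))"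
      using si by (intro integral_count_space_nat) (simp add: integrable_count_space_nat_iff)
    also have "\<dots> \<le> (\<Sum>k. u i * v k)"
      using b by (intro suminf_le si summable_mult v) auto
    also have "\<dots> = u i * (\<Sum>k. v k)"
      by (rule suminf_mult[OF v])
    finally show "norm (\<integral>k. norm (a i k) \<partial>?N) \<le> u i * (\<Sum>k. v k)"
      by (simp add: integral_nonneg_AE)
  qed
  note si' = integrable_suminf[OF int _ this] sums_integral[OF int _ this]
  have "integrable ?N (\<lambda>k. \<Sum>i. a i k)" "(\<lambda>i. integral\<^sup>L ?N (a i)) sums (\<integral>k. (\<Sum>i. a i k) \<partial>?N)"
    using si' sk by auto
  then show ?thesis
    using int by (simp add: integral_count_space_nat)
qed

context sh_system
begin

section \<open>Multipliers acting on superpositions of coefficient arrays\<close>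

definition mult :: "(nat \<Rightarrow> nat \<Rightarrow> real) \<Rightarrow> (nat \<Rightarrow> nat \<Rightarrow> real) \<Rightarrow> nat \<Rightarrow> nat \<Rightarrow> real" where
  "mult c b k j = c k j * b k j"

lemma ctame_mult': "ctame c \<Longrightarrow> ctame b \<Longrightarrow> ctame (mult c b)"
  unfolding mult_def[abs_def] by (rule ctame_mult)

lemma term_bound_mono: "(\<And>j. j \<in> {1..d k} \<Longrightarrow> \<bar>a k j\<bar> \<le> \<bar>b k j\<bar>) \<Longrightarrow> term_bound a k \<le> term_bound b k"
  unfolding term_bound_def using zonal_sup_nonneg[of k] by (intro mult_right_mono sum_mono) auto

lemma series_lincomb:
  assumes "ctame c" "ctame p" "ctame q" "norm x < 1"
  shows "series (mult c (\<lambda>k j. p k j + e * q k j)) x = series (mult c p) x + e * series (mult c q) x"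
proof -
  have "(\<lambda>k. hterm (mult c p) x k + e * hterm (mult c q) x k) sums (series (mult c p) x + e * series (mult c q) x)"
    by (intro sums_add sums_mult hterm_sums ctame_mult' assms)
  moreover have "hterm (mult c (\<lambda>k j. p k j + e * q k j)) x k = hterm (mult c p) x k + e * hterm (mult c q) x k" for k
    by (simp add: hterm_def mult_def sum_distrib_left sum.distrib algebra_simps)
  ultimately show ?thesis
    by (simp add: series_def sums_iff)
qed

text \<open>Domination by \<open>w i * u k\<close>, with a \<open>tame\<close> u independent of i,
  justifies interchanging the sums over i and k. The array of ones in place of c gives the
  superposed function, and c itself gives its image under the multiplier.\<close>

lemma superposition:
  assumes c: "ctame c" and u: "tame u" and g: "\<And>i k j. j \<in> {1..d k} \<Longrightarrow> \<bar>g i k j\<bar> \<le> u k"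
    and w: "summable w" and \<epsilon>: "\<And>i::nat. \<bar>\<epsilon> i\<bar> \<le> w i"
  defines "b \<equiv> \<lambda>k j. \<Sum>i. \<epsilon> i * g i k j"
  shows "ctame b" and "norm x < 1 \<Longrightarrow> (\<lambda>i. \<epsilon> i * series (mult c (g i)) x) sums series (mult c b) x"
proof -
  have w0: "0 \<le> w i" for i
    using \<epsilon>[of i] by linarith
  have sm: "summable (\<lambda>i. \<epsilon> i * g i k j)" and bk: "\<bar>b k j\<bar> \<le> \<bar>(\<Sum>i. w i) * u k\<bar>" if j: "j \<in> {1..d k}" for k j
  proof -
    have le: "norm (\<epsilon> i * g i k j) \<le> w i * u k" for i
      unfolding real_norm_def abs_mult using \<epsilon> g[OF j] w0 by (intro mult_mono) auto
    show "summable (\<lambda>i. \<epsilon> i * g i k j)"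
      by (rule summable_comparison_test'[OF summable_mult2[OF w], of 0]) (rule le)
    have "norm (b k j) \<le> (\<Sum>i. w i * u k)"
      unfolding b_def by (rule norm_suminf_le[OF le summable_mult2[OF w]])
    also have "\<dots> = (\<Sum>i. w i) * u k"
      by (rule suminf_mult2[OF w, symmetric])
    finally show "\<bar>b k j\<bar> \<le> \<bar>(\<Sum>i. w i) * u k\<bar>"
      by simp
  qed
  show "ctame b"
    by (rule ctame_mono[OF ctame_tame[OF tame_mult[OF tame_const u]] bk])
  assume x: "norm x < 1"
  let ?v = "\<lambda>k. norm x ^ k * term_bound (mult c (\<lambda>k j. u k)) k"
  have "(\<lambda>i. \<Sum>k. \<epsilon> i * hterm (mult c (g i)) x k) sums (\<Sum>k. \<Sum>i. \<epsilon> i * hterm (mult c (g i)) x k)"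
  proof (rule double_series_swap[OF _ w])
    show "summable ?v"
      by (intro term_bound_summable ctame_mult' c ctame_tame u x) auto
    fix i k
    have "\<bar>hterm (mult c (g i)) x k\<bar> \<le> norm x ^ k * term_bound (mult c (g i)) k"
      by (rule abs_hterm_le)
    also have "\<dots> \<le> ?v k"
    proof (intro mult_left_mono term_bound_mono)
      show "\<bar>mult c (g i) k j\<bar> \<le> \<bar>mult c (\<lambda>k j. u k) k j\<bar>" if "j \<in> {1..d k}" for j
        unfolding mult_def abs_mult using g[OF that, of i] by (intro mult_left_mono) auto
    qed simp
    finally show "\<bar>\<epsilon> i * hterm (mult c (g i)) x k\<bar> \<le> w i * ?v k"
      unfolding abs_mult using \<epsilon> w0 by (intro mult_mono) auto
  qed
  moreover have "(\<Sum>k. \<epsilon> i * hterm (mult c (g i)) x k) = \<epsilon> i * series (mult c (g i)) x" for i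
  proof -
    have "ctame (g i)"
      by (rule ctame_mono[OF ctame_tame[OF u]]) (meson g abs_ge_self order_trans)
    from series_eq[OF ctame_mult'[OF c this] x] show ?thesis
      by (simp add: suminf_mult)
  qed
  moreover have "(\<Sum>i. \<epsilon> i * hterm (mult c (g i)) x k) = hterm (mult c b) x k" for k
  proof -
    have "(\<Sum>i. \<epsilon> i * hterm (mult c (g i)) x k) = (\<Sum>i. \<Sum>j=1..d k. (c k j * H k j x) * (\<epsilon> i * g i k j))"
      by (simp add: hterm_def mult_def sum_distrib_left mult_ac)
    also have "\<dots> = (\<Sum>j=1..d k. \<Sum>i. (c k j * H k j x) * (\<epsilon> i * g i k j))"
      by (intro suminf_sum summable_mult sm)
    also have "\<dots> = (\<Sum>j=1..d k. (c k j * H k j x) * b k j)"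
      unfolding b_def by (intro sum.cong refl suminf_mult sm)
    finally show ?thesis
      by (simp add: hterm_def mult_def mult_ac)
  qed
  ultimately show "(\<lambda>i. \<epsilon> i * series (mult c (g i)) x) sums series (mult c b) x"
    by (simp add: series_def[of "mult c b"])
qed

lemma mult_1: "mult (\<lambda>k j. 1) b = b"
  by (intro ext) (simp add: mult_def)

lemma ctame_1: "ctame (\<lambda>k j. 1)"
  by (rule ctame_tame[OF tame_const])

text \<open>The witness \<open>b\<close> has coefficients that decay only polynomially, so \<open>c\<close> grows no faster than \<open>c b\<close>.\<close>
lemma multiplier_tame:
  assumes t: "0 < t" and \<alpha>: "\<alpha> \<ge> 0" and c: "c \<in> MH Y d (Hspace (ennreal t) \<alpha>) (Hspace s \<beta>)"
  shows "ctame c"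
proof -
  \<comment> \<open>The squared factor 1 + k makes the term bounds of b summable; the squared factor
    1 + \<open>zonal_sup k\<close> absorbs the number of terms of degree k and the size of the
    \<open>H k j\<close>. The product is still \<open>tame\<close>.\<close>
  define \<omega> where "\<omega> k = (1 + real k) * (1 + real k) * ((1 + zonal_sup k) * (1 + zonal_sup k))" for k
  have \<omega>1: "\<omega> k \<ge> 1" for k
  proof -
    have "1 * 1 \<le> (1 + real k) * (1 + real k)" "1 * 1 \<le> (1 + zonal_sup k) * (1 + zonal_sup k)"
      using zonal_sup_nonneg[of k] by (intro mult_mono; simp)+
    then show ?thesis
      unfolding \<omega>_def using mult_mono[of 1 "(1 + real k) * (1 + real k)" 1 "(1 + zonal_sup k) * (1 + zonal_sup k)"] by simp
  qed
  have \<omega>t: "tame \<omega>"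
    unfolding \<omega>_def[abs_def] by (intro tame_mult tame_add tame_const tame_zonal_sup tame_linear)
  define b where "b k j = (if j \<in> {1..d k} then 1 / \<omega> k else 0)" for k j
  have b: "ctame b"
  proof (rule ctame_mono[OF ctame_1])
    show "\<bar>b k j\<bar> \<le> \<bar>1\<bar>" for k j
      using \<omega>1[of k] by (simp add: b_def divide_le_eq)
  qed
  have cb: "term_bound b k \<le> inverse ((real (Suc k))\<^sup>2)" for k
  proof -
    have "term_bound b k = real (d k) * (1 / \<omega> k) * (1 + zonal_sup k)"
      using order_trans[OF zero_le_one \<omega>1[of k]] by (simp add: term_bound_def b_def)
    also have "\<dots> \<le> (1 + zonal_sup k) * (1 / \<omega> k) * (1 + zonal_sup k)"
      using d_le_zonal_sup[of k] zonal_sup_nonneg[of k] order_trans[OF zero_le_one \<omega>1[of k]] by (intro mult_right_mono) auto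
    also have "\<dots> = inverse ((real (Suc k))\<^sup>2)"
      using zonal_sup_nonneg[of k] by (simp add: \<omega>_def power2_eq_square divide_simps)
    finally show ?thesis .
  qed
  have sq: "summable (\<lambda>k. inverse ((real (Suc k))\<^sup>2))"
    using inverse_power_summable[of 2] by (subst summable_Suc_iff) auto
  define B where "B = (\<Sum>k. inverse ((real (Suc k))\<^sup>2))"
  have B: "B \<ge> 0"
    unfolding B_def by (rule suminf_nonneg[OF sq]) simp
  have sb: "\<bar>series b (r *\<^sub>R x)\<bar> \<le> B" if r: "0 \<le> r" "r < 1" and x: "norm x = 1" for r x
  proof -
    have "r ^ k * term_bound b k \<le> inverse ((real (Suc k))\<^sup>2)" for k
      using cb[of k] r term_bound_nonneg[of b k] by (intro order_trans[OF mult_left_le_one_le]) (auto simp: power_le_one)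
    then have "(\<Sum>k. r ^ k * term_bound b k) \<le> B"
      unfolding B_def by (intro suminf_le term_bound_summable b r sq)
    then show ?thesis
      using series_bound[OF b x r] by linarith
  qed
  have "Mfun (ennreal t) (series b) r \<le> ennreal (B * (1 - r) powr (- \<alpha>))" if r: "0 \<le> r" "r < 1" for r
  proof -
    have "Mfun (ennreal t) (series b) r \<le> ennreal B"
      unfolding Mfun_def using t B sb[OF r] by (intro Lnorm_le_bound) auto
    also have "\<dots> \<le> ennreal (B * (1 - r) powr (- \<alpha>))"
      using powr_mono2'[of "- \<alpha>" "1 - r" 1] r \<alpha> B by (intro ennreal_leI) (simp add: mult_left_mono[of 1 _ B, simplified])
    finally show ?thesis .
  qed
  then have f: "series b \<in> Hspace (ennreal t) \<alpha>"
    unfolding Hspace_iff using series_harmonic[OF b] B by blast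
  have hb: "hcoef Y d (series b) = b"
  proof (rule hcoef_eq)
    show "b k j = 0" if "j \<notin> {1..d k}" for k j using that by (auto simp: b_def)
    show "hterm b x sums series b x" if "norm x < 1" for x by (rule hterm_sums[OF b that])
  qed
  let ?h = "hconv Y d c (series b)"
  have "harmonic_on (ball 0 1) ?h" and sm: "\<And>x. norm x < 1 \<Longrightarrow> summable (hterm (\<lambda>k j. c k j * b k j) x)"
    using c f by (auto simp: MH_def Hspace_def hconv_term_eq hb)
  note hh = hcoef_harmonic[OF this(1)]
  have s2: "hterm (\<lambda>k j. c k j * b k j) x sums ?h x" if "norm x < 1" for x
    using sm[OF that] by (simp add: hconv_eq hb series_def summable_sums)
  have eq: "c k j * b k j = hcoef Y d ?h k j" if "j \<in> {1..d k}" for k j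
    by (rule coefficients_unique[OF zero_less_one s2 hh(2) that])
  have "\<bar>c k j\<bar> \<le> \<bar>\<omega> k * hcoef Y d ?h k j\<bar>" if "j \<in> {1..d k}" for k j
    using eq[OF that, symmetric] that \<omega>1[of k] by (simp add: b_def)
  then show ?thesis
    by (rule ctame_mono[OF ctame_mult[OF ctame_tame[OF \<omega>t] hh(1)]])
qed


section \<open>Test functions: size in the source space and their images\<close>

text \<open>Coefficients of the fractional derivative of order \<open>T\<close> of the Poisson kernel with pole \<open>y\<close>, dilated
  by \<open>\<rho>\<close>; the exponent \<open>e\<close> that makes them bounded in \<open>H\<^sup>t\<^sub>\<alpha>\<close> is found in \<open>test_norm\<close>.\<close>
definition test :: "real \<Rightarrow> real \<Rightarrow> real \<Rightarrow> real^'n \<Rightarrow> nat \<Rightarrow> nat \<Rightarrow> real" where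
  "test T e \<rho> y k j = (1 - \<rho>) powr e * (\<rho> ^ k * (gamma_ratio (real CARD('n) / 2) T k * H k j y))"

text \<open>Independent of \<rho> and y, hence one dominating sequence for all superpositions of
  test functions.\<close>

definition test_bound :: "real \<Rightarrow> nat \<Rightarrow> real" where
  "test_bound T k = gamma_ratio (real CARD('n) / 2) T k * (1 + zonal_sup k)"

lemma tame_test_bound: "T > 0 \<Longrightarrow> tame (test_bound T)"
  unfolding test_bound_def[abs_def] by (intro tame_mult tame_gamma_ratio tame_add tame_const tame_zonal_sup) auto

lemma abs_test_le:
  assumes "T > 0" "e \<ge> 0" "0 \<le> \<rho>" "\<rho> < 1" "norm y = 1"
  shows "\<bar>test T e \<rho> y k j\<bar> \<le> test_bound T k"
proof -
  have g: "gamma_ratio (real CARD('n) / 2) T k > 0"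
    using assms by (intro gamma_ratio_pos) auto
  have "\<bar>test T e \<rho> y k j\<bar> = (1 - \<rho>) powr e * (\<rho> ^ k * (gamma_ratio (real CARD('n) / 2) T k * \<bar>H k j y\<bar>))"
    using g assms by (simp add: test_def abs_mult)
  also have "\<dots> \<le> 1 * (1 * (gamma_ratio (real CARD('n) / 2) T k * (1 + zonal_sup k)))"
    using g assms abs_H_le[of y k j] by (intro mult_mono mult_nonneg_nonneg powr_le1 power_le_one) auto
  finally show ?thesis
    by (simp add: test_bound_def)
qed

lemma ctame_test:
  assumes "T > 0" "e \<ge> 0" "0 \<le> \<rho>" "\<rho> < 1" "norm y = 1"
  shows "ctame (test T e \<rho> y)"
proof (rule ctame_mono[OF ctame_tame[OF tame_test_bound[OF assms(1)]]])
  show "\<bar>test T e \<rho> y k j\<bar> \<le> \<bar>test_bound T k\<bar>" for k j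
    using abs_test_le[OF assms, of k j] by linarith
qed

text \<open>Apart from the normalising factor, the dilation and the radius of evaluation enter only
  through their product. This links the norms of the images to \<open>LambdaP\<close> at the radius
  r \<rho>.\<close>

lemma series_mult_test:
  assumes c: "ctame c" and T: "T > 0" and y: "norm y = 1" and "0 \<le> r" "0 \<le> \<rho>" "r * \<rho> < 1" and x: "norm x = 1"
  shows "series (mult c (test T e \<rho> y)) (r *\<^sub>R x) = (1 - \<rho>) powr e * series (lam c T y) ((r * \<rho>) *\<^sub>R x)"
proof -
  have "norm ((r * \<rho>) *\<^sub>R x) < 1"
    using assms by simp
  note s = series_eq[OF ctame_lam[OF c T y] this]
  have "hterm (mult c (test T e \<rho> y)) (r *\<^sub>R x) k = (1 - \<rho>) powr e * hterm (lam c T y) ((r * \<rho>) *\<^sub>R x) k" for k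
    unfolding hterm_scaleR
    by (simp add: hterm_def mult_def test_def lam_def sum_distrib_left power_mult_distrib mult_ac)
  then show ?thesis
    using s by (simp add: series_def suminf_mult)
qed

text \<open>The Poisson kernel has order 1 - n: one from 1 - r^2, and -n from the distance.
  \<open>fractional_kernel_bound\<close> with z = n / 2 lowers this by T; n \<ge> 2 ensures z + T
  \<ge> 1.\<close>

lemma kernel_bound:
  assumes n2: "CARD('n) \<ge> 2" and T: "T > 0"
  shows "\<exists>C\<ge>0. \<forall>x y \<rho>. norm x = 1 \<longrightarrow> norm y = 1 \<longrightarrow> 0 \<le> \<rho> \<longrightarrow> \<rho> < 1 \<longrightarrow>
    \<bar>series (lam (\<lambda>k j. 1) T y) (\<rho> *\<^sub>R x)\<bar> \<le> C * norm (\<rho> *\<^sub>R y - x) powr (1 - real CARD('n) - T)"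
proof -
  let ?n = "real CARD('n)"
  let ?P = "\<lambda>\<xi> r. 1 * r ^ 0 * (1 - r\<^sup>2) ^ 1 * (r - \<xi>) ^ 0 * rad \<xi> r powr (- ?n)"
  have P: "radial_order (1 - ?n) ?P"
    by (rule radial_order.monomial) simp
  obtain C where C: "C \<ge> 0" "\<And>\<xi> a \<rho>. \<bar>\<xi>\<bar> \<le> 1 \<Longrightarrow> (\<forall>r. \<bar>r\<bar> < 1 \<longrightarrow> (\<lambda>k. a k * r ^ k) sums ?P \<xi> r) \<Longrightarrow> 0 \<le> \<rho> \<Longrightarrow> \<rho> < 1 \<Longrightarrow>
      \<bar>\<Sum>k. \<rho> ^ k * gamma_ratio (?n / 2) T k * a k\<bar> \<le> C * rad \<xi> \<rho> powr (1 - ?n - T)"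
    using fractional_kernel_bound[OF P, of "?n / 2" T] n2 T by auto
  have "\<bar>series (lam (\<lambda>k j. 1) T y) (\<rho> *\<^sub>R x)\<bar> \<le> C * norm (\<rho> *\<^sub>R y - x) powr (1 - ?n - T)"
    if x: "norm x = 1" and y: "norm y = 1" and \<rho>: "0 \<le> \<rho>" "\<rho> < 1" for x y \<rho>
  proof -
    define \<xi> where "\<xi> = y \<bullet> x"
    have \<xi>: "\<bar>\<xi>\<bar> \<le> 1"
      using Cauchy_Schwarz_ineq2[of y x] x y by (simp add: \<xi>_def)
    have R: "norm (r *\<^sub>R y - x) = rad \<xi> r" for r
      unfolding \<xi>_def using rad_eq_norm[OF y x] by simp
    have ser: "\<forall>r. \<bar>r\<bar> < 1 \<longrightarrow> (\<lambda>k. Z k y x * r ^ k) sums ?P \<xi> r"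
    proof (intro allI impI)
      fix r :: real assume r: "\<bar>r\<bar> < 1"
      have "(\<lambda>k. Z k (r *\<^sub>R y) x) sums poisson (r *\<^sub>R y) x"
        using r y by (intro Z_sums_poisson x) simp
      then show "(\<lambda>k. Z k y x * r ^ k) sums ?P \<xi> r"
        using y by (simp add: Z_scaleR_left poisson_eq R mult.commute)
    qed
    have "hterm (lam (\<lambda>k j. 1) T y) (\<rho> *\<^sub>R x) k = \<rho> ^ k * gamma_ratio (?n / 2) T k * Z k y x" for k
      unfolding hterm_scaleR by (simp add: hterm_def lam_def Z_def sum_distrib_left mult_ac)
    then have "series (lam (\<lambda>k j. 1) T y) (\<rho> *\<^sub>R x) = (\<Sum>k. \<rho> ^ k * gamma_ratio (?n / 2) T k * Z k y x)"
      by (simp add: series_def)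
    then show ?thesis
      using C(2)[OF \<xi> ser \<rho>] by (simp add: R)
  qed
  then show ?thesis
    using C(1) by blast
qed

text \<open>The t-th power of the kernel bound has exponent -q with q = (n + T - 1) t, and e is
  defined so that q - (n - 1) = (e + \<alpha>) t. Since this is positive,
  \<open>nn_integral_norm_powr\<close> applies and yields the power -(e + \<alpha>) t of 1 - r
  \<rho>.\<close>

lemma test_norm:
  assumes n2: "CARD('n) \<ge> 2" and t: "0 < t" and \<alpha>: "\<alpha> \<ge> 0" and T: "T > 0"
    and e: "e = T + real CARD('n) - 1 - \<alpha> - (real CARD('n) - 1) / t" "e > 0"
  shows "\<exists>C\<ge>0. \<forall>y \<rho> r. norm y = 1 \<longrightarrow> 0 \<le> \<rho> \<longrightarrow> \<rho> < 1 \<longrightarrow> 0 \<le> r \<longrightarrow> r < 1 \<longrightarrow>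
    (\<integral>\<^sup>+x. ennreal (\<bar>series (test T e \<rho> y) (r *\<^sub>R x)\<bar> powr t) \<partial>sphere_measure) \<le> ennreal ((C * (1 - r) powr (- \<alpha>)) powr t)"
proof -
  let ?n = "real CARD('n)"
  obtain C where C: "C \<ge> 0" "\<And>x y \<rho>. norm x = 1 \<Longrightarrow> norm y = 1 \<Longrightarrow> 0 \<le> \<rho> \<Longrightarrow> \<rho> < 1 \<Longrightarrow>
      \<bar>series (lam (\<lambda>k j. 1) T y) (\<rho> *\<^sub>R x)\<bar> \<le> C * norm (\<rho> *\<^sub>R y - x) powr (1 - ?n - T)"
    using kernel_bound[OF n2 T] by blast
  define q where "q = (?n + T - 1) * t"
  have qe: "q - (?n - 1) = (e + \<alpha>) * t"
    using t by (simp add: q_def e(1) field_simps)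
  have "(e + \<alpha>) * t > 0"
    using e(2) \<alpha> t by (intro mult_pos_pos) auto
  then have q: "?n - 1 < q"
    unfolding qe[symmetric] by simp
  define D where "D = 1 + q / (q - ?n + 1)"
  have D: "D \<ge> 0"
    using q n2 by (auto simp: D_def intro!: add_nonneg_nonneg divide_nonneg_nonneg)
  define C' where "C' = C * D powr (1 / t)"
  have C': "C' \<ge> 0"
    using C(1) by (simp add: C'_def)
  have "(\<integral>\<^sup>+x. ennreal (\<bar>series (test T e \<rho> y) (r *\<^sub>R x)\<bar> powr t) \<partial>sphere_measure) \<le> ennreal ((C' * (1 - r) powr (- \<alpha>)) powr t)"
    if y: "norm y = 1" and \<rho>: "0 \<le> \<rho>" "\<rho> < 1" and r: "0 \<le> r" "r < 1" for y \<rho> r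
  proof -
    have "r * \<rho> \<le> 1 * \<rho>" "r * \<rho> \<le> r * 1"
      using \<rho> r by (intro mult_right_mono mult_left_mono; simp)+
    then have w: "0 \<le> r * \<rho>" "r * \<rho> < 1" "1 - \<rho> \<le> 1 - r * \<rho>" "1 - r \<le> 1 - r * \<rho>"
      using \<rho> r by auto
    let ?w = "r * \<rho>"
    let ?a = "(1 - \<rho>) powr e * C"
    have pt: "\<bar>series (test T e \<rho> y) (r *\<^sub>R x)\<bar> powr t \<le> ?a powr t * norm (?w *\<^sub>R y - x) powr (- q)" if x: "norm x = 1" for x
    proof -
      have "series (test T e \<rho> y) (r *\<^sub>R x) = (1 - \<rho>) powr e * series (lam (\<lambda>k j. 1) T y) (?w *\<^sub>R x)"
        using series_mult_test[OF ctame_1 T y r(1) \<rho>(1) w(2) x, of e] by (simp add: mult_1)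
      then have "\<bar>series (test T e \<rho> y) (r *\<^sub>R x)\<bar> \<le> (1 - \<rho>) powr e * (C * norm (?w *\<^sub>R y - x) powr (1 - ?n - T))"
        using C(2)[OF x y w(1,2)] by (simp add: abs_mult mult_left_mono)
      then have "\<bar>series (test T e \<rho> y) (r *\<^sub>R x)\<bar> powr t \<le> (?a * norm (?w *\<^sub>R y - x) powr (1 - ?n - T)) powr t"
        using t by (intro powr_mono2) (auto simp: mult.assoc)
      also have "\<dots> = ?a powr t * norm (?w *\<^sub>R y - x) powr ((1 - ?n - T) * t)"
        using C(1) by (simp add: powr_mult powr_powr)
      also have "(1 - ?n - T) * t = - q"
        by (simp add: q_def algebra_simps)
      finally show ?thesis .
    qed
    have "(\<integral>\<^sup>+x. ennreal (\<bar>series (test T e \<rho> y) (r *\<^sub>R x)\<bar> powr t) \<partial>sphere_measure) \<le>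
        (\<integral>\<^sup>+x. ennreal (?a powr t) * ennreal (norm (?w *\<^sub>R y - x) powr (- q)) \<partial>sphere_measure)"
      using pt by (intro nn_integral_mono) (auto simp: ennreal_leI simp flip: ennreal_mult)
    also have "\<dots> = ennreal (?a powr t) * (\<integral>\<^sup>+x. ennreal (norm (?w *\<^sub>R y - x) powr (- q)) \<partial>sphere_measure)"
    proof (rule nn_integral_cmult)
      note [measurable] = measurable_id_sphere
      show "(\<lambda>x. ennreal (norm (?w *\<^sub>R y - x) powr (- q))) \<in> borel_measurable sphere_measure"
        by measurable
    qed
    also have "\<dots> \<le> ennreal (?a powr t) * ennreal (D * (1 - ?w) powr (?n - 1 - q))"
      unfolding D_def by (intro mult_left_mono nn_integral_norm_powr q y w) auto
    also have "\<dots> = ennreal (?a powr t * (D * (1 - ?w) powr (?n - 1 - q)))"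
      by (simp add: ennreal_mult')
    also have "\<dots> \<le> ennreal ((C' * (1 - r) powr (- \<alpha>)) powr t)"
    proof (rule ennreal_leI)
      have "(1 - ?w) powr (?n - 1 - q) = ((1 - ?w) powr (- e) * (1 - ?w) powr (- \<alpha>)) powr t"
      proof -
        have "?n - 1 - q = (- e + - \<alpha>) * t"
          using qe by (simp add: algebra_simps)
        then show ?thesis
          by (simp only: powr_powr[symmetric] powr_add)
      qed
      \<comment> \<open>The number 1 - r \<rho> is at least 1 - \<rho> and at least 1 - r. The first
        takes the exponent e and cancels the normalisation; the second keeps \<alpha>.\<close>
      also have "\<dots> \<le> ((1 - \<rho>) powr (- e) * (1 - r) powr (- \<alpha>)) powr t"
        using w \<rho> r e \<alpha> t by (intro powr_mono2 mult_mono powr_mono2') auto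
      finally have le: "(1 - ?w) powr (?n - 1 - q) \<le> ((1 - \<rho>) powr (- e) * (1 - r) powr (- \<alpha>)) powr t" .
      have "?a powr t * (D * (1 - ?w) powr (?n - 1 - q)) \<le> ?a powr t * (D * ((1 - \<rho>) powr (- e) * (1 - r) powr (- \<alpha>)) powr t)"
        by (intro mult_left_mono le D) auto
      also have "\<dots> = (?a * D powr (1 / t) * ((1 - \<rho>) powr (- e) * (1 - r) powr (- \<alpha>))) powr t"
        using C(1) D t by (simp add: powr_mult powr_powr mult_ac)
      also have "?a * D powr (1 / t) * ((1 - \<rho>) powr (- e) * (1 - r) powr (- \<alpha>)) =
          ((1 - \<rho>) powr e * (1 - \<rho>) powr (- e)) * (C' * (1 - r) powr (- \<alpha>))"
        by (simp only: C'_def mult_ac)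
      also have "(1 - \<rho>) powr e * (1 - \<rho>) powr (- e) = 1"
        using \<rho> by (simp add: powr_minus)
      finally show "?a powr t * (D * (1 - ?w) powr (?n - 1 - q)) \<le> (C' * (1 - r) powr (- \<alpha>)) powr t"
        by simp
    qed
    finally show ?thesis .
  qed
  then show ?thesis
    using C' by blast
qed

text \<open>Because t-th powers are subadditive, the bounds of the terms add up with weights at most
  3^(- i t). A geometric series thus replaces the triangle inequality, whatever the signs and the
  choice of the g i.\<close>

lemma superposition_Hspace:
  assumes t: "0 < t" "t \<le> 1" and u: "tame u" and g: "\<And>i k j. j \<in> {1..d k} \<Longrightarrow> \<bar>g i k j\<bar> \<le> u k"
    and \<epsilon>: "\<And>i::nat. \<bar>\<epsilon> i\<bar> \<le> (1 / 3) ^ i" and C: "C \<ge> 0"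
    and gn: "\<And>i r. 0 \<le> r \<Longrightarrow> r < 1 \<Longrightarrow>
      (\<integral>\<^sup>+x. ennreal (\<bar>series (g i) (r *\<^sub>R x)\<bar> powr t) \<partial>sphere_measure) \<le> ennreal ((C * (1 - r) powr (- \<alpha>)) powr t)"
  shows "series (\<lambda>k j. \<Sum>i. \<epsilon> i * g i k j) \<in> Hspace (ennreal t) \<alpha>"
proof -
  define b where "b = (\<lambda>k j. \<Sum>i. \<epsilon> i * g i k j)"
  have w: "summable (\<lambda>i. (1 / 3 :: real) ^ i)"
    by (rule summable_geometric) simp
  have b: "ctame b"
    unfolding b_def by (rule superposition(1)[OF ctame_1 u _ w \<epsilon>]) (rule g)
  have sup: "(\<lambda>i. \<epsilon> i * series (g i) x) sums series b x" if "norm x < 1" for x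
    by (rule superposition(2)[OF ctame_1 u _ w \<epsilon>, of g, folded b_def, unfolded mult_1]) (auto intro: g that)
  have ct: "ctame (g i)" for i
    by (rule ctame_mono[OF ctame_tame[OF u]]) (meson g abs_ge_self order_trans)
  define q where "q = (1 / 3 :: real) powr t"
  have q: "0 < q" "q < 1"
    using t powr_less_mono2[of t "1 / 3" 1] by (auto simp: q_def)
  \<comment> \<open>The t-th root of the sum of the geometric series with ratio q.\<close>
  define A where "A = (1 / (1 - q)) powr (1 / t)"
  have At: "A powr t = 1 / (1 - q)"
    using q t by (simp add: A_def powr_powr)
  have "Mfun (ennreal t) (series b) r \<le> ennreal ((A * C) * (1 - r) powr (- \<alpha>))" if r: "0 \<le> r" "r < 1" for r
  proof -
    let ?E = "(C * (1 - r) powr (- \<alpha>)) powr t"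
    note cs = series_continuous_sphere[OF ct r]
    have "(\<integral>\<^sup>+x. ennreal (\<bar>series b (r *\<^sub>R x)\<bar> powr t) \<partial>sphere_measure) \<le>
        (\<integral>\<^sup>+x. (\<Sum>i. ennreal (\<bar>\<epsilon> i * series (g i) (r *\<^sub>R x)\<bar> powr t)) \<partial>sphere_measure)"
    proof (rule nn_integral_mono)
      fix x :: "real^'n" assume "x \<in> space sphere_measure"
      then have x: "norm x = 1" by simp
      then have "norm (r *\<^sub>R x) < 1"
        using r by simp
      note sm = sup[OF this]
      have "summable (\<lambda>i. \<bar>\<epsilon> i * series (g i) (r *\<^sub>R x)\<bar>)"
      proof (rule summable_comparison_test'[OF summable_mult2[OF w, of "\<Sum>k. r ^ k * term_bound (\<lambda>k j. u k) k"], of 0])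
        fix i
        have "\<bar>series (g i) (r *\<^sub>R x)\<bar> \<le> (\<Sum>k. r ^ k * term_bound (g i) k)"
          by (rule series_bound[OF ct x r])
        also have "\<dots> \<le> (\<Sum>k. r ^ k * term_bound (\<lambda>k j. u k) k)"
        proof (intro suminf_le term_bound_summable ct ctame_tame u r mult_left_mono term_bound_mono)
          show "\<bar>g i k j\<bar> \<le> \<bar>u k\<bar>" if "j \<in> {1..d k}" for k j
            using g[OF that, of i] by linarith
        qed (use r in auto)
        finally show "norm \<bar>\<epsilon> i * series (g i) (r *\<^sub>R x)\<bar> \<le> (1 / 3) ^ i * (\<Sum>k. r ^ k * term_bound (\<lambda>k j. u k) k)"
          using \<epsilon>[of i] by (simp add: abs_mult) (intro mult_mono; simp)
      qed
      from suminf_powr_le[OF this t] sums_unique[OF sm]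
      show "ennreal (\<bar>series b (r *\<^sub>R x)\<bar> powr t) \<le> (\<Sum>i. ennreal (\<bar>\<epsilon> i * series (g i) (r *\<^sub>R x)\<bar> powr t))"
        by simp
    qed
    also have "\<dots> = (\<Sum>i. \<integral>\<^sup>+x. ennreal (\<bar>\<epsilon> i * series (g i) (r *\<^sub>R x)\<bar> powr t) \<partial>sphere_measure)"
      by (intro nn_integral_suminf measurable_abs_powr_sphere continuous_on_mult[OF continuous_on_const cs])
    also have "\<dots> \<le> (\<Sum>i. ennreal (?E * q ^ i))"
    proof (intro suminf_le)
      fix i
      have "\<bar>\<epsilon> i\<bar> powr t \<le> ((1 / 3) ^ i) powr t"
        using t \<epsilon> by (intro powr_mono2) auto
      also have "\<dots> = q ^ i"
        by (simp add: q_def powr_powr mult.commute flip: powr_realpow)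
      finally have eq: "\<bar>\<epsilon> i\<bar> powr t \<le> q ^ i" .
      have "(\<integral>\<^sup>+x. ennreal (\<bar>\<epsilon> i * series (g i) (r *\<^sub>R x)\<bar> powr t) \<partial>sphere_measure) =
          (\<integral>\<^sup>+x. ennreal (\<bar>\<epsilon> i\<bar> powr t) * ennreal (\<bar>series (g i) (r *\<^sub>R x)\<bar> powr t) \<partial>sphere_measure)"
        by (simp add: abs_mult powr_mult ennreal_mult)
      also have "\<dots> = ennreal (\<bar>\<epsilon> i\<bar> powr t) * (\<integral>\<^sup>+x. ennreal (\<bar>series (g i) (r *\<^sub>R x)\<bar> powr t) \<partial>sphere_measure)"
        by (rule nn_integral_cmult[OF measurable_abs_powr_sphere[OF cs]])
      also have "\<dots> \<le> ennreal (q ^ i) * ennreal ?E"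
        by (intro mult_mono gn r ennreal_leI eq) auto
      finally show "(\<integral>\<^sup>+x. ennreal (\<bar>\<epsilon> i * series (g i) (r *\<^sub>R x)\<bar> powr t) \<partial>sphere_measure) \<le> ennreal (?E * q ^ i)"
        using q by (simp add: mult.commute ennreal_mult)
    qed auto
    also have "\<dots> = ennreal (\<Sum>i. ?E * q ^ i)"
      using q by (intro suminf_ennreal2 summable_mult summable_geometric) auto
    also have "(\<Sum>i. ?E * q ^ i) = ?E * (1 / (1 - q))"
      using q by (subst suminf_mult) (auto simp: suminf_geometric summable_geometric)
    also have "\<dots> = ((A * C) * (1 - r) powr (- \<alpha>)) powr t"
      by (simp only: powr_mult At mult_ac)
    finally show ?thesis
      unfolding Mfun_def using t C by (subst Lnorm_ennreal_le_iff) (auto simp: A_def)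
  qed
  then show ?thesis
    unfolding Hspace_iff b_def[symmetric] using series_harmonic[OF b] C
    by (auto simp: A_def intro!: exI[of _ "A * C"])
qed

text \<open>Sokal's elementary proof of uniform boundedness: choosing the sign of each term so that the
  \<open>n\<close>-th seminorm of the \<open>n\<close>-th partial sum is large needs no completeness and no gliding hump.\<close>
lemma multiplier_uniform_bound:
  assumes n2: "CARD('n) \<ge> 2" and t: "0 < t" "t \<le> 1" and s: "1 \<le> s" and \<alpha>: "\<alpha> \<ge> 0" and T: "T > 0"
    and e: "e = T + real CARD('n) - 1 - \<alpha> - (real CARD('n) - 1) / t" "e > 0"
    and c: "c \<in> MH Y d (Hspace (ennreal t) \<alpha>) (Hspace s \<beta>)"
  shows "\<exists>B. \<forall>r \<rho> y. 0 \<le> r \<longrightarrow> r < 1 \<longrightarrow> 0 \<le> \<rho> \<longrightarrow> \<rho> < 1 \<longrightarrow> norm y = 1 \<longrightarrow>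
    (1 - r) powr \<beta> * nrm s (\<lambda>x. series (mult c (test T e \<rho> y)) (r *\<^sub>R x)) \<le> B"
proof (rule ccontr)
  assume contr: "\<not> ?thesis"
  have ct: "ctame c"
    by (rule multiplier_tame[OF t(1) \<alpha> c])
  \<comment> \<open>The seminorm at radius r of the image under c; membership in
    \<open>Hspace s \<beta>\<close> bounds these over all r.\<close>
  define N where "N r b = (1 - r) powr \<beta> * nrm s (\<lambda>x. series (mult c b) (r *\<^sub>R x))" for r b
  define L where "L = {0..<1::real} \<times> sphere (0::real^'n) 1"
  define tst where "tst = (\<lambda>(\<rho>, y). test T e \<rho> y)"
  let ?u = "test_bound T"
  have u: "tame ?u"
    by (rule tame_test_bound[OF T])
  have tst_le: "\<bar>tst l k j\<bar> \<le> ?u k" if "l \<in> L" for l k j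
    using that abs_test_le[OF T] e(2) by (auto simp: tst_def L_def)
  have tst_ct: "ctame (tst l)" if "l \<in> L" for l
    using that ctame_test[OF T] e(2) by (auto simp: tst_def L_def)
  have scont: "continuous_on (sphere 0 1) (\<lambda>x. series (mult c b) (r *\<^sub>R x))" if "ctame b" "0 \<le> r" "r < 1" for b r
    by (rule series_continuous_sphere[OF ctame_mult'[OF ct that(1)] that(2,3)])
  have N0: "0 \<le> N r b" for r b
    by (simp add: N_def nrm_nonneg)
  \<comment> \<open>Finite for each r, because \<open>test_bound\<close> dominates the whole family;
    the assumption for contradiction says that these values are unbounded in r.\<close>
  define B where "B r = (SUP l\<in>L. N r (tst l))" for r
  have bdd: "bdd_above ((\<lambda>l. N r (tst l)) ` L)" if r: "0 \<le> r" "r < 1" for r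
  proof (rule bdd_aboveI2)
    fix l assume l: "l \<in> L"
    let ?M = "\<Sum>k. r ^ k * term_bound (mult c (\<lambda>k j. ?u k)) k"
    have "\<bar>series (mult c (tst l)) (r *\<^sub>R x)\<bar> \<le> ?M" if x: "norm x = 1" for x
    proof -
      have "\<bar>series (mult c (tst l)) (r *\<^sub>R x)\<bar> \<le> (\<Sum>k. r ^ k * term_bound (mult c (tst l)) k)"
        by (rule series_bound[OF ctame_mult'[OF ct tst_ct[OF l]] x r])
      also have "\<dots> \<le> ?M"
      proof (intro suminf_le term_bound_summable ctame_mult' ct tst_ct l ctame_tame u r mult_left_mono term_bound_mono)
        show "\<bar>mult c (tst l) k j\<bar> \<le> \<bar>mult c (\<lambda>k j. ?u k) k j\<bar>" for k j
          unfolding mult_def abs_mult using tst_le[OF l, of k j] by (intro mult_left_mono) auto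
      qed (use r in auto)
      finally show ?thesis .
    qed
    moreover have "0 \<le> ?M"
      using r term_bound_nonneg by (intro suminf_nonneg term_bound_summable ctame_mult' ct ctame_tame u r) auto
    ultimately have "nrm s (\<lambda>x. series (mult c (tst l)) (r *\<^sub>R x)) \<le> ?M"
      by (subst nrm_le_iff[OF s scont[OF tst_ct[OF l] r]]) (auto intro!: Lnorm_le_bound exponent_ge_1 s)
    then show "N r (tst l) \<le> (1 - r) powr \<beta> * ?M"
      by (simp add: N_def mult_left_mono)
  qed
  have NB: "N r (tst l) \<le> B r" if "0 \<le> r" "r < 1" "l \<in> L" for r l
    unfolding B_def by (rule cSUP_upper[OF that(3) bdd[OF that(1,2)]])
  \<comment> \<open>The growth 4^n beats the weights 3^(-n) of the superposition, and the quota 3/4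
    leaves a margin over the tail, which costs 1/2.\<close>
  have "\<forall>n::nat. \<exists>r l. 0 \<le> r \<and> r < 1 \<and> l \<in> L \<and> 4 ^ n < B r \<and> 3 / 4 * B r \<le> N r (tst l)"
  proof
    fix n :: nat
    obtain r \<rho> y where r: "0 \<le> r" "r < 1" and l: "0 \<le> \<rho>" "\<rho> < 1" "norm y = 1"
      and big: "4 ^ n < (1 - r) powr \<beta> * nrm s (\<lambda>x. series (mult c (test T e \<rho> y)) (r *\<^sub>R x))"
      using contr by (meson not_le)
    have lL: "(\<rho>, y) \<in> L"
      using l by (simp add: L_def)
    have "4 ^ n < B r"
      using big NB[OF r lL] by (simp add: N_def tst_def)
    moreover have "\<exists>l\<in>L. 3 / 4 * B r \<le> N r (tst l)"
    proof (rule ccontr)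
      assume "\<not> ?thesis"
      then have "B r \<le> 3 / 4 * B r"
        unfolding B_def[of r] using lL by (intro cSUP_least) (auto simp: B_def not_le less_imp_le)
      moreover have "B r > 0"
        using \<open>4 ^ n < B r\<close> by (rule less_trans[rotated]) simp
      ultimately show False by simp
    qed
    ultimately show "\<exists>r l. 0 \<le> r \<and> r < 1 \<and> l \<in> L \<and> 4 ^ n < B r \<and> 3 / 4 * B r \<le> N r (tst l)"
      using r by blast
  qed
  then obtain R l where "\<forall>n::nat. 0 \<le> R n \<and> R n < 1 \<and> l n \<in> L \<and> 4 ^ n < B (R n) \<and> 3 / 4 * B (R n) \<le> N (R n) (tst (l n))"
    by metis
  then have R: "\<And>n. 0 \<le> R n" "\<And>n. R n < 1" and l: "\<And>n. l n \<in> L"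
    and B4: "\<And>n. 4 ^ n < B (R n)" and N34: "\<And>n. 3 / 4 * B (R n) \<le> N (R n) (tst (l n))"
    by auto
  define G where "G n = tst (l n)" for n
  have Gct: "ctame (G n)" for n
    unfolding G_def by (rule tst_ct[OF l])
  define step where "step n e b = (\<lambda>k j. b k j + e * G n k j)" for n e and b :: "nat \<Rightarrow> nat \<Rightarrow> real"
  \<comment> \<open>The sign at stage n depends on the partial sum built so far and makes the n-th
    seminorm of the next partial sum at least that of the weighted n-th term.\<close>
  define pick where "pick n b = (if (1 / 3) ^ n * N (R n) (G n) \<le> N (R n) (step n ((1 / 3) ^ n) b) then (1 / 3) ^ n else - ((1 / 3 :: real) ^ n))" for n b
  define S where "S = rec_nat (\<lambda>k j. 0) (\<lambda>n b. step n (pick n b) b)"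
  have S0: "S 0 = (\<lambda>k j. 0)" and SSuc: "S (Suc n) = step n (pick n (S n)) (S n)" for n
    by (simp_all add: S_def)
  define \<epsilon> where "\<epsilon> n = pick n (S n)" for n
  have \<epsilon>: "\<bar>\<epsilon> n\<bar> = (1 / 3) ^ n" for n
    by (simp add: \<epsilon>_def pick_def power_abs)
  have Sct: "ctame (S n)" for n
  proof (induction n)
    case 0
    show ?case
      unfolding S0 by (rule ctame_tame[OF tame_const])
  next
    case (Suc n)
    have "ctame (\<lambda>k j. \<epsilon> n * G n k j)"
      by (intro ctame_mult Gct ctame_tame tame_const)
    then have 1: "tame (\<lambda>k. (\<Sum>j=1..d k. \<bar>S n k j\<bar>) + (\<Sum>j=1..d k. \<bar>\<epsilon> n * G n k j\<bar>))"
      using Suc unfolding ctame_def by (intro tame_add)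
    have "\<bar>\<Sum>j=1..d k. \<bar>S (Suc n) k j\<bar>\<bar> \<le> \<bar>(\<Sum>j=1..d k. \<bar>S n k j\<bar>) + (\<Sum>j=1..d k. \<bar>\<epsilon> n * G n k j\<bar>)\<bar>" for k
    proof -
      have "(\<Sum>j=1..d k. \<bar>S (Suc n) k j\<bar>) \<le> (\<Sum>j=1..d k. \<bar>S n k j\<bar> + \<bar>\<epsilon> n * G n k j\<bar>)"
        unfolding SSuc step_def \<epsilon>_def by (intro sum_mono abs_triangle_ineq)
      then show ?thesis
        by (simp add: sum.distrib sum_nonneg)
    qed
    then show ?case
      unfolding ctame_def by (rule tame_mono[OF 1])
  qed
  have lin: "series (mult c (step n a (S n))) (r *\<^sub>R x) = series (mult c (S n)) (r *\<^sub>R x) + a * series (mult c (G n)) (r *\<^sub>R x)"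
    if "0 \<le> r" "r < 1" "norm x = 1" for n a r x
    unfolding step_def using that by (intro series_lincomb ct Sct Gct) simp
  \<comment> \<open>If adding the term fails, subtracting it works: the term is half the difference
    of the two candidates, so their seminorms together are at least twice the seminorm of the
    term.\<close>
  have large: "(1 / 3) ^ n * N (R n) (G n) \<le> N (R n) (S (Suc n))" for n
  proof (cases "(1 / 3) ^ n * N (R n) (G n) \<le> N (R n) (step n ((1 / 3) ^ n) (S n))")
    case True
    then show ?thesis
      by (simp add: SSuc pick_def)
  next
    case False
    define a where "a = (1 / 3 :: real) ^ n"
    have a: "a > 0"
      by (simp add: a_def)
    let ?F = "\<lambda>x. series (mult c (S n)) (R n *\<^sub>R x)" and ?g = "\<lambda>x. series (mult c (G n)) (R n *\<^sub>R x)"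
    have cF: "continuous_on (sphere 0 1) ?F" and cg: "continuous_on (sphere 0 1) ?g"
      by (rule scont[OF Sct R], rule scont[OF Gct R])
    have Nst: "N (R n) (step n x (S n)) = (1 - R n) powr \<beta> * nrm s (\<lambda>z. ?F z + x * ?g z)" for x
      unfolding N_def nrm_def by (subst Lnorm_cong[OF lin[OF R]]) auto
    let ?P = "\<lambda>z. ?F z + a * ?g z" and ?Q = "\<lambda>z. ?F z + (- a) * ?g z"
    have cP: "continuous_on (sphere 0 1) ?P" and cQ: "continuous_on (sphere 0 1) ?Q"
      by (intro continuous_on_add continuous_on_mult continuous_on_const cF cg)+
    have "?g = (\<lambda>z. 1 / (2 * a) * (?P z + (- 1) * ?Q z))"
      using a by (auto simp: fun_eq_iff field_simps)
    then have "nrm s ?g = nrm s (\<lambda>z. 1 / (2 * a) * (?P z + (- 1) * ?Q z))"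
      by simp
    also have "\<dots> \<le> \<bar>1 / (2 * a)\<bar> * nrm s (\<lambda>z. ?P z + (- 1) * ?Q z)"
      by (intro nrm_cmult_le[OF s] continuous_on_add continuous_on_mult continuous_on_const cP cQ)
    also have "\<dots> \<le> \<bar>1 / (2 * a)\<bar> * (nrm s ?P + nrm s (\<lambda>z. (- 1) * ?Q z))"
      by (intro mult_left_mono nrm_triangle[OF s cP] continuous_on_mult continuous_on_const cQ) auto
    also have "\<dots> \<le> \<bar>1 / (2 * a)\<bar> * (nrm s ?P + \<bar>- 1\<bar> * nrm s ?Q)"
      by (intro mult_left_mono add_left_mono nrm_cmult_le[OF s cQ]) auto
    finally have "2 * a * nrm s ?g \<le> nrm s ?P + nrm s ?Q"
      using a by (simp add: field_simps)
    then have "(1 - R n) powr \<beta> * (2 * a * nrm s ?g) \<le> (1 - R n) powr \<beta> * (nrm s ?P + nrm s ?Q)"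
      by (intro mult_left_mono) auto
    then have "2 * (a * N (R n) (G n)) \<le> N (R n) (step n a (S n)) + N (R n) (step n (- a) (S n))"
      unfolding Nst by (simp add: N_def distrib_left mult_ac)
    then have "a * N (R n) (G n) \<le> N (R n) (step n (- a) (S n))"
      using False unfolding a_def[symmetric] by linarith
    then show ?thesis
      using False by (simp add: SSuc pick_def a_def)
  qed
  define b where "b = (\<lambda>k j. \<Sum>i. \<epsilon> i * G i k j)"
  have w: "summable (\<lambda>i. (1 / 3 :: real) ^ i)"
    by (rule summable_geometric) simp
  have Gle: "\<bar>G i k j\<bar> \<le> ?u k" for i k j
    unfolding G_def by (rule tst_le[OF l])
  have sup: "ctame b" "norm x < 1 \<Longrightarrow> (\<lambda>i. \<epsilon> i * series (mult c (G i)) x) sums series (mult c b) x" for x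
    unfolding b_def
    by (rule superposition[OF ct u _ w eq_refl[OF \<epsilon>]]; use Gle in simp)+
  obtain C where C: "C \<ge> 0" "\<And>y \<rho> r. norm y = 1 \<Longrightarrow> 0 \<le> \<rho> \<Longrightarrow> \<rho> < 1 \<Longrightarrow> 0 \<le> r \<Longrightarrow> r < 1 \<Longrightarrow>
    (\<integral>\<^sup>+x. ennreal (\<bar>series (test T e \<rho> y) (r *\<^sub>R x)\<bar> powr t) \<partial>sphere_measure) \<le> ennreal ((C * (1 - r) powr (- \<alpha>)) powr t)"
    using test_norm[OF n2 t(1) \<alpha> T e] by blast
  have Gn: "(\<integral>\<^sup>+x. ennreal (\<bar>series (G i) (r *\<^sub>R x)\<bar> powr t) \<partial>sphere_measure) \<le> ennreal ((C * (1 - r) powr (- \<alpha>)) powr t)"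
    if "0 \<le> r" "r < 1" for i r
    using l[of i] C(2) that by (cases "l i") (auto simp: G_def tst_def L_def)
  have f: "series b \<in> Hspace (ennreal t) \<alpha>"
    unfolding b_def by (rule superposition_Hspace[OF t u Gle eq_refl[OF \<epsilon>] C(1) Gn])
  have hb: "hcoef Y d (series b) = (\<lambda>k j. if j \<in> {1..d k} then b k j else 0)"
  proof (rule hcoef_eq)
    fix x :: "real^'n" assume "norm x < 1"
    then have "hterm b x sums series b x"
      by (rule hterm_sums[OF sup(1)])
    moreover have "hterm (\<lambda>k j. if j \<in> {1..d k} then b k j else 0) x = hterm b x"
      by (auto simp: hterm_def fun_eq_iff intro!: sum.cong)
    ultimately show "hterm (\<lambda>k j. if j \<in> {1..d k} then b k j else 0) x sums series b x"
      by simp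
  qed auto
  have hc: "hconv Y d c (series b) = series (mult c b)"
    unfolding hconv_eq[abs_def] hb series_def hterm_def mult_def
    by (intro ext suminf_cong sum.cong) auto
  have "hconv Y d c (series b) \<in> Hspace s \<beta>"
    using c f by (simp add: MH_def)
  then obtain D where D: "D \<ge> 0" "\<And>r. 0 \<le> r \<Longrightarrow> r < 1 \<Longrightarrow> Mfun s (series (mult c b)) r \<le> ennreal (D * (1 - r) powr (- \<beta>))"
    unfolding Hspace_iff hc by blast
  have ND: "N r b \<le> D" if r: "0 \<le> r" "r < 1" for r
  proof -
    have "nrm s (\<lambda>x. series (mult c b) (r *\<^sub>R x)) \<le> D * (1 - r) powr (- \<beta>)"
      using D(2)[OF r] D(1) by (subst nrm_le_iff[OF s scont[OF sup(1) r]]) (auto simp: Mfun_def)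
    then show ?thesis
      using r by (simp add: N_def powr_minus field_simps)
  qed
  \<comment> \<open>\<open>S (Suc n)\<close> is the full sum minus the terms of index above n. At
    radius \<open>R n\<close> these have seminorms at most 3^(-i) \<open>B (R n)\<close>, in total
    half of 3^(-n) \<open>B (R n)\<close>, and the full sum contributes at most D.\<close>
  have small: "(3 / 4) * ((1 / 3) ^ n * B (R n)) \<le> D + (1 / 2) * ((1 / 3) ^ n * B (R n))" for n
  proof -
    let ?r = "R n"
    define p where "p = (1 - ?r) powr \<beta>"
    have p: "p > 0"
      using R[of n] by (simp add: p_def)
    let ?f = "\<lambda>x. series (mult c b) (?r *\<^sub>R x)" and ?g = "\<lambda>i x. series (mult c (G i)) (?r *\<^sub>R x)"
    \<comment> \<open>Entry 0 is the full sum and the later entries are the tail from index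
      \<open>Suc n\<close> on, so a single countable triangle inequality covers both.\<close>
    define A where "A i = (case i of 0 \<Rightarrow> ?f | Suc i \<Rightarrow> (\<lambda>x. \<epsilon> (i + Suc n) * ?g (i + Suc n) x))" for i
    define \<kappa> where "\<kappa> i = (case i of 0 \<Rightarrow> nrm s ?f | Suc i \<Rightarrow> (1 / 3) ^ i * ((1 / 3) ^ Suc n * (B ?r / p)))" for i
    have cg: "continuous_on (sphere 0 1) (?g i)" for i
      by (rule scont[OF Gct R])
    have S_eq: "series (mult c (S m)) (?r *\<^sub>R x) = (\<Sum>i<m. \<epsilon> i * ?g i x)" if x: "norm x = 1" for m x
    proof (induction m)
      case 0
      show ?case
        by (simp add: S0 mult_def series_def hterm_def)
    next
      case (Suc m)
      then show ?case
        using lin[OF R x, of m "\<epsilon> m"] by (simp add: SSuc \<epsilon>_def)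
    qed
    have sm: "(\<lambda>i. \<epsilon> i * ?g i x) sums ?f x" if x: "norm x = 1" for x
      using R[of n] x by (intro sup(2)) simp
    have abs_sm: "summable (\<lambda>i. \<bar>\<epsilon> i * ?g i x\<bar>)" if x: "norm x = 1" for x
    proof (rule summable_comparison_test'[OF summable_mult2[OF w, of "\<Sum>k. ?r ^ k * term_bound (mult c (\<lambda>k j. ?u k)) k"], of 0])
      fix i
      have "\<bar>?g i x\<bar> \<le> (\<Sum>k. ?r ^ k * term_bound (mult c (G i)) k)"
        by (rule series_bound[OF ctame_mult'[OF ct Gct] x R])
      also have "\<dots> \<le> (\<Sum>k. ?r ^ k * term_bound (mult c (\<lambda>k j. ?u k)) k)"
      proof (intro suminf_le term_bound_summable ctame_mult' ct Gct ctame_tame u R mult_left_mono term_bound_mono)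
        show "\<bar>mult c (G i) k j\<bar> \<le> \<bar>mult c (\<lambda>k j. ?u k) k j\<bar>" for k j
          unfolding mult_def abs_mult using Gle[of i k j] by (intro mult_left_mono) auto
      qed (use R in auto)
      finally show "norm \<bar>\<epsilon> i * ?g i x\<bar> \<le> (1 / 3) ^ i * (\<Sum>k. ?r ^ k * term_bound (mult c (\<lambda>k j. ?u k)) k)"
        by (simp add: abs_mult \<epsilon> mult_left_mono)
    qed
    have "nrm s (\<lambda>x. series (mult c (S (Suc n))) (?r *\<^sub>R x)) \<le> (\<Sum>i. \<kappa> i)"
    proof (rule nrm_series_le[OF s, where F = A])
      show "continuous_on (sphere 0 1) (A i)" for i
        unfolding A_def using scont[OF sup(1) R] continuous_on_mult[OF continuous_on_const cg]
        by (cases i) auto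
      show "continuous_on (sphere 0 1) (\<lambda>x. series (mult c (S (Suc n))) (?r *\<^sub>R x))"
        by (rule scont[OF Sct R])
      show A1: "summable (\<lambda>i. \<bar>A i x\<bar>)" if x: "norm x = 1" for x
        using summable_ignore_initial_segment[OF abs_sm[OF x], of "Suc n"]
        by (subst summable_Suc_iff[symmetric]) (simp add: A_def)
      show "\<bar>series (mult c (S (Suc n))) (?r *\<^sub>R x)\<bar> \<le> (\<Sum>i. \<bar>A i x\<bar>)" if x: "norm x = 1" for x
      proof -
        let ?a = "\<lambda>i. \<epsilon> i * ?g i x"
        have s1: "summable ?a"
          using sm[OF x] by (rule sums_summable)
        have "?f x = (\<Sum>i. ?a (i + Suc n)) + (\<Sum>i<Suc n. ?a i)"
          using suminf_split_initial_segment[OF s1, of "Suc n"] sums_unique[OF sm[OF x]] by simp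
        then have "series (mult c (S (Suc n))) (?r *\<^sub>R x) = ?f x - (\<Sum>i. ?a (i + Suc n))"
          unfolding S_eq[OF x] by simp
        moreover have "\<bar>\<Sum>i. ?a (i + Suc n)\<bar> \<le> (\<Sum>i. \<bar>?a (i + Suc n)\<bar>)"
          by (rule summable_rabs[OF summable_ignore_initial_segment[OF abs_sm[OF x]]])
        moreover have "(\<Sum>i. \<bar>A i x\<bar>) = \<bar>?f x\<bar> + (\<Sum>i. \<bar>?a (i + Suc n)\<bar>)"
          using suminf_split_head[OF A1[OF x]] by (simp add: A_def)
        ultimately show ?thesis
          by linarith
      qed
      show "nrm s (A i) \<le> \<kappa> i" for i
      proof (cases i)
        case 0
        then show ?thesis
          by (simp add: A_def \<kappa>_def)
      next
        case (Suc i')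
        let ?i = "i' + Suc n"
        have "nrm s (A i) \<le> \<bar>\<epsilon> ?i\<bar> * nrm s (?g ?i)"
          unfolding A_def Suc nat.case by (rule nrm_cmult_le[OF s cg])
        also have "\<dots> \<le> (1 / 3) ^ ?i * (B ?r / p)"
        proof -
          have "p * nrm s (?g ?i) \<le> B ?r"
            using NB[OF R l, of n ?i] by (simp add: N_def G_def p_def)
          then have "nrm s (?g ?i) \<le> B ?r / p"
            using p by (simp add: field_simps)
          then show ?thesis
            unfolding \<epsilon> by (intro mult_left_mono) auto
        qed
        also have "\<dots> = \<kappa> i"
          by (simp add: \<kappa>_def Suc power_add)
        finally show ?thesis .
      qed
      show \<kappa>s: "summable \<kappa>"
        using summable_mult2[OF w] by (subst summable_Suc_iff[symmetric]) (simp add: \<kappa>_def)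
    qed
    also have "(\<Sum>i. \<kappa> i) = nrm s ?f + (3 / 2) * ((1 / 3) ^ Suc n * (B ?r / p))"
    proof -
      have "(\<lambda>i. \<kappa> (Suc i)) sums ((3 / 2) * ((1 / 3) ^ Suc n * (B ?r / p)))"
        using sums_mult2[OF geometric_sums[of "1 / 3 :: real"], of "(1 / 3) ^ Suc n * (B ?r / p)"] by (simp add: \<kappa>_def)
      then have "\<kappa> sums ((3 / 2) * ((1 / 3) ^ Suc n * (B ?r / p)) + \<kappa> 0)"
        by (subst (asm) sums_Suc_iff) simp
      moreover have "\<kappa> 0 = nrm s ?f"
        by (simp add: \<kappa>_def)
      ultimately show ?thesis
        using sums_unique[of \<kappa>] by (simp only: add.commute)
    qed
    finally have "p * nrm s (\<lambda>x. series (mult c (S (Suc n))) (?r *\<^sub>R x)) \<le> p * (nrm s ?f + (3 / 2) * ((1 / 3) ^ Suc n * (B ?r / p)))"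
      using p by (intro mult_left_mono) auto
    then have "N ?r (S (Suc n)) \<le> N ?r b + (1 / 2) * ((1 / 3) ^ n * B ?r)"
      unfolding N_def p_def[symmetric] using p by (simp add: algebra_simps)
    moreover have "(1 / 3) ^ n * (3 / 4 * B ?r) \<le> (1 / 3) ^ n * N ?r (G n)"
      unfolding G_def by (intro mult_left_mono N34) simp
    then have "3 / 4 * ((1 / 3) ^ n * B ?r) \<le> (1 / 3) ^ n * N ?r (G n)"
      by (simp only: mult.left_commute)
    ultimately show ?thesis
      using large[of n] ND[OF R, of n] by linarith
  qed
  \<comment> \<open>The difference 3/4 - 1/2 leaves a quarter of 3^(-n) \<open>B (R n)\<close> below
    D, while \<open>B (R n)\<close> exceeds 4^n.\<close>
  have "(4 / 3) ^ n \<le> 4 * D" for n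
  proof -
    have "(4 / 3 :: real) ^ n = (1 / 3) ^ n * 4 ^ n"
      by (simp flip: power_mult_distrib)
    also have "\<dots> \<le> (1 / 3) ^ n * B (R n)"
      using B4[of n] by (intro mult_left_mono) auto
    finally show ?thesis
      using small[of n] by linarith
  qed
  moreover obtain n where "4 * D < (4 / 3 :: real) ^ n"
    using real_arch_pow[of "4 / 3" "4 * D"] by auto
  ultimately show False
    by (meson not_le)
qed

theorem multiplier_necessary:
  assumes n2: "CARD('n) \<ge> 2" and t: "0 < t" "t \<le> 1" and s: "1 \<le> s" and \<alpha>: "\<alpha> \<ge> 0" and \<beta>: "\<beta> > 0"
    and m: "m > \<alpha> + (real CARD('n) - 1) / t - real CARD('n)" "m > -1"
    and c: "c \<in> MH Y d (Hspace (ennreal t) \<alpha>) (Hspace s \<beta>)"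
  shows "\<forall>x\<in>ball 0 1. summable (gc_term Y d c x)" and "harmonic_on (ball 0 1) (gc Y d c)"
    and "Ts Y d c s t \<alpha> \<beta> m < \<infinity>"
proof -
  let ?n = "real CARD('n)"
  define T where "T = m + 1"
  \<comment> \<open>The lower bound on m is equivalent to e > 0, and the exponent \<open>E\<close>
    of the weight in \<open>Ts\<close> is \<beta> + e.\<close>
  define e where "e = T + ?n - 1 - \<alpha> - (?n - 1) / t"
  define E where "E = \<beta> - \<alpha> + m + ?n - (?n - 1) / t"
  have T: "T > 0"
    using m by (simp add: T_def)
  have e: "e > 0" "E = \<beta> + e"
    using m by (simp_all add: e_def E_def T_def)
  have ct: "ctame c"
    by (rule multiplier_tame[OF t(1) \<alpha> c])
  show "\<forall>x\<in>ball 0 1. summable (gc_term Y d c x)"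
    using series_eq[OF ct] by (auto simp: gc_term_eq)
  have "gc Y d c = series c"
    by (intro ext) (rule gc_eq)
  then show "harmonic_on (ball 0 1) (gc Y d c)"
    using series_harmonic[OF ct] by simp
  obtain B where B: "\<And>r \<rho> y. 0 \<le> r \<Longrightarrow> r < 1 \<Longrightarrow> 0 \<le> \<rho> \<Longrightarrow> \<rho> < 1 \<Longrightarrow> norm y = 1 \<Longrightarrow>
      (1 - r) powr \<beta> * nrm s (\<lambda>x. series (mult c (test T e \<rho> y)) (r *\<^sub>R x)) \<le> B"
    using multiplier_uniform_bound[OF n2 t s \<alpha> T e_def e(1) c] by blast
  have "ennreal ((1 - \<rho>) powr E) * Lnorm s (\<lambda>x'. LambdaP Y d c (m + 1) x' \<rho> y) \<le> ennreal (2 powr E * B)"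
    if \<rho>: "0 \<le> \<rho>" "\<rho> < 1" and y: "norm y = 1" for \<rho> y
  proof -
    \<comment> \<open>The radius \<rho> is shared equally between the dilation of the test function
      and the radius of evaluation. Then 1 - \<rho> \<le> 2 (1 - r) lets the weights with exponents
      \<beta> and e combine into the one with exponent \<open>E\<close>.\<close>
    define r where "r = sqrt \<rho>"
    have r: "0 \<le> r" "r < 1" "r * r = \<rho>"
      using \<rho> by (auto simp: r_def)
    let ?F = "\<lambda>x. series (lam c T y) (\<rho> *\<^sub>R x)"
    have cF: "continuous_on (sphere 0 1) ?F"
      by (rule series_continuous_sphere[OF ctame_lam[OF ct T y] \<rho>])
    let ?g = "\<lambda>x. series (mult c (test T e r y)) (r *\<^sub>R x)"
    have g: "?g x = (1 - r) powr e * ?F x" if "norm x = 1" for x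
      using series_mult_test[OF ct T y r(1) r(1) _ that, of e] r \<rho> by simp
    have cg: "continuous_on (sphere 0 1) ?g"
      by (rule series_continuous_sphere[OF ctame_mult'[OF ct ctame_test[OF T less_imp_le[OF e(1)] r(1,2) y]] r(1,2)])
    have "nrm s ?F = nrm s (\<lambda>x. (1 - r) powr (- e) * ?g x)"
      unfolding nrm_def using r by (subst Lnorm_cong[of ?F "\<lambda>x. (1 - r) powr (- e) * ?g x"]) (auto simp: g powr_minus)
    also have "\<dots> \<le> \<bar>(1 - r) powr (- e)\<bar> * nrm s ?g"
      by (rule nrm_cmult_le[OF s cg])
    finally have F: "nrm s ?F \<le> (1 - r) powr (- e) * nrm s ?g"
      by simp
    have "1 - \<rho> = (1 - r) * (1 + r)"
      using r(3) by (simp add: algebra_simps)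
    also have "\<dots> \<le> (1 - r) * 2"
      using r by (intro mult_left_mono) auto
    finally have "(1 - \<rho>) powr E \<le> (2 * (1 - r)) powr E"
      using \<rho> e \<beta> by (intro powr_mono2) auto
    also have "\<dots> = 2 powr E * ((1 - r) powr \<beta> * (1 - r) powr e)"
    proof -
      have "(2 * (1 - r)) powr E = 2 powr E * (1 - r) powr E"
        by (rule powr_mult)
      then show ?thesis
        by (simp only: e(2) powr_add)
    qed
    finally have "(1 - \<rho>) powr E * nrm s ?F \<le>
        (2 powr E * ((1 - r) powr \<beta> * (1 - r) powr e)) * ((1 - r) powr (- e) * nrm s ?g)"
      using F by (intro mult_mono) (auto simp: nrm_nonneg)
    also have "\<dots> = 2 powr E * ((1 - r) powr \<beta> * nrm s ?g)"
      using r by (simp add: powr_minus)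
    also have "\<dots> \<le> 2 powr E * B"
      by (intro mult_left_mono B r y) auto
    finally have "ennreal ((1 - \<rho>) powr E * nrm s ?F) \<le> ennreal (2 powr E * B)"
      by (rule ennreal_leI)
    moreover have "Lnorm s (\<lambda>x'. LambdaP Y d c (m + 1) x' \<rho> y) = ennreal (nrm s ?F)"
      unfolding Lnorm_eq_nrm[OF s cF, symmetric] by (rule Lnorm_cong) (simp add: LambdaP_eq(2) y T_def)
    ultimately show ?thesis
      by (simp add: ennreal_mult nrm_nonneg)
  qed
  then have "Ts Y d c s t \<alpha> \<beta> m \<le> ennreal (2 powr E * B)"
    unfolding Ts_def E_def by (intro SUP_least) auto
  then show "Ts Y d c s t \<alpha> \<beta> m < \<infinity>"
    by (rule le_less_trans) simp
qed

end

theorem mainTheorem3: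
  fixes Y :: "nat \<Rightarrow> nat \<Rightarrow> real^'n \<Rightarrow> real"
    and d :: "nat \<Rightarrow> nat"
    and c :: "nat \<Rightarrow> nat \<Rightarrow> real"
    and t \<alpha> \<beta> m :: real
    and s :: ennreal
  assumes "CARD('n) \<ge> 2"
    and "sh_basis Y d"
    and "0 < t" and "t \<le> 1" and "1 \<le> s"
    and "\<alpha> \<ge> 0" and "\<beta> > 0"
    and "m > max (\<alpha> + (real CARD('n) - 1) / t - real CARD('n)) (-1)"
  shows "c \<in> MH Y d (Hspace (ennreal t) \<alpha>) (Hspace s \<beta>) \<longleftrightarrow>
         ((\<forall>x\<in>ball (0::real^'n) 1. summable (gc_term Y d c x)) \<and>
          harmonic_on (ball 0 1) (gc Y d c) \<and>
          Ts Y d c s t \<alpha> \<beta> m < \<infinity>)"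
proof -
  interpret sh_system Y d
    by (rule sh_system.intro[OF assms(2)])
  have m: "m > \<alpha> + (real CARD('n) - 1) / t - real CARD('n)" "m > -1"
    using assms(8) by auto
  note necessary = multiplier_necessary[OF assms(1,3-7) m]
  show ?thesis
  proof (intro iffI)
    assume "c \<in> MH Y d (Hspace (ennreal t) \<alpha>) (Hspace s \<beta>)"
    then show "(\<forall>x\<in>ball (0::real^'n) 1. summable (gc_term Y d c x)) \<and>
        harmonic_on (ball 0 1) (gc Y d c) \<and> Ts Y d c s t \<alpha> \<beta> m < \<infinity>"
      by (intro conjI necessary)
  next
    assume "(\<forall>x\<in>ball (0::real^'n) 1. summable (gc_term Y d c x)) \<and>
        harmonic_on (ball 0 1) (gc Y d c) \<and> Ts Y d c s t \<alpha> \<beta> m < \<infinity>"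
    then show "c \<in> MH Y d (Hspace (ennreal t) \<alpha>) (Hspace s \<beta>)"
      by (elim conjE) (rule multiplier_sufficient[OF assms(1,3-7) m(2)])
  qed
qed

end
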